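(* Assume the generalized Riemann hypothesis for $L(s,\chi_d)$ for all fundamental discriminants $d$. Let $\varepsilon>0$, let $X$ be sufficiently large, and let $z_1,z_2\in\mathbb{C}$ satisfy $0\leq \mathrm{Re}(z_1),\mathrm{Re}(z_2)\leq\frac{1}{\log X}$ and $|\mathrm{Im}(z_1)|,|\mathrm{Im}(z_2)|\leq X$. Then $$\sum_{\substack{|d|\leq X\\ d\text{ fund. disc.}}}|L(\tfrac12+z_1,\chi_d)|^2|L(\tfrac12+z_2,\chi_d)|^2\ll X(\log X)^{4+\varepsilon}\left(1+\min\left\{(\log X)^6,\frac{1}{|\mathrm{Im}(z_1)-\mathrm{Im}(z_2)|^6}\right\}\right),$$ where the implied constant depends only on $\varepsilon$.
   Context: The sum is over all fundamental discriminants $d$ (positive or negative) with $|d|\le X$. For a fundamental discriminant $d$, $\chi_d=\left(\frac{d}{\cdot}\right)$ is the real primitive Dirichlet character given by the Kronecker symbol, and $L(s,\chi_d)$ is its Dirichlet $L$-function (for $d=1$ it is $\zeta(s)$). When $\mathrm{Im}(z_1)=\mathrm{Im}(z_2)$ the minimum is interpreted as $(\log X)^6$. *)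

theory Defs
  imports
    "HOL-Complex_Analysis.Complex_Analysis"
    "HOL-Number_Theory.Number_Theory"
    "HOL-Computational_Algebra.Squarefree"
begin

text \<open>
  The discriminants of quadratic fields together with \<open>1\<close>. Note that \<open>mod\<close> on the
  integers has a nonnegative result for a positive modulus, so that negative \<open>d\<close> are
  treated correctly, and that \<open>0\<close> is not squarefree.
\<close>
definition fundamental_discriminant :: "int \<Rightarrow> bool" where
  "fundamental_discriminant d \<longleftrightarrow>
     (d mod 4 = 1 \<and> squarefree d) \<or>
     (\<exists>m. d = 4 * m \<and> m mod 4 \<in> {2, 3} \<and> squarefree m)"

definition Kronecker_prime :: "int \<Rightarrow> int \<Rightarrow> int" where
  "Kronecker_prime a p =
     (if p = 2 then (if even a then 0 else if a mod 8 \<in> {1, 7} then 1 else -1)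
      else Legendre a p)"

text \<open>
  The Kronecker symbol \<open>(a/n)\<close>. The prime factors occurring in
  \<^term>\<open>prime_factorization n\<close> are positive also for negative \<open>n\<close>; the sign of \<open>n\<close>
  contributes the factor \<open>(a/-1)\<close>, which is \<open>-1\<close> exactly for \<open>a < 0\<close>.
\<close>
definition Kronecker :: "int \<Rightarrow> int \<Rightarrow> int" where
  "Kronecker a n =
     (if n = 0 then (if \<bar>a\<bar> = 1 then 1 else 0)
      else (if n < 0 \<and> a < 0 then -1 else 1) *
           (\<Prod>p\<in>#prime_factorization n. Kronecker_prime a p))"

definition L_domain :: "int \<Rightarrow> complex set" where
  "L_domain d = (if d = 1 then - {1} else UNIV)"

text \<open>
  \<open>f\<close> is the analytic continuation of the Dirichlet series of \<open>\<chi>\<^sub>d\<close>. The index is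
  shifted so that the series runs over the positive integers.
\<close>
definition is_L_continuation :: "int \<Rightarrow> (complex \<Rightarrow> complex) \<Rightarrow> bool" where
  "is_L_continuation d f \<longleftrightarrow>
     f holomorphic_on L_domain d \<and>
     (\<forall>s. Re s > 1 \<longrightarrow>
        (\<lambda>n. of_int (Kronecker d (int (Suc n))) / of_nat (Suc n) powr s) sums f s)"

lemma is_L_continuation_unique:
  assumes "is_L_continuation d f" "is_L_continuation d g" "s \<in> L_domain d"
  shows "f s = g s"
proof (rule analytic_continuation_open[where s = "{s. Re s > 1}" and s' = "L_domain d" and f = f and g = g])
  show "open {s. Re s > 1}" by (rule open_halfspace_Re_gt)
  show "open (L_domain d)" by (auto simp: L_domain_def)
  show "{s. Re s > 1} \<noteq> {}" by (auto intro: exI[of _ 2])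
  show "connected (L_domain d)"
    by (simp add: L_domain_def connected_punctured_universe convex_connected)
  show "{s. Re s > 1} \<subseteq> L_domain d" by (auto simp: L_domain_def)
  show "f z = g z" if "z \<in> {s. Re s > 1}" for z
    using assms(1,2) that unfolding is_L_continuation_def
    by (metis (no_types, lifting) mem_Collect_eq sums_unique2)
qed (use assms in \<open>auto simp: is_L_continuation_def\<close>)

text \<open>
  \<open>L(s, \<chi>\<^sub>d)\<close> for a fundamental discriminant \<open>d\<close>. By the previous lemma the choice is
  immaterial on \<^term>\<open>L_domain d\<close>; the only point where the value is arbitrary is the
  pole \<open>s = 1\<close> of \<open>\<zeta>(s) = L(s, \<chi>\<^sub>1)\<close>.
\<close>
definition Dirichlet_L :: "int \<Rightarrow> complex \<Rightarrow> complex" where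
  "Dirichlet_L d = (SOME f. is_L_continuation d f)"

definition GRH_for :: "int \<Rightarrow> bool" where
  "GRH_for d \<longleftrightarrow>
     (\<forall>s. 0 < Re s \<and> Re s < 1 \<and> Dirichlet_L d s = 0 \<longrightarrow> Re s = 1 / 2)"

text \<open>
  The quantity \<open>min {(log X)^6, 1 / |t\<^sub>1 - t\<^sub>2|^6}\<close>, which is \<open>(log X)^6\<close> if
  \<open>t\<^sub>1 = t\<^sub>2\<close> (the case distinction is needed because of \<^prop>\<open>1 / 0 = (0::real)\<close>).
\<close>
definition shift_min :: "real \<Rightarrow> real \<Rightarrow> real \<Rightarrow> real" where
  "shift_min X t1 t2 =
     (if t1 = t2 then ln X ^ 6 else min (ln X ^ 6) (1 / \<bar>t1 - t2\<bar> ^ 6))"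

end

theory Submission
  imports Defs "HOL-Probability.Sinc_Integral" "HOL-Real_Asymp.Real_Asymp"
begin

text \<open>
  Following Soundararajan, GRH bounds \<open>log |L(1/2 + z, \<chi>\<^sub>d)|\<close> by a Dirichlet polynomial
  of length \<open>exp T\<close> up to \<open>O(log X / T)\<close>. This uses the partial fraction of \<open>L'/L\<close>,
  whose zeros contribute with a favourable sign, integrated against a Fejer kernel.
  The squares of primes give the mean. The values at primes behave like independent
  random signs, because the sum of \<open>(d/n)\<close> over all integers \<open>d\<close> with \<open>|d| \<le> X\<close> is
  small unless \<open>n\<close> is a square. High moments, with \<open>T\<close> and the order of the moment
  adapted to the size of the \<open>L\<close>-values, yield a Gaussian bound for the distribution.
  The variance is computed from \<open>\<Sum> cos (t log p) / p\<close>, that is, from \<open>log |\<zeta>(1 + it)|\<close>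
 near the edge of the critical strip.
\<close>

text \<open>Origin of the exponents: let a, b be the imaginary parts of z1, z2 and
  \<open>peak X t\<close> the size of zeta(1 + 1/ln X + it). The mean is m = log(peak(2a) peak(2b)),
  the variance v is 4 log ln X + 2 log(peak(2a) peak(2b)) + 4 log(peak(a+b) peak(a-b)), and a
  Gaussian yields exp(m + v/2) = (ln X)^2 (peak(2a) peak(2b) peak(a+b) peak(a-b))^2. At most one of
  2a, 2b, a+b is small compared with a-b, so the four peaks multiply to at most 4 ln X peak(a-b)^3.
  This gives (ln X)^4 and the sixth power. The obstacle is length. The moment of order 2k of a sum
  over primes up to y is under control only while y^(4k) is below X. But on the set where the
  logarithm is about 2k the error O(ln X / T) must be a small multiple e k of k, so T is a large
  multiple of (ln X) / k. Hence the primes are split at X^(1/(8k)). The shorter part carries the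
  variance and gets the moment of order 2k; the longer part has bounded variance and is compared
  with the threshold 2 e k, for which a moment of order a small multiple of k suffices.\<close>

section \<open>Legendre symbols modulo odd primes\<close>

lemma Legendre_cases: "Legendre a p \<in> {-1, 0, 1}"
 by (auto simp: Legendre_def)

lemma Legendre_cong: "[a = b] (mod p) ==> Legendre a p = Legendre b p"
 by (auto simp: Legendre_def QuadRes_def cong_def)

text \<open>Two such values differ by at most 2 < p. This upgrades the congruence of Euler's
  criterion to equalities of symbols.\<close>

lemma sign_cong_imp_eq:
 fixes x y p :: int
 assumes "[x = y] (mod p)" "x \<in> {-1, 0, 1}" "y \<in> {-1, 0, 1}" "p > 2"
 shows "x = y"
proof -
 have "p dvd x - y" using assms(1) by (simp add: cong_iff_dvd_diff)
 then show ?thesis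
 using assms(2-4) zdvd_imp_le[of p "x - y"] zdvd_imp_le[of p "y - x"]
 by (cases "x - y > 0"; cases "y - x > 0") (auto simp: dvd_diff_commute)
qed

lemma Legendre_mult:
 fixes p :: nat
 assumes "prime p" "p > 2"
 shows "Legendre (a * b) (int p) = Legendre a (int p) * Legendre b (int p)"
proof (rule sign_cong_imp_eq)
 show "[Legendre (a * b) (int p) = Legendre a (int p) * Legendre b (int p)] (mod int p)"
 using euler_criterion[OF assms, of "a * b", unfolded power_mult_distrib]
  cong_sym[OF cong_mult[OF euler_criterion[OF assms, of a] euler_criterion[OF assms, of b]]]
 by (rule cong_trans)
qed (use assms Legendre_cases[of a "int p"] Legendre_cases[of b "int p"] Legendre_cases[of "a*b" "int p"] in auto)

lemma Legendre_minus_one: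
 fixes p :: nat
 assumes "prime p" "p > 2"
 shows "Legendre (-1) (int p) = (-1)^((p - 1) div 2)"
proof (rule sign_cong_imp_eq)
 show "(- 1)^((p - 1) div 2) \<in> {- 1, 0, 1::int}"
 by (cases "even ((p - 1) div 2)") auto
 show "[Legendre (-1) (int p) = (-1)^((p - 1) div 2)] (mod int p)" by (rule euler_criterion[OF assms])
qed (use Legendre_cases[of "-1" "int p"] assms in auto)

text \<open>Gauss's lemma for the multiplier 2: the doubles 2x with x <= h = (p - 1)/2 are already
  reduced modulo p, and those exceeding h come from h/2 < x <= h. Their number
  \<open>h - h div 2\<close> is even exactly for p = 1, 7 mod 8.\<close>

lemma Legendre_two:
 fixes p :: nat
 assumes "prime p" "p > 2"
 shows "Legendre 2 (int p) = (if p mod 8 \<in> {1, 7} then 1 else -1)"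
proof -
 interpret GAUSS p 2
 proof
 show "prime p" "2 < p" "(0::int) < 2" using assms by auto
 show "[2 \<noteq> 0] (mod int p)" using assms by (auto simp: cong_0_iff dest: zdvd_imp_le)
 qed
 define h where "h = (int p - 1) div 2"
 have podd: "odd p" using assms prime_odd_nat by auto
 then have ph: "int p = 2 * h + 1" unfolding h_def by presburger
 have E: "E = (%x. x*2) ` {h div 2 <.. h}"
 proof -
 have "E = {x \<in> (%x. x*2) ` {0<..h}. h < x}"
 proof -
  have "(x*2) mod int p = x*2" if "x \<in> {0<..h}" for x
  using that ph by (intro mod_pos_pos_trivial) auto
  then have "C = (%x. x*2) ` {0<..h}"
  unfolding C_def B_def A_def h_def[symmetric] image_image by (intro image_cong) auto
  then show ?thesis unfolding E_def h_def[symmetric] by auto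
 qed
 also have "... = (%x. x*2) ` {h div 2 <.. h}" using ph assms by auto
 finally show ?thesis .
 qed
 have "card E = card {h div 2 <.. h}" unfolding E by (intro card_image) (auto simp: inj_on_def)
 then have c: "card E = nat (h - h div 2)" by simp
 have hpos: "h >= 1" using ph assms by auto
 have "even (card E) \<longleftrightarrow> even (h - h div 2)" unfolding c using hpos by (subst even_nat_iff) auto
 also have "... \<longleftrightarrow> h mod 4 \<in> {0, 3}" by (auto; presburger)
 also have "... \<longleftrightarrow> int p mod 8 \<in> {1, 7}" using ph by (auto; presburger)
 also have "int p mod 8 = int (p mod 8)" by (simp add: zmod_int)
 also have "int (p mod 8) \<in> {1, 7} \<longleftrightarrow> p mod 8 \<in> {1, 7}" by auto
 finally show ?thesis using gauss_lemma by (auto simp: uminus_power_if)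
qed

lemma Legendre_self [simp]: "Legendre (int p) (int p) = 0"
 by (simp add: Legendre_def cong_def)

text \<open>Otherwise squaring would be onto, hence injective, on the nonzero residues; but 1 and p
  - 1 have the same square.\<close>

lemma exists_nonresidue:
 fixes p :: nat
 assumes "prime p" "p > 2"
 obtains r :: int where "Legendre r (int p) = -1"
proof -
 have "\<exists>r. Legendre r (int p) = -1"
 proof (rule ccontr)
 assume "\<not> ?thesis"
 then have all: "Legendre r (int p) \<in> {0, 1}" for r using Legendre_cases[of r "int p"] by auto
 let ?S = "{1..int p - 1}" and ?f = "%x. x^2 mod int p"
 have "?f ` ?S \<subseteq> ?S"
 proof safe
  fix x assume x: "x \<in> ?S"
  then have "\<not> int p dvd x" by (auto dest: zdvd_imp_le)
  then have "\<not> int p dvd x^2" using assms by (auto simp: prime_dvd_power_iff)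
  then have "x^2 mod int p \<noteq> 0" by auto
  moreover have "x^2 mod int p >= 0" "x^2 mod int p < int p" using assms by auto
  ultimately show "x^2 mod int p \<in> ?S" by auto
 qed
 moreover have "?S \<subseteq> ?f ` ?S"
 proof
  fix r assume r: "r \<in> ?S"
  then have nz: "\<not> int p dvd r" by (auto dest: zdvd_imp_le)
  then have "Legendre r (int p) = 1" using all[of r]
  by (auto simp: Legendre_def cong_0_iff split: if_splits)
  then obtain y where y: "[y^2 = r] (mod int p)"
  by (auto simp: Legendre_def QuadRes_def split: if_splits)
  let ?y = "y mod int p"
  have "?y^2 mod int p = r" using y r by (simp add: cong_def power_mod)
  moreover have "?y \<noteq> 0" using \<open>?y^2 mod int p = r\<close> r by (intro notI) auto
  moreover have "?y >= 0" "?y < int p" using assms by auto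
  ultimately show "r \<in> ?f ` ?S" by (intro image_eqI[of _ _ ?y]) auto
 qed
 ultimately have "?f ` ?S = ?S" by blast
 then have "inj_on ?f ?S" by (intro eq_card_imp_inj_on) auto
 moreover have "?f 1 = ?f (int p - 1)"
 proof -
  have "(int p - 1)^2 = 1 + int p*(int p - 2)" by (simp add: power2_eq_square algebra_simps)
  then show ?thesis by (metis mod_mult_self2 power_one)
 qed
 ultimately have "1 = int p - 1" using assms by (auto dest!: inj_onD[of ?f ?S 1 "int p - 1"])
 then show False using assms by simp
 qed
 then show ?thesis using that by blast
qed

section \<open>Sums of periodic functions over intervals\<close>

text \<open>Multiplication by \<open>b\<close> permutes the residues modulo \<open>N\<close> and
  changes the sign of every value, so the sum equals its own negative.\<close>

lemma sum_zero_of_sign_change: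
 fixes h :: "int \<Rightarrow> int" and N b :: int
 assumes N: "N > 0" and b: "coprime b N"
 and per: "\<And>x y. [x = y] (mod N) ==> h x = h y" and sgn: "\<And>x. h (b * x) = - h x"
 shows "sum h {0..<N} = 0"
proof -
 let ?f = "%x. (b * x) mod N"
 have inj: "inj_on ?f {0..<N}"
 proof (rule inj_onI)
 fix x y assume xy: "x \<in> {0..<N}" "y \<in> {0..<N}" "?f x = ?f y"
 then have "[x = y] (mod N)" using b cong_mult_lcancel[of b N x y] by (simp add: cong_def)
 then show "x = y" using xy by (simp add: cong_def)
 qed
 have "?f ` {0..<N} \<subseteq> {0..<N}" using N by auto
 then have img: "?f ` {0..<N} = {0..<N}" using inj by (intro endo_inj_surj) auto
 have "sum h {0..<N} = (\<Sum>x\<in>{0..<N}. h (?f x))"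
 using sum.reindex[OF inj, of h] unfolding img by simp
 also have "... = (\<Sum>x\<in>{0..<N}. h (b * x))" by (intro sum.cong refl per) (simp add: cong_def)
 also have "... = - sum h {0..<N}" by (simp add: sgn sum_negf)
 finally show ?thesis by simp
qed

lemma sum_periodic_block:
 fixes h :: "int \<Rightarrow> int"
 assumes N: "N > 0" and per: "\<And>x y. [x = y] (mod N) ==> h x = h y"
 shows "sum h {a..<a+N} = sum h {0..<N}"
proof -
 let ?f = "%x. x mod N"
 have inj: "inj_on ?f {a..<a+N}"
 proof (rule inj_onI)
 fix x y assume xy: "x \<in> {a..<a+N}" "y \<in> {a..<a+N}" "?f x = ?f y"
 then have "N dvd x - y" by (simp add: mod_eq_dvd_iff)
 then show "x = y" using xy N zdvd_imp_le[of N "x - y"] zdvd_imp_le[of N "y - x"]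
  by (cases "x - y > 0"; cases "y - x > 0") (auto simp: dvd_diff_commute)
 qed
 have "?f ` {a..<a+N} \<subseteq> {0..<N}" using N by auto
 moreover have "card (?f ` {a..<a+N}) = card {0..<N}" using inj N by (simp add: card_image)
 ultimately have img: "?f ` {a..<a+N} = {0..<N}" by (intro card_subset_eq) auto
 show ?thesis
 using sum.reindex[OF inj, of h] per[of "_ mod N"] unfolding img
 by (simp add: o_def) (metis cong_mod_left cong_refl)
qed

text \<open>Full periods cancel, and fewer than \<open>N\<close> or exactly \<open>N\<close> terms
  of modulus at most 1 remain. This trivial bound is strong enough throughout: periods enter the
  final estimates only through logarithms or next to a power of X to spare.\<close>

lemma abs_sum_periodic_le:
 fixes h :: "int \<Rightarrow> int"
 assumes N: "N > 0" and per: "\<And>x y. [x = y] (mod N) ==> h x = h y"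
 and zero: "sum h {0..<N} = 0" and bd: "\<And>x. \<bar>h x\<bar> <= 1"
 shows "\<bar>sum h {a..<b}\<bar> <= N"
proof (induction "nat (b - a)" arbitrary: a rule: less_induct)
 case less
 show ?case
 proof (cases "b - a <= N")
 case True
 have "\<bar>sum h {a..<b}\<bar> <= (\<Sum>x\<in>{a..<b}. \<bar>h x\<bar>)" by (rule sum_abs)
 also have "... <= (\<Sum>x\<in>{a..<b}. 1)" by (intro sum_mono bd)
 also have "... <= N" using True N by auto
 finally show ?thesis .
 next
 case False
 have "sum h {a..<b} = sum h {a..<a+N} + sum h {a+N..<b}"
  using False N by (subst sum.union_disjoint[symmetric]) (auto intro!: arg_cong[where f="sum h"])
 also have "sum h {a..<a+N} = 0" using sum_periodic_block[OF N per] zero by simp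
 finally show ?thesis using less[of "a+N"] N False by auto
 qed
qed

section \<open>The Kronecker symbol as a periodic character\<close>

lemma completely_multiplicative_prime_factorization:
 fixes f :: "int \<Rightarrow> int"
 assumes "f 1 = 1" "\<And>m n. m > 0 ==> n > 0 ==> f (m * n) = f m * f n" "n > 0"
 shows "f n = (\<Prod>p\<in>#prime_factorization n. f p)"
proof -
 have "n > 0 --> f n = (\<Prod>p\<in>#prime_factorization n. f p)"
 proof (induction n rule: prime_divisors_induct)
 case (unit x)
 then show ?case using assms(1) by auto
 next
 case (factor p x)
 show ?case
 proof
  assume px: "0 < p * x"
  have p: "p > 0" using factor(1) prime_gt_0_int by auto
  with px have x: "x > 0" using zero_less_mult_pos by blast
  have "prime_factorization (p * x) = {#p#} + prime_factorization x"
  using x p factor(1) by (subst prime_factorization_mult) (auto simp: prime_factorization_prime)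
  then show "f (p * x) = (\<Prod>p\<in>#prime_factorization (p * x). f p)"
  using factor(2) x p assms(2) by simp
 qed
 qed simp
 then show ?thesis using assms by auto
qed

lemma Kronecker_pos: "n > 0 ==> Kronecker a n = (\<Prod>p\<in>#prime_factorization n. Kronecker_prime a p)"
 by (simp add: Kronecker_def)

lemma Kronecker_one_right [simp]: "Kronecker a 1 = 1"
 by (simp add: Kronecker_pos)

lemma Kronecker_mult_right:
 assumes "m > 0" "n > 0"
 shows "Kronecker a (m * n) = Kronecker a m * Kronecker a n"
 using assms by (simp add: Kronecker_pos prime_factorization_mult)

lemma Kronecker_prime_right: "prime p ==> Kronecker a p = Kronecker_prime a p"
 using prime_gt_0_int[of p] by (simp add: Kronecker_pos prime_factorization_prime)

lemma Kronecker_prime_mult: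
 assumes "prime (p::int)"
 shows "Kronecker_prime (a * b) p = Kronecker_prime a p * Kronecker_prime b p"
proof (cases "p = 2")
 case True
 have odd_mod: "a mod 8 = 1 \<or> a mod 8 = 3 \<or> a mod 8 = 5 \<or> a mod 8 = 7" if "odd a" for a :: int
 using that by presburger
 have ab: "a * b mod 8 = ((a mod 8)*(b mod 8)) mod 8" by (simp add: mod_mult_eq)
 show ?thesis
 proof (cases "even a \<or> even b")
 case False
 with odd_mod[of a] odd_mod[of b]
 have "a mod 8 = 1 \<or> a mod 8 = 3 \<or> a mod 8 = 5 \<or> a mod 8 = 7"
  "b mod 8 = 1 \<or> b mod 8 = 3 \<or> b mod 8 = 5 \<or> b mod 8 = 7" by blast+
 then show ?thesis using True False
  unfolding Kronecker_prime_def ab by (elim disjE) simp_all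
 qed (use True in \<open>auto simp: Kronecker_prime_def\<close>)
next
 case False
 then have "prime (nat p)" "nat p > 2" using assms prime_ge_2_int[of p] by auto
 from Legendre_mult[OF this] show ?thesis using False assms prime_ge_2_int[of p] by (simp add: Kronecker_prime_def)
qed

lemma Kronecker_mult_left:
 assumes "n > 0"
 shows "Kronecker (a * b) n = Kronecker a n * Kronecker b n"
proof -
 have "Kronecker (a * b) n = (\<Prod>p\<in>#prime_factorization n. Kronecker_prime a p * Kronecker_prime b p)"
 unfolding Kronecker_pos[OF assms]
 by (intro arg_cong[where f = prod_mset] image_mset_cong Kronecker_prime_mult) auto
 then show ?thesis by (simp add: Kronecker_pos[OF assms] prod_mset.distrib)
qed

text \<open>Closed forms of (a/n) are verified by this principle: both sides are completely
  multiplicative in n, so a comparison at primes decides.\<close>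

lemma Kronecker_eqI:
 assumes "f 1 = 1" "\<And>m n. m > 0 ==> n > 0 ==> f (m * n) = f m * f n"
 "\<And>p. prime p ==> Kronecker_prime a p = f p" "n > 0"
 shows "Kronecker a n = f n"
proof -
 have "f n = (\<Prod>p\<in>#prime_factorization n. f p)"
 by (rule completely_multiplicative_prime_factorization) (use assms in auto)
 also have "... = Kronecker a n"
 unfolding Kronecker_pos[OF assms(4)]
 by (intro arg_cong[where f = prod_mset] image_mset_cong assms(3)[symmetric]) (rule in_prime_factors_imp_prime)
 finally show ?thesis by simp
qed

lemma abs_Kronecker_le_1:
 assumes "n > 0"
 shows "\<bar>Kronecker a n\<bar> <= 1"
proof -
 have "\<bar>\<Prod>p\<in>#M. Kronecker_prime a p\<bar> <= 1" for M
 proof (induction M)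
 case (add x M)
 have "\<bar>Kronecker_prime a x\<bar> <= 1" using Legendre_cases[of a x] by (auto simp: Kronecker_prime_def)
 then show ?case using add by (simp add: abs_mult mult_le_one)
 qed simp
 then show ?thesis using assms by (simp add: Kronecker_pos)
qed

lemma Legendre_one:
 assumes "prime (p :: int)"
 shows "Legendre 1 p = 1"
proof -
 have "\<not> [1 = 0] (mod p)" using prime_gt_1_int[OF assms] by (auto simp: cong_0_iff)
 moreover have "QuadRes p 1" unfolding QuadRes_def by (rule exI[of _ 1]) simp
 ultimately show ?thesis by (simp add: Legendre_def)
qed

text \<open>The sign makes P congruent to 1 modulo 4, and then quadratic reciprocity reads (P/q) =
  (q/p) without a sign. At q = 2 both sides depend on p modulo 8 in a way that is unchanged under p
  -> -p.\<close>

lemma Kronecker_prime_discriminant: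
 fixes p :: nat
 assumes p: "prime p" "p > 2" and n: "n > 0"
 defines "P \<equiv> (if p mod 4 = 1 then int p else - int p)"
 shows "Kronecker P n = Legendre n (int p)"
proof (rule Kronecker_eqI[where f = "%n. Legendre n (int p)"])
 show "Legendre 1 (int p) = 1"
 using p by (simp add: Legendre_one)
 show "Legendre (m * n) (int p) = Legendre m (int p) * Legendre n (int p)" for m n
 by (rule Legendre_mult[OF p])
 fix q :: int assume q: "prime q"
 have podd: "odd p" using p prime_odd_nat by auto
 show "Kronecker_prime P q = Legendre q (int p)"
 proof (cases "q = 2")
 case True
 have "odd P" using podd by (simp add: P_def)
 moreover have "P mod 8 \<in> {1, 7} \<longleftrightarrow> p mod 8 \<in> {1, 7}"
 proof -
  have ip: "int p mod 8 = int (p mod 8)" by (simp add: zmod_int)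
  have "(- x) mod 8 = 1 \<longleftrightarrow> x mod 8 = 7" "(- x) mod 8 = 7 \<longleftrightarrow> x mod 8 = 1" for x :: int
  by presburger+
  then show ?thesis unfolding P_def using ip by auto
 qed
 ultimately show ?thesis using Legendre_two[OF p] True by (simp add: Kronecker_prime_def)
 next
 case False
 define r where "r = nat q"
 have r: "prime r" "q = int r" "r > 2"
  using q False prime_ge_2_int[of q] by (auto simp: r_def)
 have K: "Kronecker_prime P q = Legendre P (int r)" using False r by (simp add: Kronecker_prime_def)
 show ?thesis
 proof (cases "r = p")
  case True
  have "Legendre P (int r) = 0" using True by (auto simp: Legendre_def cong_0_iff P_def)
  then show ?thesis using K True r by simp
 next
  case ne: False
  note QR = Quadratic_Reciprocity[OF p(1,2) r(1,3)] 
  have QR: "Legendre (int p) (int r) * Legendre (int r) (int p) = (- 1)^((p - 1) div 2*((r - 1) div 2))"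
  using QR ne by auto
  have ev: "even ((p - 1) div 2) \<longleftrightarrow> p mod 4 = 1" using podd by presburger
  have LP: "Legendre P (int r) = (if p mod 4 = 1 then 1 else (-1)^((r - 1) div 2)) * Legendre (int p) (int r)"
  using Legendre_mult[OF r(1,3), of "-1" "int p"] Legendre_minus_one[OF r(1,3)] by (simp add: P_def)
  show ?thesis using K LP QR ev Legendre_cases[of "int p" "int r"] Legendre_cases[of "int r" "int p"] r(2)
  by (cases "p mod 4 = 1"; cases "even ((r - 1) div 2)") (auto simp: uminus_power_if)
 qed
 qed
qed (rule n)

lemma Kronecker_one_left: "n > 0 ==> Kronecker 1 n = 1"
 by (rule Kronecker_eqI[where f = "%_. 1"]) (auto simp: Kronecker_prime_def Legendre_one)

text \<open>Only positive arguments are compared, which is the range where multiplicativity has been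
  established. The modulus may be negative, so a negative discriminant can serve as its own
  modulus.\<close>

definition Kronecker_periodic :: "int \<Rightarrow> int \<Rightarrow> bool" where
 "Kronecker_periodic d M \<longleftrightarrow>
  (\<forall>m>0. \<forall>n>0. [m = n] (mod M) --> Kronecker d m = Kronecker d n)"

lemma Kronecker_periodic_mult:
 assumes "Kronecker_periodic d M" "Kronecker_periodic e N" "M dvd K" "N dvd K"
 shows "Kronecker_periodic (d * e) K"
 unfolding Kronecker_periodic_def
proof (intro allI impI)
 fix m n :: int assume mn: "m > 0" "n > 0" "[m = n] (mod K)"
 have "Kronecker d m = Kronecker d n" "Kronecker e m = Kronecker e n"
 using mn assms cong_dvd_modulus unfolding Kronecker_periodic_def by blast+
 then show "Kronecker (d * e) m = Kronecker (d * e) n" using mn by (simp add: Kronecker_mult_left)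
qed

text \<open>Splitting off a prime with the sign that makes it 1 modulo 4 leaves a cofactor of the
  same kind, which permits induction on the size of d. That p does not divide \<open>e\<close> is
  what the Chinese remainder theorem needs later.\<close>

lemma prime_dvd_odd_discriminant:
 assumes d: "d mod 4 = 1" "squarefree d" "d \<noteq> 1"
 obtains p :: nat and e :: int where "prime p" "p > 2"
 "d = (if p mod 4 = 1 then int p else - int p) * e" "e mod 4 = 1" "squarefree e" "\<not> int p dvd e"
proof -
 have "d \<noteq> -1" using d(1) by auto
 with d have "\<not> d dvd 1" by (auto simp: zdvd1_eq abs_if split: if_splits)
 moreover have "d \<noteq> 0" using d(1) by auto
 ultimately obtain q where q: "prime q" "q dvd d" using prime_divisor_exists[of d] by auto
 define p where "p = nat q"
 have p: "prime p" "q = int p" using q prime_ge_2_int[of q] by (auto simp: p_def)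
 have "odd d" using d(1) by presburger
 then have "odd p" using q p by auto
 then have p2: "p > 2" using p prime_ge_2_nat[of p] by (cases "p = 2") auto
 define P where "P = (if p mod 4 = 1 then int p else - int p)"
 have "P dvd d" using q p by (auto simp: P_def)
 then obtain e where e: "d = P * e" by auto
 have Pmod: "P mod 4 = 1"
 proof -
 have "p mod 4 = 1 \<or> p mod 4 = 3" using \<open>odd p\<close> by presburger
 moreover have "int p mod 4 = int (p mod 4)" by (simp add: zmod_int)
 moreover have "(- x) mod 4 = 1 \<longleftrightarrow> x mod 4 = 3" for x :: int by presburger
 ultimately show ?thesis unfolding P_def by auto
 qed
 then have "e mod 4 = 1" using d(1) e by (metis mod_mult_left_eq mult_1)
 moreover have "squarefree e" using d(2) e squarefree_mono[of e d] by simp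
 moreover have "\<not> int p dvd e"
 proof
 assume "int p dvd e"
 then have "int p^2 dvd d" using e by (auto simp: P_def power2_eq_square elim!: dvdE)
 then have "int p dvd 1" using d(2) squarefreeD by blast
 then show False using p2 by auto
 qed
 ultimately show ?thesis using that p p2 e by (simp add: P_def)
qed

lemma Kronecker_periodic_odd:
 assumes "d mod 4 = 1" "squarefree d"
 shows "Kronecker_periodic d d"
 using assms
proof (induction "nat \<bar>d\<bar>" arbitrary: d rule: less_induct)
 case less
 show ?case
 proof (cases "d = 1")
 case True
 then show ?thesis using True by (simp add: Kronecker_periodic_def Kronecker_one_left)
 next
 case False
 obtain p e where pe: "prime p" "p > 2"
  "d = (if p mod 4 = 1 then int p else - int p) * e" "e mod 4 = 1" "squarefree e"
  using prime_dvd_odd_discriminant[OF less.prems False] by metis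
 define P where "P = (if p mod 4 = 1 then int p else - int p)"
 have "e \<noteq> 0" using pe(4) by auto
 then have "nat \<bar>e\<bar> < nat \<bar>d\<bar>" using pe(2,3) by (auto simp: abs_mult)
 then have "Kronecker_periodic e e" using less.hyps pe by blast
 moreover have "Kronecker_periodic P (int p)"
  unfolding Kronecker_periodic_def P_def
  using Kronecker_prime_discriminant[OF pe(1,2)] Legendre_cong by metis
 moreover have "d = P * e" using pe(3) by (simp add: P_def)
 ultimately show ?thesis
  using Kronecker_periodic_mult[of P "int p" e e d] by (simp add: P_def)
 qed
qed

lemma Kronecker_minus_four:
 assumes "n > 0"
 shows "Kronecker (-4) n = (if even n then 0 else if n mod 4 = 1 then 1 else -1)"
proof (rule Kronecker_eqI[where f = "%n. if even n then 0 else if n mod 4 = 1 then 1 else -1"])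
 show "(if even (m * n) then 0 else if m * n mod 4 = 1 then 1 else - 1) =
  (if even m then 0 else if m mod 4 = 1 then 1 else - 1) *
  (if even n then 0 else if n mod 4 = 1 then 1 else (- 1 :: int))" for m n :: int
 proof (cases "even m \<or> even n")
 case False
 then have "m mod 4 = 1 \<or> m mod 4 = 3" "n mod 4 = 1 \<or> n mod 4 = 3" by presburger+
 then show ?thesis using False mod_mult_eq[of m 4 n] by auto
 qed auto
 fix p :: int assume p: "prime p"
 show "Kronecker_prime (- 4) p = (if even p then 0 else if p mod 4 = 1 then 1 else - 1)"
 proof (cases "p = 2")
 case False
 define r where "r = nat p"
 have r: "prime r" "p = int r" "r > 2" "odd r"
  using p False prime_ge_2_int[of p] prime_odd_int[of p] by (auto simp: r_def even_nat_iff)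
 have "Legendre (-4) (int r) = Legendre (-1) (int r) * Legendre (2*2) (int r)"
  using Legendre_mult[OF r(1,3), of "-1" 4] by simp
 also have "... = Legendre (-1) (int r)*(Legendre 2 (int r))^2"
  using Legendre_mult[OF r(1,3), of 2 2] by (simp add: power2_eq_square)
 also have "... = (-1)^((r - 1) div 2)"
  using Legendre_minus_one[OF r(1,3)] Legendre_two[OF r(1,3)] by auto
 also have "... = (if int r mod 4 = 1 then 1 else -1)"
 proof -
  have "even ((r - 1) div 2) \<longleftrightarrow> r mod 4 = 1" using r(3,4) by presburger
  moreover have "int r mod 4 = int (r mod 4)" by (simp add: zmod_int)
  ultimately have "even ((r - 1) div 2) \<longleftrightarrow> int r mod 4 = 1" by auto
  then show ?thesis by (simp add: uminus_power_if)
 qed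
 finally show ?thesis using False r by (simp add: Kronecker_prime_def)
 qed (simp add: Kronecker_prime_def)
qed (use assms in auto)

lemma Kronecker_two:
 assumes "n > 0"
 shows "Kronecker 2 n = (if even n then 0 else if n mod 8 = 1 \<or> n mod 8 = 7 then 1 else -1)"
proof (rule Kronecker_eqI[where f = "%n. if even n then 0 else if n mod 8 = 1 \<or> n mod 8 = 7 then 1 else -1"])
 show "(if even (m * n) then 0 else if m * n mod 8 = 1 \<or> m * n mod 8 = 7 then 1 else - 1) =
  (if even m then 0 else if m mod 8 = 1 \<or> m mod 8 = 7 then 1 else - 1) *
  (if even n then 0 else if n mod 8 = 1 \<or> n mod 8 = 7 then 1 else (- 1 :: int))" for m n :: int
 proof (cases "even m \<or> even n")
 case False
 then have "m mod 8 = 1 \<or> m mod 8 = 3 \<or> m mod 8 = 5 \<or> m mod 8 = 7"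
  "n mod 8 = 1 \<or> n mod 8 = 3 \<or> n mod 8 = 5 \<or> n mod 8 = 7" by presburger+
 moreover have mn: "m * n mod 8 = (m mod 8)*(n mod 8) mod 8" by (simp add: mod_mult_eq)
 ultimately show ?thesis using False unfolding mn by (elim disjE) simp_all
 qed auto
 fix p :: int assume p: "prime p"
 show "Kronecker_prime 2 p = (if even p then 0 else if p mod 8 = 1 \<or> p mod 8 = 7 then 1 else - 1)"
 proof (cases "p = 2")
 case False
 define r where "r = nat p"
 have r: "prime r" "p = int r" "r > 2" "odd p"
  using p False prime_ge_2_int[of p] prime_odd_int[of p] by (auto simp: r_def)
 have "p mod 8 = int (r mod 8)" by (simp add: r(2) zmod_int)
 then have "p mod 8 = 1 \<longleftrightarrow> r mod 8 = 1" "p mod 8 = 7 \<longleftrightarrow> r mod 8 = 7" by auto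
 then show ?thesis using False r Legendre_two[OF r(1,3)] by (simp add: Kronecker_prime_def)
 qed (simp add: Kronecker_prime_def)
qed (use assms in auto)

lemma Kronecker_periodic_even_part:
 assumes "e \<in> {1, -4, 2, -8}"
 shows "Kronecker_periodic e 8"
proof -
 have 1: "Kronecker_periodic 1 8" by (simp add: Kronecker_periodic_def Kronecker_one_left)
 have 2: "Kronecker_periodic (-4) 8"
 unfolding Kronecker_periodic_def
 proof (intro allI impI)
 fix m n :: int assume "m > 0" "n > 0" "[m = n] (mod 8)"
 moreover from this have "[m = n] (mod 4)" "[m = n] (mod 2)"
  using cong_dvd_modulus[of m n 8 4] cong_dvd_modulus[of m n 8 2] by simp_all
 then have "m mod 4 = n mod 4" "even m \<longleftrightarrow> even n" by (simp_all add: cong_def even_iff_mod_2_eq_zero)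
 ultimately show "Kronecker (-4) m = Kronecker (-4) n" by (simp add: Kronecker_minus_four)
 qed
 have 3: "Kronecker_periodic 2 8"
 unfolding Kronecker_periodic_def
 proof (intro allI impI)
 fix m n :: int assume "m > 0" "n > 0" "[m = n] (mod 8)"
 moreover from this have "[m = n] (mod 8)" "[m = n] (mod 2)"
  using cong_dvd_modulus[of m n 8 2] by simp_all
 then have "m mod 8 = n mod 8" "even m \<longleftrightarrow> even n" by (simp_all add: cong_def even_iff_mod_2_eq_zero)
 ultimately show "Kronecker 2 m = Kronecker 2 n" by (simp add: Kronecker_two)
 qed
 have 4: "Kronecker_periodic (-8) 8" using Kronecker_periodic_mult[OF 2 3, of 8] by simp
 show ?thesis using assms 1 2 3 4 by auto
qed

text \<open>The factor \<open>8\<close> of the paper's prime discriminants is replaced by \<open>2\<close>, which has the same symbol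
  since \<open>(4/n) = 1\<close> for odd \<open>n\<close>; hence the factor \<open>c\<close> below.\<close>
lemma fundamental_discriminant_factor:
 assumes "fundamental_discriminant d"
 obtains e D c :: int where "d = c*(e * D)" "c \<in> {1, 4}" "e \<in> {1, -4, 2, -8}" "D mod 4 = 1" "squarefree D"
 "c = 4 ==> e = 2"
proof -
 consider "d mod 4 = 1" "squarefree d" | m where "d = 4 * m" "m mod 4 = 3" "squarefree m"
 | m where "d = 4 * m" "m mod 4 = 2" "squarefree m"
 using assms by (auto simp: fundamental_discriminant_def)
 then show ?thesis
 proof cases
 case 1
 then show ?thesis using that[of 1 1 d] by auto
 next
 case (2 m)
 have "(-m) mod 4 = 1" using 2(2) by presburger
 then show ?thesis using that[of 1 "-4" "-m"] 2 by auto
 next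
 case (3 m)
 have "even m" using 3(2) by presburger
 then obtain k where k: "m = 2 * k" by auto
 have sk: "squarefree k" using 3(3) k squarefree_mono[of k m] by simp
 have "odd k" using 3(2) k by presburger
 then have "k mod 4 = 1 \<or> (-k) mod 4 = 1" by presburger
 then consider "k mod 4 = 1" | "(-k) mod 4 = 1" by blast
 then show ?thesis
 proof cases
  case 1
  then show ?thesis using that[of 4 2 k] 3 k sk by auto
 next
  case 2
  then show ?thesis using that[of 1 "-8" "-k"] 3 k sk by auto
 qed
 qed
qed

lemma Kronecker_four_two:
 assumes "n > 0"
 shows "Kronecker (4*(2 * D)) n = Kronecker (2 * D) n"
proof -
 have "Kronecker (4*(2 * D)) n = Kronecker 2 n^3 * Kronecker D n"
 using Kronecker_mult_left[OF assms, of 2 2] Kronecker_mult_left[OF assms, of 4 2]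
  Kronecker_mult_left[OF assms, of 8 D] by (simp add: power3_eq_cube)
 also have "Kronecker 2 n^3 = Kronecker 2 n" using assms by (auto simp: Kronecker_two)
 finally show ?thesis using assms by (simp add: Kronecker_mult_left)
qed

text \<open>The product 8d is a convenient common multiple of the period 8 of the even part and the
  period D of the odd part. The exact period |d| would improve only constants.\<close>

lemma Kronecker_periodic_fundamental:
 assumes "fundamental_discriminant d"
 shows "Kronecker_periodic d (8 * d)"
proof -
 obtain e D c where *: "d = c*(e * D)" "c \<in> {1, 4}" "e \<in> {1, -4, 2, -8}" "D mod 4 = 1" "squarefree D"
 "c = 4 ==> e = 2" using fundamental_discriminant_factor[OF assms] by metis
 have "Kronecker_periodic (e * D) (8 * d)"
 by (rule Kronecker_periodic_mult[OF Kronecker_periodic_even_part[OF *(3)] Kronecker_periodic_odd[OF *(4,5)]])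
  (simp_all add: *(1))
 moreover have "Kronecker d n = Kronecker (e * D) n" if "n > 0" for n
 using * Kronecker_four_two[OF that, of D] by auto
 ultimately show ?thesis unfolding Kronecker_periodic_def by metis
qed

text \<open>The character is not principal. If d has no odd part, 3 or 5 is a witness. Otherwise
  choose an odd prime p dividing d, a nonresidue modulo p, and residue 1 modulo 8 times the
  remaining odd part, so that only the factor at p contributes. Coprimality to 8d makes
  multiplication by \<open>b\<close> a permutation of the residues.\<close>

lemma exists_Kronecker_minus_one:
 assumes d: "fundamental_discriminant d" "d \<noteq> 1"
 obtains b where "b > 0" "coprime b (8 * d)" "Kronecker d b = -1"
proof -
 obtain e D c where *: "d = c*(e * D)" "c \<in> {1, 4}" "e \<in> {1, -4, 2, -8}" "D mod 4 = 1" "squarefree D"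
 "c = 4 ==> e = 2" using fundamental_discriminant_factor[OF d(1)] by metis
 have K: "Kronecker d n = Kronecker (e * D) n" if "n > 0" for n
 using * Kronecker_four_two[OF that, of D] by auto
 have cop: "coprime (3::int) 4" "coprime (3::int) 16" "coprime (3::int) 32" "coprime (3::int) 64" "coprime (5::int) 64"
 using coprime_power_right_iff[of "3::int" 2 2] coprime_power_right_iff[of "3::int" 2 4] coprime_power_right_iff[of "3::int" 2 5]
  coprime_power_right_iff[of "3::int" 2 6] coprime_power_right_iff[of "5::int" 2 6] by simp_all
 show ?thesis
 proof (cases "D = 1")
 case True
 consider "e = 1" | "e = -4" | "e = 2" | "e = -8" using *(3) by auto
 then show ?thesis
 proof cases
  case 1
  then show ?thesis using True * d by auto
 next
  case 2
  then show ?thesis using True * K that[of 3] cop by (auto simp: Kronecker_minus_four)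
 next
  case 3
  then show ?thesis using True * K that[of 3] cop by (auto simp: Kronecker_two)
 next
  case 4
  then show ?thesis using True * K that[of 5] Kronecker_mult_left[of 5 "-4" 2] cop
  by (auto simp: Kronecker_two Kronecker_minus_four)
 qed
 next
 case False
 obtain p D' where p: "prime p" "p > 2"
  "D = (if p mod 4 = 1 then int p else - int p) * D'" "D' mod 4 = 1" "squarefree D'" "\<not> int p dvd D'"
  using prime_dvd_odd_discriminant[OF *(4,5) False] by metis
 define P where "P = (if p mod 4 = 1 then int p else - int p)"
 obtain r :: int where r: "Legendre r (int p) = -1" using exists_nonresidue[OF p(1,2)] by metis
 have "\<not> int p dvd 8"
 proof
  assume "int p dvd 8"
  then have "int p dvd 2^3" by simp
  then have "int p dvd 2" using p(1) prime_dvd_power[of "int p" 2 3] by simp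
  then show False using p(2) zdvd_imp_le[of "int p" 2] by auto
 qed
 then have "\<not> int p dvd 8 * D'" using p prime_dvd_mult_iff[of "int p" 8 D'] by simp
 moreover have "prime (int p)" using p(1) by simp
 ultimately have cop: "coprime (int p) (8 * D')" using prime_imp_coprime by blast
 have D0: "D' \<noteq> 0" using p(4) by auto
 obtain b0 where b0: "[b0 = r] (mod int p)" "[b0 = 1] (mod 8 * D')"
  using binary_chinese_remainder_int[OF cop] by blast
 \<comment> \<open>\<open>w\<close> is a multiple of both moduli and exceeds |b0|; adding it makes
   the solution positive without changing its residues.\<close>
 define q where "q = int p*\<bar>8 * D'\<bar>"
 define w where "w = q*(\<bar>b0\<bar> + 1)"
 define b where "b = b0 + w"
 have "q > 0" unfolding q_def using D0 p(2) by (intro mult_pos_pos) auto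
 then have "w >= 1*(\<bar>b0\<bar> + 1)" unfolding w_def by (intro mult_right_mono) auto
 moreover have "- b0 <= \<bar>b0\<bar>" by (rule abs_ge_minus_self)
 ultimately have b_pos: "b > 0" unfolding b_def by (simp only: mult_1)
 have "int p dvd q" "8 * D' dvd q" unfolding q_def by (simp_all add: dvd_mult)
 then have "int p dvd b - b0" "8 * D' dvd b - b0" unfolding b_def w_def by simp_all
 then have "[b = b0] (mod int p)" "[b = b0] (mod 8 * D')" by (simp_all add: cong_iff_dvd_diff)
 then have b1: "[b = r] (mod int p)" and "[b = b0] (mod 8 * D')" using b0(1) cong_trans by blast+
 then have b2: "[b = 1] (mod 8 * D')" using b0(2) cong_trans by blast
 have "Kronecker_periodic (e * D') (8 * D')"
  by (rule Kronecker_periodic_mult[OF Kronecker_periodic_even_part[OF *(3)] Kronecker_periodic_odd[OF p(4,5)]])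
   simp_all
 then have "Kronecker (e * D') b = Kronecker (e * D') 1"
  using b2 b_pos zero_less_one unfolding Kronecker_periodic_def by blast
 then have "Kronecker (e * D') b = 1" by simp
 moreover have "Kronecker P b = -1"
  using Kronecker_prime_discriminant[OF p(1,2) b_pos] r Legendre_cong[OF b1] by (simp add: P_def)
 moreover have "Kronecker (e * D) b = Kronecker P b * Kronecker (e * D') b"
  using p(3) Kronecker_mult_left[OF b_pos, of P "e * D'"] by (simp add: P_def mult_ac)
 ultimately have Kb: "Kronecker d b = -1" using K[OF b_pos] by simp
 have "coprime b (8 * D')" using b2 by (metis cong_imp_coprime coprime_1_left cong_sym)
 moreover have "coprime b (int p)"
 proof -
  have "\<not> int p dvd b" using r b1 Legendre_cong[OF b1] by (auto simp: Legendre_def cong_0_iff split: if_splits)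
  then show ?thesis using p(1) prime_imp_coprime[of "int p" b] by (simp add: coprime_commute)
 qed
 ultimately have "coprime b (8 * D)" using p(3) by (auto simp: coprime_mult_right_iff)
 moreover from this have "coprime b 2" using coprime_mult_right_iff[of b 8 D] coprime_mult_right_iff[of b 2 4] by simp
 ultimately have "coprime b (8 * d)" using *(1,2,3) coprime_mult_right_iff[of b 2 2]
  by (auto simp: coprime_mult_right_iff)
 then show ?thesis using that b_pos Kb by blast
 qed
qed

lemma abs_sum_Kronecker_le:
 assumes d: "fundamental_discriminant d" "d \<noteq> 1"
 shows "(\<Sum>n=1..8 * nat \<bar>d\<bar>. Kronecker d (int n)) = 0"
 and "\<bar>\<Sum>n=1..m. Kronecker d (int n)\<bar> <= 8*\<bar>d\<bar>"
proof -
 define N where "N = 8*\<bar>d\<bar>"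
 have "d \<noteq> 0" using d(1) by (auto simp: fundamental_discriminant_def)
 then have N: "N > 0" by (simp add: N_def)
 \<comment> \<open>The positive representative \<open>x mod N + N\<close> extends the symbol to all
   integers, so that the lemmas on periodic functions apply although periodicity was shown for
   positive arguments.\<close>
 define h where "h = (%x. Kronecker d (x mod N + N))"
 have modpos: "x mod N + N > 0" for x using N by (simp add: add_nonneg_pos)
 have h_per: "h x = h y" if "[x = y] (mod N)" for x y using that by (simp add: h_def cong_def)
 have per: "Kronecker d x = Kronecker d y" if "x > 0" "y > 0" "[x = y] (mod N)" for x y
 proof -
 have "[x = y] (mod 8 * d)" using that(3) by (cases "d > 0") (auto simp: N_def cong_iff_dvd_diff)
 then show ?thesis using Kronecker_periodic_fundamental[OF d(1)] that unfolding Kronecker_periodic_def by blast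
 qed
 have hK: "h x = Kronecker d x" if "x > 0" for x unfolding h_def
 by (rule per[OF modpos that]) (simp add: cong_def)
 obtain b where b: "b > 0" "coprime b (8 * d)" "Kronecker d b = -1"
 using exists_Kronecker_minus_one[OF d] by metis
 have cop: "coprime b N" using b(2) by (simp add: N_def abs_if)
 have sgn: "h (b * x) = - h x" for x
 proof -
 have "h (b * x) = Kronecker d (b*(x mod N + N))" unfolding h_def
 proof (rule per[OF modpos])
  show "0 < b*(x mod N + N)" using modpos b by simp
  have "N dvd b * x - b*(x mod N + N)"
  by (metis dvd_mult mod_add_self2 mod_eq_dvd_iff mod_mod_trivial right_diff_distrib)
  then show "[(b * x) mod N + N = b*(x mod N + N)] (mod N)"
  by (simp add: cong_def mod_eq_dvd_iff)
 qed
 also have "... = Kronecker d b * h x" unfolding h_def using modpos b by (simp add: Kronecker_mult_right)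
 finally show ?thesis using b by simp
 qed
 have zero: "sum h {0..<N} = 0" by (rule sum_zero_of_sign_change[where b = b and N = N and h = h, OF N cop]) (erule h_per, rule sgn)
 have conv: "(\<Sum>n=1..m. Kronecker d (int n)) = sum h {1..<1 + int m}" for m
 proof -
 have "(\<Sum>n=1..m. Kronecker d (int n)) = (\<Sum>n=1..m. h (int n))" by (intro sum.cong) (auto simp: hK)
 also have "... = sum h (int ` {1..m})" by (simp add: sum.reindex)
 also have "int ` {1..m} = {1..<1 + int m}" by (auto simp: image_int_atLeastAtMost)
 finally show ?thesis .
 qed
 show "(\<Sum>n=1..8 * nat \<bar>d\<bar>. Kronecker d (int n)) = 0"
 unfolding conv using sum_periodic_block[where h = h and N = N and a = 1, OF N] h_per zero
 by (simp add: N_def add.commute)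
 show "\<bar>\<Sum>n=1..m. Kronecker d (int n)\<bar> <= 8*\<bar>d\<bar>"
 unfolding conv N_def[symmetric]
 proof (rule abs_sum_periodic_le[where h = h and N = N, OF N _ zero])
 show "\<bar>h x\<bar> <= 1" for x unfolding h_def by (rule abs_Kronecker_le_1[OF modpos])
 qed (erule h_per)
qed

section \<open>Analytic continuation by repeated summation by parts\<close>

text \<open>Each summation by parts replaces the weight by its difference g(x) - g(x+1). After k
  rounds the weight x^(-s) has become a k-th difference of size x^(-Re s - k), which moves the half
  plane of absolute convergence to Re s > 1 - k.\<close>

primrec iterated_diff :: "nat \<Rightarrow> (real \<Rightarrow> complex) \<Rightarrow> real \<Rightarrow> complex" where
 "iterated_diff 0 g = g"
| "iterated_diff (Suc k) g = iterated_diff k (%x. g x - g (x + 1))"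

lemma iterated_diff_Suc:
 "iterated_diff (Suc k) g x = iterated_diff k g x - iterated_diff k g (x + 1)"
proof (induction k arbitrary: g x)
 case (Suc k)
 have "iterated_diff (Suc (Suc k)) g x = iterated_diff (Suc k) (%x. g x - g (x + 1)) x"
 by (simp only: iterated_diff.simps)
 also have "... = iterated_diff k (%x. g x - g (x + 1)) x - iterated_diff k (%x. g x - g (x + 1)) (x + 1)"
 by (rule Suc.IH)
 finally show ?case by (simp only: iterated_diff.simps)
qed simp

text \<open>The mean value inequality, applied k times: a k-th difference is bounded by the k-th
  derivative. \<open>G j\<close> stands for the j-th derivative, and the induction passes to the
  family of differences of all derivatives at once.\<close>

lemma norm_iterated_diff_le:
 assumes "\<And>j x. x >= a ==> (G j has_vector_derivative G (Suc j) x) (at x)"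
 and "\<And>x. x >= a ==> norm (G k x) <= B"
 shows "norm (iterated_diff k (G 0) a) <= B"
 using assms
proof (induction k arbitrary: G)
 case 0
 then show ?case by simp
next
 case (Suc k)
 let ?H = "%j x. G j x - G j (x + 1)"
 have "norm (iterated_diff k (?H 0) a) <= B"
 proof (rule Suc.IH)
 fix j x assume "x >= a"
 then have 1: "(G j has_vector_derivative G (Suc j) x) (at x)"
  and 2: "(G j has_vector_derivative G (Suc j) (x + 1)) (at (x + 1))" using Suc.prems(1) by auto
 have "((%x. G j (x + 1)) has_vector_derivative G (Suc j) (x + 1)) (at x)"
 proof -
  have "((%x. x + 1) has_vector_derivative 1) (at x)"
  unfolding has_real_derivative_iff_has_vector_derivative[symmetric]
  by (auto intro!: derivative_eq_intros)
  from vector_diff_chain_at[OF this 2] show ?thesis by (simp add: o_def)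
 qed
 with 1 show "(?H j has_vector_derivative ?H (Suc j) x) (at x)" by (rule has_vector_derivative_diff)
 next
 fix x assume x: "x >= a"
 have "norm (G k (x + 1) - G k x) <= B * norm (x + 1 - x)"
 proof (rule differentiable_bound_general[where \<phi> = "%t. B * t" and a = x and b = "x + 1", simplified, THEN order_trans])
  show "continuous_on {x..x + 1} (G k)"
  using x by (auto intro!: continuous_at_imp_continuous_on Suc.prems(1)[THEN has_vector_derivative_continuous])
  show "\<And>y. x < y ==> y < x + 1 ==> (G k has_vector_derivative G (Suc k) y) (at y)"
  using Suc.prems(1) x by auto
  show "\<And>y. x < y ==> y < x + 1 ==> ((*) B has_vector_derivative B) (at y)"
  by (auto intro!: derivative_eq_intros simp: has_real_derivative_iff_has_vector_derivative[symmetric])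
  show "\<And>y. x < y ==> y < x + 1 ==> norm (G (Suc k) y) <= B" using Suc.prems(2) x by auto
 qed (auto intro!: continuous_intros simp: algebra_simps)
 then show "norm (?H k x) <= B" by (simp add: norm_minus_commute)
 qed
 then show ?case by simp
qed

lemma has_vector_derivative_of_real_powr:
 fixes w :: complex
 assumes "x > 0"
 shows "((%x. of_real x powr w) has_vector_derivative (w * of_real x powr (w - 1))) (at x)"
proof -
 have "((%z. z powr w) has_field_derivative (w * of_real x powr (w - 1))) (at (of_real x))"
 using assms by (intro has_field_derivative_powr) (auto simp: complex_nonpos_Reals_iff)
 then show ?thesis by (rule has_vector_derivative_real_field)
qed

lemma norm_iterated_diff_powr_le:
 assumes a: "a > 0" and s: "Re s + real k >= 0"
 shows "norm (iterated_diff k (%x. of_real x powr - s) a) \<le>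
   (\<Prod>i<k. cmod (s + of_nat i)) * a powr (- Re s - real k)"
proof -
 define G where "G = (%j x. (\<Prod>i<j. - s - of_nat i) * of_real x powr (- s - of_nat j))"
 have "norm (iterated_diff k (G 0) a) <= (\<Prod>i<k. cmod (s + of_nat i)) * a powr (- Re s - real k)"
 proof (rule norm_iterated_diff_le)
 fix j x assume "x >= a"
 then have "x > 0" using a by simp
 from has_vector_derivative_mult_right[OF has_vector_derivative_of_real_powr[OF this],
  of "\<Prod>i<j. - s - of_nat i" "- s - of_nat j"]
 show "(G j has_vector_derivative G (Suc j) x) (at x)" unfolding G_def
  by (simp add: algebra_simps diff_diff_eq)
 next
 fix x assume x: "x >= a"
 have "norm (G k x) = (\<Prod>i<k. cmod (s + of_nat i)) * x powr (- Re s - real k)"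
  using x a by (simp add: G_def norm_mult prod_norm[symmetric] norm_powr_real_powr norm_minus_commute[of "- s"] add.commute)
 also have "... <= (\<Prod>i<k. cmod (s + of_nat i)) * a powr (- Re s - real k)"
  using x a s by (intro mult_left_mono powr_mono2' prod_nonneg) auto
 finally show "norm (G k x) <= (\<Prod>i<k. cmod (s + of_nat i)) * a powr (- Re s - real k)" .
 qed
 then show ?thesis by (simp add: G_def)
qed

lemma holomorphic_iterated_diff_powr:
 assumes "x > 0"
 shows "(%s. iterated_diff k (%x. of_real x powr - s) x) holomorphic_on A"
 using assms
proof (induction k arbitrary: x)
 case 0
 then show ?case by (auto intro!: holomorphic_intros)
next
 case (Suc k)
 then show ?case unfolding iterated_diff_Suc by (intro holomorphic_intros Suc.IH) auto
qed

definition mean_zero_periodic :: "nat \<Rightarrow> (nat \<Rightarrow> complex) \<Rightarrow> bool" where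
 "mean_zero_periodic q f \<longleftrightarrow> q > 0 & (\<forall>n. f (n + q) = f n) & (\<Sum>n<q. f n) = 0"

definition partial_sum_mean :: "nat \<Rightarrow> (nat \<Rightarrow> complex) \<Rightarrow> complex" where
 "partial_sum_mean q f = (\<Sum>n<q. \<Sum>m\<le>n. f m) / of_nat q"

text \<open>Removing the average over a period makes the partial sums periodic with mean zero again,
  so that summation by parts can be repeated indefinitely.\<close>

definition centred_partial_sum :: "nat \<Rightarrow> (nat \<Rightarrow> complex) \<Rightarrow> nat \<Rightarrow> complex" where
 "centred_partial_sum q f n = (\<Sum>m\<le>n. f m) - partial_sum_mean q f"

lemma mean_zero_periodic_centred_partial_sum:
 assumes "mean_zero_periodic q f"
 shows "mean_zero_periodic q (centred_partial_sum q f)"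
proof -
 have q: "q > 0" and per: "\<And>n. f (n + q) = f n" and z: "(\<Sum>n<q. f n) = 0"
 using assms by (auto simp: mean_zero_periodic_def)
 have "(\<Sum>m\<le>n+q. f m) = (\<Sum>m\<le>n. f m)" for n
 proof (induction n)
 case 0
 then show ?case using z per[of 0] by (simp add: lessThan_Suc_atMost[symmetric])
 next
 case (Suc n)
 then show ?case using per[of "Suc n"] by simp
 qed
 moreover have "(\<Sum>n<q. centred_partial_sum q f n) = 0"
 using q by (simp add: centred_partial_sum_def sum_subtractf partial_sum_mean_def)
 ultimately show ?thesis using q by (simp add: mean_zero_periodic_def centred_partial_sum_def)
qed

lemma mean_zero_periodic_bounded:
 assumes "mean_zero_periodic q f"
 obtains B where "B > 0" "\<And>n. cmod (f n) <= B"
proof -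
 have q: "q > 0" and per: "\<And>n. f (n + q) = f n"
 using assms by (auto simp: mean_zero_periodic_def)
 have mod: "f (n mod q) = f n" for n
 proof (induction n rule: less_induct)
 case (less n)
 show ?case using less[of "n - q"] per[of "n - q"] q by (cases "n < q") (auto simp: le_mod_geq)
 qed
 have "cmod (f n) <= (\<Sum>i<q. cmod (f i)) + 1" for n
 using member_le_sum[of "n mod q" "{..<q}" "%i. cmod (f i)"] q mod[of n] by simp
 then show ?thesis using that[of "(\<Sum>i<q. cmod (f i)) + 1"] by (simp add: sum_nonneg add_nonneg_pos)
qed

definition diff_series :: "(nat \<Rightarrow> complex) \<Rightarrow> nat \<Rightarrow> complex \<Rightarrow> complex" where
 "diff_series f k s = (\<Sum>n. f n * iterated_diff k (%x. of_real x powr - s) (real (Suc n)))"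

lemma norm_diff_series_term_le:
 assumes "\<And>n. cmod (f n) <= B" "Re s + real k >= 0"
 shows "cmod (f n * iterated_diff k (%x. of_real x powr - s) (real (Suc n)))
  <= B*(\<Prod>i<k. cmod (s + of_nat i)) * real (Suc n) powr (- Re s - real k)"
proof -
 have "cmod (f n * iterated_diff k (%x. of_real x powr - s) (real (Suc n)))
 <= B*((\<Prod>i<k. cmod (s + of_nat i)) * real (Suc n) powr (- Re s - real k))"
 unfolding norm_mult by (intro mult_mono assms norm_iterated_diff_powr_le order_trans[OF norm_ge_zero assms(1)]) (use assms in auto)
 then show ?thesis by (simp add: mult_ac)
qed

lemma summable_Suc_powr: "a < -1 ==> summable (%n. real (Suc n) powr a)"
 using summable_Suc_iff[of "%n. real n powr a"] by (simp add: summable_real_powr_iff)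

lemma summable_diff_series:
 assumes "\<And>n. cmod (f n) <= B" "Re s + real k > 1"
 shows "summable (%n. f n * iterated_diff k (%x. of_real x powr - s) (real (Suc n)))"
proof (rule summable_comparison_test'[where N = 0])
 show "summable (%n. B*(\<Prod>i<k. cmod (s + of_nat i)) * real (Suc n) powr (- Re s - real k))"
 using assms(2) by (intro summable_mult summable_Suc_powr) auto
qed (use assms in \<open>intro norm_diff_series_term_le\<close>, auto)

lemma holomorphic_diff_series:
 assumes B: "\<And>n. cmod (f n) <= B"
 shows "diff_series f k holomorphic_on {s. Re s > 1 - real k}"
proof (rule holomorphic_uniform_sequence)
 show "open {s. Re s > 1 - real k}" by (rule open_halfspace_Re_gt)
 show "(%s. \<Sum>n<N. f n * iterated_diff k (%x. of_real x powr - s) (real (Suc n)))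
  holomorphic_on {s. Re s > 1 - real k}" for N
 by (intro holomorphic_intros holomorphic_iterated_diff_powr) auto
 fix s0 assume "s0 \<in> {s. Re s > 1 - real k}"
 define r where "r = (Re s0 - (1 - real k))/2"
 have r: "r > 0" using \<open>s0 \<in> _\<close> by (simp add: r_def)
 define \<sigma> where "\<sigma> = Re s0 - r"
 have "\<sigma> - (1 - real k) = r" by (simp add: \<sigma>_def r_def field_simps)
 then have \<sigma>: "\<sigma> > 1 - real k" using r by linarith
 have Re: "Re s >= \<sigma>" if "s \<in> cball s0 r" for s
 using that abs_Re_le_cmod[of "s0 - s"] by (auto simp: dist_norm \<sigma>_def)
 have "compact ((%s. \<Prod>i<k. cmod (s + of_nat i)) ` cball s0 r)"
 by (intro compact_continuous_image continuous_intros) auto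
 then have "bounded ((%s. \<Prod>i<k. cmod (s + of_nat i)) ` cball s0 r)" by (rule compact_imp_bounded)
 then obtain C where "\<And>x. x \<in> (%s. \<Prod>i<k. cmod (s + of_nat i)) ` cball s0 r ==> norm x <= C"
 unfolding bounded_iff by blast
 then have C: "(\<Prod>i<k. cmod (s + of_nat i)) <= C" if "s \<in> cball s0 r" for s
 using order_trans[OF abs_ge_self, of "\<Prod>i<k. cmod (s + of_nat i)" C] that by auto
 have B0: "B >= 0" using order_trans[OF norm_ge_zero B] .
 have "uniform_limit (cball s0 r) (%N s. \<Sum>n<N. f n * iterated_diff k (%x. of_real x powr - s) (real (Suc n)))
   (diff_series f k) sequentially"
 unfolding diff_series_def[abs_def]
 proof (rule Weierstrass_m_test)
 fix n s assume s: "s \<in> cball s0 r"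
 have "cmod (f n * iterated_diff k (%x. of_real x powr - s) (real (Suc n)))
  <= B*(\<Prod>i<k. cmod (s + of_nat i)) * real (Suc n) powr (- Re s - real k)"
  by (rule norm_diff_series_term_le[OF B]) (use Re[OF s] \<sigma> in auto)
 also have "... <= B * C * real (Suc n) powr (- \<sigma> - real k)"
  using Re[OF s] C[OF s] B0 by (intro mult_mono powr_mono) (auto intro!: mult_nonneg_nonneg prod_nonneg order_trans[OF _ C[OF s]])
 finally show "cmod (f n * iterated_diff k (%x. of_real x powr - s) (real (Suc n)))
  <= B * C * real (Suc n) powr (- \<sigma> - real k)" .
 next
 show "summable (%n. B * C * real (Suc n) powr (- \<sigma> - real k))"
  using \<sigma> by (intro summable_mult summable_Suc_powr) auto
 qed
 moreover have "cball s0 r \<subseteq> {s. Re s > 1 - real k}" using Re \<sigma> by force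
 ultimately show "\<exists>d>0. cball s0 d \<subseteq> {s. Re s > 1 - real k} \<and>
  uniform_limit (cball s0 d) (%N s. \<Sum>n<N. f n * iterated_diff k (%x. of_real x powr - s) (real (Suc n)))
  (diff_series f k) sequentially" using r by blast
qed

text \<open>One summation by parts. The constant part of the partial sums telescopes to the boundary
  term at x = 1, the centred part goes into the next difference series. The hypothesis is weaker by
  one than absolute convergence of the series on the left, because that next series has gained a
  power of n.\<close>

lemma diff_series_sums:
 assumes f: "mean_zero_periodic q f" and s: "Re s > - real k"
 shows "(%n. f n * iterated_diff k (%x. of_real x powr - s) (real (Suc n))) sums
   (partial_sum_mean q f * iterated_diff k (%x. of_real x powr - s) 1
   + diff_series (centred_partial_sum q f) (Suc k) s)"
proof -
 define g where "g = iterated_diff k (%x. of_real x powr - s)"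
 define m where "m = partial_sum_mean q f"
 define h where "h = centred_partial_sum q f"
 obtain B' where B': "\<And>n. cmod (h n) <= B'" unfolding h_def
 using mean_zero_periodic_bounded[OF mean_zero_periodic_centred_partial_sum[OF f]] by metis
 have g_tendsto: "(%n. g (real (Suc n))) \<longlonglongrightarrow> 0"
 proof (rule Lim_null_comparison)
 show "\<forall>\<^sub>F n in sequentially. cmod (g (real (Suc n))) \<le>
  (\<Prod>i<k. cmod (s + of_nat i)) * real (Suc n) powr (- Re s - real k)"
  unfolding g_def by (intro always_eventually allI norm_iterated_diff_powr_le) (use s in auto)
 show "(%n. (\<Prod>i<k. cmod (s + of_nat i)) * real (Suc n) powr (- Re s - real k)) \<longlonglongrightarrow> 0"
  using s by (intro tendsto_mult_right_zero LIMSEQ_Suc tendsto_neg_powr filterlim_real_sequentially) auto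
 qed
 have A: "(\<Sum>i\<le>n. f i) = h n + m" for n by (simp add: h_def m_def centred_partial_sum_def)
 have part: "(\<Sum>n<N. f n * g (real (Suc n))) =
  m * g 1 + (\<Sum>n<N. h n*(g (real (Suc n)) - g (real (Suc n) + 1)))
  + (if N = 0 then - m * g 1 else h (N - 1) * g (real (Suc N)))" for N
 proof (induction N)
 case (Suc N)
 have fN: "f N = (if N = 0 then h N + m else h N - h (N - 1))"
  using A[of N] A[of "N - 1"] by (cases N) (auto simp: eq_diff_eq add.commute)
 show ?case
 proof (cases "N = 0")
  case False
  then have e: "f N * G = h N * G - h (N - 1) * G" for G using fN by (simp add: left_diff_distrib)
  show ?thesis using Suc False by (simp add: algebra_simps e)
 qed (use fN in \<open>simp add: algebra_simps\<close>)
 qed simp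
 have "(%N. \<Sum>n<N. h n*(g (real (Suc n)) - g (real (Suc n) + 1))) \<longlonglongrightarrow> diff_series h (Suc k) s"
 unfolding diff_series_def g_def iterated_diff_Suc[symmetric]
 by (intro summable_LIMSEQ summable_diff_series[OF B']) (use s in auto)
 then have lim2: "(%N. \<Sum>n<Suc N. h n*(g (real (Suc n)) - g (real (Suc n) + 1))) \<longlonglongrightarrow> diff_series h (Suc k) s"
 by (rule LIMSEQ_Suc)
 have lim3: "(%N. h N * g (real (Suc (Suc N)))) \<longlonglongrightarrow> 0"
 proof (rule Lim_null_comparison)
 show "\<forall>\<^sub>F N in sequentially. cmod (h N * g (real (Suc (Suc N)))) <= B' * cmod (g (real (Suc (Suc N))))"
  unfolding norm_mult by (intro always_eventually allI mult_right_mono B') auto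
 show "(%N. B' * cmod (g (real (Suc (Suc N))))) \<longlonglongrightarrow> 0"
  using tendsto_mult_right_zero[OF tendsto_norm_zero[OF LIMSEQ_Suc[OF g_tendsto]]] .
 qed
 have "(%N. \<Sum>n<Suc N. f n * g (real (Suc n))) \<longlonglongrightarrow> m * g 1 + diff_series h (Suc k) s + 0"
 unfolding part by (simp only: if_False nat.distinct diff_Suc_1) (intro tendsto_intros lim2 lim3)
 then have "(%N. \<Sum>n<N. f n * g (real (Suc n))) \<longlonglongrightarrow> m * g 1 + diff_series h (Suc k) s"
 unfolding add_0_right by (rule LIMSEQ_imp_Suc)
 then show ?thesis by (simp only: sums_def m_def g_def h_def)
qed

lemma diff_series_step:
 assumes "mean_zero_periodic q f" "Re s > 1 - real k"
 shows "diff_series f k s = partial_sum_mean q f * iterated_diff k (%x. of_real x powr - s) 1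
   + diff_series (centred_partial_sum q f) (Suc k) s"
 using diff_series_sums[OF assms(1), of k s] assms(2) by (simp add: diff_series_def sums_iff)

text \<open>The outcome of k summations by parts: all boundary terms at x = 1, and a remainder that
  converges absolutely for Re s > 1 - k. Different k agree wherever both are valid.\<close>

definition diff_series_extension :: "nat \<Rightarrow> (nat \<Rightarrow> complex) \<Rightarrow> nat \<Rightarrow> complex \<Rightarrow> complex" where
 "diff_series_extension q f k s =
  (\<Sum>j<k. partial_sum_mean q ((centred_partial_sum q ^^ j) f) * iterated_diff j (%x. of_real x powr - s) 1)
  + diff_series ((centred_partial_sum q ^^ k) f) k s"

lemma mean_zero_periodic_funpow:
 "mean_zero_periodic q f ==> mean_zero_periodic q ((centred_partial_sum q ^^ k) f)"
 by (induction k) (auto intro: mean_zero_periodic_centred_partial_sum)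

lemma diff_series_extension_eq:
 assumes f: "mean_zero_periodic q f" and s: "Re s > 1 - real k" and "k <= l"
 shows "diff_series_extension q f l s = diff_series_extension q f k s"
 using \<open>k <= l\<close>
proof (induction l rule: dec_induct)
 case (step l)
 have "diff_series_extension q f l s = diff_series_extension q f (Suc l) s"
 unfolding diff_series_extension_def
 using diff_series_step[OF mean_zero_periodic_funpow[OF f, of l], of l s] step(1) s by simp
 with step show ?case by simp
qed simp

text \<open>The half planes Re s > 1 - k exhaust the plane, so at each s any sufficiently large k
  defines the value. The form with k = 1 is recorded separately, since it yields an explicit growth
  bound.\<close>

lemma Dirichlet_series_continuation:
 assumes f: "mean_zero_periodic q f"
 obtains F where "F holomorphic_on UNIV"
 "\<And>s. Re s > 0 ==> (%n. f n * of_nat (Suc n) powr - s) sums F s"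
 "\<And>s. Re s > 0 ==> F s = partial_sum_mean q f + diff_series (centred_partial_sum q f) 1 s"
proof -
 define K where "K = (%s. nat \<lceil>2 - Re s\<rceil>)"
 have K: "Re s > 1 - real (K s)" for s unfolding K_def by linarith
 define F where "F = (%s. diff_series_extension q f (K s) s)"
 have eq: "F s = diff_series_extension q f k s" if "Re s > 1 - real k" for s k
 unfolding F_def using diff_series_extension_eq[OF f that] diff_series_extension_eq[OF f K[of s]]
 by (metis linorder_le_cases)
 have "F holomorphic_on UNIV"
 proof (rule holomorphic_on_UN_open[where A = "%k::nat. {s. Re s > 1 - real k}", THEN holomorphic_on_subset])
 fix k :: nat
 obtain B where "\<And>n. cmod ((centred_partial_sum q ^^ k) f n) <= B"
  using mean_zero_periodic_bounded[OF mean_zero_periodic_funpow[OF f, of k]] by metis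
 then have "diff_series_extension q f k holomorphic_on {s. Re s > 1 - real k}"
  unfolding diff_series_extension_def[abs_def]
  by (intro holomorphic_intros holomorphic_iterated_diff_powr holomorphic_diff_series) auto
 then show "F holomorphic_on {s. Re s > 1 - real k}"
  by (rule holomorphic_transform) (auto simp: eq)
 show "open {s. Re s > 1 - real k}" by (rule open_halfspace_Re_gt)
 next
 show "UNIV \<subseteq> (\<Union>k\<in>UNIV. {s. Re s > 1 - real k})" using K by blast
 qed
 moreover have F1: "F s = partial_sum_mean q f + diff_series (centred_partial_sum q f) 1 s" if "Re s > 0" for s
 using that eq[of 1 s] by (simp add: diff_series_extension_def)
 moreover have "(%n. f n * of_nat (Suc n) powr - s) sums F s" if "Re s > 0" for s
 using diff_series_sums[OF f, of 0 s] F1[OF that] that by simp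
 ultimately show ?thesis using that by blast
qed

text \<open>The integral test: by the mean value theorem the n-th term is at most a difference of
  n^(-\<sigma>) / \<sigma>, and these differences telescope to 1/\<sigma>.\<close>

lemma sums_Suc_powr_bound:
 assumes "\<sigma> > 0"
 shows "(\<Sum>n. real (Suc n) powr (- \<sigma> - 1)) <= 1 + 1 / \<sigma>"
proof -
 have step: "real (Suc n) powr (- \<sigma> - 1) <= 1 / \<sigma>*(real n powr - \<sigma> - real (Suc n) powr - \<sigma>)" if "n > 0" for n
 proof -
 have "\<exists>\<xi>. real n < \<xi> & \<xi> < real (Suc n) \<and>
  real (Suc n) powr - \<sigma> - real n powr - \<sigma> = (real (Suc n) - real n)*(- \<sigma>*\<xi> powr (- \<sigma> - 1))"
 proof (rule MVT2[of "real n" "real (Suc n)" "%x. x powr - \<sigma>" "%x. - \<sigma> * x powr (- \<sigma> - 1)"], goal_cases)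
  case (2 x)
  then show ?case using that by (auto intro!: derivative_eq_intros)
 qed auto
 then obtain \<xi> where \<xi>: "real n < \<xi>" "\<xi> < real (Suc n)"
  "real (Suc n) powr - \<sigma> - real n powr - \<sigma> = (real (Suc n) - real n)*(- \<sigma>*\<xi> powr (- \<sigma> - 1))"
  by blast
 have "real (Suc n) powr (- \<sigma> - 1) <= \<xi> powr (- \<sigma> - 1)" using \<xi> that assms by (intro powr_mono2') auto
 moreover have "1 / \<sigma>*(real n powr - \<sigma> - real (Suc n) powr - \<sigma>) = \<xi> powr (- \<sigma> - 1)"
  using \<xi>(3) assms by (simp add: field_simps)
 ultimately show ?thesis by simp
 qed
 have lim: "(%n. real (Suc n) powr - \<sigma>) \<longlonglongrightarrow> 0"
 using assms by (intro LIMSEQ_Suc tendsto_neg_powr filterlim_real_sequentially) auto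
 have tele: "(%n. 1 / \<sigma>*(real (Suc n) powr - \<sigma> - real (Suc (Suc n)) powr - \<sigma>)) sums (1 / \<sigma>*(1 - 0))"
 using telescope_sums'[OF lim] by (intro sums_mult) simp
 have sm: "summable (%n. real (Suc n) powr (- \<sigma> - 1))" using assms by (intro summable_Suc_powr) simp
 have sm2: "summable (%n. real (Suc (Suc n)) powr (- \<sigma> - 1))"
 by (rule summable_Suc_iff[of "%n. real (Suc n) powr (- \<sigma> - 1)", THEN iffD2]) (rule sm)
 have "(\<Sum>n. real (Suc (Suc n)) powr (- \<sigma> - 1)) <= 1 / \<sigma>*(1 - 0)"
 unfolding sums_unique[OF tele]
 by (intro suminf_le sm2 sums_summable[OF tele] step) simp
 moreover have "(\<Sum>n. real (Suc n) powr (- \<sigma> - 1)) = (\<Sum>n. real (Suc (Suc n)) powr (- \<sigma> - 1)) + 1"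
 using suminf_split_head[OF sm] by simp
 ultimately show ?thesis by simp
qed

lemma norm_diff_series_one_le:
 assumes B: "\<And>n. cmod (f n) <= B" and s: "Re s > 0"
 shows "cmod (diff_series f 1 s) <= B * cmod s*(1 + 1 / Re s)"
proof -
 have B0: "B >= 0" using order_trans[OF norm_ge_zero B] .
 have sm: "summable (%n. real (Suc n) powr (- Re s - 1))" using s by (intro summable_Suc_powr) auto
 have "cmod (diff_series f 1 s) <= (\<Sum>n. B * cmod s * real (Suc n) powr (- Re s - 1))"
 unfolding diff_series_def
 by (intro norm_suminf_le summable_mult sm)
  (use norm_diff_series_term_le[of f B s 1] B s in auto)
 also have "... = B * cmod s*(\<Sum>n. real (Suc n) powr (- Re s - 1))" using sm by (rule suminf_mult)
 also have "... <= B * cmod s*(1 + 1 / Re s)"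
 using sums_Suc_powr_bound[OF s] B0 by (intro mult_left_mono) auto
 finally show ?thesis .
qed

lemma norm_partial_sum_mean_le:
 assumes "q > 0" "\<And>n. cmod (\<Sum>m\<le>n. f m) <= B"
 shows "cmod (partial_sum_mean q f) <= B"
proof -
 have "cmod (\<Sum>n<q. \<Sum>m\<le>n. f m) <= (\<Sum>n<q. B)" by (intro sum_norm_le assms)
 then show ?thesis using assms(1) by (simp add: partial_sum_mean_def norm_divide field_simps)
qed

text \<open>The partial sums of the character are at most 8|d|, the centred ones at most 16|d|, and
  one summation by parts gives a bound linear in |d| and |s|. Only the logarithm of this bound
  matters later.\<close>

lemma L_continuation_exists_nontrivial:
 assumes d: "fundamental_discriminant d" "d \<noteq> 1"
 obtains F where "is_L_continuation d F"
 "\<And>s. Re s > 0 ==> cmod (F s) <= 16*\<bar>real_of_int d\<bar>*(1 + cmod s*(1 + 1 / Re s))"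
 "\<And>s. Re s > 0 ==> (%n. of_int (Kronecker d (int (Suc n))) * of_nat (Suc n) powr - s) sums F s"
proof -
 define q where "q = 8 * nat \<bar>d\<bar>"
 define f where "f = (%n. complex_of_int (Kronecker d (int (Suc n))))"
 define B where "B = 8*\<bar>real_of_int d\<bar>"
 have d0: "d \<noteq> 0" using d by (auto simp: fundamental_discriminant_def)
 then have q: "q > 0" by (simp add: q_def)
 have sums: "(\<Sum>m<n. f m) = of_int (\<Sum>m=1..n. Kronecker d (int m))" for n
 by (simp add: f_def sum.atLeast1_atMost_eq)
 have part: "cmod (\<Sum>m\<le>n. f m) <= B" for n
 proof -
 have "(\<Sum>m\<le>n. f m) = of_int (\<Sum>m=1..Suc n. Kronecker d (int m))"
  unfolding sums[symmetric] by (simp add: lessThan_Suc_atMost)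
 then have "cmod (\<Sum>m\<le>n. f m) = real_of_int \<bar>\<Sum>m=1..Suc n. Kronecker d (int m)\<bar>"
  by (simp only: norm_of_int of_int_abs)
 also have "... <= real_of_int (8*\<bar>d\<bar>)"
  using abs_sum_Kronecker_le(2)[OF d, of "Suc n"] by (simp only: of_int_le_iff)
 finally show ?thesis by (simp add: B_def)
 qed
 have "mean_zero_periodic q f"
 unfolding mean_zero_periodic_def
 proof (intro conjI allI q)
 show "f (n + q) = f n" for n
 proof -
  have "int (Suc (n + q)) - int (Suc n) = 8*\<bar>d\<bar>" by (simp add: q_def)
  then have "[int (Suc (n + q)) = int (Suc n)] (mod 8 * d)"
  by (simp only: cong_iff_dvd_diff) (simp add: abs_if)
  then show ?thesis using Kronecker_periodic_fundamental[OF d(1)]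
  unfolding Kronecker_periodic_def f_def by (metis of_nat_0_less_iff zero_less_Suc)
 qed
 show "(\<Sum>n<q. f n) = 0" using abs_sum_Kronecker_le(1)[OF d] by (simp add: sums q_def)
 qed
 from Dirichlet_series_continuation[OF this] obtain F where F: "F holomorphic_on UNIV"
 "\<And>s. Re s > 0 ==> (%n. f n * of_nat (Suc n) powr - s) sums F s"
 "\<And>s. Re s > 0 ==> F s = partial_sum_mean q f + diff_series (centred_partial_sum q f) 1 s" by metis
 have "is_L_continuation d F"
 using F(1,2) d(2) unfolding is_L_continuation_def L_domain_def
 by (simp add: f_def powr_minus divide_inverse)
 moreover have "cmod (F s) <= 16*\<bar>real_of_int d\<bar>*(1 + cmod s*(1 + 1 / Re s))" if s: "Re s > 0" for s
 proof -
 have m: "cmod (partial_sum_mean q f) <= B" by (rule norm_partial_sum_mean_le[OF q part])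
 have "cmod (centred_partial_sum q f n) <= 2 * B" for n
  using norm_triangle_ineq4[of "\<Sum>m\<le>n. f m" "partial_sum_mean q f"] part[of n] m
  by (simp add: centred_partial_sum_def)
 from norm_diff_series_one_le[OF this s]
 have "cmod (F s) <= B + 2 * B * cmod s*(1 + 1 / Re s)"
  unfolding F(3)[OF s] by (intro norm_triangle_le add_mono m)
 also have "... <= 2 * B*(1 + cmod s*(1 + 1 / Re s))" by (simp add: B_def algebra_simps)
 finally show ?thesis by (simp add: B_def)
 qed
 ultimately show ?thesis using that F(2) unfolding f_def by blast
qed

lemma norm_nat_powr: "n > 0 ==> cmod (of_nat n powr s) = real n powr Re s"
 by (subst norm_powr_real_powr) auto

lemma summable_Suc_powr_complex:
 assumes "Re s > 1"
 shows "summable (%n. complex_of_nat (Suc n) powr - s)"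
 by (rule summable_comparison_test'[where N = 0 and g = "%n. real (Suc n) powr - Re s"])
  (use assms summable_Suc_powr[of "- Re s"] in \<open>simp_all add: norm_nat_powr del: of_nat_Suc\<close>)

text \<open>Subtracting m times the multiples of m gives zeta a factor 1 - m^(1-s) and makes the
  coefficients periodic with mean zero, so the continuation by summation by parts applies to the
  product.\<close>

lemma sums_Suc_powr_multiples_removed:
 assumes s: "Re s > 1" and m: "m > 0"
 shows "(%n. (if m dvd Suc n then 1 - of_nat m else 1) * complex_of_nat (Suc n) powr - s)
   sums ((1 - of_nat m powr (1 - s))*(\<Sum>n. complex_of_nat (Suc n) powr - s))"
proof -
 let ?a = "%n. complex_of_nat (Suc n) powr - s"
 let ?b = "%n. if m dvd Suc n then ?a n else 0"
 have sa: "summable (%n. norm (?a n))"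
 using s summable_Suc_powr[of "- Re s"] by (simp add: norm_nat_powr del: of_nat_Suc)
 have "summable ?b"
 by (rule summable_comparison_test'[OF sa, where N = 0]) auto
 then have b: "?b sums suminf ?b" by (rule summable_sums)
 have "(%n. sum ?b {n * m..<n * m + m}) sums suminf ?b" by (rule sums_group[OF b m])
 \<comment> \<open>The series is grouped into blocks of length m. Because the index is shifted by
   one, the only multiple of m in a block is its last element.\<close>
 moreover have "sum ?b {n * m..<n * m + m} = of_nat m powr - s * ?a n" for n
 proof -
 have e: "Suc (n * m + m - 1) = m * Suc n" using m by (simp add: algebra_simps)
 have "sum ?b {n * m..<n * m + m} = (\<Sum>i\<in>{n * m + m - 1}. ?b i)"
 proof (rule sum.mono_neutral_right)
  show "\<forall>i\<in>{n * m..<n * m + m} - {n * m + m - 1}. ?b i = 0"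
  proof
  fix i assume i: "i \<in> {n * m..<n * m + m} - {n * m + m - 1}"
  have "\<not> m dvd Suc i"
  proof
   assume "m dvd Suc i"
   then obtain k where k: "Suc i = m * k" by auto
   have "m * n < Suc i" "Suc i < m * Suc n" using i m by (auto simp: algebra_simps)
   then have "m * n < m * k" "m * k < m * Suc n" unfolding k by blast+
   then have "n < k" "k < Suc n" using mult_less_cancel1 by blast+
   then show False by simp
  qed
  then show "?b i = 0" by simp
  qed
 qed (use m in auto)
 also have "... = ?b (n * m + m - 1)" by simp
 also have "... = of_nat (m * Suc n) powr - s" unfolding e by (simp only: dvd_triv_left if_True)
 also have "... = of_nat m powr - s * of_nat (Suc n) powr - s"
  unfolding of_nat_mult by (rule powr_times_real) auto
 finally show ?thesis .
 qed
 ultimately have "(%n. of_nat m powr - s * ?a n) sums suminf ?b" by simp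
 moreover have "(%n. of_nat m powr - s * ?a n) sums (of_nat m powr - s * suminf ?a)"
 by (intro sums_mult summable_sums summable_Suc_powr_complex s)
 ultimately have sb: "suminf ?b = of_nat m powr - s * suminf ?a" by (rule sums_unique2)
 have "(%n. ?a n - of_nat m * ?b n) sums (suminf ?a - of_nat m * suminf ?b)"
 by (intro sums_diff sums_mult b summable_sums summable_Suc_powr_complex s)
 also have "suminf ?a - of_nat m * suminf ?b = (1 - of_nat m powr (1 - s)) * suminf ?a"
 using m by (simp add: sb powr_diff powr_minus field_simps)
 also have "(%n. ?a n - of_nat m * ?b n) = (%n. (if m dvd Suc n then 1 - of_nat m else 1) * ?a n)"
 by (auto simp: algebra_simps)
 finally show ?thesis .
qed

lemma mean_zero_periodic_multiples:
 assumes "m > 0"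
 shows "mean_zero_periodic m (%n. if m dvd Suc n then 1 - of_nat m else 1)"
 unfolding mean_zero_periodic_def
proof (intro conjI allI assms)
 fix n
 have "m dvd Suc (n + m) \<longleftrightarrow> m dvd Suc n" using dvd_add_left_iff[of m m "Suc n"] by simp
 then show "(if m dvd Suc (n + m) then 1 - of_nat m else (1::complex)) = (if m dvd Suc n then 1 - of_nat m else 1)"
 by simp
next
 obtain k where k: "m = Suc k" using assms by (cases m) auto
 have "(\<Sum>n<m. if m dvd Suc n then 1 - of_nat m else (1::complex)) = (\<Sum>n<k. 1) + (1 - of_nat m)"
 unfolding k sum.lessThan_Suc by (intro arg_cong2[where f = "(+)"] sum.cong) (auto dest: dvd_imp_le)
 then show "(\<Sum>n<m. if m dvd Suc n then 1 - of_nat m else (1::complex)) = 0" by (simp add: k)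
qed

text \<open>A nonzero common solution would make ln 2 / ln 3 rational, hence a power of 2 equal to a
  power of 3; parity excludes this.\<close>

lemma two_powr_and_three_powr_eq_1:
 assumes "(2::complex) powr w = 1" "(3::complex) powr w = 1"
 shows "w = 0"
proof (rule ccontr)
 assume w: "w \<noteq> 0"
 have "Ln 2 = of_real (ln 2)" "Ln 3 = of_real (ln 3)" using Ln_of_real[of 2] Ln_of_real[of 3] by simp_all
 with assms have "exp (w * of_real (ln 2)) = 1" "exp (w * of_real (ln 3)) = 1" by (simp_all add: powr_def)
 then obtain k l :: int where "Re w = 0" "Im w * ln 2 = 2 * k * pi" "Im w * ln 3 = 2 * l * pi"
 by (auto simp: exp_eq_1)
 then have k: "w * of_real (ln 2) = of_int (2 * k) * of_real pi*\<i>"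
 and l: "w * of_real (ln 3) = of_int (2 * l) * of_real pi*\<i>" by (simp_all add: complex_eq_iff)
 have "of_real (real_of_int l * ln 2) * w = of_int l*(w * of_real (ln 2))" by simp
 also have "... = of_int k*(w * of_real (ln 3))" by (simp only: k l) (simp add: mult_ac)
 also have "... = of_real (real_of_int k * ln 3) * w" by simp
 finally have kl: "real_of_int l * ln 2 = real_of_int k * ln 3" using w by (simp del: of_real_mult)
 have "k \<noteq> 0" using k w by auto
 have "real_of_int \<bar>l\<bar> * ln 2 = real_of_int \<bar>k\<bar> * ln 3" using arg_cong[OF kl, of abs] by (simp add: abs_mult)
 then have "ln (2 ^ nat \<bar>l\<bar>) = ln (3 ^ nat \<bar>k\<bar> :: real)" by (simp add: ln_realpow)
 then have "(2::real) ^ nat \<bar>l\<bar> = 3 ^ nat \<bar>k\<bar>" by (subst (asm) ln_inj_iff) auto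
 then have e: "(2::nat) ^ nat \<bar>l\<bar> = 3 ^ nat \<bar>k\<bar>"
 by (metis of_nat_eq_iff of_nat_numeral of_nat_power)
 have "odd ((3::nat) ^ nat \<bar>k\<bar>)" by simp
 then have "nat \<bar>l\<bar> = 0" using e by (metis even_power even_numeral neq0_conv)
 then have "3 ^ nat \<bar>k\<bar> = (1::nat)" using e by simp
 then show False using \<open>k \<noteq> 0\<close> by simp
qed

text \<open>The products (1 - 2^(1-s)) zeta(s) and (1 - 3^(1-s)) zeta(s) are entire. Cross
  multiplication shows that the two quotients agree where both make sense, and away from s = 1 at
  least one denominator is nonzero.\<close>

lemma zeta_continuation_exists: "\<exists>F. is_L_continuation 1 F"
proof -
 obtain E where E: "E holomorphic_on UNIV" "\<And>s. Re s > 0 ==>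
  (%n. (if 2 dvd Suc n then 1 - of_nat 2 else 1) * of_nat (Suc n) powr - s) sums E s"
 using Dirichlet_series_continuation[OF mean_zero_periodic_multiples[of 2, OF zero_less_numeral]] by metis
 obtain T where T: "T holomorphic_on UNIV" "\<And>s. Re s > 0 ==>
  (%n. (if 3 dvd Suc n then 1 - of_nat 3 else 1) * of_nat (Suc n) powr - s) sums T s"
 using Dirichlet_series_continuation[OF mean_zero_periodic_multiples[of 3, OF zero_less_numeral]] by metis
 let ?z = "%s. \<Sum>n. complex_of_nat (Suc n) powr - s"
 let ?e = "%s. 1 - (2::complex) powr (1 - s)" and ?t = "%s. 1 - (3::complex) powr (1 - s)"
 have Ez: "E s = ?e s * ?z s" and Tz: "T s = ?t s * ?z s" if "Re s > 1" for s
 using that sums_unique2[OF E(2) sums_Suc_powr_multiples_removed[OF that, of 2]]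
  sums_unique2[OF T(2) sums_Suc_powr_multiples_removed[OF that, of 3]] by simp_all
 have eq: "E s * ?t s = T s * ?e s" for s
 proof (rule analytic_continuation_open[where s = "{s. Re s > 1}" and s' = UNIV
  and f = "%s. E s * ?t s" and g = "%s. T s * ?e s"])
 show "open {s. Re s > 1}" by (rule open_halfspace_Re_gt)
 show "{s. Re s > 1} \<noteq> {}" by (auto intro: exI[of _ 2])
 qed (auto intro!: holomorphic_intros E T simp: Ez Tz)
 define F where "F = (%s. if ?e s \<noteq> 0 then E s / ?e s else T s / ?t s)"
 have Fe: "F s = E s / ?e s" if "?e s \<noteq> 0" for s using that by (simp add: F_def)
 have Ft: "F s = T s / ?t s" if "?t s \<noteq> 0" for s
 proof (cases "?e s \<noteq> 0")
 case True
 then show ?thesis using eq[of s] that by (simp add: F_def frac_eq_eq mult.commute)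
 qed (use that in \<open>simp add: F_def\<close>)
 have oe: "open {s. ?e s \<noteq> 0}" and ot: "open {s. ?t s \<noteq> 0}"
 by (intro open_Collect_neq continuous_intros; simp)+
 have "F holomorphic_on {s. ?e s \<noteq> 0}"
 by (rule holomorphic_transform[of "%s. E s / ?e s"])
  (auto intro!: holomorphic_intros holomorphic_on_subset[OF E(1)] simp: Fe)
 moreover have "F holomorphic_on {s. ?t s \<noteq> 0}"
 by (rule holomorphic_transform[of "%s. T s / ?t s"])
  (auto intro!: holomorphic_intros holomorphic_on_subset[OF T(1)] simp: Ft)
 ultimately have "F holomorphic_on ({s. ?e s \<noteq> 0} \<union> {s. ?t s \<noteq> 0})"
 using oe ot by (intro holomorphic_on_Un) auto
 moreover have "L_domain 1 \<subseteq> {s. ?e s \<noteq> 0} \<union> {s. ?t s \<noteq> 0}"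
 using two_powr_and_three_powr_eq_1[of "1 - s" for s] by (force simp: L_domain_def)
 ultimately have hol: "F holomorphic_on L_domain 1" by (rule holomorphic_on_subset)
 have "F s = ?z s" if "Re s > 1" for s
 proof -
 have "norm ((2::complex) powr (1 - s)) = 2 powr (1 - Re s)"
  using norm_nat_powr[of 2 "1 - s"] by simp
 also have "... < 2 powr 0" using that by (intro powr_less_mono) auto
 finally have "?e s \<noteq> 0" by auto
 then show ?thesis using Fe Ez that by simp
 qed
 then have "(%n. of_int (Kronecker 1 (int (Suc n))) / of_nat (Suc n) powr s) sums F s" if "Re s > 1" for s
 using summable_sums[OF summable_Suc_powr_complex[OF that]] that
 by (simp add: Kronecker_one_left powr_minus divide_inverse del: of_nat_Suc)
 with hol show ?thesis unfolding is_L_continuation_def by blast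
qed

lemma Dirichlet_L_is_continuation:
 assumes "fundamental_discriminant d"
 shows "is_L_continuation d (Dirichlet_L d)"
proof -
 have "\<exists>f. is_L_continuation d f"
 using zeta_continuation_exists L_continuation_exists_nontrivial[OF assms] by (cases "d = 1") (simp, blast)
 then show ?thesis unfolding Dirichlet_L_def by (rule someI_ex)
qed

lemma holomorphic_Dirichlet_L:
 "fundamental_discriminant d ==> Dirichlet_L d holomorphic_on L_domain d"
 using Dirichlet_L_is_continuation by (simp add: is_L_continuation_def)

lemma norm_Dirichlet_L_le:
 assumes d: "fundamental_discriminant d" "d \<noteq> 1" and s: "Re s > 0"
 shows "cmod (Dirichlet_L d s) <= 16*\<bar>real_of_int d\<bar>*(1 + cmod s*(1 + 1 / Re s))"
proof -
 obtain F where F: "is_L_continuation d F"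
 "\<And>s. Re s > 0 ==> cmod (F s) <= 16*\<bar>real_of_int d\<bar>*(1 + cmod s*(1 + 1 / Re s))"
 using L_continuation_exists_nontrivial[OF d] by metis
 have "Dirichlet_L d s = F s"
 by (rule is_L_continuation_unique[OF Dirichlet_L_is_continuation[OF d(1)] F(1)])
  (use d(2) in \<open>simp add: L_domain_def\<close>)
 then show ?thesis using F(2)[OF s] by simp
qed

lemma Dirichlet_L_sums:
 assumes d: "fundamental_discriminant d" "d \<noteq> 1" and s: "Re s > 0"
 shows "(%n. of_int (Kronecker d (int (Suc n))) * of_nat (Suc n) powr - s) sums Dirichlet_L d s"
proof -
 obtain F where F: "is_L_continuation d F"
 "\<And>s. Re s > 0 ==> (%n. of_int (Kronecker d (int (Suc n))) * of_nat (Suc n) powr - s) sums F s"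
 using L_continuation_exists_nontrivial[OF d] by metis
 have "Dirichlet_L d s = F s"
 by (rule is_L_continuation_unique[OF Dirichlet_L_is_continuation[OF d(1)] F(1)])
  (use d(2) in \<open>simp add: L_domain_def\<close>)
 then show ?thesis using F(2)[OF s] by simp
qed

text \<open>Here \<open>t n s\<close> is the difference between N^(-s) and the integral of u^(-s)
  over [N, N+1], with N = n + 1; it is at most |s| N^(-Re s - 1). The integrals add up to 1/(s - 1),
  and the sum of the differences converges for Re s > 0.\<close>

lemma norm_zeta_minus_pole_le:
 assumes s: "Re s > 0" "s \<noteq> 1"
 shows "cmod (Dirichlet_L 1 s - 1/(s - 1)) <= cmod s*(1 + 1 / Re s)"
proof -
 have fund: "fundamental_discriminant 1" by (simp add: fundamental_discriminant_def)
 let ?D = "{s. Re s > 0} - {1::complex}"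
 define t where "t = (%n s. complex_of_nat (Suc n) powr - s -
  (of_nat (Suc n) powr (1 - s) - of_nat (Suc (Suc n)) powr (1 - s))/(s - 1))"
 have bd: "cmod (t n s) <= cmod s * real (Suc n) powr (- Re s - 1)" if "Re s > 0" "s \<noteq> 1" for n s
 proof -
 let ?N = "real (Suc n)"
 \<comment> \<open>\<open>\<phi>\<close> interpolates: it is x N^(-s) minus the integral of u^(-s)
   over [N, N + x]. Its value at 0 is 0, at 1 it is \<open>t n s\<close>, and its derivative is
   bounded by a second mean value estimate.\<close>
 define \<phi> where "\<phi> = (%x::real. of_real x * of_real ?N powr - s -
  (of_real ?N powr (1 - s) - of_real (?N + x) powr (1 - s))/(s - 1))"
 have der: "(\<phi> has_vector_derivative (of_real ?N powr - s - of_real (?N + x) powr - s)) (at x)" if "x >= 0" for x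
 proof -
  have "((%x. x + ?N) has_vector_derivative 1) (at x)"
  unfolding has_real_derivative_iff_has_vector_derivative[symmetric] by (auto intro!: derivative_eq_intros)
  from vector_diff_chain_at[OF this has_vector_derivative_of_real_powr[of "x + ?N" "1 - s"]] that
  have "((%x. of_real (?N + x) powr (1 - s)) has_vector_derivative ((1 - s) * of_real (?N + x) powr - s)) (at x)"
  by (simp add: o_def add.commute)
  note * = has_vector_derivative_divide[OF has_vector_derivative_diff[OF has_vector_derivative_const[of "of_real ?N powr (1 - s)"] this], of "s - 1"]
  have "((%x. (of_real ?N powr (1 - s) - of_real (?N + x) powr (1 - s))/(s - 1)) has_vector_derivative
   (of_real (?N + x) powr - s)) (at x)"
  proof -
  have eqD: "(0 - (1 - s) * X)/(s - 1) = X" for X using \<open>s \<noteq> 1\<close> by (simp add: divide_eq_eq algebra_simps)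
  show ?thesis using * by (simp only: eqD)
  qed
  moreover have "((%x. of_real x * of_real ?N powr - s) has_vector_derivative (of_real ?N powr - s)) (at x)"
  by (rule has_vector_derivative_real_field) (auto intro!: derivative_eq_intros)
  ultimately show ?thesis unfolding \<phi>_def by (intro has_vector_derivative_diff)
 qed
 have "norm (of_real ?N powr - s - of_real (?N + x) powr - s) <= cmod s * ?N powr (- Re s - 1)" if x: "0 <= x" "x <= 1" for x
 proof -
  have "norm (of_real (?N + x) powr - s - of_real ?N powr - s) <= cmod s * ?N powr (- Re s - 1)*(?N + x) - cmod s * ?N powr (- Re s - 1) * ?N"
  proof (cases "x = 0")
  case False
  show ?thesis
  proof (rule differentiable_bound_general[where f = "%y. of_real y powr - s"
    and \<phi> = "%y. cmod s * ?N powr (- Re s - 1) * y"])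
   show "continuous_on {?N..?N + x} (%y. complex_of_real y powr - s)"
   using has_vector_derivative_of_real_powr[THEN has_vector_derivative_continuous]
   by (intro continuous_at_imp_continuous_on) auto
   fix y assume y: "?N < y" "y < ?N + x"
   show "((%y. of_real y powr - s) has_vector_derivative (- s * of_real y powr (- s - 1))) (at y)"
   using y by (intro has_vector_derivative_of_real_powr) auto
   show "((%y. cmod s * ?N powr (- Re s - 1) * y) has_vector_derivative cmod s * ?N powr (- Re s - 1)) (at y)"
   unfolding has_real_derivative_iff_has_vector_derivative[symmetric] by (auto intro!: derivative_eq_intros)
   show "norm (- s * of_real y powr (- s - 1)) <= cmod s * ?N powr (- Re s - 1)"
   using y \<open>Re s > 0\<close> by (auto simp: norm_mult norm_powr_real_powr intro!: mult_left_mono powr_mono2')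
  qed (use x False in \<open>auto intro!: continuous_intros\<close>)
  qed simp
  also have "... = cmod s * ?N powr (- Re s - 1) * x" by (simp add: algebra_simps)
  also have "... <= cmod s * ?N powr (- Re s - 1)*1" using x by (intro mult_left_mono) auto
  finally show ?thesis by (simp add: norm_minus_commute)
 qed
 note bound = this
 have "norm (\<phi> 1 - \<phi> 0) <= cmod s * ?N powr (- Re s - 1)*1 - cmod s * ?N powr (- Re s - 1)*0"
 proof (rule differentiable_bound_general[where \<phi> = "%y. cmod s * ?N powr (- Re s - 1) * y"
   and f' = "%x. of_real ?N powr - s - of_real (?N + x) powr - s"])
  show "continuous_on {0..1} \<phi>"
  using der[THEN has_vector_derivative_continuous] by (intro continuous_at_imp_continuous_on) auto
  show "((%y. cmod s * ?N powr (- Re s - 1) * y) has_vector_derivative cmod s * ?N powr (- Re s - 1)) (at y)" for y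
  unfolding has_real_derivative_iff_has_vector_derivative[symmetric] by (auto intro!: derivative_eq_intros)
 qed (use der bound in \<open>auto intro!: continuous_intros\<close>)
 then show ?thesis by (simp add: \<phi>_def t_def add.commute)
 qed
 have sm: "summable (%n. real (Suc n) powr (- Re s - 1))" if "Re s > 0" for s :: complex
 using that by (intro summable_Suc_powr) simp
 have smt: "summable (%n. t n s)" if "Re s > 0" "s \<noteq> 1" for s
 by (rule summable_comparison_test'[where N = 0, OF summable_mult[OF sm[OF that(1)]]]) (use bd that in auto)
 define Z where "Z = (%s. 1/(s - 1) + (\<Sum>n. t n s))"
 have openD: "open ?D" by (intro open_Diff open_halfspace_Re_gt) auto
 have "(%s. \<Sum>n. t n s) holomorphic_on ?D"
 proof (rule holomorphic_uniform_sequence[OF openD])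
 show "(%s. \<Sum>n<N. t n s) holomorphic_on ?D" for N
  unfolding t_def by (intro holomorphic_intros) auto
 fix s0 assume s0: "s0 \<in> ?D"
 obtain r where r: "r > 0" "cball s0 r \<subseteq> ?D" using openD s0 open_contains_cball by blast
 define \<sigma> where "\<sigma> = Re s0 - r"
 have "s0 - of_real r \<in> cball s0 r" using r by (simp add: dist_norm)
 then have "s0 - of_real r \<in> ?D" using r by blast
 then have \<sigma>: "\<sigma> > 0" by (simp add: \<sigma>_def)
 have Re: "Re s >= \<sigma>" if "s \<in> cball s0 r" for s
  using that abs_Re_le_cmod[of "s0 - s"] by (auto simp: dist_norm \<sigma>_def)
 have "uniform_limit (cball s0 r) (%N s. \<Sum>n<N. t n s) (%s. \<Sum>n. t n s) sequentially"
 proof (rule Weierstrass_m_test)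
  fix n s assume s: "s \<in> cball s0 r"
  then have "Re s > 0" "s \<noteq> 1" using r by auto
  then have "cmod (t n s) <= cmod s * real (Suc n) powr (- Re s - 1)" by (rule bd)
  also have "... <= (cmod s0 + r) * real (Suc n) powr (- \<sigma> - 1)"
  using Re[OF s] s norm_triangle_ineq2[of s s0] r
  by (intro mult_mono powr_mono) (auto simp: dist_norm norm_minus_commute)
  finally show "cmod (t n s) <= (cmod s0 + r) * real (Suc n) powr (- \<sigma> - 1)" .
 next
  show "summable (%n. (cmod s0 + r) * real (Suc n) powr (- \<sigma> - 1))"
  using \<sigma> by (intro summable_mult summable_Suc_powr) auto
 qed
 then show "\<exists>d>0. cball s0 d \<subseteq> ?D & uniform_limit (cball s0 d) (%N s. \<Sum>n<N. t n s) (%s. \<Sum>n. t n s) sequentially"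
  using r by blast
 qed
 then have holZ: "Z holomorphic_on ?D" unfolding Z_def by (intro holomorphic_intros) auto
 have eqZ: "Dirichlet_L 1 s = Z s" if "Re s > 1" for s
 proof -
 have s1: "s \<noteq> 1" using that by auto
 have l1: "(%n. complex_of_nat (Suc n) powr - s) sums Dirichlet_L 1 s"
  using Dirichlet_L_is_continuation[OF fund] that unfolding is_L_continuation_def
  by (auto simp: Kronecker_one_left powr_minus divide_inverse simp del: of_nat_Suc)
 have "(%n. complex_of_nat (Suc n) powr (1 - s)) \<longlonglongrightarrow> 0"
 proof (rule tendsto_norm_zero_cancel)
  have "(%n. real (Suc n) powr (1 - Re s)) \<longlonglongrightarrow> 0"
  using that by (intro LIMSEQ_Suc tendsto_neg_powr filterlim_real_sequentially) auto
  then show "(%n. cmod (complex_of_nat (Suc n) powr (1 - s))) \<longlonglongrightarrow> 0"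
  by (simp add: norm_nat_powr del: of_nat_Suc)
 qed
 from telescope_sums'[OF this]
 have "(%n. of_nat (Suc n) powr (1 - s) - complex_of_nat (Suc (Suc n)) powr (1 - s)) sums 1" by simp
 from sums_diff[OF l1 sums_divide[OF this, of "s - 1"]]
 have "(%n. t n s) sums (Dirichlet_L 1 s - 1/(s - 1))" by (simp add: t_def)
 then show ?thesis by (simp add: Z_def sums_iff)
 qed
 have "Dirichlet_L 1 s = Z s"
 proof (rule analytic_continuation_open[where s = "{s. Re s > 1}" and s' = ?D and f = "Dirichlet_L 1" and g = Z])
 show "open {s. Re s > 1}" by (rule open_halfspace_Re_gt)
 show "{s. Re s > 1} \<noteq> {}" by (auto intro: exI[of _ 2])
 show "connected ?D"
  by (intro connected_open_delete open_halfspace_Re_gt convex_connected convex_halfspace_Re_gt) auto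
 show "Dirichlet_L 1 holomorphic_on ?D"
  by (rule holomorphic_on_subset[OF holomorphic_Dirichlet_L[OF fund]]) (auto simp: L_domain_def)
 qed (use openD holZ eqZ s in auto)
 then have "Dirichlet_L 1 s - 1/(s - 1) = (\<Sum>n. t n s)" by (simp add: Z_def)
 also have "cmod ... <= (\<Sum>n. cmod s * real (Suc n) powr (- Re s - 1))"
 by (intro norm_suminf_le summable_mult sm bd s)
 also have "... = cmod s*(\<Sum>n. real (Suc n) powr (- Re s - 1))" using sm[OF s(1)] by (rule suminf_mult)
 also have "... <= cmod s*(1 + 1 / Re s)" by (intro mult_left_mono sums_Suc_powr_bound s) auto
 finally show ?thesis .
qed

section \<open>Dirichlet series, their logarithms and logarithmic derivatives\<close>

lemma has_sum_over_divisors: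
 fixes g :: "nat \<times> nat \<Rightarrow> 'a::{topological_comm_monoid_add, t3_space}"
 assumes "(g has_sum S) ({0<..} \<times> {0<..})"
 shows "((%n. \<Sum>d | d dvd n. g (d, n div d)) has_sum S) {0<..}"
proof -
 have "(g has_sum S) ({0<..} \<times> {0<..}) \<longleftrightarrow>
  ((%(n, d). g (d, n div d)) has_sum S) (Sigma {0<..} (%n. {d. d dvd n}))"
 by (rule has_sum_reindex_bij_witness[where i = "%(n, d). (d, n div d)" and j = "%(a, b). (a * b, a)"])
  (auto elim!: dvdE)
 with assms have "((%(n, d). g (d, n div d)) has_sum S) (Sigma {0<..} (%n. {d. d dvd n}))" by blast
 then show ?thesis by (rule has_sum_SigmaD) (auto intro!: has_sum_finiteI finite_divisors_nat)
qed

lemma has_sum_dirichlet_convolution: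
 fixes x y :: "nat \<Rightarrow> complex"
 assumes x: "summable (%n. cmod (x n))" "x 0 = 0" and y: "summable (%n. cmod (y n))" "y 0 = 0"
 shows "(%n. \<Sum>d | d dvd n. x d * y (n div d)) sums ((\<Sum>n. x n)*(\<Sum>n. y n))"
proof -
 have hx: "(x has_sum suminf x) UNIV" and hy: "(y has_sum suminf y) UNIV"
 using x y by (auto intro!: norm_summable_imp_has_sum summable_sums summable_norm_cancel)
 have ax: "(%n. norm (x n)) summable_on UNIV" and ay: "(%n. norm (y n)) summable_on UNIV"
 using x y by (auto intro!: norm_summable_imp_summable_on)
 let ?g = "%(a, b). x a * y b"
 have "(%p. norm (?g p)) summable_on (UNIV \<times> UNIV)"
 proof (subst Infinite_Sum.abs_summable_on_Sigma_iff, intro conjI ballI)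
 fix a show "(%b. norm (?g (a, b))) summable_on UNIV"
  using summable_on_cmult_right[OF ay, of "cmod (x a)"] by (simp add: norm_mult)
 next
 have "(%a. cmod (x a) * infsum (%b. cmod (y b)) UNIV) summable_on UNIV"
  by (intro summable_on_cmult_left ax)
 then show "(%a. norm (infsum (%b. norm (?g (a, b))) UNIV)) summable_on UNIV"
  by (simp add: norm_mult infsum_cmult_right' infsum_nonneg abs_mult)
 qed
 then have "?g summable_on (UNIV \<times> UNIV)" by (rule abs_summable_summable)
 then have hg: "(?g has_sum infsum ?g (UNIV \<times> UNIV)) (UNIV \<times> UNIV)" by (rule has_sum_infsum)
 have "((%a. x a * suminf y) has_sum infsum ?g (UNIV \<times> UNIV)) UNIV"
 by (rule has_sum_SigmaD[OF hg]) (auto intro!: has_sum_cmult_right hy)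
 moreover have "((%a. x a * suminf y) has_sum (suminf x * suminf y)) UNIV"
 by (intro has_sum_cmult_left hx)
 ultimately have "infsum ?g (UNIV \<times> UNIV) = suminf x * suminf y" using has_sum_unique by blast
 with hg have "(?g has_sum (suminf x * suminf y)) (UNIV \<times> UNIV)" by simp
 moreover have "(?g has_sum (suminf x * suminf y)) (UNIV \<times> UNIV)
  \<longleftrightarrow> (?g has_sum (suminf x * suminf y)) ({0<..} \<times> {0<..})"
 by (rule has_sum_cong_neutral) (use x y in \<open>auto intro!: Nat.gr0I\<close>)
 ultimately have "(?g has_sum (suminf x * suminf y)) ({0<..} \<times> {0<..})" by simp
 from has_sum_over_divisors[OF this]
 have "((%n. \<Sum>d | d dvd n. x d * y (n div d)) has_sum (suminf x * suminf y)) {0<..}" by simp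
 also have "?this \<longleftrightarrow> ((%n. \<Sum>d | d dvd n. x d * y (n div d)) has_sum (suminf x * suminf y)) UNIV"
 by (rule has_sum_cong_neutral) auto
 finally show ?thesis by (rule has_sum_imp_sums)
qed

definition unit_completely_multiplicative :: "(nat \<Rightarrow> complex) \<Rightarrow> bool" where
 "unit_completely_multiplicative f \<longleftrightarrow>
  f 1 = 1 & (\<forall>m>0. \<forall>n>0. f (m * n) = f m * f n) & (\<forall>n. cmod (f n) <= 1)"

definition dirichlet_series :: "(nat \<Rightarrow> complex) \<Rightarrow> complex \<Rightarrow> complex" where
 "dirichlet_series c s = (\<Sum>n. c n * of_nat n powr - s)"

lemma norm_dirichlet_term_le:
 assumes "cmod (c n) <= 1"
 shows "cmod (c n * of_nat n powr - s) <= real n powr - Re s"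
proof (cases "n = 0")
 case False
 then have "cmod (c n * of_nat n powr - s) = cmod (c n) * real n powr - Re s"
 by (simp add: norm_mult norm_nat_powr)
 also have "... <= 1 * real n powr - Re s" using assms by (intro mult_right_mono) auto
 finally show ?thesis by simp
qed simp

lemma summable_dirichlet_series_norm:
 assumes "\<And>n. cmod (c n) <= 1" "Re s > 1"
 shows "summable (%n. cmod (c n * of_nat n powr - s))"
 by (rule summable_comparison_test'[where N = 0 and g = "%n. real n powr - Re s"])
  (use assms norm_dirichlet_term_le in \<open>simp_all add: summable_real_powr_iff\<close>)

lemma summable_ln_powr:
 assumes "\<sigma> > 1"
 shows "summable (%n. ln (real n) * real n powr - \<sigma>)"
proof (rule summable_comparison_test'[where N = 1])
 define h where "h = (\<sigma> - 1)/2"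
 show "summable (%n. 1 / h * real n powr (h - \<sigma>))"
 using assms by (intro summable_mult) (simp add: summable_real_powr_iff h_def field_simps)
 fix n :: nat assume n: "n >= 1"
 have "ln (real n) <= real n powr h / h" using n assms by (intro ln_powr_bound) (auto simp: h_def)
 then have "ln (real n) * real n powr - \<sigma> <= real n powr h / h * real n powr - \<sigma>" by (intro mult_right_mono) auto
 also have "... = 1 / h * real n powr (h - \<sigma>)" using n by (simp add: powr_add[symmetric] powr_diff powr_minus field_simps)
 finally show "norm (ln (real n) * real n powr - \<sigma>) <= 1 / h * real n powr (h - \<sigma>)" using n by simp
qed

lemma summable_dirichlet_series_ln_norm:
 assumes c: "\<And>n. cmod (c n) <= ln (real n)" and s: "Re s > 1" and c0: "c 0 = 0"
 shows "summable (%n. cmod (c n * of_nat n powr - s))"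
proof (rule summable_comparison_test'[where N = 1, OF summable_ln_powr[OF s]])
 fix n :: nat assume "n >= 1"
 then have "cmod (c n * of_nat n powr - s) = cmod (c n) * real n powr - Re s"
 by (simp add: norm_mult norm_nat_powr)
 also have "... <= ln (real n) * real n powr - Re s" by (intro mult_right_mono c) auto
 finally show "norm (cmod (c n * of_nat n powr - s)) <= ln (real n) * real n powr - Re s" by simp
qed

lemma has_field_derivative_dirichlet_series:
 assumes c: "\<And>n. cmod (c n) <= 1" and s: "Re s > 1"
 shows "(dirichlet_series c has_field_derivative
   - dirichlet_series (%n. c n * of_real (ln (real n))) s) (at s)"
proof -
 define \<sigma> where "\<sigma> = (1 + Re s)/2"
 have \<sigma>: "\<sigma> > 1" "\<sigma> < Re s" using s by (simp_all add: \<sigma>_def)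
 let ?S = "{z. Re z >= \<sigma>}"
 let ?f = "%n z. c n * of_nat n powr - z" and ?f' = "%n z. - (c n * of_real (ln (real n)) * of_nat n powr - z)"
 have der: "(?f n has_field_derivative ?f' n z) (at z within ?S)" for n z
 proof (cases "n = 0")
 case False
 then have "((%w. of_nat n powr w) has_field_derivative Ln (of_nat n) * of_nat n powr - z) (at (- z))"
  by (intro has_field_derivative_powr_right) auto
 moreover have "((%z. - z) has_field_derivative - 1) (at z)" by (auto intro!: derivative_eq_intros)
 ultimately have "((%z. of_nat n powr - z) has_field_derivative Ln (of_nat n) * of_nat n powr - z * - 1) (at z)"
  by (rule DERIV_chain2)
 from DERIV_cmult[OF this, of "c n"] have "(?f n has_field_derivative
  c n*(Ln (of_nat n) * of_nat n powr - z * - 1)) (at z within ?S)" by (rule has_field_derivative_at_within)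
 moreover have "c n*(Ln (of_nat n) * of_nat n powr - z * - 1) = ?f' n z"
  using False by (simp add: Ln_of_nat)
 ultimately show ?thesis by (rule DERIV_cong)
 qed simp
 have unif: "uniformly_convergent_on ?S (%n z. \<Sum>i<n. ?f' i z)"
 proof (rule Weierstrass_m_test'[OF _ summable_ln_powr[OF \<sigma>(1)]])
 fix n z assume z: "z \<in> ?S"
 show "norm (?f' n z) <= ln (real n) * real n powr - \<sigma>"
 proof (cases "n = 0")
  case False
  then have "norm (?f' n z) = ln (real n)*(cmod (c n) * real n powr - Re z)"
  by (simp add: norm_mult norm_nat_powr)
  also have "... <= ln (real n)*(1 * real n powr - \<sigma>)"
  using False z c by (intro mult_left_mono mult_mono powr_mono) auto
  finally show ?thesis by simp
 qed simp
 qed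
 have "s \<in> interior ?S"
 proof (rule interiorI[where T = "{z. Re z > \<sigma>}"])
 show "open {z. Re z > \<sigma>}" by (rule open_halfspace_Re_gt)
 qed (use \<sigma> in auto)
 from has_field_derivative_series'(2)[OF convex_halfspace_Re_ge der unif _ _ this, of s]
 have "((%z. \<Sum>n. ?f n z) has_field_derivative (\<Sum>n. ?f' n s)) (at s)"
 using \<sigma> summable_norm_cancel[OF summable_dirichlet_series_norm[OF c s]] by auto
 moreover have "(\<Sum>n. ?f' n s) = - dirichlet_series (%n. c n * of_real (ln (real n))) s"
 proof -
 have "summable (%n. cmod (c n * of_real (ln (real n)) * of_nat n powr - s))"
 proof (rule summable_dirichlet_series_ln_norm[OF _ s])
  show "cmod (c n * of_real (ln (real n))) <= ln (real n)" for n
  using mult_right_mono[OF c[of n], of "ln (real n)"] by (cases "n = 0") (auto simp: norm_mult)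
 qed simp
 from suminf_minus[OF summable_norm_cancel[OF this]] show ?thesis unfolding dirichlet_series_def .
 qed
 ultimately show ?thesis unfolding dirichlet_series_def[abs_def] by simp
qed

text \<open>Every term with n >= 2 gains a factor (1/2)^k. The limit serves to identify a constant
  of integration.\<close>

lemma dirichlet_series_near_infinity:
 assumes c: "\<And>n. cmod (c n) <= 1"
 shows "(%k. dirichlet_series c (of_nat (k + 2))) \<longlonglongrightarrow> c 1"
proof (rule LIM_zero_cancel, rule Lim_null_comparison)
 define Z where "Z = (\<Sum>n. real n powr - 2)"
 have sZ: "summable (%n. real n powr - 2)" by (simp add: summable_real_powr_iff)
 show "\<forall>\<^sub>F k in sequentially. cmod (dirichlet_series c (of_nat (k + 2)) - c 1) <= (1/2) ^ k * Z"
 proof (intro always_eventually allI)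
 fix k
 let ?t = "%n. c n * of_nat n powr - complex_of_nat (k + 2)"
 have sm: "summable (%n. cmod (?t n))" by (rule summable_dirichlet_series_norm[OF c]) simp
 have "(%n. ?t n - (if n = 1 then c 1 else 0)) sums (dirichlet_series c (of_nat (k + 2)) - c 1)"
  unfolding dirichlet_series_def
  by (intro sums_diff summable_sums summable_norm_cancel[OF sm] sums_single)
 then have "dirichlet_series c (of_nat (k + 2)) - c 1 = (\<Sum>n. ?t n - (if n = 1 then c 1 else 0))"
  by (simp add: sums_iff)
 also have "cmod ... <= (\<Sum>n. (1/2) ^ k * real n powr - 2)"
 proof (rule norm_suminf_le)
  fix n :: nat
  consider "n = 0" | "n = 1" | "n >= 2" by linarith
  then show "cmod (?t n - (if n = 1 then c 1 else 0)) <= (1/2) ^ k * real n powr - 2"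
  proof cases
  case 3
  have "cmod (?t n) <= real n powr - Re (complex_of_nat (k + 2))" by (rule norm_dirichlet_term_le[OF c])
  also have "... = (1 / real n) ^ k * real n powr - 2"
   using 3 by (simp add: powr_add powr_diff powr_minus powr_realpow divide_simps power_divide)
  also have "... <= (1/2) ^ k * real n powr - 2"
   using 3 by (intro mult_right_mono power_mono) (auto simp: divide_simps)
  finally show ?thesis using 3 by simp
  qed auto
 qed (intro summable_mult sZ)
 also have "... = (1/2) ^ k * Z" unfolding Z_def by (intro suminf_mult sZ)
 finally show "cmod (dirichlet_series c (of_nat (k + 2)) - c 1) <= (1/2) ^ k * Z" .
 qed
 show "(%k. (1/2) ^ k * Z) \<longlonglongrightarrow> 0"
 by (rule tendsto_mult_left_zero) (simp add: LIMSEQ_power_zero)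
qed

lemma norm_mangoldt_over_ln_le: "cmod (mangoldt n / of_real (ln (real n))) <= 1"
proof (cases "n <= 1")
 case True
 then have "n = 0 \<or> n = Suc 0" by auto
 then show ?thesis by auto
next
 case False
 then have "mangoldt n <= ln (real n)" "ln (real n) > 0" by (auto intro: mangoldt_le)
 then show ?thesis by (simp add: norm_divide)
qed

definition mangoldt_series :: "(nat \<Rightarrow> complex) \<Rightarrow> complex \<Rightarrow> complex" where
 "mangoldt_series f = dirichlet_series (%n. mangoldt n * f n)"

text \<open>The Dirichlet series of log L: the quotient is 1/k at a prime power p^k and 0 elsewhere,
  including n = 1, where 0/0 is 0 by convention.\<close>

definition log_series :: "(nat \<Rightarrow> complex) \<Rightarrow> complex \<Rightarrow> complex" where
 "log_series f = dirichlet_series (%n. mangoldt n / of_real (ln (real n)) * f n)"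

lemma norm_log_coeff_le:
 assumes "\<And>n. cmod (f n) <= 1"
 shows "cmod (mangoldt n / of_real (ln (real n)) * f n) <= 1"
 unfolding norm_mult using mult_mono[OF norm_mangoldt_over_ln_le assms, of n n] by simp

lemma norm_mangoldt_coeff_le:
 assumes "\<And>n. cmod (f n) <= 1"
 shows "cmod (mangoldt n * f n) <= ln (real n)"
proof (cases "n = 0")
 case False
 then have "mangoldt n * cmod (f n) <= ln (real n)*1"
 using assms by (intro mult_mono mangoldt_le) (auto simp: mangoldt_nonneg)
 then show ?thesis by (simp add: norm_mult)
qed simp

lemma has_field_derivative_log_series:
 assumes f: "\<And>n. cmod (f n) <= 1" and s: "Re s > 1"
 shows "(log_series f has_field_derivative - mangoldt_series f s) (at s)"
proof -
 have "mangoldt n / of_real (ln (real n)) * f n * of_real (ln (real n)) = mangoldt n * f n" for n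
 proof (cases "n <= 1")
 case True
 then have "n = 0 \<or> n = Suc 0" by auto
 then show ?thesis by auto
 qed simp
 then show ?thesis
 using has_field_derivative_dirichlet_series[where c = "%n. mangoldt n / of_real (ln (real n)) * f n",
  OF norm_log_coeff_le[where f = f, OF f] s]
 by (simp add: log_series_def mangoldt_series_def)
qed

text \<open>The identity "Mangoldt convolved with 1 is log", twisted by the completely
  multiplicative f, says that the differentiated series is the product of the two series.\<close>

lemma has_field_derivative_unit_dirichlet_series:
 assumes f: "unit_completely_multiplicative f" and s: "Re s > 1"
 shows "(dirichlet_series f has_field_derivative - dirichlet_series f s * mangoldt_series f s) (at s)"
proof -
 have f1: "\<And>n. cmod (f n) <= 1" and fm: "\<And>m n. m > 0 ==> n > 0 ==> f (m * n) = f m * f n"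
 using f by (auto simp: unit_completely_multiplicative_def)
 have sm: "summable (%n. cmod (mangoldt n * f n * of_nat n powr - s))"
 by (rule summable_dirichlet_series_ln_norm[OF norm_mangoldt_coeff_le[OF f1] s]) simp
 have "(%n. \<Sum>d | d dvd n. (mangoldt d * f d * of_nat d powr - s)*(f (n div d) * of_nat (n div d) powr - s))
  sums (mangoldt_series f s * dirichlet_series f s)"
 unfolding mangoldt_series_def dirichlet_series_def
 by (rule has_sum_dirichlet_convolution[OF sm _ summable_dirichlet_series_norm[OF f1 s]]) simp_all
 also have "(%n. \<Sum>d | d dvd n. (mangoldt d * f d * of_nat d powr - s)*(f (n div d) * of_nat (n div d) powr - s))
  = (%n. f n * of_real (ln (real n)) * of_nat n powr - s)"
 proof
 fix n :: nat
 show "(\<Sum>d | d dvd n. (mangoldt d * f d * of_nat d powr - s)*(f (n div d) * of_nat (n div d) powr - s))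
  = f n * of_real (ln (real n)) * of_nat n powr - s"
 proof (cases "n = 0")
  case False
  have "(\<Sum>d | d dvd n. (mangoldt d * f d * of_nat d powr - s)*(f (n div d) * of_nat (n div d) powr - s))
  = (\<Sum>d | d dvd n. mangoldt d*(f n * of_nat n powr - s))"
  proof (intro sum.cong refl)
  fix d assume "d \<in> {d. d dvd n}"
  then obtain e where e: "n = d * e" by auto
  with False have de: "d > 0" "e > 0" by auto
  have "of_nat n powr - s = of_nat d powr - s * complex_of_nat e powr - s"
   unfolding e of_nat_mult by (rule powr_times_real) auto
  then show "(mangoldt d * f d * of_nat d powr - s)*(f (n div d) * of_nat (n div d) powr - s)
   = mangoldt d*(f n * of_nat n powr - s)"
   using de fm[of d e] e by (simp add: mult_ac)
  qed
  also have "... = of_real (ln (real n))*(f n * of_nat n powr - s)"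
  unfolding sum_distrib_right[symmetric] using mangoldt_sum[OF False, where ?'a = complex] by simp
  finally show ?thesis by (simp add: mult_ac)
 qed simp
 qed
 finally have "dirichlet_series (%n. f n * of_real (ln (real n))) s = mangoldt_series f s * dirichlet_series f s"
 unfolding dirichlet_series_def[of "%n. f n * of_real (ln (real n))"] by (simp add: sums_iff)
 then show ?thesis
 using has_field_derivative_dirichlet_series[where c = f, OF f1 s] by (simp add: mult.commute)
qed

text \<open>The product of the series with exp of minus its candidate logarithm has derivative 0, so
  it is constant on the half plane; letting s tend to infinity along the integers shows that the
  constant is 1. No Euler product is involved.\<close>

lemma exp_log_series:
 assumes f: "unit_completely_multiplicative f" and s: "Re s > 1"
 shows "exp (log_series f s) = dirichlet_series f s"
proof -
 have f1: "\<And>n. cmod (f n) <= 1" and fone: "f 1 = 1" using f by (auto simp: unit_completely_multiplicative_def)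
 let ?S = "{z. Re z > 1}"
 let ?q = "%z. dirichlet_series f z * exp (- log_series f z)"
 have "\<exists>c. \<forall>z\<in>?S. ?q z = c"
 proof (rule has_field_derivative_zero_constant)
 show "convex ?S" by (rule convex_halfspace_Re_gt)
 fix z assume "z \<in> ?S"
 then have z: "Re z > 1" by simp
 have "(?q has_field_derivative 0) (at z)"
  by (rule derivative_eq_intros has_field_derivative_unit_dirichlet_series[OF f z]
   has_field_derivative_log_series[OF f1 z] refl)+ (simp add: algebra_simps)
 then show "(?q has_field_derivative 0) (at z within ?S)" by (rule has_field_derivative_at_within)
 qed
 then obtain c where c: "\<And>z. Re z > 1 ==> ?q z = c" by auto
 have "(%k. ?q (of_nat (k + 2))) \<longlonglongrightarrow> f 1 * exp (- (mangoldt 1 / of_real (ln (real 1)) * f 1))"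
 unfolding log_series_def
 by (intro tendsto_intros dirichlet_series_near_infinity f1 norm_log_coeff_le)
 moreover have "(%k. ?q (of_nat (k + 2))) = (%k. c)" by (intro ext c) simp
 ultimately have "c = 1" using fone by (simp add: LIMSEQ_const_iff)
 with c[OF s] show ?thesis by (simp add: exp_minus field_simps)
qed

lemma norm_log_series_le:
 assumes f: "\<And>n. cmod (f n) <= 1" and s: "Re s > 1"
 shows "cmod (log_series f s) <= 1 + 1/(Re s - 1)"
proof -
 have sm: "summable (%n. real n powr - Re s)" using s by (simp add: summable_real_powr_iff)
 have "cmod (log_series f s) <= (\<Sum>n. real n powr - Re s)"
 unfolding log_series_def dirichlet_series_def
 by (intro norm_suminf_le sm norm_dirichlet_term_le norm_log_coeff_le f)
 also have "... = (\<Sum>n. real (Suc n) powr (- (Re s - 1) - 1))"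
 using suminf_split_head[OF sm] by simp
 also have "... <= 1 + 1/(Re s - 1)" using s by (intro sums_Suc_powr_bound) simp
 finally show ?thesis .
qed


section \<open>L-functions of quadratic characters for Re s > 1\<close>

definition chi :: "int \<Rightarrow> nat \<Rightarrow> complex" where
 "chi d n = (if n = 0 then 0 else of_int (Kronecker d (int n)))"

lemma unit_completely_multiplicative_chi: "unit_completely_multiplicative (chi d)"
 unfolding unit_completely_multiplicative_def
proof (intro conjI allI impI)
 show "chi d 1 = 1" by (simp add: chi_def)
 show "chi d (m * n) = chi d m * chi d n" if "m > 0" "n > 0" for m n
 using that Kronecker_mult_right[of "int m" "int n" d] by (simp add: chi_def)
 show "cmod (chi d n) <= 1" for n
 using abs_Kronecker_le_1[of "int n" d] by (cases "n = 0") (auto simp: chi_def norm_of_int)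
qed

lemma norm_chi_le: "cmod (chi d n) <= 1"
 using unit_completely_multiplicative_chi by (simp add: unit_completely_multiplicative_def)

lemma Dirichlet_L_eq_dirichlet_series:
 assumes d: "fundamental_discriminant d" and s: "Re s > 1"
 shows "Dirichlet_L d s = dirichlet_series (chi d) s"
proof -
 have "(%n. of_int (Kronecker d (int (Suc n))) / of_nat (Suc n) powr s) sums Dirichlet_L d s"
 using Dirichlet_L_is_continuation[OF d] s by (simp add: is_L_continuation_def)
 also have "(%n. of_int (Kronecker d (int (Suc n))) / of_nat (Suc n) powr s) =
  (%n. chi d (Suc n) * of_nat (Suc n) powr - s)"
 by (simp add: chi_def powr_minus divide_inverse del: of_nat_Suc)
 finally have "(%n. chi d n * of_nat n powr - s) sums Dirichlet_L d s"
 using sums_Suc_iff[of "%n. chi d n * of_nat n powr - s" "Dirichlet_L d s"] by simp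
 then show ?thesis by (simp add: dirichlet_series_def sums_iff)
qed

lemma exp_log_series_chi:
 "fundamental_discriminant d ==> Re s > 1 ==> exp (log_series (chi d) s) = Dirichlet_L d s"
 by (simp add: exp_log_series unit_completely_multiplicative_chi Dirichlet_L_eq_dirichlet_series)

lemma Dirichlet_L_nonzero_Re_gt_1:
 "fundamental_discriminant d ==> Re s > 1 ==> Dirichlet_L d s \<noteq> 0"
 using exp_log_series_chi[of d s] by (metis exp_not_eq_zero)

lemma logderiv_Dirichlet_L_Re_gt_1:
 assumes d: "fundamental_discriminant d" and s: "Re s > 1"
 shows "deriv (Dirichlet_L d) s / Dirichlet_L d s = - mangoldt_series (chi d) s"
proof -
 have "(Dirichlet_L d has_field_derivative - dirichlet_series (chi d) s * mangoldt_series (chi d) s) (at s)"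
 by (rule has_field_derivative_transform_within_open[where S = "{z. Re z > 1}",
   OF has_field_derivative_unit_dirichlet_series[OF unit_completely_multiplicative_chi s]])
  (use s d in \<open>auto simp: open_halfspace_Re_gt Dirichlet_L_eq_dirichlet_series\<close>)
 then show ?thesis
 using Dirichlet_L_nonzero_Re_gt_1[OF d s] Dirichlet_L_eq_dirichlet_series[OF d s]
 by (simp add: DERIV_imp_deriv)
qed

lemma norm_Dirichlet_L_bounds:
 assumes d: "fundamental_discriminant d" and s: "Re s >= 2"
 shows "cmod (Dirichlet_L d s) >= exp (-2)" "cmod (Dirichlet_L d s) <= exp 2"
proof -
 have "1/(Re s - 1) <= 1" using s by (simp add: divide_simps)
 then have "cmod (log_series (chi d) s) <= 2"
 proof -
 have "Re s > 1" using s by simp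
 from norm_log_series_le[where f = "chi d", OF norm_chi_le this] \<open>1/(Re s - 1) <= 1\<close> show ?thesis by linarith
 qed
 then have "\<bar>Re (log_series (chi d) s)\<bar> <= 2" using abs_Re_le_cmod order_trans by blast
 moreover have "cmod (Dirichlet_L d s) = exp (Re (log_series (chi d) s))"
 using exp_log_series_chi[OF d, of s] s by (metis norm_exp_eq_Re less_le_trans one_less_numeral_iff semiring_norm(76))
 ultimately show "cmod (Dirichlet_L d s) >= exp (-2)" "cmod (Dirichlet_L d s) <= exp 2" by simp_all
qed

section \<open>Nonvanishing on the line Re s = 1\<close>

text \<open>Zeta itself can serve in place of L(s, chi^2): where chi(n) = 0 the combination 3 +
  cos(2x) is still nonnegative.\<close>

lemma three_four_one:
 fixes c x y :: real
 assumes "c \<in> {-1, 0, 1}"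
 shows "3 + 4 * c * cos x + cos (2 * x) >= 0"
proof -
 have "3 + 4 * c * cos x + cos (2 * x) = 2*(1 + c * cos x)^2 + 2*(1 - c^2)*(cos x)^2"
 using cos_double_cos[of x] by (simp add: power2_eq_square algebra_simps)
 moreover have "1 - c^2 >= 0" using assms by auto
 ultimately show ?thesis by (simp add: mult_nonneg_nonneg)
qed

lemma of_nat_powr_imaginary:
 assumes "n > 0"
 shows "of_nat n powr - (of_real \<sigma> + \<i> * of_real t) = of_real (real n powr - \<sigma>) * cis (- (t * ln (real n)))"
proof -
 have "of_nat n powr - (of_real \<sigma> + \<i> * of_real t) = exp (- (of_real \<sigma> + \<i> * of_real t) * of_real (ln (real n)))"
 using assms by (simp add: powr_def Ln_of_nat)
 also have "- (of_real \<sigma> + \<i> * of_real t) * of_real (ln (real n)) = of_real (- \<sigma> * ln (real n)) + \<i> * of_real (- (t * ln (real n)))"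
 by (simp add: algebra_simps)
 also have "exp ... = of_real (real n powr - \<sigma>) * cis (- (t * ln (real n)))"
 using assms by (simp only: exp_add cis_conv_exp exp_of_real) (simp add: powr_def)
 finally show ?thesis .
qed

lemma Re_log_series_3_4_1:
 assumes \<sigma>: "\<sigma> > 1"
 shows "Re (3 * log_series (chi 1) (of_real \<sigma>) + 4 * log_series (chi d) (of_real \<sigma> + \<i> * of_real t)
   + log_series (chi 1) (of_real \<sigma> + \<i> * of_real (2 * t))) >= 0"
proof -
 let ?c = "%d n. mangoldt n / of_real (ln (real n)) * chi d n"
 let ?u = "%d w n. ?c d n * of_nat n powr - w"
 let ?s = "of_real \<sigma> :: complex" and ?s1 = "of_real \<sigma> + \<i> * of_real t :: complex"
 and ?s2 = "of_real \<sigma> + \<i> * of_real (2 * t) :: complex"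
 have sm: "?u d w sums log_series (chi d) w" if "Re w > 1" for d w
 unfolding log_series_def dirichlet_series_def
 by (intro summable_sums summable_norm_cancel[OF summable_dirichlet_series_norm] norm_log_coeff_le norm_chi_le that)
 have "(%n. 3 * ?u 1 ?s n + 4 * ?u d ?s1 n + ?u 1 ?s2 n) sums
  (3 * log_series (chi 1) ?s + 4 * log_series (chi d) ?s1 + log_series (chi 1) ?s2)"
 by (intro sums_add sums_mult sm) (use \<sigma> in auto)
 then have S: "(%n. Re (3 * ?u 1 ?s n + 4 * ?u d ?s1 n + ?u 1 ?s2 n)) sums
  Re (3 * log_series (chi 1) ?s + 4 * log_series (chi d) ?s1 + log_series (chi 1) ?s2)"
 by (rule sums_Re)
 show ?thesis
 proof (rule sums_le[OF _ sums_zero S])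
 fix n :: nat
 show "0 <= Re (3 * ?u 1 ?s n + 4 * ?u d ?s1 n + ?u 1 ?s2 n)"
 proof (cases "n = 0")
  case False
  then have n: "n > 0" by simp
  define a where "a = mangoldt n / ln (real n) * real n powr - \<sigma>"
  define k where "k = Kronecker d (int n)"
  have a: "a >= 0" using n by (auto simp: a_def mangoldt_nonneg)
  have k: "real_of_int k \<in> {-1, 0, 1}" using abs_Kronecker_le_1[of "int n" d] n by (auto simp: k_def)
  have eq: "mangoldt n / complex_of_real (ln (real n)) * x*(of_real (real n powr - \<sigma>) * y) = of_real a * x * y" for x y
  by (simp add: a_def mult_ac)
  have "?u 1 ?s n = of_real a"
  using of_nat_powr_imaginary[OF n, of \<sigma> 0] n eq[of 1 1] by (simp add: chi_def Kronecker_one_left)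
  moreover have "?u d ?s1 n = of_real a * of_int k * cis (- (t * ln (real n)))"
  unfolding of_nat_powr_imaginary[OF n] eq using n by (simp add: chi_def k_def)
  moreover have "?u 1 ?s2 n = of_real a * cis (- (2 * t * ln (real n)))"
  unfolding of_nat_powr_imaginary[OF n] eq using n by (simp add: chi_def Kronecker_one_left)
  ultimately have "Re (3 * ?u 1 ?s n + 4 * ?u d ?s1 n + ?u 1 ?s2 n) =
   a*(3 + 4 * real_of_int k * cos (t * ln (real n)) + cos (2*(t * ln (real n))))"
  by (simp add: algebra_simps)
  then show ?thesis using a three_four_one[OF k, of "t * ln (real n)"] by simp
 qed simp
 qed
qed

lemma fundamental_discriminant_1: "fundamental_discriminant 1"
 by (simp add: fundamental_discriminant_def)

lemma Dirichlet_L_3_4_1: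
 assumes d: "fundamental_discriminant d" and \<sigma>: "\<sigma> > 1"
 shows "cmod (Dirichlet_L 1 (of_real \<sigma>))^3 * cmod (Dirichlet_L d (of_real \<sigma> + \<i> * of_real t))^4
   * cmod (Dirichlet_L 1 (of_real \<sigma> + \<i> * of_real (2 * t))) >= 1"
proof -
 have e: "cmod (Dirichlet_L d s) = exp (Re (log_series (chi d) s))" if "fundamental_discriminant d" "Re s > 1" for d s
 using exp_log_series_chi[OF that] by (metis norm_exp_eq_Re)
 show ?thesis
 using Re_log_series_3_4_1[OF \<sigma>, of d t] \<sigma> d
 by (simp add: e fundamental_discriminant_1 exp_of_nat_mult[symmetric] exp_add[symmetric] del: of_real_mult)
qed

text \<open>A zero at 1 + it would contribute x^4 at 1 + x + it, against the x^(-3) of zeta(1 +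
  x)^3. Since t is nonzero, the factor at 1 + x + 2it stays bounded, so the product would tend to 0
  although it is at least 1.\<close>

lemma Dirichlet_L_nonzero_Re_eq_1:
 assumes d: "fundamental_discriminant d" and t: "t \<noteq> 0"
 shows "Dirichlet_L d (1 + \<i> * of_real t) \<noteq> 0"
proof
 assume zero: "Dirichlet_L d (1 + \<i> * of_real t) = 0"
 let ?w = "1 + \<i> * of_real t :: complex" and ?w2 = "1 + \<i> * of_real (2 * t) :: complex"
 have to1: "filterlim (%x. of_real x :: complex) (at 0) (at_right 0)"
 proof (rule filterlim_atI)
 show "((%x. of_real x :: complex) \<longlongrightarrow> 0) (at_right 0)"
  using tendsto_of_real[OF tendsto_ident_at, of 0 "{0<..}"] by simp
 show "\<forall>\<^sub>F x in at_right 0. of_real x \<noteq> (0::complex)"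
  unfolding eventually_at_filter by simp
 qed
 have wd: "?w \<in> L_domain d" "?w2 \<in> L_domain 1" using t by (auto simp: L_domain_def complex_eq_iff)
 have openL: "open (L_domain d)" for d by (simp add: L_domain_def open_Compl)
 obtain D where "(Dirichlet_L d has_field_derivative D) (at ?w)"
 using holomorphic_Dirichlet_L[OF d] wd openL unfolding holomorphic_on_open[OF openL] by blast
 then have "((%h. (Dirichlet_L d (?w + h) - Dirichlet_L d ?w) / h) \<longlongrightarrow> D) (at 0)"
 by (simp add: DERIV_def)
 then have l1: "((%x. Dirichlet_L d (?w + of_real x) / of_real x) \<longlongrightarrow> D) (at_right 0)"
 using filterlim_compose[OF _ to1] zero by simp
 have "isCont (Dirichlet_L 1) ?w2"
 using holomorphic_on_imp_continuous_on[OF holomorphic_Dirichlet_L[OF fundamental_discriminant_1]] wd(2) openL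
 by (simp add: continuous_on_eq_continuous_at)
 then have "((%h. Dirichlet_L 1 (?w2 + h)) \<longlongrightarrow> Dirichlet_L 1 ?w2) (at 0)" by (simp add: isCont_iff)
 then have l2: "((%x. Dirichlet_L 1 (?w2 + of_real x)) \<longlongrightarrow> Dirichlet_L 1 ?w2) (at_right 0)"
 by (rule filterlim_compose[OF _ to1])
 have bd: "x * cmod (Dirichlet_L 1 (of_real (1 + x))) <= 5" if x: "x > 0" "x <= 1" for x
 proof -
 have "cmod (Dirichlet_L 1 (of_real (1 + x)) - 1/(of_real (1 + x) - 1)) <= cmod (of_real (1 + x))*(1 + 1 / Re (of_real (1 + x)))"
  by (rule norm_zeta_minus_pole_le) (use x in \<open>auto simp: complex_eq_iff\<close>)
 also have "... = (1 + x)*(1 + 1/(1 + x))" using x by (simp add: norm_of_real del: of_real_add)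
 also have "... = 2 + x" using x by (simp add: field_simps)
 finally have "cmod (Dirichlet_L 1 (of_real (1 + x)) - 1 / of_real x) <= 2 + x" by simp
 then have "cmod (Dirichlet_L 1 (of_real (1 + x))) <= 2 + x + 1 / x"
  using norm_triangle_sub[of "Dirichlet_L 1 (of_real (1 + x))" "1 / of_real x"] x by (simp add: norm_divide)
 then have "x * cmod (Dirichlet_L 1 (of_real (1 + x))) <= x*(2 + x + 1 / x)" using x by (intro mult_left_mono) auto
 also have "... = 2 * x + x * x + 1" using x by (simp add: field_simps)
 also have "... <= 5" using x mult_mono[of x 1 x 1] by simp
 finally show ?thesis .
 qed
 let ?P = "%x. x*(5^3 * cmod (Dirichlet_L d (?w + of_real x) / of_real x)^4 * cmod (Dirichlet_L 1 (?w2 + of_real x)))"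
 have "(?P \<longlongrightarrow> 0*(5^3 * cmod D^4 * cmod (Dirichlet_L 1 ?w2))) (at_right 0)"
 by (intro tendsto_intros l1 l2)
 then have "(?P \<longlongrightarrow> 0) (at_right 0)" by simp
 moreover have "\<forall>\<^sub>F x in at_right 0. ?P x >= 1"
 proof (rule eventually_at_rightI[of 0 1])
 fix x :: real assume "x \<in> {0<..<1}"
 then have x: "0 < x" "x <= 1" by auto
 let ?Z = "cmod (Dirichlet_L 1 (of_real (1 + x)))" and ?L = "cmod (Dirichlet_L d (of_real (1 + x) + \<i> * of_real t))"
  and ?Z2 = "cmod (Dirichlet_L 1 (of_real (1 + x) + \<i> * of_real (2 * t)))"
 have "1 <= ?Z^3 * ?L^4 * ?Z2" by (rule Dirichlet_L_3_4_1[OF d]) (use x in simp)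
 also have "... = x*((x * ?Z)^3*(?L / x)^4 * ?Z2)"
  using x by (simp add: field_simps power_divide eval_nat_numeral)
 also have "... <= x*(5^3*(?L / x)^4 * ?Z2)"
  using x bd[OF x] by (intro mult_left_mono mult_right_mono power_mono) auto
 also have "... = ?P x" using x by (simp add: norm_divide algebra_simps)
 finally show "1 <= ?P x" .
 qed simp
 ultimately have "(1::real) <= 0"
 by (intro tendsto_lowerbound[of ?P 0 "at_right 0" 1]) auto
 then show False by simp
qed

lemma abel_bound:
 fixes a b :: "nat \<Rightarrow> real"
 assumes A: "\<And>n. \<bar>\<Sum>i<n. a i\<bar> <= B" and b: "\<And>n. b (Suc n) <= b n" "\<And>n. b n >= 0"
 shows "\<bar>\<Sum>i<n. a i * b i\<bar> <= B * b 0"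
proof -
 let ?A = "%n. \<Sum>i<n. a i"
 have id: "(\<Sum>i<n. a i * b i) = ?A n * b n + (\<Sum>i<n. ?A (Suc i)*(b i - b (Suc i)))" for n
 by (induction n) (simp_all add: algebra_simps)
 have "\<bar>\<Sum>i<n. a i * b i\<bar> <= \<bar>?A n * b n\<bar> + (\<Sum>i<n. \<bar>?A (Suc i)*(b i - b (Suc i))\<bar>)"
 unfolding id by (intro order_trans[OF abs_triangle_ineq] add_left_mono sum_abs)
 also have "... <= B * b n + (\<Sum>i<n. B*(b i - b (Suc i)))"
 unfolding abs_mult using b
 by (intro add_mono sum_mono mult_mono A order_trans[OF abs_ge_zero A]) (auto simp del: sum.lessThan_Suc)
 also have "... = B * b 0" by (induction n) (simp_all add: algebra_simps)
 finally show ?thesis .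
qed

lemma divisor_sum_prime_power_mult:
 fixes f :: "nat \<Rightarrow> real"
 assumes p: "prime p" and m: "\<not> p dvd m" "m > 0" and f: "\<And>a b. a > 0 ==> b > 0 ==> f (a * b) = f a * f b" "f 1 = 1"
 shows "(\<Sum>k | k dvd p ^ e * m. f k) = (\<Sum>i\<le>e. f p ^ i)*(\<Sum>k | k dvd m. f k)"
proof -
 have p0: "p > 0" using p prime_gt_0_nat by blast
 have fp: "f (p ^ i) = f p ^ i" for i
 by (induction i) (use f p0 in auto)
 have "(\<Sum>i\<le>e. f p ^ i)*(\<Sum>k | k dvd m. f k) = (\<Sum>(i, k)\<in>{..e} \<times> {k. k dvd m}. f (p ^ i * k))"
 unfolding sum_product sum.cartesian_product using m p0
 by (intro sum.cong) (auto simp: f(1) fp dvd_pos_nat)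
 also have "... = (\<Sum>k | k dvd p ^ e * m. f k)"
 proof -
 have "bij_betw (%x. p ^ fst x * snd x) ({..e} \<times> {k. k dvd m}) {k. k dvd p ^ e * m}"
  unfolding bij_betw_def
 proof
  show "inj_on (%x. p ^ fst x * snd x) ({..e} \<times> {k. k dvd m})"
  proof (rule inj_onI, clarsimp)
  fix i k i' k' assume a: "k dvd m" "k' dvd m" "p ^ i * k = p ^ i' * k'"
  have nd: "\<not> p dvd k" "\<not> p dvd k'" using a m dvd_trans by blast+
  have k0: "k \<noteq> 0" "k' \<noteq> 0" using a m by auto
  have "multiplicity p (p ^ i * k) = i" "multiplicity p (p ^ i' * k') = i'"
   using p nd k0 by (simp_all add: prime_elem_multiplicity_mult_distrib not_dvd_imp_multiplicity_0)
  with a have "i = i'" by simp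
  with a p0 show "i = i' & k = k'" by simp
  qed
  show "(%x. p ^ fst x * snd x) ` ({..e} \<times> {k. k dvd m}) = {k. k dvd p ^ e * m}"
  proof safe
  fix i k assume "i <= e" "k dvd m"
  then show "p ^ fst (i, k) * snd (i, k) dvd p ^ e * m" by (simp add: mult_dvd_mono le_imp_power_dvd)
  next
  fix k assume "k dvd p ^ e * m"
  then obtain a b where ab: "k = a * b" "a dvd p ^ e" "b dvd m" using division_decomp by blast
  then obtain i where "i <= e" "a = p ^ i" using divides_primepow_nat[OF p] by auto
  with ab show "k \<in> (%x. p ^ fst x * snd x) ` ({..e} \<times> {k. k dvd m})" by force
  qed
 qed
 from sum.reindex_bij_betw[OF this, of f] show ?thesis by (simp add: case_prod_beta)
 qed
 finally show ?thesis by simp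
qed

text \<open>The divisor sum is multiplicative, and at p^e it is 1 + f(p) + ... + f(p)^e. With f(p)
  in {-1, 0, 1} this is never negative, and it is at least 1 for even e.\<close>

lemma divisor_sum_real_character:
 fixes f :: "nat \<Rightarrow> real"
 assumes f: "\<And>a b. a > 0 ==> b > 0 ==> f (a * b) = f a * f b" "f 1 = 1" "\<And>n. n > 0 ==> f n \<in> {-1, 0, 1}"
 and n: "n > 0"
 shows "(\<Sum>k | k dvd n. f k) >= 0" and "n = m^2 ==> (\<Sum>k | k dvd n. f k) >= 1"
proof -
 have geo: "(\<Sum>i\<le>e. x ^ i) >= (if even e then 1 else 0)" if "x \<in> {-1, 0, 1}" for x :: real and e :: nat
 proof -
 have "(\<Sum>i\<le>e. (-1) ^ i) = (if even e then 1 else (0::real))" by (induction e) auto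
 moreover have "(\<Sum>i\<le>e. 0 ^ i) = (1::real)" by (induction e) auto
 ultimately show ?thesis using that by auto
 qed
 have "(\<Sum>k | k dvd n. f k) >= (if \<exists>m. n = m^2 then 1 else 0)" using n
 proof (induction n rule: less_induct)
 case (less n)
 show ?case
 proof (cases "n = 1")
  case True
  then show ?thesis using f(2) by simp
 next
  case False
  then obtain p where p: "prime p" "p dvd n" using prime_factor_nat by blast
  define e where "e = multiplicity p n"
  obtain r where r: "n = p ^ e * r" "\<not> p dvd r"
  using multiplicity_decompose'[of n p] less.prems p by (metis e_def not_prime_unit less_irrefl)
  have "e > 0" using p less.prems unfolding e_def by (simp add: prime_multiplicity_gt_zero_iff)
  have r0: "r > 0" using r less.prems by (cases r) auto
  have "p ^ e > 1" using prime_gt_1_nat[OF p(1)] \<open>e > 0\<close> by (rule one_less_power)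
  then have "r < n" using r r0 by simp
  have S: "(\<Sum>k | k dvd n. f k) = (\<Sum>i\<le>e. f p ^ i)*(\<Sum>k | k dvd r. f k)"
  unfolding r(1) by (rule divisor_sum_prime_power_mult[OF p(1) r(2) r0 f(1,2)])
  have fp: "f p \<in> {-1, 0, 1}" using f(3)[of p] p prime_gt_0_nat by blast
  have IH: "(\<Sum>k | k dvd r. f k) >= (if \<exists>m. r = m^2 then 1 else 0)" using less.IH[OF \<open>r < n\<close> r0] .
  show ?thesis
  proof (cases "\<exists>m. n = m^2")
  case True
  then obtain m where m: "n = m^2" by blast
  then have "m \<noteq> 0" using less.prems by auto
  have "e = 2 * multiplicity p m"
   unfolding e_def m using \<open>m \<noteq> 0\<close> p by (simp add: prime_elem_multiplicity_power_distrib)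
  moreover from this have "m^2 = (p ^ multiplicity p m)^2 * r" using r m by (simp add: power_mult mult.commute)
  then have "(p ^ multiplicity p m)^2 dvd m^2" by simp
  then have "p ^ multiplicity p m dvd m" by (simp add: pow_divides_pow_iff)
  then obtain m' where "m = p ^ multiplicity p m * m'" by auto
  then have "(p ^ multiplicity p m)^2 * m'^2 = (p ^ multiplicity p m)^2 * r"
   using \<open>m^2 = _\<close> by (metis power_mult_distrib)
  then have "r = m'^2" using p prime_gt_0_nat by auto
  ultimately have "even e" "\<exists>m. r = m^2" by auto
  then have "1*1 <= (\<Sum>i\<le>e. f p ^ i)*(\<Sum>k | k dvd r. f k)"
   using geo[OF fp, of e] IH by (intro mult_mono) auto
  then show ?thesis using True S by simp
  next
  case False
  have "(\<Sum>i\<le>e. f p ^ i) >= 0" using geo[OF fp, of e] by (auto split: if_splits)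
  moreover have "(\<Sum>k | k dvd r. f k) >= 0" using IH by (auto split: if_splits)
  ultimately show ?thesis using False S by simp
  qed
 qed
 qed
 then show "(\<Sum>k | k dvd n. f k) >= 0" and "n = m^2 ==> (\<Sum>k | k dvd n. f k) >= 1"
 by (auto split: if_splits)
qed

text \<open>With P(n) = 1 + x + ... + x^(n-1), the decrease is 1/(1-x) times 1/(n(n+1)) - x^n/(P(n)
  P(n+1)). Pairing opposite terms of P(n) by the inequality of arithmetic and geometric means gives
  P(n) >= n x^((n-1)/2), which makes this nonnegative.\<close>

lemma lambert_coefficient_decreasing:
 fixes x :: real
 assumes x: "0 < x" "x < 1" and n: "n > 0"
 defines "b \<equiv> %n::nat. 1/(real n*(1 - x)) - x ^ n/(1 - x ^ n)"
 shows "b (Suc n) <= b n"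
proof -
 define P where "P = (%n. \<Sum>i<n. x ^ i)"
 have P: "1 - x ^ k = (1 - x) * P k" for k unfolding P_def using x by (simp add: one_diff_power_eq)
 have Pge: "P k >= real k * sqrt (x^(k - 1))" if "k > 0" for k
 proof -
 have "2 * P k = (\<Sum>i<k. x ^ i) + (\<Sum>i<k. x^(k - Suc i))"
  unfolding P_def using sum.nat_diff_reindex[of "%i. x ^ i" k] by simp
 also have "... = (\<Sum>i<k. x ^ i + x^(k - Suc i))" by (simp add: sum.distrib)
 also have "... >= (\<Sum>i<k. 2 * sqrt (x^(k - 1)))"
 proof (rule sum_mono)
  fix i assume "i \<in> {..<k}"
  then have "i + (k - Suc i) = k - 1" by auto
  then have e: "x ^ i * x^(k - Suc i) = x^(k - 1)" by (metis power_add)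
  have "sqrt (x ^ i * x^(k - Suc i)) <= (x ^ i + x^(k - Suc i))/2"
  using x by (intro arith_geo_mean_sqrt) auto
  then show "2 * sqrt (x^(k - 1)) <= x ^ i + x^(k - Suc i)" unfolding e by simp
 qed
 finally show ?thesis by simp
 qed
 have Ppos: "P k > 0" if "k > 0" for k
 using order.strict_trans2[OF _ Pge[OF that]] x that by simp
 have "real n * real (Suc n) * x ^ n <= (real n * sqrt (x^(n - 1)))*(real (Suc n) * sqrt (x ^ n))"
 proof -
 have "x ^ n = sqrt (x ^ n * x ^ n)" using x by (simp add: real_sqrt_mult)
 also have "... <= sqrt (x^(n - 1) * x ^ n)"
  using x n by (intro real_sqrt_le_mono mult_right_mono power_decreasing) auto
 finally have "x ^ n <= sqrt (x^(n - 1)) * sqrt (x ^ n)" by (simp add: real_sqrt_mult)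
 then have "real n * real (Suc n) * x ^ n <= real n * real (Suc n)*(sqrt (x^(n - 1)) * sqrt (x ^ n))"
  by (intro mult_left_mono) auto
 then show ?thesis by (simp add: mult_ac)
 qed
 also have "... <= P n * P (Suc n)"
 using Pge[OF n] Pge[of "Suc n"] x by (intro mult_mono) (auto intro!: mult_nonneg_nonneg order_less_imp_le[OF Ppos[OF n]])
 finally have key: "real n * real (Suc n) * x ^ n <= P n * P (Suc n)" .
 have "x ^ n/(1 - x ^ n) - x ^ Suc n/(1 - x ^ Suc n) = x ^ n*(1 - x)/((1 - x ^ n)*(1 - x ^ Suc n))"
 proof -
 have "1 - x ^ n \<noteq> 0" "1 - x ^ Suc n \<noteq> 0" unfolding P using x Ppos[of n] Ppos[of "Suc n"] n by auto
 then show ?thesis by (simp add: diff_frac_eq) (simp add: algebra_simps)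
 qed
 also have "... = x ^ n/(P n * P (Suc n))/(1 - x)"
 unfolding P using x Ppos[of n] Ppos[of "Suc n"] n by (simp add: divide_simps)
 also have "... <= 1/(real n * real (Suc n))/(1 - x)"
 using key x n Ppos[of n] Ppos[of "Suc n"] by (intro divide_right_mono) (simp_all add: divide_simps mult_ac)
 also have "... = 1/(real n*(1 - x)) - 1/(real (Suc n)*(1 - x))"
 using x n by (simp add: divide_simps)
 finally show ?thesis by (simp add: b_def)
qed

text \<open>Monsky's argument: if \<open>L(1, \<chi>) = 0\<close>, the Lambert series \<open>\<Sum>\<chi>(n)x\<^sup>n/(1 - x\<^sup>n)\<close> stays bounded
  as \<open>x \<rightarrow> 1\<close>, although its coefficients are nonnegative and at least 1 at the squares.\<close>
lemma Dirichlet_L_nonzero_at_1: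
 assumes d: "fundamental_discriminant d" "d \<noteq> 1"
 shows "Dirichlet_L d 1 \<noteq> 0"
proof
 assume zero: "Dirichlet_L d 1 = 0"
 define f where "f = (%n. real_of_int (Kronecker d (int n)))"
 have fm: "\<And>a b. a > 0 ==> b > 0 ==> f (a * b) = f a * f b" and f1: "f 1 = 1"
 using Kronecker_mult_right[of "int a" "int b" d for a b] by (auto simp: f_def)
 have fv: "f n \<in> {-1, 0, 1}" if "n > 0" for n
 using abs_Kronecker_le_1[of "int n" d] that by (auto simp: f_def)
 define B where "B = 8*\<bar>real_of_int d\<bar>"
 have fB: "\<bar>\<Sum>i<n. f (Suc i)\<bar> <= B" for n
 proof -
 have "(\<Sum>i<n. f (Suc i)) = real_of_int (\<Sum>m=1..n. Kronecker d (int m))"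
  by (simp add: f_def sum.atLeast1_atMost_eq)
 then have "\<bar>\<Sum>i<n. f (Suc i)\<bar> = real_of_int \<bar>\<Sum>m=1..n. Kronecker d (int m)\<bar>" by (simp only: of_int_abs)
 also have "... <= real_of_int (8*\<bar>d\<bar>)" using abs_sum_Kronecker_le(2)[OF d, of n] by (simp only: of_int_le_iff)
 finally show ?thesis by (simp add: B_def)
 qed
 have "(%n. of_int (Kronecker d (int (Suc n))) * of_nat (Suc n) powr - 1) sums (0::complex)"
 using Dirichlet_L_sums[OF d, of 1] zero by simp
 then have "(%n. Re (of_int (Kronecker d (int (Suc n))) * of_nat (Suc n) powr - 1)) sums 0"
 using sums_Re by fastforce
 also have "(%n. Re (of_int (Kronecker d (int (Suc n))) * of_nat (Suc n) powr - 1)) = (%n. f (Suc n) / real (Suc n))"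
 proof
 fix n
 have "of_nat (Suc n) powr - 1 = complex_of_real (1 / real (Suc n))"
  by (simp add: powr_minus divide_inverse del: of_nat_Suc)
 then have "of_int (Kronecker d (int (Suc n))) * of_nat (Suc n) powr - 1 = complex_of_real (f (Suc n) / real (Suc n))"
  by (simp add: f_def del: of_nat_Suc)
 then show "Re (of_int (Kronecker d (int (Suc n))) * of_nat (Suc n) powr - 1) = f (Suc n) / real (Suc n)"
  by (simp only: Re_complex_of_real)
 qed
 finally have L0: "(%n. f (Suc n) / real (Suc n)) sums 0" .
 have main: "(\<Sum>m=1..M. x^(m^2)) <= B" if x: "0 < x" "x < 1" for x :: real and M :: nat
 proof -
 define g where "g = (%(k, j). f k * x^(k * j))"
 have xk: "x ^ k < 1" if "k > 0" for k using x that by (simp add: power_less_one_iff)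
 have geom: "((%j. c * x^(k * j)) has_sum (c*(x ^ k/(1 - x ^ k)))) {0<..}" if "k > 0" for k c
 proof -
  have "(%j. (x ^ k) ^ Suc j) sums (x ^ k*(1/(1 - x ^ k)))"
  using sums_mult[OF geometric_sums[of "x ^ k"], of "x ^ k"] xk[OF that] x by simp
  then have "((%j. (x ^ k) ^ Suc j) has_sum (x ^ k/(1 - x ^ k))) UNIV"
  using x by (intro norm_summable_imp_has_sum) (auto simp: sums_iff abs_mult power_abs)
  then have "((%j. x^(k * j)) has_sum (x ^ k/(1 - x ^ k))) (Suc ` UNIV)"
  by (subst has_sum_reindex) (auto simp: o_def power_mult[symmetric] power_add[symmetric] simp del: power_Suc)
  moreover have "Suc ` UNIV = {0<..}" by (auto simp: image_def gr0_conv_Suc)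
  ultimately have "((%j. x^(k * j)) has_sum (x ^ k/(1 - x ^ k))) {0<..}" by simp
  then show ?thesis by (rule has_sum_cmult_right)
 qed
 have nsum: "summable (%n. \<bar>f (Suc n)*(x ^ Suc n/(1 - x ^ Suc n))\<bar>)"
 proof (rule summable_comparison_test'[where N = 0])
  show "summable (%n. x ^ Suc n/(1 - x))" using x by (intro summable_divide) (auto simp: summable_mult)
  fix n
  have "x ^ Suc n <= x^1" using x by (intro power_decreasing) auto
  then have "x ^ Suc n/(1 - x ^ Suc n) <= x ^ Suc n/(1 - x)"
  using x xk[of "Suc n"] by (intro divide_left_mono mult_pos_pos) auto
  moreover have "\<bar>f (Suc n)\<bar> <= 1" using fv[of "Suc n"] by auto
  moreover have "0 <= x ^ Suc n/(1 - x ^ Suc n)" using xk[of "Suc n"] x by simp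
  moreover have "norm \<bar>c * y\<bar> <= z" if "y <= z" "\<bar>c\<bar> <= 1" "0 <= y" for c y z :: real
  using mult_mono[of "\<bar>c\<bar>" 1 y z] that by (simp add: abs_mult)
  ultimately show "norm \<bar>f (Suc n)*(x ^ Suc n/(1 - x ^ Suc n))\<bar> <= x ^ Suc n/(1 - x)"
  by blast
 qed
 have "(%p. norm (g p)) summable_on ({0<..} \<times> {0<..})"
 proof (subst Infinite_Sum.abs_summable_on_Sigma_iff, intro conjI ballI)
  fix k :: nat assume "k \<in> {0<..}"
  from geom[of k "\<bar>f k\<bar>"] this show "(%j. norm (g (k, j))) summable_on {0<..}"
  using x by (auto simp: g_def abs_mult summable_on_def)
 next
  have "(%k. \<bar>f k*(x ^ k/(1 - x ^ k))\<bar>) summable_on (Suc ` UNIV)"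
  using norm_summable_imp_summable_on[of "%n. \<bar>f (Suc n)*(x ^ Suc n/(1 - x ^ Suc n))\<bar>"] nsum
  by (subst summable_on_reindex) (auto simp: o_def)
  moreover have "Suc ` UNIV = {0<..}" by (auto simp: image_def gr0_conv_Suc)
  moreover have "norm (infsum (%j. norm (g (k, j))) {0<..}) = \<bar>f k*(x ^ k/(1 - x ^ k))\<bar>" if "k \<in> {0<..}" for k
  proof -
  have "((%j. norm (g (k, j))) has_sum (\<bar>f k\<bar>*(x ^ k/(1 - x ^ k)))) {0<..}"
   using geom[of k "\<bar>f k\<bar>"] that x by (auto simp: g_def abs_mult)
  then have "infsum (%j. norm (g (k, j))) {0<..} = \<bar>f k\<bar>*(x ^ k/(1 - x ^ k))" by (rule infsumI)
  then show ?thesis by (simp add: abs_mult)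
  qed
  ultimately show "(%k. norm (infsum (%j. norm (g (k, j))) {0<..})) summable_on {0<..}"
  by (metis (no_types, lifting) summable_on_cong)
 qed
 then have "g summable_on ({0<..} \<times> {0<..})" by (rule abs_summable_summable)
 then obtain S where S: "(g has_sum S) ({0<..} \<times> {0<..})" by (auto simp: summable_on_def)
 have "((%n. \<Sum>k | k dvd n. g (k, n div k)) has_sum S) {0<..}" by (rule has_sum_over_divisors[OF S])
 then have S1: "((%n. (\<Sum>k | k dvd n. f k) * x ^ n) has_sum S) {0<..}"
  by (rule has_sum_cong[THEN iffD1, rotated]) (auto simp: g_def sum_distrib_right intro!: sum.cong)
 have S2: "((%k. f k*(x ^ k/(1 - x ^ k))) has_sum S) {0<..}"
  by (rule has_sum_SigmaD[OF S]) (unfold g_def prod.case, rule geom, simp)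
 have "(\<Sum>m=1..M. x^(m^2)) <= (\<Sum>n\<in>(%m. m^2) ` {1..M}. (\<Sum>k | k dvd n. f k) * x ^ n)"
 proof (subst sum.reindex)
  show "inj_on (%m::nat. m^2) {1..M}" by (auto simp: inj_on_def)
  have "1 * x^(m^2) <= (\<Sum>k | k dvd m^2. f k) * x^(m^2)" if "m \<in> {1..M}" for m
  using divisor_sum_real_character(2)[of f "m^2" m] fm f1 fv that x by (intro mult_right_mono) auto
  then show "(\<Sum>m=1..M. x^(m^2)) <= sum ((%n. (\<Sum>k | k dvd n. f k) * x ^ n) \<circ> (%m. m^2)) {1..M}"
  by (auto intro!: sum_mono)
 qed
 also have "... <= S"
  by (rule finite_sum_le_has_sum[OF S1])
   (use divisor_sum_real_character(1)[of f] fm f1 fv x in \<open>auto intro!: mult_nonneg_nonneg\<close>)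
 also have "S <= B"
 proof -
  have "((%k. f k*(x ^ k/(1 - x ^ k))) has_sum S) (Suc ` UNIV)"
  using S2 by (simp add: image_def gr0_conv_Suc[symmetric] greaterThan_def)
  then have "((%k. f (Suc k)*(x ^ Suc k/(1 - x ^ Suc k))) has_sum S) UNIV"
  by (subst (asm) has_sum_reindex) (auto simp: o_def)
  then have "(%k. f (Suc k)*(x ^ Suc k/(1 - x ^ Suc k))) sums S" by (rule has_sum_imp_sums)
  \<comment> \<open>As L(1, chi) = 0, the series of chi(k)/(k(1 - x)) is 0 and can be subtracted.
    The Lambert coefficients become the sequence \<open>b\<close>, which decreases from 1 to 0, and
    Abel summation bounds S by the bound for the character sums.\<close>
  from sums_diff[OF sums_divide[OF L0, of "1 - x"] this]
  have "(%k. f (Suc k)*(1/(real (Suc k)*(1 - x)) - x ^ Suc k/(1 - x ^ Suc k))) sums (- S)"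
  by (simp add: algebra_simps)
  then have lim: "(%n. \<bar>\<Sum>k<n. f (Suc k)*(1/(real (Suc k)*(1 - x)) - x ^ Suc k/(1 - x ^ Suc k))\<bar>) \<longlonglongrightarrow> \<bar>- S\<bar>"
  unfolding sums_def by (rule tendsto_rabs)
  define b where "b = (%k. 1/(real (Suc k)*(1 - x)) - x ^ Suc k/(1 - x ^ Suc k))"
  have bdec: "b (Suc k) <= b k" for k
  using lambert_coefficient_decreasing[OF x, of "Suc k"] by (simp add: b_def)
  have "b \<longlonglongrightarrow> 0 - 0/(1 - 0)"
  unfolding b_def
  proof (intro tendsto_diff tendsto_divide tendsto_const)
  have "(%k. inverse (real (Suc k)) * inverse (1 - x)) \<longlonglongrightarrow> 0 * inverse (1 - x)"
   by (intro tendsto_intros LIMSEQ_inverse_real_of_nat)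
  then show "(%k. 1/(real (Suc k)*(1 - x))) \<longlonglongrightarrow> 0"
   by (simp only: mult_zero_left divide_inverse mult_1 inverse_mult_distrib)
  have "(%k. x ^ Suc k) \<longlonglongrightarrow> 0" using x by (intro LIMSEQ_Suc LIMSEQ_realpow_zero) auto
  then show "(%k. x ^ Suc k) \<longlonglongrightarrow> 0" "(%k. x ^ Suc k) \<longlonglongrightarrow> 0" by blast+
  qed simp
  then have "b k >= 0" for k
  using decseq_ge[of b 0 k] bdec by (simp add: decseq_Suc_iff)
  then have "\<bar>\<Sum>k<n. f (Suc k) * b k\<bar> <= B * b 0" for n
  by (intro abel_bound fB bdec)
  moreover have "b 0 = 1" using x by (simp add: b_def diff_divide_distrib[symmetric])
  ultimately have "\<bar>\<Sum>k<n. f (Suc k) * b k\<bar> <= B" for n by simp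
  moreover have "(%n. \<bar>\<Sum>k<n. f (Suc k) * b k\<bar>) \<longlonglongrightarrow> \<bar>- S\<bar>" unfolding b_def by (rule lim)
  ultimately have "\<bar>- S\<bar> <= B" by (intro LIMSEQ_le_const2[of "%n. \<bar>\<Sum>k<n. f (Suc k) * b k\<bar>"]) blast+
  then show ?thesis by simp
 qed
 finally show ?thesis .
 qed
 \<comment> \<open>As x tends to 1 the sum of x^(m^2) over m <= M tends to M, which exceeds
   B.\<close>
 define M where "M = nat \<lceil>B\<rceil> + 1"
 have "((%x::real. \<Sum>m=1..M. x^(m^2)) \<longlongrightarrow> (\<Sum>m=1..M. 1^(m^2))) (at_left 1)"
 by (intro tendsto_intros)
 moreover have "\<forall>\<^sub>F x::real in at_left 1. (\<Sum>m=1..M. x^(m^2)) <= B"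
 by (rule eventually_at_leftI[of 0]) (use main in auto)
 ultimately have "(\<Sum>m=1..M. 1^(m^2)) <= B" by (intro tendsto_upperbound) auto
 then show False unfolding M_def by simp linarith
qed

text \<open>The hypothesis speaks about the open strip only; the line Re s = 1, the point 1 and the
  half plane of absolute convergence are supplied unconditionally.\<close>

lemma Dirichlet_L_nonzero_GRH:
 assumes d: "fundamental_discriminant d" and GRH: "GRH_for d" and s: "Re s > 1/2" "s \<noteq> 1 \<or> d \<noteq> 1"
 shows "Dirichlet_L d s \<noteq> 0"
proof -
 consider "Re s < 1" | "Re s = 1" "Im s \<noteq> 0" | "s = 1" | "Re s > 1"
 by (cases "Re s" "1::real" rule: linorder_cases) (auto simp: complex_eq_iff)
 then show ?thesis
 proof cases
 case 1
 moreover have "Re s > 0" using s by linarith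
 ultimately show ?thesis using GRH[unfolded GRH_for_def, rule_format, of s] s by auto
 next
 case 2
 then have "s = 1 + \<i> * of_real (Im s)" by (simp add: complex_eq_iff)
 then show ?thesis using Dirichlet_L_nonzero_Re_eq_1[OF d 2(2)] by simp
 next
 case 3
 then show ?thesis using Dirichlet_L_nonzero_at_1[OF d] s by simp
 qed (use Dirichlet_L_nonzero_Re_gt_1[OF d] in simp)
qed

section \<open>Local expansion of the logarithmic derivative in terms of zeros\<close>

text \<open>The map u -> u/(2A - u) fixes 0 and sends the half plane Re u < A into the unit disc.
  The Schwarz lemma for the composition, rescaled to radius 1, is then solved for h(z).\<close>

lemma borel_caratheodory_norm:
 assumes h: "h holomorphic_on ball 0 R" "h 0 = 0" and Re: "\<And>z. z \<in> ball 0 R ==> Re (h z) < A"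
 and R: "R > 0" and z: "z \<in> ball 0 R"
 shows "cmod (h z) <= 2 * A * cmod z/(R - cmod z)"
proof -
 have A: "A > 0" using Re[of 0] h R by simp
 define w where "w = (%\<zeta>. h (of_real R*\<zeta>)/(2 * of_real A - h (of_real R*\<zeta>)))"
 have inb: "of_real R*\<zeta> \<in> ball 0 R" if "cmod \<zeta> < 1" for \<zeta> :: complex
 using that R by (simp add: norm_mult)
 have ne: "2 * of_real A - h (of_real R*\<zeta>) \<noteq> 0" if "cmod \<zeta> < 1" for \<zeta>
 proof
 assume "2 * of_real A - h (of_real R*\<zeta>) = 0"
 then have "Re (h (of_real R*\<zeta>)) = 2 * A" by (simp add: complex_eq_iff)
 then show False using Re[OF inb[OF that]] A by simp
 qed
 have "w holomorphic_on ball 0 1"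
 unfolding w_def
 proof (intro holomorphic_intros)
 have "(h \<circ> (%\<zeta>. of_real R*\<zeta>)) holomorphic_on ball 0 1"
  by (rule holomorphic_on_compose_gen[OF _ h(1)]) (auto intro!: holomorphic_intros inb)
 then show "(%\<zeta>. h (of_real R*\<zeta>)) holomorphic_on ball 0 1" "(%\<zeta>. h (of_real R*\<zeta>)) holomorphic_on ball 0 1"
  by (simp_all add: o_def)
 qed (use ne in auto)
 moreover have "cmod (w \<zeta>) < 1" if "cmod \<zeta> < 1" for \<zeta>
 proof -
 let ?h = "h (of_real R*\<zeta>)"
 have "(cmod ?h)^2 < (cmod (2 * of_real A - ?h))^2"
  unfolding cmod_power2 using Re[OF inb[OF that]] A
  by (simp add: power2_eq_square algebra_simps)
 then have "cmod ?h < cmod (2 * of_real A - ?h)" by (rule power_less_imp_less_base) simp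
 then show ?thesis by (simp add: w_def norm_divide divide_less_eq)
 qed
 ultimately have schw: "cmod (w \<zeta>) <= cmod \<zeta>" if "cmod \<zeta> < 1" for \<zeta>
 using Schwarz_Lemma(1)[of w] that h by (simp add: w_def)
 define \<zeta> where "\<zeta> = z / of_real R"
 have \<zeta>: "cmod \<zeta> < 1" "of_real R*\<zeta> = z" using z R by (auto simp: \<zeta>_def norm_divide)
 define t where "t = cmod \<zeta>"
 have t: "0 <= t" "t < 1" using \<zeta> by (auto simp: t_def)
 have "w \<zeta>*(2 * of_real A - h z) = h z" using ne[OF \<zeta>(1)] \<zeta>(2) by (simp add: w_def)
 then have "h z = w \<zeta>*(2 * of_real A - h z)" by simp
 then have "cmod (h z) = cmod (w \<zeta>) * cmod (2 * of_real A - h z)" by (metis norm_mult)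
 also have "... <= t*(2 * A + cmod (h z))"
 using schw[OF \<zeta>(1)] norm_triangle_ineq4[of "2 * of_real A" "h z"] A t
 by (intro mult_mono) (auto simp: t_def norm_mult)
 finally have "cmod (h z)*(1 - t) <= 2 * A * t" by (simp add: algebra_simps)
 then have "cmod (h z) <= 2 * A * t/(1 - t)" using t by (simp add: pos_le_divide_eq)
 also have "... = 2 * A * cmod z/(R - cmod z)"
 proof -
 have "t = cmod z / R" using R by (simp add: t_def \<zeta>_def norm_divide)
 then have e: "cmod z = t * R" using R by simp
 have "R - t * R = (1 - t) * R" by (simp add: algebra_simps)
 then show ?thesis unfolding e using R by simp
 qed
 finally show ?thesis .
qed

text \<open>Apply the preceding bound to h = log F - log F(0), whose real part stays below A. On the
  circle of radius \<rho> = (R - r)/2 about z it gives |h| <= 2AR/\<rho>, and Cauchy's inequality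
  divides by \<rho> once more.\<close>

lemma borel_caratheodory_logderiv:
 assumes F: "F holomorphic_on ball 0 R" "\<And>z. z \<in> ball 0 R ==> F z \<noteq> 0"
 and A: "\<And>z. z \<in> ball 0 R ==> cmod (F z) < exp A * cmod (F 0)" and r: "cmod z <= r" "r < R" "r > 0"
 shows "cmod (deriv F z / F z) <= 8 * A * R/(R - r)^2"
proof -
 have R: "R > 0" using r by simp
 obtain g where g: "g holomorphic_on ball 0 R" "\<And>z. z \<in> ball 0 R ==> F z = exp (g z)"
 using contractible_imp_holomorphic_log[OF F(1) _ F(2)] convex_imp_contractible[OF convex_ball] by metis
 define h where "h = (%z. g z - g 0)"
 have h: "h holomorphic_on ball 0 R" "h 0 = 0" unfolding h_def by (auto intro!: holomorphic_intros g)
 have ReA: "Re (h z) < A" if "z \<in> ball 0 R" for z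
 proof -
 have "exp (Re (h z)) = cmod (F z) / cmod (F 0)"
  using g(2)[OF that] g(2)[of 0] R by (simp add: h_def exp_diff)
 also have "... < exp A" using A[OF that] F(2)[of 0] R by (simp add: divide_less_eq)
 finally show ?thesis by simp
 qed
 have A0: "A > 0" using ReA[of 0] h R by simp
 have zb: "z \<in> ball 0 R" using r by simp
 define \<rho> where "\<rho> = (R - r)/2"
 have \<rho>: "\<rho> > 0" using r by (simp add: \<rho>_def)
 have sub: "cball z \<rho> \<subseteq> ball 0 R"
 proof
 fix x assume "x \<in> cball z \<rho>"
 then have "cmod x <= r + \<rho>" using norm_triangle_sub[of x z] r by (simp add: dist_norm norm_minus_commute)
 also have "... < R" using r by (simp add: \<rho>_def field_simps)
 finally show "x \<in> ball 0 R" by simp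
 qed
 have "norm ((deriv ^^ 1) h z) <= fact 1*(2 * A * R / \<rho>) / \<rho>^1"
 proof (rule Cauchy_inequality)
 show "h holomorphic_on ball z \<rho>" by (rule holomorphic_on_subset[OF h(1)]) (use sub in force)
 show "continuous_on (cball z \<rho>) h"
  using continuous_on_subset[OF holomorphic_on_imp_continuous_on[OF h(1)] sub] .
 fix x assume x: "cmod (z - x) = \<rho>"
 then have "x \<in> cball z \<rho>" by (simp add: dist_norm)
 then have xb: "x \<in> ball 0 R" using sub by blast
 have "cmod x <= r + \<rho>" using x norm_triangle_sub[of x z] r by (simp add: norm_minus_commute)
 then have Rx: "R - cmod x >= \<rho>" by (simp add: \<rho>_def field_simps)
 have "cmod (h x) <= 2 * A * cmod x/(R - cmod x)" by (rule borel_caratheodory_norm[OF h ReA R xb])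
 also have "... <= 2 * A * R / \<rho>" using Rx \<rho> A0 xb R by (intro frac_le mult_left_mono mult_nonneg_nonneg) auto
 finally show "cmod (h x) <= 2 * A * R / \<rho>" .
 qed (use \<rho> in auto)
 then have "cmod (deriv h z) <= 2 * A * R / \<rho> / \<rho>" by simp
 also have "... = 8 * A * R/(R - r)^2" by (simp add: \<rho>_def power2_eq_square)
 finally have "cmod (deriv h z) <= 8 * A * R/(R - r)^2" .
 moreover have "deriv F z / F z = deriv h z"
 proof -
 have dg: "(g has_field_derivative deriv g z) (at z)" by (rule holomorphic_derivI[OF g(1) open_ball zb])
 then have "((%z. exp (g z)) has_field_derivative exp (g z) * deriv g z) (at z)"
  by (auto intro!: derivative_eq_intros)
 then have "(F has_field_derivative exp (g z) * deriv g z) (at z)"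
  by (rule has_field_derivative_transform_within_open[OF _ open_ball zb]) (simp add: g(2))
 moreover have "(h has_field_derivative deriv g z) (at z)" unfolding h_def using dg by (auto intro!: derivative_eq_intros)
 ultimately show ?thesis using g(2)[OF zb] by (simp add: DERIV_imp_deriv)
 qed
 ultimately show ?thesis by simp
qed

lemma norm_blaschke_factor_eq:
 assumes "cmod z = R"
 shows "cmod (of_real (R^2) - cnj \<rho> * z) = R * cmod (z - \<rho>)"
proof -
 have "of_real (R^2) = z * cnj z" using assms by (simp add: complex_norm_square[symmetric])
 then have "of_real (R^2) - cnj \<rho> * z = z * cnj (z - \<rho>)" by (simp add: algebra_simps)
 then show ?thesis using assms by (simp only: norm_mult complex_mod_cnj)
qed

text \<open>Each factor z - \<rho> is exchanged for (R^2 - cnj \<rho> z)/R, which has the same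
  modulus on |z| = R; the maximum principle carries the bound inside. At 0 the new factor is R while
  the old one has modulus at most R1. This is Jensen's count of zeros.\<close>

lemma zero_divisor_bound:
 assumes g: "g holomorphic_on ball 0 R0" and R: "0 < R1" "R1 < R" "R < R0"
 and f: "\<And>z. z \<in> ball 0 R0 ==> f z = g z*(\<Prod>\<rho>\<leftarrow>zs. z - \<rho>)"
 and zs: "set zs \<subseteq> cball 0 R1" and M: "\<And>z. cmod z <= R ==> cmod (f z) <= M"
 shows "cmod z <= R ==> cmod (g z*(\<Prod>\<rho>\<leftarrow>zs. (of_real (R^2) - cnj \<rho> * z) / of_real R)) <= M"
 and "cmod (f 0)*(R / R1) ^ length zs <= cmod (g 0) * R ^ length zs"
 and "cmod (f 0)*(R / R1) ^ length zs <= M"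
proof -
 let ?F = "%z. g z*(\<Prod>\<rho>\<leftarrow>zs. (of_real (R^2) - cnj \<rho> * z) / of_real R)"
 have hol_prod: "(%z. \<Prod>\<rho>\<leftarrow>ys. (of_real (R^2) - cnj \<rho> * z) / of_real R) holomorphic_on B" for ys B
 using R by (induction ys) (auto intro!: holomorphic_intros)
 have holF: "?F holomorphic_on ball 0 R0" by (intro holomorphic_intros g hol_prod)
 show *: "cmod (?F z) <= M" if "cmod z <= R" for z
 proof (rule maximum_modulus_frontier[of ?F "cball 0 R"])
 show "?F holomorphic_on interior (cball 0 R)" by (rule holomorphic_on_subset[OF holF]) (use R in auto)
 show "continuous_on (closure (cball 0 R)) ?F"
  by (rule continuous_on_subset[OF holomorphic_on_imp_continuous_on[OF holF]]) (use R in auto)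
 fix z :: complex assume "z \<in> frontier (cball 0 R)"
 then have z: "cmod z = R" using R by (simp add: frontier_cball)
 have bl: "cmod ((of_real (R^2) - cnj \<rho> * z) / of_real R) = cmod (z - \<rho>)" for \<rho>
  using norm_blaschke_factor_eq[OF z, of \<rho>] R by (simp add: norm_divide del: of_real_power)
 have "cmod (\<Prod>\<rho>\<leftarrow>ys. (of_real (R^2) - cnj \<rho> * z) / of_real R) = cmod (\<Prod>\<rho>\<leftarrow>ys. z - \<rho>)" for ys
  by (induction ys) (simp, simp only: list.map prod_list.Cons norm_mult bl)
 then have "cmod (?F z) = cmod (f z)" using f[of z] z R by (simp add: norm_mult)
 also have "... <= M" using M z by simp
 finally show "cmod (?F z) <= M" .
 qed (use that in auto)
 have "(\<Prod>\<rho>\<leftarrow>ys. (of_real (R^2) - cnj \<rho>*0) / complex_of_real R) = of_real (R ^ length ys)" for ys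
 using R by (induction ys) (simp_all add: power2_eq_square)
 then have F0: "cmod (?F 0) = cmod (g 0) * R ^ length zs" using R by (simp add: norm_mult norm_power)
 have "cmod (\<Prod>\<rho>\<leftarrow>ys. 0 - \<rho>) <= R1 ^ length ys" if "set ys \<subseteq> cball 0 R1" for ys
 using that R by (induction ys) (auto simp: norm_mult intro!: mult_mono)
 from this[OF zs] have "cmod (f 0) <= cmod (g 0) * R1 ^ length zs"
 using f[of 0] R by (simp add: norm_mult mult_left_mono)
 then have "cmod (f 0)*(R / R1) ^ length zs <= (cmod (g 0) * R1 ^ length zs)*(R / R1) ^ length zs"
 using R by (intro mult_right_mono) auto
 also have "... = cmod (g 0) * R ^ length zs" using R by (simp add: power_divide)
 finally show "cmod (f 0)*(R / R1) ^ length zs <= cmod (g 0) * R ^ length zs" .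
 with F0 *[of 0] R show "cmod (f 0)*(R / R1) ^ length zs <= M" by simp
qed

text \<open>Zeros are divided out one at a time. Jensen's count bounds how many can be removed, so a
  maximal extraction exists, and its cofactor has no zero left in the smaller disc.\<close>

lemma zero_extraction:
 assumes f: "f holomorphic_on ball 0 R0" and R: "0 < R1" "R1 < R" "R < R0"
 and f0: "f 0 \<noteq> 0" and M: "\<And>z. cmod z <= R ==> cmod (f z) <= M"
 obtains zs g where "g holomorphic_on ball 0 R0" "\<And>z. z \<in> ball 0 R0 ==> f z = g z*(\<Prod>\<rho>\<leftarrow>zs. z - \<rho>)"
 "set zs \<subseteq> cball 0 R1" "\<And>z. z \<in> cball 0 R1 ==> g z \<noteq> 0"
proof -
 define P where "P = (%n. \<exists>zs g. length zs = n & g holomorphic_on ball 0 R0 \<and>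
  (\<forall>z\<in>ball 0 R0. f z = g z*(\<Prod>\<rho>\<leftarrow>zs. z - \<rho>)) & set zs \<subseteq> cball 0 R1)"
 have P0: "P 0" unfolding P_def using f by (intro exI[of _ "[]"] exI[of _ f]) auto
 obtain N where N: "(R / R1) ^ N > M / cmod (f 0)" using real_arch_pow[of "R / R1"] R by auto
 have bound: "n <= N" if "P n" for n
 proof (rule ccontr)
 assume "\<not> n <= N"
 from that obtain zs g where *: "length zs = n" "g holomorphic_on ball 0 R0"
  "\<And>z. z \<in> ball 0 R0 ==> f z = g z*(\<Prod>\<rho>\<leftarrow>zs. z - \<rho>)" "set zs \<subseteq> cball 0 R1" unfolding P_def by blast
 from zero_divisor_bound(3)[OF *(2) R *(3,4) M]
 have "(R / R1) ^ n <= M / cmod (f 0)" using f0 *(1) by (simp add: pos_le_divide_eq mult.commute)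
 moreover have "(R / R1) ^ N <= (R / R1) ^ n" using \<open>\<not> n <= N\<close> R by (intro power_increasing) auto
 ultimately show False using N by simp
 qed
 obtain n where n: "P n" "\<And>m. P m ==> m <= n"
 using Nat.ex_has_greatest_nat[of P 0 N, OF P0] bound by blast
 then obtain zs g where *: "length zs = n" "g holomorphic_on ball 0 R0"
  "\<And>z. z \<in> ball 0 R0 ==> f z = g z*(\<Prod>\<rho>\<leftarrow>zs. z - \<rho>)" "set zs \<subseteq> cball 0 R1" unfolding P_def by blast
 have "g z \<noteq> 0" if z: "z \<in> cball 0 R1" for z
 proof
 assume gz: "g z = 0"
 define k where "k = (%w. if w = z then deriv g z else (g w - g z)/(w - z))"
 have "k holomorphic_on ball 0 R0" unfolding k_def by (rule pole_lemma_open[OF *(2) open_ball])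
 moreover have "g w = k w*(w - z)" for w using gz by (auto simp: k_def)
 ultimately have "P (Suc n)" unfolding P_def using * z
  by (intro exI[of _ "z # zs"] exI[of _ k]) (auto simp: mult_ac)
 then show False using n(2) by fastforce
 qed
 with * that show ?thesis by blast
qed

lemma logderiv_prod_list:
 assumes "\<And>\<rho>. \<rho> \<in> set zs ==> (k \<rho> has_field_derivative k' \<rho>) (at z)" "\<And>\<rho>. \<rho> \<in> set zs ==> k \<rho> z \<noteq> 0"
 and g: "(g has_field_derivative g') (at z)" "g z \<noteq> 0"
 shows "\<exists>D. ((%z. g z*(\<Prod>\<rho>\<leftarrow>zs. k \<rho> z)) has_field_derivative D) (at z) \<and>
  D/(g z*(\<Prod>\<rho>\<leftarrow>zs. k \<rho> z)) = g' / g z + (\<Sum>\<rho>\<leftarrow>zs. k' \<rho> / k \<rho> z)"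
 using assms(1,2)
proof (induction zs)
 case Nil
 then show ?case using g by auto
next
 case (Cons \<rho> zs)
 then obtain D where D: "((%z. g z*(\<Prod>\<rho>\<leftarrow>zs. k \<rho> z)) has_field_derivative D) (at z)"
  "D/(g z*(\<Prod>\<rho>\<leftarrow>zs. k \<rho> z)) = g' / g z + (\<Sum>\<rho>\<leftarrow>zs. k' \<rho> / k \<rho> z)" by force
 have nz: "g z*(\<Prod>\<rho>\<leftarrow>zs. k \<rho> z) \<noteq> 0"
 using Cons.prems(2) g(2) by (auto simp: prod_list_zero_iff)
 have k: "(k \<rho> has_field_derivative k' \<rho>) (at z)" "k \<rho> z \<noteq> 0" using Cons.prems by auto
 have "((%z. k \<rho> z*(g z*(\<Prod>\<rho>\<leftarrow>zs. k \<rho> z))) has_field_derivative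
  (k \<rho> z * D + k' \<rho>*(g z*(\<Prod>\<rho>\<leftarrow>zs. k \<rho> z)))) (at z)"
 using DERIV_mult'[OF k(1) D(1)] by simp
 moreover have "(%z. k \<rho> z*(g z*(\<Prod>\<rho>\<leftarrow>zs. k \<rho> z))) = (%z. g z*(\<Prod>\<rho>\<leftarrow>\<rho> # zs. k \<rho> z))"
 by (simp add: mult_ac)
 moreover have "(k \<rho> z * D + k' \<rho>*(g z*(\<Prod>\<rho>\<leftarrow>zs. k \<rho> z)))/(k \<rho> z*(g z*(\<Prod>\<rho>\<leftarrow>zs. k \<rho> z)))
  = k' \<rho> / k \<rho> z + D/(g z*(\<Prod>\<rho>\<leftarrow>zs. k \<rho> z))"
 using k(2) nz by (simp add: add_divide_distrib)
 ultimately show ?case using D(2) by (intro exI[of _ "k \<rho> z * D + k' \<rho>*(g z*(\<Prod>\<rho>\<leftarrow>zs. k \<rho> z))"]) (auto simp: mult_ac)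
qed

lemma norm_sum_list_le:
 assumes "\<And>x. x \<in> set xs ==> norm (f x :: 'b :: real_normed_vector) <= B"
 shows "norm (\<Sum>x\<leftarrow>xs. f x) <= real (length xs) * B"
 using assms
proof (induction xs)
 case (Cons x xs)
 have "norm (f x + (\<Sum>x\<leftarrow>xs. f x)) <= B + real (length xs) * B"
 using Cons by (intro norm_triangle_mono) auto
 then show ?case by (simp add: algebra_simps)
qed simp

text \<open>Landau's local form of the partial fraction expansion of \<open>f'/f\<close>.\<close>
lemma logderiv_local_expansion:
 assumes R: "0 < r" "r < R1" "R1 < R" "R < R0"
 shows "\<exists>C>0. \<forall>f A. f holomorphic_on ball 0 R0 & f 0 \<noteq> 0 & (\<forall>z. cmod z <= R --> cmod (f z) < exp A * cmod (f 0)) -->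
  (\<exists>zs. set zs \<subseteq> {\<rho>\<in>cball 0 R1. f \<rho> = 0} & real (length zs) <= C * A \<and>
  (\<forall>z. cmod z <= r & f z \<noteq> 0 --> cmod (deriv f z / f z - (\<Sum>\<rho>\<leftarrow>zs. 1/(z - \<rho>))) <= C * A))"
proof -
 \<comment> \<open>\<open>C1\<close> comes from (R/R1)^n <= exp A for the number n of zeros.
   \<open>C2\<close> adds the Borel-Caratheodory bound for the zero-free part and the contribution
   of the n exchanged factors, each at most R1/(R^2 - R1^2).\<close>
 define C1 where "C1 = 1 / ln (R / R1)"
 define C2 where "C2 = 8 * R1/(R1 - r)^2 + C1*(R1/(R^2 - R1 * R1))"
 have C1: "C1 > 0" unfolding C1_def using R by (simp add: ln_gt_zero_iff)
 have RR: "R^2 - R1 * R1 > 0" using R by (simp add: power2_eq_square mult_strict_mono)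
 have C2: "C2 > 0" unfolding C2_def using R C1 RR by (intro add_pos_pos mult_pos_pos divide_pos_pos) auto
 have "\<exists>zs. set zs \<subseteq> {\<rho>\<in>cball 0 R1. f \<rho> = 0} & real (length zs) <= (C1 + C2) * A \<and>
  (\<forall>z. cmod z <= r & f z \<noteq> 0 --> cmod (deriv f z / f z - (\<Sum>\<rho>\<leftarrow>zs. 1/(z - \<rho>))) <= (C1 + C2) * A)"
 if f: "f holomorphic_on ball 0 R0" "f 0 \<noteq> 0" "\<And>z. cmod z <= R ==> cmod (f z) < exp A * cmod (f 0)" for f A
 proof -
 define M where "M = exp A * cmod (f 0)"
 have A: "A > 0" using f(3)[of 0] f(2) R by (simp add: mult_less_cancel_right1)
 have M: "cmod (f z) <= M" if "cmod z <= R" for z using f(3)[OF that] by (simp add: M_def)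
 obtain zs g where zg: "g holomorphic_on ball 0 R0" "\<And>z. z \<in> ball 0 R0 ==> f z = g z*(\<Prod>\<rho>\<leftarrow>zs. z - \<rho>)"
  "set zs \<subseteq> cball 0 R1" "\<And>z. z \<in> cball 0 R1 ==> g z \<noteq> 0"
  using zero_extraction[OF f(1) _ R(3,4) f(2) M] R by (metis order_less_trans)
 have R1: "0 < R1" using R by simp
 note zb = zero_divisor_bound[OF zg(1) R1 R(3,4) zg(2,3) M]
 have zeros: "set zs \<subseteq> {\<rho>\<in>cball 0 R1. f \<rho> = 0}"
 proof
  fix \<rho> assume "\<rho> \<in> set zs"
  then have "(\<Prod>\<rho>'\<leftarrow>zs. \<rho> - \<rho>') = 0" by (auto simp: prod_list_zero_iff)
  moreover have "\<rho> \<in> cball 0 R1" using \<open>\<rho> \<in> set zs\<close> zg(3) by auto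
  ultimately show "\<rho> \<in> {\<rho>\<in>cball 0 R1. f \<rho> = 0}" using zg(2)[of \<rho>] R by auto
 qed
 have len: "real (length zs) <= C1 * A"
 proof -
  have "cmod (f 0)*(R / R1) ^ length zs <= exp A * cmod (f 0)" using zb(3) by (simp add: M_def)
  then have "(R / R1) ^ length zs <= exp A" using f(2) by simp
  then have "ln ((R / R1) ^ length zs) <= ln (exp A)" using R by (subst ln_le_cancel_iff) auto
  then have "ln ((R / R1) ^ length zs) <= A" by simp
  then have "real (length zs) * ln (R / R1) <= A" using R by (simp add: ln_realpow)
  moreover have "ln (R / R1) > 0" using R by (simp add: ln_gt_zero_iff)
  ultimately show ?thesis by (simp add: C1_def pos_le_divide_eq)
 qed
 define k where "k = (%\<rho> z. (of_real (R^2) - cnj \<rho> * z) / complex_of_real R)"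
 let ?F = "%z. g z*(\<Prod>\<rho>\<leftarrow>zs. k \<rho> z)"
 have knz: "k \<rho> z \<noteq> 0" "cmod (of_real (R^2) - cnj \<rho> * z) >= R^2 - R1 * R1" if "\<rho> \<in> set zs" "cmod z <= R1" for \<rho> z
 proof -
  have "cmod (cnj \<rho> * z) <= R1 * R1" unfolding norm_mult complex_mod_cnj
  using that zg(3) R by (intro mult_mono) auto
  moreover have "cmod (of_real (R^2) :: complex) = R^2" by (simp only: norm_of_real abs_power2)
  ultimately show "cmod (of_real (R^2) - cnj \<rho> * z) >= R^2 - R1 * R1"
  using norm_triangle_ineq2[of "of_real (R^2)" "cnj \<rho> * z"] by linarith
  then show "k \<rho> z \<noteq> 0" unfolding k_def using RR R by auto
 qed
 have main: "cmod (deriv f z / f z - (\<Sum>\<rho>\<leftarrow>zs. 1/(z - \<rho>))) <= C2 * A" if z: "cmod z <= r" "f z \<noteq> 0" for z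
 proof -
  have zb1: "z \<in> ball 0 R0" "z \<in> cball 0 R1" "cmod z <= R1" using z R by auto
  have dg: "(g has_field_derivative deriv g z) (at z)" by (rule holomorphic_derivI[OF zg(1) open_ball zb1(1)])
  have gz: "g z \<noteq> 0" using zg(4) zb1 by blast
  have "\<exists>D. ((%z. g z*(\<Prod>\<rho>\<leftarrow>zs. z - \<rho>)) has_field_derivative D) (at z) \<and>
   D/(g z*(\<Prod>\<rho>\<leftarrow>zs. z - \<rho>)) = deriv g z / g z + (\<Sum>\<rho>\<leftarrow>zs. 1/(z - \<rho>))"
  by (rule logderiv_prod_list[where k = "%\<rho> z. z - \<rho>"])
   (use zeros z dg gz in \<open>auto intro!: derivative_eq_intros\<close>)
  then obtain D where D: "((%z. g z*(\<Prod>\<rho>\<leftarrow>zs. z - \<rho>)) has_field_derivative D) (at z)"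
   "D/(g z*(\<Prod>\<rho>\<leftarrow>zs. z - \<rho>)) = deriv g z / g z + (\<Sum>\<rho>\<leftarrow>zs. 1/(z - \<rho>))" by blast
  have "(f has_field_derivative D) (at z)"
  by (rule has_field_derivative_transform_within_open[OF D(1) open_ball zb1(1)]) (simp add: zg(2))
  then have e1: "deriv f z / f z = deriv g z / g z + (\<Sum>\<rho>\<leftarrow>zs. 1/(z - \<rho>))"
  using D(2) zg(2)[OF zb1(1)] by (simp add: DERIV_imp_deriv)
  have "\<exists>E. (?F has_field_derivative E) (at z) \<and>
   E / ?F z = deriv g z / g z + (\<Sum>\<rho>\<leftarrow>zs. (- cnj \<rho> / of_real R) / k \<rho> z)"
  by (rule logderiv_prod_list)
   (use knz(1) zb1 R dg gz in \<open>auto intro!: derivative_eq_intros simp: k_def\<close>)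
  then obtain E where E: "(?F has_field_derivative E) (at z)"
   "E / ?F z = deriv g z / g z + (\<Sum>\<rho>\<leftarrow>zs. (- cnj \<rho> / of_real R) / k \<rho> z)" by blast
  then have e2: "deriv ?F z / ?F z = deriv g z / g z + (\<Sum>\<rho>\<leftarrow>zs. (- cnj \<rho> / of_real R) / k \<rho> z)"
  by (simp add: DERIV_imp_deriv)
  have hol_prod: "(%z. \<Prod>\<rho>\<leftarrow>ys. k \<rho> z) holomorphic_on B" for ys B
  unfolding k_def using R by (induction ys) (auto intro!: holomorphic_intros)
  have bF: "cmod (deriv ?F z / ?F z) <= 8 * A * R1/(R1 - r)^2"
  proof (rule borel_caratheodory_logderiv)
  show "?F holomorphic_on ball 0 R1"
   by (intro holomorphic_intros hol_prod holomorphic_on_subset[OF zg(1)]) (use R in auto)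
  show "?F w \<noteq> 0" if "w \<in> ball 0 R1" for w
   using zg(4)[of w] knz(1)[of _ w] that by (auto simp: prod_list_zero_iff)
  show "cmod (?F w) < exp A * cmod (?F 0)" if "w \<in> ball 0 R1" for w
  proof -
   have "(\<Prod>\<rho>\<leftarrow>ys. k \<rho> 0) = of_real (R ^ length ys)" for ys
   using R by (induction ys) (simp_all add: k_def power2_eq_square)
   then have F0: "cmod (?F 0) = cmod (g 0) * R ^ length zs" using R by (simp add: norm_mult norm_power)
   have "cmod (f 0)*1 <= cmod (f 0)*(R / R1) ^ length zs" using R by (intro mult_left_mono one_le_power) auto
   also have "... <= cmod (?F 0)" using zb(2) F0 by simp
   finally have f0F: "cmod (f 0) <= cmod (?F 0)" by simp

   show ?thesis
   proof -
   \<comment> \<open>Borel-Caratheodory asks for a strict inequality, while the maximum principle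
     returns a weak one. The maximum of |f| over the compact disc is strictly below the bound and
     bridges the gap.\<close>
   obtain m where m: "\<And>u. cmod u <= R ==> cmod (f u) <= m" "m < exp A * cmod (f 0)"
   proof -
    have "continuous_on (cball 0 R) (%u. cmod (f u))"
    by (intro continuous_intros continuous_on_subset[OF holomorphic_on_imp_continuous_on[OF f(1)]]) (use R in auto)
    moreover have "cball (0::complex) R \<noteq> {}" using R by auto
    ultimately obtain u0 where "u0 \<in> cball 0 R" "\<forall>u\<in>cball 0 R. cmod (f u) <= cmod (f u0)"
    using continuous_attains_sup[of "cball 0 R" "%u. cmod (f u)"] compact_cball by blast
    then show ?thesis using that[of "cmod (f u0)"] f(3)[of u0] by auto
   qed
   have "cmod (?F w) <= m"
    using zero_divisor_bound(1)[OF zg(1) R1 R(3,4) zg(2,3) m(1), of w] that R by (simp add: k_def)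
   also have "m < exp A * cmod (f 0)" by (rule m(2))
   also have "... <= exp A * cmod (?F 0)" using f0F by (intro mult_left_mono) auto
   finally show ?thesis .
   qed
  qed
  qed (use z R in auto)
  have bS: "cmod (\<Sum>\<rho>\<leftarrow>zs. (- cnj \<rho> / of_real R) / k \<rho> z) <= real (length zs)*(R1/(R^2 - R1 * R1))"
  proof (rule norm_sum_list_le)
  fix \<rho> assume \<rho>: "\<rho> \<in> set zs"
  have "(- cnj \<rho> / of_real R) / k \<rho> z = - cnj \<rho>/(of_real (R^2) - cnj \<rho> * z)"
   using R by (simp add: k_def del: of_real_power)
  then have "cmod ((- cnj \<rho> / of_real R) / k \<rho> z) = cmod \<rho> / cmod (of_real (R^2) - cnj \<rho> * z)"
   by (simp only: norm_divide norm_minus_cancel complex_mod_cnj)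
  also have "... <= R1/(R^2 - R1 * R1)"
   using knz(2)[OF \<rho> zb1(3)] \<rho> zg(3) RR R by (intro frac_le) auto
  finally show "cmod ((- cnj \<rho> / of_real R) / k \<rho> z) <= R1/(R^2 - R1 * R1)" .
  qed
  have "deriv f z / f z - (\<Sum>\<rho>\<leftarrow>zs. 1/(z - \<rho>)) = deriv ?F z / ?F z - (\<Sum>\<rho>\<leftarrow>zs. (- cnj \<rho> / of_real R) / k \<rho> z)"
  unfolding e1 e2 by simp
  also have "cmod ... <= 8 * A * R1/(R1 - r)^2 + real (length zs)*(R1/(R^2 - R1 * R1))"
  by (rule order_trans[OF norm_triangle_ineq4 add_mono[OF bF bS]])
  also have "... <= 8 * A * R1/(R1 - r)^2 + C1 * A*(R1/(R^2 - R1 * R1))"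
  using len RR R by (intro add_left_mono mult_right_mono) auto
  also have "... = C2 * A" by (simp add: C2_def algebra_simps)
  finally show ?thesis .
 qed
 show ?thesis
 proof (intro exI[of _ zs] conjI allI impI zeros)
  show "real (length zs) <= (C1 + C2) * A" using len C2 A by (simp add: distrib_right add_increasing2)
  fix z assume "cmod z <= r & f z \<noteq> 0"
  then show "cmod (deriv f z / f z - (\<Sum>\<rho>\<leftarrow>zs. 1/(z - \<rho>))) <= (C1 + C2) * A"
  using main[of z] C1 A by (simp add: distrib_right add_increasing)
 qed
 qed
 then show ?thesis using C1 C2 by (intro exI[of _ "C1 + C2"]) auto
qed

lemma abs_fundamental_discriminant_ge_1:
 assumes "fundamental_discriminant d"
 shows "1 <= \<bar>real_of_int d\<bar>"
proof -
 have "d \<noteq> 0" using assms by (auto simp: fundamental_discriminant_def)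
 then have "1 <= \<bar>d\<bar>" by linarith
 then show ?thesis by linarith
qed

text \<open>The disc of radius 9/5 about 2 + it stays in Re w >= 1/5; for d = 1 the condition |t| >=
  2 keeps it at distance at least 1/5 from the pole. The constant 208 is 16 times 13.\<close>

lemma Dirichlet_L_disc_bound:
 assumes d: "fundamental_discriminant d" and dt: "d \<noteq> 1 \<or> \<bar>t\<bar> >= 2"
 and w: "cmod (w - (2 + \<i> * of_real t)) <= 9/5"
 shows "cmod (Dirichlet_L d w) <= 208*(\<bar>real_of_int d\<bar>*(2 + \<bar>t\<bar>))"
proof -
 let ?c = "2 + \<i> * of_real t :: complex"
 have d1: "1 <= \<bar>real_of_int d\<bar>" by (rule abs_fundamental_discriminant_ge_1[OF d])
 have Re: "Re w >= 1/5" using abs_Re_le_cmod[of "w - ?c"] w by simp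
 have Im: "\<bar>Im w - t\<bar> <= 9/5" using abs_Im_le_cmod[of "w - ?c"] w by simp
 have "cmod ?c <= 2 + \<bar>t\<bar>" using norm_triangle_ineq[of 2 "\<i> * complex_of_real t"] by (simp add: norm_mult)
 then have cw: "cmod w <= 4 + \<bar>t\<bar>" using norm_triangle_sub[of w ?c] w by linarith
 have "1 / Re w <= 5" using Re by (simp add: divide_simps)
 then have prod: "cmod w*(1 + 1 / Re w) <= (4 + \<bar>t\<bar>)*6" using cw Re by (intro mult_mono) auto
 show ?thesis
 proof (cases "d = 1")
 case False
 have "cmod (Dirichlet_L d w) <= 16*\<bar>real_of_int d\<bar>*(1 + cmod w*(1 + 1 / Re w))"
  by (rule norm_Dirichlet_L_le[OF d False]) (use Re in linarith)
 also have "... <= 16*\<bar>real_of_int d\<bar>*(13*(2 + \<bar>t\<bar>))" using prod by (intro mult_left_mono) auto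
 finally show ?thesis by (simp add: mult_ac)
 next
 case True
 then have t: "\<bar>t\<bar> >= 2" using dt by simp
 have Imw: "\<bar>Im w\<bar> >= 1/5" using Im t by linarith
 then have w1: "w \<noteq> 1" by auto
 have "cmod (w - 1) >= 1/5" using Imw abs_Im_le_cmod[of "w - 1"] by simp
 then have "cmod (1/(w - 1)) <= 5" using w1 by (simp add: norm_divide divide_simps)
 moreover have "cmod (Dirichlet_L 1 w - 1/(w - 1)) <= (4 + \<bar>t\<bar>)*6"
  using norm_zeta_minus_pole_le[of w] Re w1 prod by linarith
 ultimately have "cmod (Dirichlet_L 1 w) <= (4 + \<bar>t\<bar>)*6 + 5"
  using norm_triangle_sub[of "Dirichlet_L 1 w" "1/(w - 1)"] by linarith
 then show ?thesis using True by simp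
 qed
qed

lemma Dirichlet_L_zero_Re:
 assumes d: "fundamental_discriminant d" "GRH_for d" and w: "Re w > 0" "w \<noteq> 1 \<or> d \<noteq> 1" and z: "Dirichlet_L d w = 0"
 shows "Re w = 1/2"
proof (cases "Re w > 1/2")
 case True
 then show ?thesis using Dirichlet_L_nonzero_GRH[OF d True w(2)] z by simp
next
 case False
 then show ?thesis using d(2)[unfolded GRH_for_def, rule_format, of w] w z by auto
qed

lemma L_domain_I: "w \<noteq> 1 \<or> d \<noteq> 1 ==> w \<in> L_domain d"
 by (auto simp: L_domain_def)

lemma open_L_domain: "open (L_domain d)"
 by (simp add: L_domain_def open_Compl)

lemma sum_list_Re_nonneg: "(\<And>x. x \<in> set xs ==> Re (f x) >= 0) ==> Re (\<Sum>x\<leftarrow>xs. f x) >= 0"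
 by (induction xs) auto

lemma ln_discriminant_height_ge:
 assumes "fundamental_discriminant d"
 shows "ln (\<bar>real_of_int d\<bar>*(2 + \<bar>t\<bar>)) >= ln 2"
proof -
 have "1 <= \<bar>real_of_int d\<bar>" by (rule abs_fundamental_discriminant_ge_1[OF assms])
 then have "1*2 <= \<bar>real_of_int d\<bar>*(2 + \<bar>t\<bar>)" by (intro mult_mono) auto
 then show ?thesis by (simp add: ln_mono)
qed

text \<open>The discs have centre 2 + it, and the inner radius 3/2 just reaches Re s = 1/2. All
  zeros involved have real part 1/2 under GRH, so each 1/(s - \<rho>) has positive real part: the
  lower bound for the real part is uniform up to the critical line, while the modulus pays 1/(Re s -
  1/2) per zero. This one-sided uniformity is what the method rests on.\<close>

lemma logderiv_Dirichlet_L_bounds: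
 "\<exists>C>0. \<forall>d s. fundamental_discriminant d & GRH_for d & (d \<noteq> 1 \<or> \<bar>Im s\<bar> >= 2) & 1/2 < Re s & Re s <= 2 -->
  Re (deriv (Dirichlet_L d) s / Dirichlet_L d s) >= - C * ln (\<bar>real_of_int d\<bar>*(2 + \<bar>Im s\<bar>)) \<and>
  cmod (deriv (Dirichlet_L d) s / Dirichlet_L d s)
  <= C * ln (\<bar>real_of_int d\<bar>*(2 + \<bar>Im s\<bar>))*(1 + 1/(Re s - 1/2))"
proof -
 obtain C0 where C0: "C0 > 0"
 "\<And>f A. f holomorphic_on ball 0 (37/20) ==> f 0 \<noteq> 0 ==> (\<And>z. cmod z <= 9/5 ==> cmod (f z) < exp A * cmod (f 0)) ==>
  (\<exists>zs. set zs \<subseteq> {\<rho>\<in>cball 0 (17/10). f \<rho> = 0} & real (length zs) <= C0 * A \<and>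
  (\<forall>z. cmod z <= 3/2 & f z \<noteq> 0 --> cmod (deriv f z / f z - (\<Sum>\<rho>\<leftarrow>zs. 1/(z - \<rho>))) <= C0 * A))"
 using logderiv_local_expansion[of "3/2" "17/10" "9/5" "37/20"] by auto
 \<comment> \<open>Chosen so that ln (208 Q) + 3 <= K ln Q for all Q >= 2.\<close>
 define K :: real where "K = 1 + (ln 208 + 3) / ln 2"
 have K: "K > 0" unfolding K_def by (intro add_pos_nonneg divide_nonneg_pos) auto
 define C where "C = C0 * K"
 have C: "C > 0" using C0 K by (simp add: C_def)
 show ?thesis
 proof (intro exI[of _ C] conjI C allI impI)
 fix d s assume "fundamental_discriminant d & GRH_for d & (d \<noteq> 1 \<or> \<bar>Im s\<bar> >= 2) & 1/2 < Re s & Re s <= 2"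
 then have d: "fundamental_discriminant d" "GRH_for d" and dt: "d \<noteq> 1 \<or> \<bar>Im s\<bar> >= 2"
  and s: "1/2 < Re s" "Re s <= 2" by auto
 define t where "t = Im s"
 define c where "c = (2 + \<i> * of_real t :: complex)"
 define Q where "Q = \<bar>real_of_int d\<bar>*(2 + \<bar>t\<bar>)"
 have "1 <= \<bar>real_of_int d\<bar>" by (rule abs_fundamental_discriminant_ge_1[OF d(1)])
 then have "1*2 <= Q" unfolding Q_def by (intro mult_mono) auto
 then have Q: "Q >= 2" by simp
 have lnQ: "ln Q >= ln 2" using ln_discriminant_height_ge[OF d(1)] by (simp add: Q_def)
 define f where "f = (%z. Dirichlet_L d (c + z))"
 have dom: "c + z \<noteq> 1 \<or> d \<noteq> 1" if "cmod z < 2" for z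
 proof (rule ccontr)
  assume "\<not> ?thesis"
  then have "c + z = 1" "\<bar>t\<bar> >= 2" using dt by (auto simp: t_def)
  then have "Im z = - t" by (auto simp: c_def complex_eq_iff)
  then show False using abs_Im_le_cmod[of z] that \<open>\<bar>t\<bar> >= 2\<close> by simp
 qed
 have holf: "f holomorphic_on ball 0 (37/20)"
  unfolding f_def
 proof (rule holomorphic_on_compose_gen[of "%z. c + z" _ "Dirichlet_L d" "L_domain d", unfolded o_def])
  show "(%z. c + z) ` ball 0 (37/20) \<subseteq> L_domain d"
  proof
  fix w assume "w \<in> (%z. c + z) ` ball 0 (37/20)"
  then obtain z where z: "w = c + z" "z \<in> ball 0 (37/20)" by (rule imageE)
  then show "w \<in> L_domain d" using dom[of z] by (intro L_domain_I) simp
  qed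
 qed (use holomorphic_Dirichlet_L[OF d(1)] in \<open>auto intro!: holomorphic_intros\<close>)
 have f0: "cmod (f 0) >= exp (-2)" unfolding f_def
  using norm_Dirichlet_L_bounds(1)[OF d(1), of c] by (simp add: c_def)
 then have f0': "f 0 \<noteq> 0" by (metis exp_gt_zero leD norm_zero)
 \<comment> \<open>|f(0)| is at least exp(-2), so a summand 2 would give the weak inequality; 3
   makes it strict.\<close>
 define A where "A = ln (208 * Q) + 3"
 have "cmod (f z) < exp A * cmod (f 0)" if "cmod z <= 9/5" for z
 proof -
  have "cmod (f z) <= 208 * Q" unfolding f_def Q_def
  by (rule Dirichlet_L_disc_bound[OF d(1)]) (use dt that in \<open>auto simp: c_def t_def\<close>)
  also have "208 * Q < (208 * Q * exp 3) * exp (-2)"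
  using Q by (simp add: exp_add[symmetric] mult.assoc)
  also have "208 * Q * exp 3 = exp A" using Q by (simp add: A_def exp_add)
  also have "exp A * exp (-2) <= exp A * cmod (f 0)" using f0 by (intro mult_left_mono) auto
  finally show ?thesis .
 qed
 from C0(2)[OF holf f0' this] obtain zs where zs: "set zs \<subseteq> {\<rho>\<in>cball 0 (17/10). f \<rho> = 0}" "real (length zs) <= C0 * A"
  "\<And>z. cmod z <= 3/2 ==> f z \<noteq> 0 ==> cmod (deriv f z / f z - (\<Sum>\<rho>\<leftarrow>zs. 1/(z - \<rho>))) <= C0 * A" by auto
 have A: "A <= K * ln Q"
 proof -
  have "A = ln Q + (ln 208 + 3)" using Q by (simp add: A_def ln_mult)
  also have "ln 208 + 3 <= (ln 208 + 3) / ln 2 * ln Q" using lnQ by (simp add: divide_simps mult_left_mono)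
  finally show ?thesis by (simp add: K_def algebra_simps)
 qed
 then have CA: "C0 * A <= C * ln Q" using C0(1) by (simp add: C_def mult_left_mono mult.assoc)
 define z where "z = s - c"
 have "z = of_real (Re s - 2)" by (simp add: z_def c_def t_def complex_eq_iff)
 then have z: "cmod z <= 3/2" using s by (simp only: norm_of_real)
 have cz: "c + z = s" by (simp add: z_def)
 have fz: "f z \<noteq> 0" unfolding f_def cz
  by (rule Dirichlet_L_nonzero_GRH[OF d s(1)]) (use dom[of z] z cz in auto)
 have "s \<in> L_domain d" using dom[of z] z cz by (intro L_domain_I) auto
 from holomorphic_derivI[OF holomorphic_Dirichlet_L[OF d(1)] open_L_domain this]
 have "(Dirichlet_L d has_field_derivative deriv (Dirichlet_L d) s) (at (c + z))" by (simp add: cz)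
 moreover have "((%z. c + z) has_field_derivative 0 + 1) (at z)" by (intro derivative_intros)
 ultimately have "((%z. Dirichlet_L d (c + z)) has_field_derivative deriv (Dirichlet_L d) s*(0 + 1)) (at z)"
  by (rule DERIV_chain2)
 then have "(f has_field_derivative deriv (Dirichlet_L d) s) (at z)" by (simp add: f_def)
 then have df: "deriv f z / f z = deriv (Dirichlet_L d) s / Dirichlet_L d s"
  by (simp add: DERIV_imp_deriv f_def cz)
 have zero: "Re (z - \<rho>) = Re s - 1/2" if "\<rho> \<in> set zs" for \<rho>
 proof -
  have \<rho>: "cmod \<rho> <= 17/10" "Dirichlet_L d (c + \<rho>) = 0" using that zs(1) by (auto simp: f_def)
  have "Re (c + \<rho>) > 0" using abs_Re_le_cmod[of \<rho>] \<rho> by (simp add: c_def)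
  then have "Re (c + \<rho>) = 1/2"
  by (rule Dirichlet_L_zero_Re[OF d _ dom \<rho>(2)]) (use \<rho> in simp)
  then show ?thesis by (simp add: z_def)
 qed
 let ?S = "\<Sum>\<rho>\<leftarrow>zs. 1/(z - \<rho>)"
 have bd: "cmod (deriv (Dirichlet_L d) s / Dirichlet_L d s - ?S) <= C * ln Q"
  using zs(3)[OF z fz] CA unfolding df by linarith
 have "Re ?S >= 0"
 proof (rule sum_list_Re_nonneg)
  fix \<rho> assume "\<rho> \<in> set zs"
  then show "Re (1/(z - \<rho>)) >= 0" using zero[of \<rho>] s by (simp add: Re_divide)
 qed
 then have 1: "Re (deriv (Dirichlet_L d) s / Dirichlet_L d s) >= - C * ln Q"
  using bd abs_Re_le_cmod[of "deriv (Dirichlet_L d) s / Dirichlet_L d s - ?S"] by simp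
 have "cmod ?S <= real (length zs)*(1/(Re s - 1/2))"
 proof (rule norm_sum_list_le)
  fix \<rho> assume "\<rho> \<in> set zs"
  then have "cmod (z - \<rho>) >= Re s - 1/2" using zero[of \<rho>] abs_Re_le_cmod[of "z - \<rho>"] by simp
  then show "cmod (1/(z - \<rho>)) <= 1/(Re s - 1/2)" using s by (simp add: norm_divide frac_le)
 qed
 also have "... <= C * ln Q*(1/(Re s - 1/2))" using zs(2) CA s by (intro mult_right_mono) auto
 finally have "cmod (deriv (Dirichlet_L d) s / Dirichlet_L d s) <= C * ln Q + C * ln Q*(1/(Re s - 1/2))"
  using bd norm_triangle_sub[of "deriv (Dirichlet_L d) s / Dirichlet_L d s" ?S] by linarith
 then have 2: "cmod (deriv (Dirichlet_L d) s / Dirichlet_L d s) <= C * ln Q*(1 + 1/(Re s - 1/2))"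
  by (simp add: algebra_simps)
 from 1 show "Re (deriv (Dirichlet_L d) s / Dirichlet_L d s) >= - C * ln (\<bar>real_of_int d\<bar>*(2 + \<bar>Im s\<bar>))"
  by (simp add: Q_def t_def)
 from 2 show "cmod (deriv (Dirichlet_L d) s / Dirichlet_L d s)
  <= C * ln (\<bar>real_of_int d\<bar>*(2 + \<bar>Im s\<bar>))*(1 + 1/(Re s - 1/2))"
  by (simp add: Q_def t_def)
 qed
qed

section \<open>The Fejer kernel\<close>

text \<open>Being nonnegative, it preserves one-sided bounds under the integral; its Fourier
  transform is a multiple of the tent function, which truncates Dirichlet series. The value at 0 is
  the limit.\<close>

definition fejer :: "real \<Rightarrow> real" where
 "fejer u = (if u = 0 then 1/2 else (1 - cos u) / u^2)"

lemma fejer_eq_sinc: "fejer u = (sinc (u/2))^2/2"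
 using cos_double_sin[of "u/2"] by (simp add: fejer_def power_divide)

lemma continuous_on_fejer [continuous_intros]: "continuous_on S f ==> continuous_on S (%x. fejer (f x))"
 unfolding fejer_eq_sinc by (intro continuous_intros) auto

lemma borel_measurable_fejer [measurable]: "fejer \<in> borel_measurable borel"
 by (intro borel_measurable_continuous_onI continuous_on_fejer continuous_on_id)

lemma fejer_nonneg: "fejer u >= 0"
 by (simp add: fejer_def)

lemma fejer_minus: "fejer (- u) = fejer u"
 by (simp add: fejer_def)

lemma fejer_scaled: "v \<noteq> 0 ==> b^2 * fejer (b * v) = (1 - cos (b * v)) / v^2"
 by (simp add: fejer_def power_mult_distrib)

lemma fejer_le: "fejer u <= 8*(1 + \<bar>u\<bar>) powr - 2"
proof (cases "\<bar>u\<bar> <= 1")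
 case True
 have "fejer u <= 1/2"
 proof -
 have "\<bar>sinc (u/2)\<bar> <= 1" using abs_sin_x_le_abs_x[of "u/2"] by (auto simp: divide_simps abs_if split: if_splits)
 then have "(sinc (u/2))^2 <= 1" by (simp only: abs_square_le_1)
 then show ?thesis unfolding fejer_eq_sinc by simp
 qed
 also have "1/2 <= 8*(2 powr - 2 :: real)" by (simp add: powr_minus)
 also have "... <= 8*(1 + \<bar>u\<bar>) powr - 2" using True by (intro mult_left_mono powr_mono2') auto
 finally show ?thesis .
next
 case False
 then have "fejer u <= 2 / u^2"
 using cos_ge_minus_one[of u] by (auto simp: fejer_def intro!: divide_right_mono)
 also have "u^2 = \<bar>u\<bar>^2" by simp
 also have "2 / \<bar>u\<bar>^2 = 8/(2*\<bar>u\<bar>)^2" by (simp add: power_mult_distrib)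
 also have "... <= 8/(1 + \<bar>u\<bar>)^2" using False by (intro divide_left_mono power_mono mult_pos_pos) auto
 also have "... = 8*(1 + \<bar>u\<bar>) powr - 2" by (simp add: powr_minus divide_inverse)
 finally show ?thesis .
qed

lemma integrable_tail_weight: "integrable lborel (%u::real. (1 + \<bar>u\<bar>) powr (- 3/2))"
proof -
 let ?f = "%u::real. (1 + \<bar>u\<bar>) powr (- 3/2)" and ?F = "%u::real. - 2*(1 + u) powr (- 1/2)"
 have "(\<integral>\<^sup>+x. ennreal (?f x) * indicator {0..} x \<partial>lborel) = ennreal (0 - ?F 0)"
 proof (rule nn_integral_FTC_atLeast)
 show "(?F has_real_derivative ?f x) (at x)" if "0 <= x" for x
  using that by (auto intro!: derivative_eq_intros)
 have "((%u::real. (1 + u) powr (- 1/2)) \<longlongrightarrow> 0) at_top"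
  by (intro tendsto_neg_powr filterlim_tendsto_add_at_top[OF tendsto_const] filterlim_ident) auto
 from tendsto_mult_right_zero[OF this] show "(?F \<longlongrightarrow> 0) at_top" .
 qed auto
 then have "integrable lborel (%x. indicator {0..} x *\<^sub>R ?f x)"
 by (intro integrableI_nonneg) (auto simp: ennreal_mult' ennreal_indicator mult.commute[of "indicator _ _"] simp flip: ennreal_mult'')
 then have "has_bochner_integral lborel (%x. indicator {0..} x *\<^sub>R ?f x) (\<integral>x. indicator {0..} x *\<^sub>R ?f x \<partial>lborel)"
 by (rule has_bochner_integral_integrable)
 from has_bochner_integral_even_function[OF this] show ?thesis by (auto simp: has_bochner_integral_iff)
qed

text \<open>The weight (1 + |u|)^(1/2) stands for the logarithmic growth of L'/L along vertical
  lines; the kernel decays fast enough to leave the integrable exponent -3/2.\<close>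

lemma fejer_weight_le: "fejer u*(1 + \<bar>u\<bar>) powr (1/2) <= 8*(1 + \<bar>u\<bar>) powr (- 3/2)"
proof -
 have "fejer u*(1 + \<bar>u\<bar>) powr (1/2) <= 8*(1 + \<bar>u\<bar>) powr - 2*(1 + \<bar>u\<bar>) powr (1/2)"
 by (intro mult_right_mono fejer_le) auto
 also have "... = 8*(1 + \<bar>u\<bar>) powr (- 3/2)" by (simp add: powr_add[symmetric] mult.assoc)
 finally show ?thesis .
qed

lemma integrable_fejer_weight: "integrable lborel (%u. fejer u*(1 + \<bar>u\<bar>) powr (1/2))"
proof (rule Bochner_Integration.integrable_bound[where f = "%u. 8*(1 + \<bar>u\<bar>) powr (- 3/2)"])
 show "integrable lborel (%u::real. 8*(1 + \<bar>u\<bar>) powr (- 3/2))"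
 by (intro integrable_mult_right integrable_tail_weight)
 show "AE u in lborel. norm (fejer u*(1 + \<bar>u\<bar>) powr (1/2)) <= norm (8*(1 + \<bar>u\<bar>) powr (- 3/2))"
 using fejer_weight_le fejer_nonneg by (intro AE_I2) (simp add: abs_mult)
qed measurable

lemma integrable_fejer_bounded:
 fixes g :: "real \<Rightarrow> 'a :: {banach, second_countable_topology}"
 assumes "g \<in> borel_measurable borel" "\<And>u. norm (g u) <= K*(1 + \<bar>u\<bar>) powr (1/2)"
 shows "integrable lborel (%u. fejer u *\<^sub>R g u)"
proof (rule Bochner_Integration.integrable_bound[where f = "%u. K*(fejer u*(1 + \<bar>u\<bar>) powr (1/2))"])
 show "integrable lborel (%u. K*(fejer u*(1 + \<bar>u\<bar>) powr (1/2)))"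
 by (intro integrable_mult_right integrable_fejer_weight)
 have "norm (fejer u *\<^sub>R g u) <= K*(fejer u*(1 + \<bar>u\<bar>) powr (1/2))" for u
 using mult_left_mono[OF assms(2)[of u] fejer_nonneg[of u]] fejer_nonneg[of u] by (simp add: mult_ac)
 then show "AE u in lborel. norm (fejer u *\<^sub>R g u) <= norm (K*(fejer u*(1 + \<bar>u\<bar>) powr (1/2)))"
 by (intro AE_I2) (metis abs_ge_self order_trans real_norm_def)
qed (use assms(1) in measurable)

lemma integrable_fejer: "integrable lborel fejer"
 using integrable_fejer_bounded[of "%_. 1::real" 1] by (simp add: ge_one_powr_ge_zero)

text \<open>The value is pi. It cancels from the identities in which it occurs, so its positivity is
  enough.\<close>

definition fejer_mass :: real where
 "fejer_mass = (\<integral>u. fejer u \<partial>lborel)"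

lemma fejer_mass_pos: "fejer_mass > 0"
proof -
 have "fejer_mass \<noteq> 0"
 proof
 assume "fejer_mass = 0"
 then have "AE u in lborel. fejer u = 0"
  using integral_nonneg_eq_0_iff_AE[OF integrable_fejer] fejer_nonneg by (simp add: fejer_mass_def)
 then have "{u \<in> space lborel. \<not> fejer u = 0} \<in> null_sets lborel"
  by (subst (asm) AE_iff_null) (auto, measurable)
 note null = this
 have "{0<..<1} \<subseteq> {u \<in> space lborel. \<not> fejer u = 0}"
 proof safe
  fix u :: real assume u: "u \<in> {0<..<1}" "fejer u = 0"
  then have "cos u = cos 0" by (auto simp: fejer_def)
  then show False using cos_monotone_0_pi[of 0 u] u pi_gt3 by auto
 qed auto
 from null_sets_subset[OF null _ this] have "{0<..<1::real} \<in> null_sets lborel" by simp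
 then show False by (simp add: null_sets_def)
 qed
 moreover have "fejer_mass >= 0" unfolding fejer_mass_def by (intro integral_nonneg_AE AE_I2 fejer_nonneg)
 ultimately show ?thesis by simp
qed

lemma integrable_fejer_scaled: "integrable lborel (%v. b^2 * fejer (b * v))"
proof (cases "b = 0")
 case False
 then show ?thesis
 using lborel_integrable_real_affine[OF integrable_fejer False, of 0] by (intro integrable_mult_right) simp
qed simp

lemma integral_fejer_scaled: "(\<integral>v. b^2 * fejer (b * v) \<partial>lborel) = \<bar>b\<bar> * fejer_mass"
proof (cases "b = 0")
 case False
 have "fejer_mass = \<bar>b\<bar>*(\<integral>v. fejer (b * v) \<partial>lborel)"
 unfolding fejer_mass_def using lborel_integral_real_affine[OF False, of fejer 0] by simp
 moreover have "(\<integral>v. b^2 * fejer (b * v) \<partial>lborel) = \<bar>b\<bar>*(\<bar>b\<bar>*(\<integral>v. fejer (b * v) \<partial>lborel))"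
 by (simp add: power2_eq_square mult.assoc)
 ultimately show ?thesis by simp
qed simp

text \<open>By the product formula for cosines the integrand is a second difference of (1 -
  cos(bv))/v^2 in b, at b = 1 + c, c, 1 - c. That function has integral |b| times the mass, and the
  tent is the same second difference of the absolute value.\<close>

lemma integral_fejer_cos: "(\<integral>v. fejer v * cos (c * v) \<partial>lborel) = fejer_mass * max 0 (1 - \<bar>c\<bar>)"
proof -
 have "fejer v * cos (c * v) = 1/2*((1 + c)^2 * fejer ((1 + c) * v)) + 1/2*((1 - c)^2 * fejer ((1 - c) * v))
  - c^2 * fejer (c * v)" for v
 proof (cases "v = 0")
 case True
 then show ?thesis by (simp add: fejer_def power2_eq_square field_simps)
 next
 case False
 have "cos v * cos (c * v) = (cos ((1 + c) * v) + cos ((1 - c) * v))/2"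
  by (simp add: cos_times_cos algebra_simps)
 then have "(1 - cos v) * cos (c * v) = 1/2*(1 - cos ((1 + c) * v)) + 1/2*(1 - cos ((1 - c) * v)) - (1 - cos (c * v))"
  by (simp add: algebra_simps)
 moreover have "x / q * k = 1/2*(B / q) + 1/2*(C / q) - D / q"
  if "x * k = 1/2 * B + 1/2 * C - D" for x k B C D q :: real
 proof -
  have "x / q * k = (x * k) / q" by simp
  then show ?thesis unfolding that by (simp add: add_divide_distrib diff_divide_distrib)
 qed
 ultimately have "(1 - cos v) / v^2 * cos (c * v) = 1/2*((1 - cos ((1 + c) * v)) / v^2) + 1/2*((1 - cos ((1 - c) * v)) / v^2)
  - (1 - cos (c * v)) / v^2" by blast
 then show ?thesis unfolding fejer_scaled[OF False] using False by (simp add: fejer_def)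
 qed
 then have "(\<integral>v. fejer v * cos (c * v) \<partial>lborel) = 1/2*(\<bar>1 + c\<bar> * fejer_mass) + 1/2*(\<bar>1 - c\<bar> * fejer_mass) - \<bar>c\<bar> * fejer_mass"
 by (simp only: Bochner_Integration.integral_diff Bochner_Integration.integral_add integrable_fejer_scaled
  integrable_mult_right Bochner_Integration.integrable_add integral_mult_right_zero
  integral_fejer_scaled[unfolded integral_mult_right_zero])
 also have "... = fejer_mass*(1/2*\<bar>1 + c\<bar> + 1/2*\<bar>1 - c\<bar> - \<bar>c\<bar>)" by (simp add: algebra_simps)
 also have "1/2*\<bar>1 + c\<bar> + 1/2*\<bar>1 - c\<bar> - \<bar>c\<bar> = max 0 (1 - \<bar>c\<bar>)" by (simp add: abs_if max_def field_simps)
 finally show ?thesis .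
qed

lemma integral_fejer_sin: "(\<integral>v. fejer v * sin (c * v) \<partial>lborel) = 0"
proof -
 have "(\<integral>v. fejer v * sin (c * v) \<partial>lborel) = (\<integral>v. - (fejer v * sin (c * v)) \<partial>lborel)"
 using lborel_integral_real_affine[of "-1" "%v. fejer v * sin (c * v)" 0] by (simp add: fejer_minus)
 then show ?thesis by simp
qed

lemma integrable_fejer_cis: "integrable lborel (%v. of_real (fejer v) * cis (c * v))"
proof -
 have "(%v. cis (c * v)) \<in> borel_measurable borel"
 by (intro borel_measurable_continuous_onI continuous_intros)
 from integrable_fejer_bounded[OF this, of 1] show ?thesis
 by (simp add: ge_one_powr_ge_zero scaleR_conv_of_real)
qed

lemma integral_fejer_cis:
 "(\<integral>v. of_real (fejer v) * cis (c * v) \<partial>lborel) = of_real (fejer_mass * max 0 (1 - \<bar>c\<bar>))"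
proof (rule complex_eqI)
 have "Re (\<integral>v. of_real (fejer v) * cis (c * v) \<partial>lborel) = (\<integral>v. fejer v * cos (c * v) \<partial>lborel)"
 by (subst integral_Re[OF integrable_fejer_cis, symmetric]) simp
 then show "Re (\<integral>v. of_real (fejer v) * cis (c * v) \<partial>lborel) = Re (of_real (fejer_mass * max 0 (1 - \<bar>c\<bar>)))"
 by (simp add: integral_fejer_cos)
 have "Im (\<integral>v. of_real (fejer v) * cis (c * v) \<partial>lborel) = (\<integral>v. fejer v * sin (c * v) \<partial>lborel)"
 by (subst integral_Im[OF integrable_fejer_cis, symmetric]) simp
 then show "Im (\<integral>v. of_real (fejer v) * cis (c * v) \<partial>lborel) = Im (of_real (fejer_mass * max 0 (1 - \<bar>c\<bar>)))"
 by (simp add: integral_fejer_sin)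
qed

lemma of_nat_powr_vertical_shift:
 assumes "n > 0"
 shows "of_nat n powr - (s + \<i> * of_real y) = of_nat n powr - s * cis (- (ln (real n) * y))"
proof -
 have "of_nat n powr - (s + \<i> * of_real y) = exp (- s * of_real (ln (real n)) + \<i> * of_real (- (ln (real n) * y)))"
 using assms by (simp add: powr_def Ln_of_nat algebra_simps)
 also have "... = of_nat n powr - s * cis (- (ln (real n) * y))"
 using assms by (simp only: exp_add cis_conv_exp) (simp add: powr_def Ln_of_nat)
 finally show ?thesis .
qed

text \<open>A vertical shift by v/a multiplies the n-th term by a wave of frequency (ln n)/a. Its
  transform vanishes once n >= exp a, so the integral becomes a finite sum with linear
  weights.\<close>

lemma integral_fejer_mangoldt_series:
 assumes f: "\<And>n. cmod (f n) <= 1" and s: "Re s > 1" and a: "a > 0"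
 shows "(\<integral>v. of_real (fejer v) * mangoldt_series f (s + \<i> * of_real (v / a)) \<partial>lborel) =
  of_real fejer_mass*(\<Sum>n. mangoldt n * f n * of_nat n powr - s * of_real (max 0 (1 - ln (real n) / a)))"
proof -
 let ?c = "%n. mangoldt n * f n * of_nat n powr - s"
 let ?t = "%n v. ?c n*(of_real (fejer v) * cis (- (ln (real n) / a) * v))"
 have sm: "summable (%n. cmod (?c n))"
 by (rule summable_dirichlet_series_ln_norm[OF norm_mangoldt_coeff_le[OF f] s]) simp
 have nt: "cmod (?t n v) = cmod (?c n) * fejer v" for n v
 by (simp add: norm_mult fejer_nonneg)
 have int: "integrable lborel (?t n)" for n
 by (intro integrable_mult_right integrable_fejer_cis)
 have "of_real (fejer v) * mangoldt_series f (s + \<i> * of_real (v / a)) = (\<Sum>n. ?t n v)" for v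
 proof -
 have "(%n. ?t n v) = (%n. of_real (fejer v)*(mangoldt n * f n * of_nat n powr - (s + \<i> * of_real (v / a))))"
 proof
  fix n show "?t n v = of_real (fejer v)*(mangoldt n * f n * of_nat n powr - (s + \<i> * of_real (v / a)))"
  by (cases "n = 0") (use of_nat_powr_vertical_shift[of n s "v / a"] in \<open>simp_all add: mult_ac\<close>)
 qed
 moreover have "summable (%n. mangoldt n * f n * of_nat n powr - (s + \<i> * of_real (v / a)))"
  by (rule summable_norm_cancel, rule summable_dirichlet_series_ln_norm[OF norm_mangoldt_coeff_le[OF f]]) (use s in auto)
 ultimately show ?thesis by (simp add: mangoldt_series_def dirichlet_series_def suminf_mult)
 qed
 then have "(\<integral>v. of_real (fejer v) * mangoldt_series f (s + \<i> * of_real (v / a)) \<partial>lborel) = (\<integral>v. (\<Sum>n. ?t n v) \<partial>lborel)"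
 by simp
 also have "... = (\<Sum>n. (\<integral>v. ?t n v \<partial>lborel))"
 proof (rule integral_suminf[OF int])
 show "AE v in lborel. summable (%n. norm (?t n v))"
  unfolding nt by (intro AE_I2 summable_mult2 sm)
 have "(\<integral>v. norm (?t n v) \<partial>lborel) = cmod (?c n) * fejer_mass" for n
  unfolding nt fejer_mass_def by simp
 then show "summable (%n. (\<integral>v. norm (?t n v) \<partial>lborel))" by (simp only: summable_mult2[OF sm])
 qed
 also have "(\<Sum>n. (\<integral>v. ?t n v \<partial>lborel)) = (\<Sum>n. of_real fejer_mass*(?c n * of_real (max 0 (1 - ln (real n) / a))))"
 proof (rule arg_cong[where f = suminf], rule ext)
 fix n
 have "(\<integral>v. ?t n v \<partial>lborel) = ?c n*(\<integral>v. of_real (fejer v) * cis (- (ln (real n) / a) * v) \<partial>lborel)"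
  by (rule integral_mult_right_zero)
 also have "(\<integral>v. of_real (fejer v) * cis (- (ln (real n) / a) * v) \<partial>lborel) = of_real (fejer_mass * max 0 (1 - \<bar>- (ln (real n) / a)\<bar>))"
  by (rule integral_fejer_cis)
 also have "\<bar>- (ln (real n) / a)\<bar> = ln (real n) / a" using a by (cases "n = 0") auto
 finally show "(\<integral>v. ?t n v \<partial>lborel) = of_real fejer_mass*(?c n * of_real (max 0 (1 - ln (real n) / a)))" by simp
 qed
 also have "(\<Sum>n. of_real fejer_mass*(?c n * of_real (max 0 (1 - ln (real n) / a)))) =
  of_real fejer_mass*(\<Sum>n. ?c n * of_real (max 0 (1 - ln (real n) / a)))"
 proof (rule suminf_mult, rule summable_comparison_test'[where N = 0, OF sm])
 fix n show "norm (?c n * of_real (max 0 (1 - ln (real n) / a))) <= cmod (?c n)"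
 proof -
  have "0 <= ln (real n) / a" using a by (cases "n = 0") auto
  then have "cmod (of_real (max 0 (1 - ln (real n) / a))) <= 1" by (auto simp: max_def)
  from mult_left_mono[OF this norm_ge_zero[of "?c n"]] show ?thesis by (simp only: norm_mult mult_1_right)
 qed
 qed
 finally show ?thesis .
qed

section \<open>Smoothed prime power sums as upper bounds for log |L|\<close>

definition fejer_sum :: "(nat \<Rightarrow> complex) \<Rightarrow> real \<Rightarrow> complex \<Rightarrow> complex" where
 "fejer_sum f a s = (\<Sum>n=1..nat \<lfloor>exp a\<rfloor>. mangoldt n * f n * of_nat n powr - s * of_real (1 - ln (real n) / a))"

text \<open>The square is chosen because the T-derivative of (1 - ln n / T)^2 / ln n is (2/T^2)(1 -
  ln n / T): differentiating in T returns \<open>fejer_sum\<close>, for which a one-sided bound is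
  available.\<close>

definition smoothed_log_sum :: "(nat \<Rightarrow> complex) \<Rightarrow> real \<Rightarrow> complex \<Rightarrow> complex" where
 "smoothed_log_sum f T s = (\<Sum>n=1..nat \<lfloor>exp T\<rfloor>.
  mangoldt n / of_real (ln (real n)) * f n * of_nat n powr - s * of_real ((1 - ln (real n) / T)^2))"

text \<open>With the positive part in the weight, the range of summation no longer depends on T, so
  the sum can be differentiated in T; the square is differentiable across the cutoff as
  well.\<close>

lemma cutoff_sum_eq:
 fixes g :: "nat \<Rightarrow> complex"
 assumes T: "T > 0" and m: "m >= nat \<lfloor>exp T\<rfloor>" and k: "k > 0"
 shows "(\<Sum>n=1..nat \<lfloor>exp T\<rfloor>. g n * of_real ((1 - ln (real n) / T) ^ k)) =
   (\<Sum>n=1..m. g n * of_real (max 0 (1 - ln (real n) / T) ^ k))"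
proof (rule sum.mono_neutral_cong_left)
 show "\<forall>n\<in>{1..m} - {1..nat \<lfloor>exp T\<rfloor>}. g n * of_real (max 0 (1 - ln (real n) / T) ^ k) = 0"
 proof
 fix n assume n: "n \<in> {1..m} - {1..nat \<lfloor>exp T\<rfloor>}"
 have "exp T < real n"
 proof (rule ccontr)
  assume "\<not> exp T < real n"
  then have "n <= nat \<lfloor>exp T\<rfloor>" by (intro le_nat_floor) simp
  then show False using n by auto
 qed
 then have "T < ln (real n)" using n by (subst ln_exp[symmetric], subst ln_less_cancel_iff) auto
 then have "1 - ln (real n) / T < 0" using T by (simp add: field_simps)
 then show "g n * of_real (max 0 (1 - ln (real n) / T) ^ k) = 0" using k by (simp add: max_def)
 qed
 fix n assume n: "n \<in> {1..nat \<lfloor>exp T\<rfloor>}"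
 then have "n <= nat \<lfloor>exp T\<rfloor>" by simp
 then have "real n <= real (nat \<lfloor>exp T\<rfloor>)" by (simp only: of_nat_le_iff)
 also have "... <= exp T" by (intro of_nat_floor) simp
 finally have "ln (real n) <= T" using n by (subst ln_exp[symmetric], subst ln_le_cancel_iff) auto
 then have "0 <= 1 - ln (real n) / T" using T by (simp add: field_simps)
 then show "g n * of_real ((1 - ln (real n) / T) ^ k) = g n * of_real (max 0 (1 - ln (real n) / T) ^ k)"
 by (simp add: max_def)
qed (use m in auto)

lemma cutoff_sum_suminf:
 fixes g :: "nat \<Rightarrow> complex"
 assumes T: "T > 0" and k: "k > 0" and g0: "g 0 = 0"
 shows "(\<Sum>n. g n * of_real (max 0 (1 - ln (real n) / T) ^ k)) =
  (\<Sum>n=1..nat \<lfloor>exp T\<rfloor>. g n * of_real ((1 - ln (real n) / T) ^ k))"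
 and "summable (%n. g n * complex_of_real (max 0 (1 - ln (real n) / T) ^ k))"
proof -
 have z: "g n * complex_of_real (max 0 (1 - ln (real n) / T) ^ k) = 0" if "n \<notin> {1..nat \<lfloor>exp T\<rfloor>}" for n
 proof (cases "n = 0")
 case False
 have "exp T < real n"
 proof (rule ccontr)
  assume "\<not> exp T < real n"
  then have "n <= nat \<lfloor>exp T\<rfloor>" by (intro le_nat_floor) simp
  then show False using that False by auto
 qed
 then have "T < ln (real n)" using False by (subst ln_exp[symmetric], subst ln_less_cancel_iff) auto
 then have "1 - ln (real n) / T < 0" using T by (simp add: field_simps)
 then show ?thesis using k by (simp add: max_def)
 qed (use g0 in simp)
 show "summable (%n. g n * complex_of_real (max 0 (1 - ln (real n) / T) ^ k))"
 by (rule summable_finite[of "{1..nat \<lfloor>exp T\<rfloor>}"]) (use z in auto)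
 have "(\<Sum>n. g n * of_real (max 0 (1 - ln (real n) / T) ^ k)) =
  (\<Sum>n=1..nat \<lfloor>exp T\<rfloor>. g n * of_real (max 0 (1 - ln (real n) / T) ^ k))"
 by (rule suminf_finite) (use z in auto)
 then show "(\<Sum>n. g n * of_real (max 0 (1 - ln (real n) / T) ^ k)) =
  (\<Sum>n=1..nat \<lfloor>exp T\<rfloor>. g n * of_real ((1 - ln (real n) / T) ^ k))"
 using cutoff_sum_eq[OF T order_refl k] by simp
qed

lemma has_real_derivative_max_0_square: "((%x. (max 0 x)^2) has_real_derivative 2 * max 0 x) (at (x::real))"
proof (cases x "0::real" rule: linorder_cases)
 case less
 have "((%x. 0) has_real_derivative 0) (at x)" by simp
 then have "((%x. (max 0 x)^2) has_real_derivative 0) (at x)"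
 by (rule has_field_derivative_transform_within_open[where S = "{..<0}"]) (use less in auto)
 then show ?thesis using less by simp
next
 case equal
 have "((%h. (max 0 h)^2 / h) \<longlongrightarrow> (0::real)) (at 0)"
 proof (rule Lim_null_comparison[where g = "%h. \<bar>h\<bar>"])
 show "\<forall>\<^sub>F h in at 0. norm ((max 0 h)^2 / h) <= \<bar>h\<bar>"
  by (intro always_eventually allI) (auto simp: max_def power2_eq_square)
 show "((%h. \<bar>h\<bar>) \<longlongrightarrow> (0::real)) (at 0)" by (intro tendsto_rabs_zero tendsto_ident_at)
 qed
 then show ?thesis unfolding equal DERIV_def by simp
next
 case greater
 have "((%x. x^2) has_real_derivative 2 * x) (at x)" by (auto intro!: derivative_eq_intros)
 then have "((%x. (max 0 x)^2) has_real_derivative 2 * x) (at x)"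
 by (rule has_field_derivative_transform_within_open[where S = "{0<..}"]) (use greater in auto)
 then show ?thesis using greater by simp
qed

lemma smoothed_log_sum_derivative:
 assumes T: "T > 0" and m: "m >= nat \<lfloor>exp T\<rfloor>"
 shows "((%T. \<Sum>n=1..m. mangoldt n / of_real (ln (real n)) * f n * of_nat n powr - s * of_real (max 0 (1 - ln (real n) / T)^2))
  has_vector_derivative (2 / T^2) *\<^sub>R fejer_sum f T s) (at T)"
proof -
 let ?g = "%n. mangoldt n / of_real (ln (real n)) * f n * of_nat n powr - s"
 have D: "((%T. ?g n * of_real (max 0 (1 - ln (real n) / T)^2)) has_vector_derivative
  ?g n * of_real (2 * max 0 (1 - ln (real n) / T)*(ln (real n) / T^2))) (at T)" for n
 proof -
 have *: "((%T. 1 - ln (real n) / T) has_real_derivative (ln (real n) / T^2)) (at T)"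
  using T by (auto intro!: derivative_eq_intros simp: power2_eq_square)
 have "((%T. complex_of_real (max 0 (1 - ln (real n) / T)^2)) has_vector_derivative
  of_real (2 * max 0 (1 - ln (real n) / T)*(ln (real n) / T^2))) (at T)"
  by (rule has_vector_derivative_of_real[OF DERIV_chain2[OF has_real_derivative_max_0_square *]])
 then show ?thesis by (rule has_vector_derivative_mult_right)
 qed
 have "fejer_sum f T s = (\<Sum>n=1..m. mangoldt n * f n * of_nat n powr - s * of_real (max 0 (1 - ln (real n) / T)))"
 unfolding fejer_sum_def using cutoff_sum_eq[OF T m zero_less_one, of "%n. mangoldt n * f n * of_nat n powr - s"] by simp
 then have "(2 / T^2) *\<^sub>R fejer_sum f T s = (\<Sum>n=1..m. ?g n * of_real (2 * max 0 (1 - ln (real n) / T)*(ln (real n) / T^2)))"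
 unfolding scaleR_conv_of_real
 proof (simp only: sum_distrib_left, intro sum.cong refl)
 fix n assume "n \<in> {1..m}"
 then consider "n = Suc 0" | "n > 1" by force
 then show "of_real (2 / T^2)*(mangoldt n * f n * of_nat n powr - s * of_real (max 0 (1 - ln (real n) / T)))
  = ?g n * of_real (2 * max 0 (1 - ln (real n) / T)*(ln (real n) / T^2))"
  by cases (simp_all add: field_simps)
 qed
 moreover have "((%T. \<Sum>n=1..m. ?g n * of_real (max 0 (1 - ln (real n) / T)^2)) has_vector_derivative
  (\<Sum>n=1..m. ?g n * of_real (2 * max 0 (1 - ln (real n) / T)*(ln (real n) / T^2)))) (at T)"
 by (intro has_vector_derivative_sum D)
 ultimately show ?thesis by simp
qed

lemma smoothed_log_sum_eq:
 assumes "T > 0" "m >= nat \<lfloor>exp T\<rfloor>"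
 shows "smoothed_log_sum f T s =
 (\<Sum>n=1..m. mangoldt n / of_real (ln (real n)) * f n * of_nat n powr - s * of_real (max 0 (1 - ln (real n) / T)^2))"
 unfolding smoothed_log_sum_def
 using cutoff_sum_eq[OF assms, of 2 "%n. mangoldt n / of_real (ln (real n)) * f n * of_nat n powr - s"] by simp

lemma nat_floor_exp_mono: "a <= b ==> nat \<lfloor>exp a\<rfloor> <= nat \<lfloor>exp (b::real)\<rfloor>"
 by (intro nat_mono floor_mono) simp

text \<open>The bound for \<open>fejer_sum\<close> says that Re of the smoothed sum plus 2B/T is
  nonincreasing in T. So an upper bound at T passes to all larger N, and to the limit, at the price
  2B/T.\<close>

lemma Re_smoothed_log_sum_mono:
 assumes B: "\<And>a. a >= 1 ==> Re (fejer_sum f a s) <= B" and T: "1 <= T" "T <= N"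
 shows "Re (smoothed_log_sum f N s) <= Re (smoothed_log_sum f T s) + 2 * B / T - 2 * B / N"
proof -
 define m where "m = nat \<lfloor>exp N\<rfloor>"
 define p where "p = (%T. \<Sum>n=1..m. mangoldt n / of_real (ln (real n)) * f n * of_nat n powr - s * of_real (max 0 (1 - ln (real n) / T)^2))"
 have p: "smoothed_log_sum f T s = p T" if "T > 0" "T <= N" for T
 unfolding p_def by (rule smoothed_log_sum_eq) (use that nat_floor_exp_mono in \<open>auto simp: m_def\<close>)
 have "Re (p N) + 2 * B / N <= Re (p T) + 2 * B / T"
 proof (rule DERIV_nonpos_imp_nonincreasing[of T N "%x. Re (p x) + 2 * B / x"])
 fix x assume x: "T <= x" "x <= N"
 then have x0: "x > 0" using T by simp
 have "(p has_vector_derivative (2 / x^2) *\<^sub>R fejer_sum f x s) (at x)"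
  unfolding p_def by (rule smoothed_log_sum_derivative[OF x0]) (use x nat_floor_exp_mono in \<open>auto simp: m_def\<close>)
 then have "((%x. Re (p x)) has_vector_derivative Re ((2 / x^2) *\<^sub>R fejer_sum f x s)) (at x)"
  by (rule bounded_linear.has_vector_derivative[OF bounded_linear_Re])
 then have "((%x. Re (p x)) has_real_derivative 2 / x^2 * Re (fejer_sum f x s)) (at x)"
  by (simp add: has_real_derivative_iff_has_vector_derivative)
 moreover have "((%x. 2 * B / x) has_real_derivative - (2 / x^2 * B)) (at x)"
  using x0 by (auto intro!: derivative_eq_intros simp: power2_eq_square)
 ultimately have "((%x. Re (p x) + 2 * B / x) has_real_derivative 2 / x^2 * Re (fejer_sum f x s) + - (2 / x^2 * B)) (at x)"
  by (rule DERIV_add)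
 moreover have "2 / x^2 * Re (fejer_sum f x s) <= 2 / x^2 * B" using x T by (intro mult_left_mono B) auto
 ultimately show "\<exists>y. ((%x. Re (p x) + 2 * B / x) has_real_derivative y) (at x) & y <= 0"
  by (intro exI conjI) auto
 qed (use T in auto)
 then show ?thesis using p[of T] p[of N] T by simp
qed

text \<open>The two-sided analogue. Its constant deteriorates at the critical line, so it serves for
  the existence and holomorphy of the limit rather than for the final inequality.\<close>

lemma norm_smoothed_log_sum_diff_le:
 assumes K: "\<And>a. a >= 1 ==> cmod (fejer_sum f a s) <= K" and T: "1 <= T" "T <= N"
 shows "cmod (smoothed_log_sum f N s - smoothed_log_sum f T s) <= 2 * K / T"
proof (cases "T = N")
 case True
 have "K >= 0" using K[of 1] norm_ge_zero[of "fejer_sum f 1 s"] by linarith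
 then show ?thesis using True T by simp
next
 case False
 have K0: "K >= 0" using K[of 1] norm_ge_zero[of "fejer_sum f 1 s"] by linarith
 define m where "m = nat \<lfloor>exp N\<rfloor>"
 define p where "p = (%T. \<Sum>n=1..m. mangoldt n / of_real (ln (real n)) * f n * of_nat n powr - s * of_real (max 0 (1 - ln (real n) / T)^2))"
 have p: "smoothed_log_sum f T s = p T" if "T > 0" "T <= N" for T
 unfolding p_def by (rule smoothed_log_sum_eq) (use that nat_floor_exp_mono in \<open>auto simp: m_def\<close>)
 have der: "(p has_vector_derivative (2 / x^2) *\<^sub>R fejer_sum f x s) (at x)" if "T <= x" "x <= N" for x
 unfolding p_def by (rule smoothed_log_sum_derivative) (use that T nat_floor_exp_mono in \<open>auto simp: m_def\<close>)
 have "cmod (p N - p T) <= - (2 * K / N) - (- (2 * K / T))"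
 proof (rule differentiable_bound_general[where \<phi> = "%x. - (2 * K / x)" and \<phi>' = "%x. 2 / x^2 * K"])
 show "continuous_on {T..N} p"
  using der by (intro continuous_at_imp_continuous_on ballI has_vector_derivative_continuous) auto
 show "continuous_on {T..N} (%x. - (2 * K / x))" using T by (intro continuous_intros) auto
 fix x assume x: "T < x" "x < N"
 show "(p has_vector_derivative (2 / x^2) *\<^sub>R fejer_sum f x s) (at x)" by (rule der) (use x in auto)
 have "((%x. - (2 * K / x)) has_real_derivative 2 / x^2 * K) (at x)"
  using x T by (auto intro!: derivative_eq_intros simp: power2_eq_square)
 then show "((%x. - (2 * K / x)) has_vector_derivative 2 / x^2 * K) (at x)"
  by (simp add: has_real_derivative_iff_has_vector_derivative)
 have "norm ((2 / x^2) *\<^sub>R fejer_sum f x s) = 2 / x^2 * cmod (fejer_sum f x s)" by simp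
 also have "... <= 2 / x^2 * K" using x T by (intro mult_left_mono K) auto
 finally show "norm ((2 / x^2) *\<^sub>R fejer_sum f x s) <= 2 / x^2 * K" .
 qed (use T False in auto)
 also have "... <= 2 * K / T" using K0 T by simp
 finally show ?thesis using p[of T] p[of N] T by simp
qed

lemma smoothed_log_sum_tendsto_log_series:
 assumes f: "\<And>n. cmod (f n) <= 1" and s: "Re s > 1"
 shows "(%k. smoothed_log_sum f (real (Suc k)) s) \<longlonglongrightarrow> log_series f s"
proof (rule LIM_zero_cancel, rule Lim_null_comparison)
 let ?g = "%n. mangoldt n / of_real (ln (real n)) * f n * of_nat n powr - s"
 define Z where "Z = (\<Sum>n. cmod (mangoldt n * f n * of_nat n powr - s))"
 have sZ: "summable (%n. cmod (mangoldt n * f n * of_nat n powr - s))"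
 by (rule summable_dirichlet_series_ln_norm[OF norm_mangoldt_coeff_le[OF f] s]) simp
 have sg: "summable ?g"
 by (rule summable_norm_cancel, rule summable_dirichlet_series_norm[OF norm_log_coeff_le[where f = f, OF f] s])
 show "\<forall>\<^sub>F k in sequentially. cmod (smoothed_log_sum f (real (Suc k)) s - log_series f s) <= 2 * Z * inverse (real (Suc k))"
 proof (intro always_eventually allI)
 fix k
 let ?T = "real (Suc k)"
 note c = cutoff_sum_suminf[of ?T 2 ?g]
 have "smoothed_log_sum f ?T s - log_series f s = (\<Sum>n. ?g n * of_real (max 0 (1 - ln (real n) / ?T)^2)) - (\<Sum>n. ?g n)"
  using c(1) by (simp add: smoothed_log_sum_def log_series_def dirichlet_series_def)
 also have "... = (\<Sum>n. ?g n * of_real (max 0 (1 - ln (real n) / ?T)^2) - ?g n)"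
  using c(2) sg by (intro suminf_diff) auto
 also have "cmod ... <= (\<Sum>n. 2 * inverse ?T * cmod (mangoldt n * f n * of_nat n powr - s))"
 proof (rule norm_suminf_le)
  fix n :: nat
  consider "n = 0" | "n = Suc 0" | "n > 1" by linarith
  then show "cmod (?g n * of_real (max 0 (1 - ln (real n) / ?T)^2) - ?g n)
   <= 2 * inverse ?T * cmod (mangoldt n * f n * of_nat n powr - s)"
  proof cases
  case 3
  define x where "x = ln (real n) / ?T"
  have x: "x > 0" using 3 by (simp add: x_def)
  have "(max 0 (1 - x))^2 <= 1" using x by (auto simp: max_def power_le_one)
  moreover have "1 - (max 0 (1 - x))^2 <= 2 * x"
   using x zero_le_power2[of x] by (auto simp: max_def power2_eq_square algebra_simps)
  ultimately have le: "\<bar>(max 0 (1 - x))^2 - 1\<bar> <= 2 * x" by simp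
  have "?g n * of_real ((max 0 (1 - x))^2) - ?g n = ?g n * of_real ((max 0 (1 - x))^2 - 1)"
   by (simp only: of_real_diff of_real_1 right_diff_distrib mult_1_right)
  then have "cmod (?g n * of_real ((max 0 (1 - x))^2) - ?g n) = cmod (?g n)*\<bar>(max 0 (1 - x))^2 - 1\<bar>"
   by (simp only: norm_mult norm_of_real)
  also have "... <= cmod (?g n)*(2 * x)" using le by (intro mult_left_mono) auto
  also have "... = 2 * inverse ?T*(cmod (?g n) * ln (real n))"
   by (simp only: x_def divide_inverse mult_ac)
  also have "cmod (?g n) * ln (real n) = cmod (mangoldt n * f n * of_nat n powr - s)"
   using 3 by (simp add: norm_mult norm_divide)
  finally show ?thesis by (simp only: x_def)
  qed auto
 qed (intro summable_mult sZ)
 also have "... = 2 * inverse ?T * Z" unfolding Z_def by (intro suminf_mult sZ)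
 finally show "cmod (smoothed_log_sum f ?T s - log_series f s) <= 2 * Z * inverse ?T" by (simp only: mult_ac)
 qed
 show "(%k. 2 * Z * inverse (real (Suc k))) \<longlonglongrightarrow> 0"
 by (rule tendsto_mult_right_zero[OF LIMSEQ_inverse_real_of_nat])
qed

text \<open>Moving the height by v/a costs at most ln(1 + |v|), which is exchanged for 2(1 +
  |v|)^(1/2), a growth that the kernel can absorb.\<close>

lemma ln_height_shift_le:
 assumes d: "D >= (1::real)" and a: "a >= 1"
 shows "ln (D*(2 + \<bar>t + v / a\<bar>)) <= ln (D*(2 + \<bar>t\<bar>)) + 2*(1 + \<bar>v\<bar>) powr (1/2)"
proof -
 have "\<bar>v / a\<bar> <= \<bar>v\<bar>" using a by (simp add: abs_divide divide_le_eq mult_le_cancel_left1)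
 moreover have "(2 + \<bar>t\<bar>)*(1 + \<bar>v\<bar>) = 2 + \<bar>t\<bar> + 2*\<bar>v\<bar> + \<bar>t\<bar>*\<bar>v\<bar>" by (simp add: algebra_simps)
 moreover have "\<bar>t\<bar>*\<bar>v\<bar> >= 0" "\<bar>v\<bar> >= 0" by simp_all
 ultimately have "2 + \<bar>t + v / a\<bar> <= (2 + \<bar>t\<bar>)*(1 + \<bar>v\<bar>)"
 using abs_triangle_ineq[of t "v / a"] by linarith
 then have "D*(2 + \<bar>t + v / a\<bar>) <= D*((2 + \<bar>t\<bar>)*(1 + \<bar>v\<bar>))" using d by (intro mult_left_mono) auto
 then have "ln (D*(2 + \<bar>t + v / a\<bar>)) <= ln (D*(2 + \<bar>t\<bar>)*(1 + \<bar>v\<bar>))"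
 using d by (subst ln_le_cancel_iff) (auto intro!: mult_pos_pos add_pos_nonneg simp: mult.assoc)
 also have "... = ln (D*(2 + \<bar>t\<bar>)) + ln (1 + \<bar>v\<bar>)"
 using d by (subst ln_mult) (auto simp: add_pos_nonneg)
 also have "ln (1 + \<bar>v\<bar>) <= (1 + \<bar>v\<bar>) powr (1/2)/(1/2)" by (intro ln_powr_bound) auto
 finally show ?thesis by simp
qed

lemma holomorphic_logderiv_Dirichlet_L:
 assumes d: "fundamental_discriminant d" "GRH_for d" "d \<noteq> 1"
 shows "(%s. deriv (Dirichlet_L d) s / Dirichlet_L d s) holomorphic_on {s. Re s > 1/2}"
proof -
 have hol: "Dirichlet_L d holomorphic_on UNIV"
 using holomorphic_Dirichlet_L[OF d(1)] d(3) by (simp add: L_domain_def)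
 show ?thesis
 by (intro holomorphic_intros holomorphic_deriv holomorphic_on_subset[OF hol] open_halfspace_Re_gt)
  (use Dirichlet_L_nonzero_GRH[OF d(1,2)] d(3) in auto)
qed

text \<open>Both sides are holomorphic in the strip, and for \<open>Re s > 1\<close> the identity is the Fourier transform
  of the Fejer kernel applied termwise.\<close>
lemma fejer_sum_eq_integral:
 assumes d: "fundamental_discriminant d" "GRH_for d" "d \<noteq> 1" and a: "a >= 1" and s: "1/2 < Re s" "Re s < 2"
 and C: "\<And>s. 1/2 < Re s ==> Re s <= 2 ==> cmod (deriv (Dirichlet_L d) s / Dirichlet_L d s)
  <= C * ln (\<bar>real_of_int d\<bar>*(2 + \<bar>Im s\<bar>))*(1 + 1/(Re s - 1/2))"
 defines "G \<equiv> %s. deriv (Dirichlet_L d) s / Dirichlet_L d s"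
 shows "(%v. G (s + \<i> * of_real (v / a))) \<in> borel_measurable borel"
 and "\<And>v. cmod (G (s + \<i> * of_real (v / a))) \<le>
  C*(1 + 1/(Re s - 1/2))*(ln (\<bar>real_of_int d\<bar>*(2 + \<bar>Im s\<bar>)) + 2*(1 + \<bar>v\<bar>) powr (1/2))"
 and "(\<integral>v. of_real (fejer v) * G (s + \<i> * of_real (v / a)) \<partial>lborel) = - of_real fejer_mass * fejer_sum (chi d) a s"
proof -
 let ?H = "{s. Re s > 1/2}" and ?U = "{s. 1/2 < Re s & Re s < 2}"
 define D where "D = \<bar>real_of_int d\<bar>"
 have D: "D >= 1" unfolding D_def by (rule abs_fundamental_discriminant_ge_1[OF d(1)])
 have holG: "G holomorphic_on ?H" unfolding G_def by (rule holomorphic_logderiv_Dirichlet_L[OF d])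
 have openH: "open ?H" by (rule open_halfspace_Re_gt)
 have contG: "continuous_on ?H G" by (rule holomorphic_on_imp_continuous_on[OF holG])
 have "0 <= C * ln (D*(2 + 0))*(1 + 1/(1 - 1/2))"
 using order_trans[OF norm_ge_zero C[of 1]] by (simp add: D_def)
 moreover have "ln (D*(2 + 0)) > 0" using D by (intro ln_gt_zero) auto
 ultimately have C0: "C >= 0" by (simp add: zero_le_mult_iff)
 have vert: "s + \<i> * of_real (v / a) \<in> ?H" if "Re s > 1/2" for s v using that by simp
 have meas: "(%v. G (s + \<i> * of_real (v / a))) \<in> borel_measurable borel" if "Re s > 1/2" for s
 by (intro borel_measurable_continuous_onI continuous_on_compose2[OF contG] continuous_intros) (use that a in auto)
 have bound: "cmod (G (s + \<i> * of_real (v / a))) \<le>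
  C*(1 + 1/(Re s - 1/2))*(ln (D*(2 + \<bar>Im s\<bar>)) + 2*(1 + \<bar>v\<bar>) powr (1/2))" if "1/2 < Re s" "Re s < 2" for s v
 proof -
 have "cmod (G (s + \<i> * of_real (v / a))) <= C * ln (D*(2 + \<bar>Im s + v / a\<bar>))*(1 + 1/(Re s - 1/2))"
  using C[of "s + \<i> * of_real (v / a)"] that by (simp add: G_def D_def)
 also have "... <= C*(ln (D*(2 + \<bar>Im s\<bar>)) + 2*(1 + \<bar>v\<bar>) powr (1/2))*(1 + 1/(Re s - 1/2))"
  using ln_height_shift_le[OF D a, of "Im s" v] C0 that by (intro mult_right_mono mult_left_mono) auto
 finally show ?thesis by (simp add: mult_ac)
 qed
 show "(%v. G (s + \<i> * of_real (v / a))) \<in> borel_measurable borel" by (rule meas[OF s(1)])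
 show "cmod (G (s + \<i> * of_real (v / a))) \<le>
  C*(1 + 1/(Re s - 1/2))*(ln (\<bar>real_of_int d\<bar>*(2 + \<bar>Im s\<bar>)) + 2*(1 + \<bar>v\<bar>) powr (1/2))" for v
 using bound[OF s] by (simp add: D_def)
 define J where "J = (%s. \<integral>v. of_real (fejer v) * G (s + \<i> * of_real (v / a)) \<partial>lborel)"
 define m where "m = (%v::real. (1 + \<bar>v\<bar>) powr (- 3/2))"
 have im: "integrable lborel m" unfolding m_def by (rule integrable_tail_weight)
 \<comment> \<open>The mass of the majorant outside [-N, N]. It bounds the error of truncating the
   integral uniformly near a point, so the full integral is a locally uniform limit of holomorphic
   functions.\<close>
 define tail where "tail = (%N::nat. \<integral>v. indicator (- {- real N..real N}) v * m v \<partial>lborel)"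
 have tail0: "tail \<longlonglongrightarrow> 0"
 proof -
 have "tail \<longlonglongrightarrow> integral\<^sup>L lborel (%v::real. 0::real)"
  unfolding tail_def
 proof (rule integral_dominated_convergence[where w = m and M = lborel and f = "%_. 0"
   and s = "%N v. indicator (- {- real N..real N}) v * m v"])
  show "AE v in lborel. (%N. indicator (- {- real N..real N}) v * m v) \<longlonglongrightarrow> 0"
  proof (rule AE_I2)
  fix v
  obtain N0 :: nat where N0: "\<bar>v\<bar> <= real N0" using real_arch_simple by blast
  show "(%N. indicator (- {- real N..real N}) v * m v) \<longlonglongrightarrow> 0"
   by (rule tendsto_eventually, rule eventually_sequentiallyI[of N0]) (use N0 in \<open>auto simp: indicator_def\<close>)
  qed
  show "AE v in lborel. norm (indicator (- {- real N..real N}) v * m v) <= m v" for N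
  by (intro AE_I2) (auto simp: indicator_def m_def)
 qed (use im in \<open>auto simp: m_def\<close>)
 then show ?thesis by simp
 qed
 have "J holomorphic_on ?U"
 proof (rule holomorphic_uniform_sequence)
 have openU: "open ?U" by (intro open_Collect_conj open_halfspace_Re_gt open_halfspace_Re_lt)
 show "open ?U" by (rule openU)
 show "(%x. integral (cbox (- real N) (real N)) (%v. of_real (fejer v) * G (x + \<i> * of_real (v / a)))) holomorphic_on ?U" for N
 proof (rule leibniz_rule_holomorphic[where fx = "%x v. of_real (fejer v) * deriv G (x + \<i> * of_real (v / a))"])
  fix x v assume x: "x \<in> ?U"
  have "(G has_field_derivative deriv G (x + \<i> * of_real (v / a))) (at (x + \<i> * of_real (v / a)))"
  by (rule holomorphic_derivI[OF holG openH vert]) (use x in auto)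
  moreover have "((%x. x + \<i> * of_real (v / a)) has_field_derivative 1 + 0) (at x)" by (intro derivative_intros)
  ultimately have "((%x. G (x + \<i> * of_real (v / a))) has_field_derivative deriv G (x + \<i> * of_real (v / a))*(1 + 0)) (at x)"
  by (rule DERIV_chain2)
  then have "((%x. of_real (fejer v) * G (x + \<i> * of_real (v / a))) has_field_derivative
   of_real (fejer v)*(deriv G (x + \<i> * of_real (v / a))*(1 + 0))) (at x)" by (rule DERIV_cmult)
  then show "((%x. of_real (fejer v) * G (x + \<i> * of_real (v / a))) has_field_derivative
   of_real (fejer v) * deriv G (x + \<i> * of_real (v / a))) (at x within ?U)"
  by (simp add: has_field_derivative_at_within)
 next
  fix x assume x: "x \<in> ?U"
  show "(%v. of_real (fejer v) * G (x + \<i> * of_real (v / a))) integrable_on cbox (- real N) (real N)"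
  by (intro integrable_continuous continuous_intros continuous_on_compose2[OF contG]) (use x a in auto)
 next
  have "continuous_on ?H (deriv G)"
  by (intro holomorphic_on_imp_continuous_on holomorphic_deriv holG openH)
  moreover have "continuous_on (?U \<times> cbox (- real N) (real N)) (%p. fst p + \<i> * of_real (snd p / a))"
  by (intro continuous_intros) (use a in auto)
  ultimately have "continuous_on (?U \<times> cbox (- real N) (real N)) (%p. deriv G (fst p + \<i> * of_real (snd p / a)))"
  by (rule continuous_on_compose2) auto
  moreover have "continuous_on (?U \<times> cbox (- real N) (real N)) (%p. complex_of_real (fejer (snd p)))"
  by (intro continuous_intros)
  ultimately show "continuous_on (?U \<times> cbox (- real N) (real N)) (%(x, v). of_real (fejer v) * deriv G (x + \<i> * of_real (v / a)))"
  unfolding case_prod_unfold by (intro continuous_on_mult)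
 next
  have "?U = {s. Re s > 1/2} \<inter> {s. Re s < 2}" by auto
  then show "convex ?U" by (simp only:) (intro convex_Int convex_halfspace_Re_gt convex_halfspace_Re_lt)
 qed
 fix s0 assume "s0 \<in> ?U"
 then obtain r where r: "r > 0" "cball s0 r \<subseteq> ?U" using openU open_contains_cball by blast
 define \<delta> where "\<delta> = Re s0 - r - 1/2"
 have "s0 - of_real r \<in> cball s0 r" using r by (simp add: dist_norm)
 then have "s0 - of_real r \<in> ?U" using r by blast
 then have \<delta>: "\<delta> > 0" by (simp add: \<delta>_def)
 define K where "K = C*(1 + 1 / \<delta>)*(ln (D*(2 + (\<bar>Im s0\<bar> + r))) + 2)"
 have "1*1 <= D*(2 + (\<bar>Im s0\<bar> + r))" using D r by (intro mult_mono) auto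
 then have lnpos: "ln (D*(2 + (\<bar>Im s0\<bar> + r))) >= 0" by simp
 have K0: "K >= 0" unfolding K_def using C0 \<delta> lnpos by (intro mult_nonneg_nonneg) auto
 have bK: "cmod (G (x + \<i> * of_real (v / a))) <= K*(1 + \<bar>v\<bar>) powr (1/2)" if x: "x \<in> cball s0 r" for x v
 proof -
  have xU: "1/2 < Re x" "Re x < 2" using x r by auto
  have R: "Re x - 1/2 >= \<delta>" using x abs_Re_le_cmod[of "s0 - x"] by (simp add: \<delta>_def dist_norm)
  have I: "\<bar>Im x\<bar> <= \<bar>Im s0\<bar> + r" using x abs_Im_le_cmod[of "s0 - x"] by (simp add: dist_norm)
  have "ln (D*(2 + \<bar>Im x\<bar>)) <= ln (D*(2 + (\<bar>Im s0\<bar> + r)))"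
  using I D by (subst ln_le_cancel_iff) (auto intro!: mult_left_mono mult_pos_pos add_pos_nonneg)
  moreover have p1: "1 <= (1 + \<bar>v\<bar>) powr (1/2)" by (intro ge_one_powr_ge_zero) auto
  ultimately have "ln (D*(2 + \<bar>Im x\<bar>)) + 2*(1 + \<bar>v\<bar>) powr (1/2) <= (ln (D*(2 + (\<bar>Im s0\<bar> + r))) + 2)*(1 + \<bar>v\<bar>) powr (1/2)"
  using mult_left_mono[OF p1 lnpos] by (simp add: algebra_simps)
  moreover have "1 + 1/(Re x - 1/2) <= 1 + 1 / \<delta>" using R \<delta> by (intro add_left_mono divide_left_mono) auto
  ultimately have "C*(1 + 1/(Re x - 1/2))*(ln (D*(2 + \<bar>Im x\<bar>)) + 2*(1 + \<bar>v\<bar>) powr (1/2)) \<le>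
  C*(1 + 1 / \<delta>)*((ln (D*(2 + (\<bar>Im s0\<bar> + r))) + 2)*(1 + \<bar>v\<bar>) powr (1/2))"
  using C0 \<delta> xU ln_discriminant_height_ge[OF d(1), of "Im x"]
  by (intro mult_mono mult_nonneg_nonneg) (auto simp: D_def intro!: add_nonneg_nonneg order_trans[OF _ ln_discriminant_height_ge[OF d(1)]])
  then show ?thesis using bound[OF xU, of v] by (simp add: K_def mult_ac)
 qed
 have "uniform_limit (cball s0 r) (%N x. integral (cbox (- real N) (real N)) (%v. of_real (fejer v) * G (x + \<i> * of_real (v / a)))) J sequentially"
 proof (rule uniform_limitI)
  fix e :: real assume e: "e > 0"
  have "(%N. 8 * K * tail N) \<longlonglongrightarrow> 8 * K*0" by (intro tendsto_intros tail0)
  then have "\<forall>\<^sub>F N in sequentially. 8 * K * tail N < e" using e by (auto dest: order_tendstoD(2))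
  then show "\<forall>\<^sub>F N in sequentially. \<forall>x\<in>cball s0 r.
   dist (integral (cbox (- real N) (real N)) (%v. of_real (fejer v) * G (x + \<i> * of_real (v / a)))) (J x) < e"
  proof eventually_elim
  case (elim N)
  show ?case
  proof
   fix x assume x: "x \<in> cball s0 r"
   then have x2: "Re x > 1/2" using r by auto
   define h where "h = (%v. of_real (fejer v) * G (x + \<i> * of_real (v / a)))"
   let ?I = "{- real N..real N}"
   have ih: "integrable lborel h" unfolding h_def
   using integrable_fejer_bounded[OF meas[OF x2] bK[OF x]] by (simp add: scaleR_conv_of_real)
   have si: "set_integrable lborel ?I h" unfolding set_integrable_def
   by (intro integrable_mult_indicator ih) auto
   have "integral (cbox (- real N) (real N)) h = (\<integral>v. indicator ?I v *\<^sub>R h v \<partial>lborel)"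
   using set_borel_integral_eq_integral(2)[OF si] by (simp add: set_lebesgue_integral_def)
   moreover have "J x = (\<integral>v. h v \<partial>lborel)" by (simp add: J_def h_def)
   ultimately have "J x - integral (cbox (- real N) (real N)) h = (\<integral>v. h v - indicator ?I v *\<^sub>R h v \<partial>lborel)"
   using ih si by (simp add: set_integrable_def)
   also have "(%v. h v - indicator ?I v *\<^sub>R h v) = (%v. indicator (- ?I) v *\<^sub>R h v)"
   by (auto simp: indicator_def)
   finally have "cmod (J x - integral (cbox (- real N) (real N)) h) = cmod (\<integral>v. indicator (- ?I) v *\<^sub>R h v \<partial>lborel)"
   by simp
   also have "... <= (\<integral>v. 8 * K*(indicator (- ?I) v * m v) \<partial>lborel)"
   proof (rule Bochner_Integration.integral_norm_bound_integral)
   show "integrable lborel (%v. indicator (- ?I) v *\<^sub>R h v)" by (intro integrable_mult_indicator ih) auto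
   have "integrable lborel (%v. indicator (- ?I) v *\<^sub>R m v)" by (intro integrable_mult_indicator im) auto
   then show "integrable lborel (%v. 8 * K*(indicator (- ?I) v * m v))" by (intro integrable_mult_right) simp
   fix v
   have "cmod (h v) = fejer v * cmod (G (x + \<i> * of_real (v / a)))" by (simp add: h_def norm_mult fejer_nonneg)
   also have "... <= fejer v * (K*(1 + \<bar>v\<bar>) powr (1/2))" by (intro mult_left_mono bK[OF x] fejer_nonneg)
   also have "... = K*(fejer v * (1 + \<bar>v\<bar>) powr (1/2))" by simp
   also have "... <= K*(8 * m v)" unfolding m_def by (intro mult_left_mono fejer_weight_le K0)
   finally show "norm (indicator (- ?I) v *\<^sub>R h v) <= 8 * K*(indicator (- ?I) v * m v)"
    by (simp add: indicator_def)
   qed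
   also have "... = 8 * K * tail N" by (simp add: tail_def)
   also have "... < e" by (rule elim)
   finally show "dist (integral (cbox (- real N) (real N)) (%v. of_real (fejer v) * G (x + \<i> * of_real (v / a)))) (J x) < e"
   by (simp add: dist_norm norm_minus_commute h_def)
  qed
  qed
 qed
 then show "\<exists>d>0. cball s0 d \<subseteq> ?U & uniform_limit (cball s0 d) (%N x. integral (cbox (- real N) (real N)) (%v. of_real (fejer v) * G (x + \<i> * of_real (v / a)))) J sequentially"
  using r by blast
 qed
 moreover have "(%s. - of_real fejer_mass * fejer_sum (chi d) a s) holomorphic_on ?U"
 unfolding fejer_sum_def by (intro holomorphic_intros) auto
 moreover have "J x = - of_real fejer_mass * fejer_sum (chi d) a x" if "Re x > 1" for x
 proof -
 have "J x = - (\<integral>v. of_real (fejer v) * mangoldt_series (chi d) (x + \<i> * of_real (v / a)) \<partial>lborel)"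
  unfolding J_def G_def using that
  by (subst logderiv_Dirichlet_L_Re_gt_1[OF d(1)]) (simp_all add: Bochner_Integration.integral_minus)
 also have "... = - (of_real fejer_mass * fejer_sum (chi d) a x)"
  using integral_fejer_mangoldt_series[where f = "chi d", OF norm_chi_le that, of a] a
  cutoff_sum_suminf(1)[of a 1 "%n. mangoldt n * chi d n * of_nat n powr - x"]
  by (simp add: fejer_sum_def)
 finally show ?thesis by simp
 qed
 moreover have "open ?U" by (intro open_Collect_conj open_halfspace_Re_gt open_halfspace_Re_lt)
 moreover have "open {s. 1 < Re s & Re s < 2}" by (intro open_Collect_conj open_halfspace_Re_gt open_halfspace_Re_lt)
 moreover have "?U = {s. Re s > 1/2} \<inter> {s. Re s < 2}" by auto
 then have "connected ?U"
 by (simp only:) (intro convex_connected convex_Int convex_halfspace_Re_gt convex_halfspace_Re_lt)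
 moreover have "{s. 1 < Re s & Re s < 2} \<noteq> {}" by (auto intro!: exI[of _ "3/2"])
 moreover have "{s. 1 < Re s & Re s < 2} \<subseteq> ?U" by auto
 ultimately have "J s = - of_real fejer_mass * fejer_sum (chi d) a s"
 using analytic_continuation_open[of "{s. 1 < Re s & Re s < 2}" ?U J "%s. - of_real fejer_mass * fejer_sum (chi d) a s" s] s
 by auto
 then show "(\<integral>v. of_real (fejer v) * G (s + \<i> * of_real (v / a)) \<partial>lborel) = - of_real fejer_mass * fejer_sum (chi d) a s"
 by (simp only: J_def)
qed

text \<open>The sum is minus the average of L'/L, so the lower bound for Re(L'/L) turns into an
  upper bound for its real part, still uniform up to the critical line. The contribution W of the
  weight is absorbed by the logarithm, which is at least ln 2.\<close>

lemma fejer_sum_bounds: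
 "\<exists>C>0. \<forall>d s a. fundamental_discriminant d & GRH_for d & d \<noteq> 1 & 1/2 < Re s & Re s < 2 & a >= 1 -->
  Re (fejer_sum (chi d) a s) <= C * ln (\<bar>real_of_int d\<bar>*(2 + \<bar>Im s\<bar>)) \<and>
  cmod (fejer_sum (chi d) a s) <= C * ln (\<bar>real_of_int d\<bar>*(2 + \<bar>Im s\<bar>))*(1 + 1/(Re s - 1/2))"
proof -
 obtain C where C: "C > 0" "\<And>d s. fundamental_discriminant d ==> GRH_for d ==> (d \<noteq> 1 \<or> \<bar>Im s\<bar> >= 2) ==> 1/2 < Re s ==> Re s <= 2 ==>
  Re (deriv (Dirichlet_L d) s / Dirichlet_L d s) >= - C * ln (\<bar>real_of_int d\<bar>*(2 + \<bar>Im s\<bar>))"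
  "\<And>d s. fundamental_discriminant d ==> GRH_for d ==> (d \<noteq> 1 \<or> \<bar>Im s\<bar> >= 2) ==> 1/2 < Re s ==> Re s <= 2 ==>
  cmod (deriv (Dirichlet_L d) s / Dirichlet_L d s)
  <= C * ln (\<bar>real_of_int d\<bar>*(2 + \<bar>Im s\<bar>))*(1 + 1/(Re s - 1/2))"
 using logderiv_Dirichlet_L_bounds by metis
 define W where "W = (\<integral>v. fejer v * (1 + \<bar>v\<bar>) powr (1/2) \<partial>lborel)"
 have W: "W >= 0" unfolding W_def by (intro integral_nonneg_AE AE_I2 mult_nonneg_nonneg fejer_nonneg) auto
 note \<kappa> = fejer_mass_pos
 define C' where "C' = C*(1 + 2 * W/(fejer_mass * ln 2))"
 have C': "C' > 0" unfolding C'_def using C(1) W \<kappa> by (intro mult_pos_pos add_pos_nonneg divide_nonneg_pos) auto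
 have main: "Re (fejer_sum (chi d) a s) <= C' * ln (\<bar>real_of_int d\<bar>*(2 + \<bar>Im s\<bar>)) \<and>
  cmod (fejer_sum (chi d) a s) <= C' * ln (\<bar>real_of_int d\<bar>*(2 + \<bar>Im s\<bar>))*(1 + 1/(Re s - 1/2))"
 if d: "fundamental_discriminant d" "GRH_for d" "d \<noteq> 1" and s: "1/2 < Re s" "Re s < 2" and a: "a >= 1" for d s a
 proof -
 define G where "G = (%s. deriv (Dirichlet_L d) s / Dirichlet_L d s)"
 define lQ where "lQ = ln (\<bar>real_of_int d\<bar>*(2 + \<bar>Im s\<bar>))"
 have lQ: "lQ >= ln 2" unfolding lQ_def by (rule ln_discriminant_height_ge[OF d(1)])
 have E: "(%v. G (s + \<i> * of_real (v / a))) \<in> borel_measurable borel"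
  "\<And>v. cmod (G (s + \<i> * of_real (v / a))) <= C*(1 + 1/(Re s - 1/2))*(lQ + 2*(1 + \<bar>v\<bar>) powr (1/2))"
  "(\<integral>v. of_real (fejer v) * G (s + \<i> * of_real (v / a)) \<partial>lborel) = - of_real fejer_mass * fejer_sum (chi d) a s"
  unfolding G_def lQ_def by (rule fejer_sum_eq_integral[OF d a s C(3)[OF d(1,2) disjI1[OF d(3)]]]; assumption)+
 let ?h = "%v. of_real (fejer v) * G (s + \<i> * of_real (v / a))"
 let ?w = "%v. lQ + 2*(1 + \<bar>v\<bar>) powr (1/2)"
 have w: "lQ >= 0" using lQ ln_gt_zero[of 2] by linarith
 define K where "K = C*(1 + 1/(Re s - 1/2))"
 have K: "K >= 0" using C(1) s by (auto simp: K_def)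
 have iw: "integrable lborel (%v. fejer v * ?w v)"
  and intw: "(\<integral>v. fejer v * ?w v \<partial>lborel) = lQ * fejer_mass + 2 * W"
  using integrable_fejer integrable_fejer_weight
  by (simp_all add: distrib_left mult.commute[of _ lQ] mult.left_commute[of _ "2::real"] fejer_mass_def W_def)
 have ih: "integrable lborel ?h"
 proof (rule Bochner_Integration.integrable_bound[OF integrable_mult_right[OF iw, of K]])
  show "?h \<in> borel_measurable lborel"
  using E(1) borel_measurable_fejer by (intro borel_measurable_times borel_measurable_of_real) auto
  show "AE v in lborel. norm (?h v) <= norm (K*(fejer v * ?w v))"
  proof (rule AE_I2)
  fix v
  have "norm (?h v) = fejer v * cmod (G (s + \<i> * of_real (v / a)))" by (simp add: norm_mult fejer_nonneg)
  also have "... <= fejer v * (K * ?w v)" unfolding K_def by (intro mult_left_mono E(2) fejer_nonneg)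
  also have "... <= norm (K*(fejer v * ?w v))" by (simp add: mult_ac)
  finally show "norm (?h v) <= norm (K*(fejer v * ?w v))" .
  qed
 qed
 have S: "fejer_sum (chi d) a s = - (\<integral>v. ?h v \<partial>lborel) / of_real fejer_mass" using E(3) \<kappa> by simp
 have ratio: "(lQ * fejer_mass + 2 * W) / fejer_mass * C <= C' * lQ"
 proof -
  have "2 * W / fejer_mass <= 2 * W/(fejer_mass * ln 2) * lQ"
  proof -
  have "2 * W / fejer_mass*1 <= 2 * W / fejer_mass*(lQ / ln 2)"
   using lQ W \<kappa> by (intro mult_left_mono) (auto simp: divide_simps)
  then show ?thesis by simp
  qed
  then have "(lQ * fejer_mass + 2 * W) / fejer_mass <= lQ + 2 * W/(fejer_mass * ln 2) * lQ"
  using \<kappa> by (simp add: add_divide_distrib)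
  then have "(lQ * fejer_mass + 2 * W) / fejer_mass * C <= (lQ + 2 * W/(fejer_mass * ln 2) * lQ) * C"
  using C(1) by (intro mult_right_mono) auto
  then show ?thesis by (simp add: C'_def algebra_simps)
 qed
 have "(\<integral>v. - C*(fejer v * ?w v) \<partial>lborel) <= (\<integral>v. Re (?h v) \<partial>lborel)"
 proof (rule integral_mono)
  show "integrable lborel (%v. - C*(fejer v * ?w v))" by (rule integrable_mult_right[OF iw])
  show "integrable lborel (%v. Re (?h v))" using ih by (rule integrable_Re)
  fix v
  have "Re (G (s + \<i> * of_real (v / a))) >= - C * ln (\<bar>real_of_int d\<bar>*(2 + \<bar>Im s + v / a\<bar>))"
  using C(2)[OF d(1,2) disjI1[OF d(3)], of "s + \<i> * of_real (v / a)"] s by (simp add: G_def)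
  moreover have "C * ln (\<bar>real_of_int d\<bar>*(2 + \<bar>Im s + v / a\<bar>)) <= C * ?w v"
  using ln_height_shift_le[OF abs_fundamental_discriminant_ge_1[OF d(1)] a, of "Im s" v] C(1)
  by (intro mult_left_mono) (auto simp: lQ_def)
  ultimately have "- (C * ?w v) <= Re (G (s + \<i> * of_real (v / a)))" by linarith
  from mult_left_mono[OF this fejer_nonneg[of v]]
  show "- C*(fejer v * ?w v) <= Re (?h v)" by (simp add: mult_ac)
 qed
 then have "- C*(lQ * fejer_mass + 2 * W) <= Re (\<integral>v. ?h v \<partial>lborel)"
  using intw integral_Re[OF ih] by simp
 then have "- Re (\<integral>v. ?h v \<partial>lborel) / fejer_mass <= C*(lQ * fejer_mass + 2 * W) / fejer_mass"
  using \<kappa> by (intro divide_right_mono) auto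
 also have "... <= C' * lQ" using ratio by (simp add: mult_ac)
 finally have 1: "Re (fejer_sum (chi d) a s) <= C' * lQ" unfolding S by simp
 have "cmod (\<integral>v. ?h v \<partial>lborel) <= (\<integral>v. K*(fejer v * ?w v) \<partial>lborel)"
 proof (rule Bochner_Integration.integral_norm_bound_integral[OF ih integrable_mult_right[OF iw]])
  fix v
  have "norm (?h v) = fejer v * cmod (G (s + \<i> * of_real (v / a)))" by (simp add: norm_mult fejer_nonneg)
  also have "... <= fejer v * (K * ?w v)" unfolding K_def by (intro mult_left_mono E(2) fejer_nonneg)
  finally show "norm (?h v) <= K*(fejer v * ?w v)" by (simp add: mult_ac)
 qed
 then have "cmod (\<integral>v. ?h v \<partial>lborel) <= K*(lQ * fejer_mass + 2 * W)" using intw by simp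
 then have "cmod (fejer_sum (chi d) a s) <= K*(lQ * fejer_mass + 2 * W) / fejer_mass"
  unfolding S using \<kappa> by (simp add: norm_divide divide_right_mono)
 also have "... = ((lQ * fejer_mass + 2 * W) / fejer_mass * C)*(1 + 1/(Re s - 1/2))" by (simp add: K_def)
 also have "... <= C' * lQ*(1 + 1/(Re s - 1/2))" using ratio s by (intro mult_right_mono) auto
 finally show ?thesis using 1 by (simp add: lQ_def)
 qed
 show ?thesis using C' main by blast
qed

text \<open>The two-sided bound makes the sums converge locally uniformly in the strip. The limit is
  the logarithm series for Re s > 1, so its exponential continues to L; exponentiating avoids any
  choice of branch.\<close>

lemma exp_lim_smoothed_log_sum:
 assumes d: "fundamental_discriminant d" "GRH_for d" "d \<noteq> 1" and s: "1/2 < Re s" "Re s < 2"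
 obtains h where "(%k. smoothed_log_sum (chi d) (real (Suc k)) s) \<longlonglongrightarrow> h" "exp h = Dirichlet_L d s"
proof -
 obtain C where C: "C > 0" "\<And>s a. 1/2 < Re s ==> Re s < 2 ==> a >= 1 ==>
  cmod (fejer_sum (chi d) a s) <= C * ln (\<bar>real_of_int d\<bar>*(2 + \<bar>Im s\<bar>))*(1 + 1/(Re s - 1/2))"
 using fejer_sum_bounds d by metis
 let ?U = "{s. 1/2 < Re s & Re s < 2}"
 let ?P = "%k. smoothed_log_sum (chi d) (real (Suc k))"
 define B where "B = (%s. C * ln (\<bar>real_of_int d\<bar>*(2 + \<bar>Im s\<bar>))*(1 + 1/(Re s - 1/2)))"
 have B: "cmod (?P l s - ?P k s) <= 2 * B s / real (Suc k)" if "1/2 < Re s" "Re s < 2" "k <= l" for s k l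
 using norm_smoothed_log_sum_diff_le[of "chi d" s "B s" "real (Suc k)" "real (Suc l)"] C(2)[OF that(1,2)] that(3)
 by (simp add: B_def)
 have B0: "B s >= 0" if "1/2 < Re s" "Re s < 2" for s
 using order_trans[OF norm_ge_zero C(2)[OF that, of 1]] by (simp add: B_def)
 have inv0: "(%k. c / real (Suc k)) \<longlonglongrightarrow> 0" for c :: real
 using tendsto_mult_right_zero[OF LIMSEQ_inverse_real_of_nat, of c] by (simp add: divide_inverse)
 have "Cauchy (%k. ?P k s)" if "1/2 < Re s" "Re s < 2" for s
 proof (rule CauchyI')
 fix e :: real assume e: "e > 0"
 from order_tendstoD(2)[OF inv0[of "2 * B s"] e] obtain M where M: "\<And>k. k >= M ==> 2 * B s / real (Suc k) < e"
  by (auto simp: eventually_sequentially)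
 show "\<exists>M. \<forall>m\<ge>M. \<forall>n>m. dist (?P m s) (?P n s) < e"
 proof (intro exI[of _ M] allI impI)
  fix m n assume "M <= m" "m < n"
  then show "dist (?P m s) (?P n s) < e"
  using B[OF that, of m n] M[of m] by (simp add: dist_norm norm_minus_commute)
 qed
 qed
 then have conv: "convergent (%k. ?P k s)" if "1/2 < Re s" "Re s < 2" for s
 using that Cauchy_convergent by blast
 define H where "H = (%s. lim (%k. ?P k s))"
 have lim: "(%k. ?P k s) \<longlonglongrightarrow> H s" if "1/2 < Re s" "Re s < 2" for s
 using conv[OF that] unfolding H_def by (simp add: convergent_LIMSEQ_iff)
 have diff: "cmod (H s - ?P k s) <= 2 * B s / real (Suc k)" if "1/2 < Re s" "Re s < 2" for s k
 proof (rule LIMSEQ_le_const2)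
 show "(%l. cmod (?P l s - ?P k s)) \<longlonglongrightarrow> cmod (H s - ?P k s)" by (intro tendsto_intros lim that)
 show "\<exists>N. \<forall>l\<ge>N. cmod (?P l s - ?P k s) <= 2 * B s / real (Suc k)" using B[OF that] by blast
 qed
 have openU: "open ?U" by (intro open_Collect_conj open_halfspace_Re_gt open_halfspace_Re_lt)
 have holH: "H holomorphic_on ?U"
 proof (rule holomorphic_uniform_sequence[OF openU])
 show "?P k holomorphic_on ?U" for k unfolding smoothed_log_sum_def by (intro holomorphic_intros) auto
 fix s0 assume "s0 \<in> ?U"
 then obtain r where r: "r > 0" "cball s0 r \<subseteq> ?U" using openU open_contains_cball by blast
 have "continuous_on (cball s0 r) B"
  unfolding B_def using r abs_fundamental_discriminant_ge_1[OF d(1)]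
  by (intro continuous_intros) (auto simp: add_pos_nonneg)
 then have "bounded (B ` cball s0 r)" by (intro compact_imp_bounded compact_continuous_image compact_cball)
 then obtain M where "\<forall>y\<in>B ` cball s0 r. norm y <= M" unfolding bounded_iff by blast
 then have M: "\<bar>B x\<bar> <= M" if "x \<in> cball s0 r" for x using that by auto
 have "uniform_limit (cball s0 r) ?P H sequentially"
 proof (rule uniform_limitI)
  fix e :: real assume e: "e > 0"
  from order_tendstoD(2)[OF inv0[of "2 * M"] e]
  show "\<forall>\<^sub>F k in sequentially. \<forall>x\<in>cball s0 r. dist (?P k x) (H x) < e"
  proof eventually_elim
  case (elim k)
  show ?case
  proof
   fix x assume x: "x \<in> cball s0 r"
   then have "1/2 < Re x" "Re x < 2" using r by auto
   from diff[OF this, of k] have "dist (?P k x) (H x) <= 2 * B x / real (Suc k)"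
   by (simp add: dist_norm norm_minus_commute)
   also have "... <= 2 * M / real (Suc k)" using M[OF x] by (intro divide_right_mono) auto
   finally show "dist (?P k x) (H x) < e" using elim by simp
  qed
  qed
 qed
 then show "\<exists>d>0. cball s0 d \<subseteq> ?U & uniform_limit (cball s0 d) ?P H sequentially" using r by blast
 qed
 have "exp (H s) = Dirichlet_L d s"
 proof (rule analytic_continuation_open[of "{s. 1 < Re s & Re s < 2}" ?U "%s. exp (H s)" "Dirichlet_L d" s])
 show "open {s. 1 < Re s & Re s < 2}" by (intro open_Collect_conj open_halfspace_Re_gt open_halfspace_Re_lt)
 show "{s. 1 < Re s & Re s < 2} \<noteq> {}" by (auto intro!: exI[of _ "3/2"])
 have "?U = {s. Re s > 1/2} \<inter> {s. Re s < 2}" by auto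
 then show "connected ?U"
  by (simp only:) (intro convex_connected convex_Int convex_halfspace_Re_gt convex_halfspace_Re_lt)
 show "(%s. exp (H s)) holomorphic_on ?U" by (intro holomorphic_intros holH)
 show "Dirichlet_L d holomorphic_on ?U"
  by (rule holomorphic_on_subset[OF holomorphic_Dirichlet_L[OF d(1)]]) (use d(3) in \<open>auto simp: L_domain_def\<close>)
 fix z assume "z \<in> {s. 1 < Re s & Re s < 2}"
 then have z: "Re z > 1" "Re z < 2" by auto
 have "(%k. ?P k z) \<longlonglongrightarrow> log_series (chi d) z"
  by (rule smoothed_log_sum_tendsto_log_series[OF norm_chi_le z(1)])
 moreover have "(%k. ?P k z) \<longlonglongrightarrow> H z" using z by (intro lim) auto
 ultimately have "H z = log_series (chi d) z" by (rule LIMSEQ_unique[symmetric])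
 then show "exp (H z) = Dirichlet_L d z" using exp_log_series_chi[OF d(1) z(1)] by simp
 qed (use openU s in auto)
 with lim[OF s] that show ?thesis by blast
qed

text \<open>Let N tend to infinity in the monotonicity statement. Because the one-sided constant
  does not depend on Re s, the line Re s = 1/2 itself is reached by continuity.\<close>

theorem norm_Dirichlet_L_le_smoothed_log_sum:
 "\<exists>C>0. \<forall>d s T. fundamental_discriminant d & GRH_for d & d \<noteq> 1 & 1/2 <= Re s & Re s < 2 & T >= 1 -->
  cmod (Dirichlet_L d s) <= exp (Re (smoothed_log_sum (chi d) T s) + C * ln (\<bar>real_of_int d\<bar>*(2 + \<bar>Im s\<bar>)) / T)"
proof -
 obtain C where C: "C > 0" "\<And>d s a. fundamental_discriminant d ==> GRH_for d ==> d \<noteq> 1 ==> 1/2 < Re s ==> Re s < 2 ==> a >= 1 ==>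
  Re (fejer_sum (chi d) a s) <= C * ln (\<bar>real_of_int d\<bar>*(2 + \<bar>Im s\<bar>))"
 using fejer_sum_bounds by metis
 have open_case: "cmod (Dirichlet_L d s) <= exp (Re (smoothed_log_sum (chi d) T s) + 2 * C * ln (\<bar>real_of_int d\<bar>*(2 + \<bar>Im s\<bar>)) / T)"
 if d: "fundamental_discriminant d" "GRH_for d" "d \<noteq> 1" and s: "1/2 < Re s" "Re s < 2" and T: "T >= 1" for d s T
 proof -
 define lQ where "lQ = C * ln (\<bar>real_of_int d\<bar>*(2 + \<bar>Im s\<bar>))"
 have "ln 2 > (0::real)" by simp
 then have "ln (\<bar>real_of_int d\<bar>*(2 + \<bar>Im s\<bar>)) >= 0" using ln_discriminant_height_ge[OF d(1), of "Im s"] by linarith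
 then have lQ: "lQ >= 0" unfolding lQ_def using C(1) by (intro mult_nonneg_nonneg) auto
 obtain h where h: "(%k. smoothed_log_sum (chi d) (real (Suc k)) s) \<longlonglongrightarrow> h" "exp h = Dirichlet_L d s"
  using exp_lim_smoothed_log_sum[OF d s] by metis
 have "Re h <= Re (smoothed_log_sum (chi d) T s) + 2 * lQ / T"
 proof (rule LIMSEQ_le_const2)
  show "(%k. Re (smoothed_log_sum (chi d) (real (Suc k)) s)) \<longlonglongrightarrow> Re h" by (intro tendsto_intros h(1))
  have "Re (smoothed_log_sum (chi d) (real (Suc k)) s) <= Re (smoothed_log_sum (chi d) T s) + 2 * lQ / T"
  if "k >= nat \<lceil>T\<rceil>" for k
  proof -
  have "T <= real (Suc k)" using that by linarith
  then have "Re (smoothed_log_sum (chi d) (real (Suc k)) s) \<le>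
   Re (smoothed_log_sum (chi d) T s) + 2 * lQ / T - 2 * lQ / real (Suc k)"
   unfolding lQ_def by (intro Re_smoothed_log_sum_mono C(2) d s T)
  moreover have "2 * lQ / real (Suc k) >= 0" using lQ by simp
  ultimately show ?thesis by linarith
  qed
  then show "\<exists>N. \<forall>k\<ge>N. Re (smoothed_log_sum (chi d) (real (Suc k)) s) <= Re (smoothed_log_sum (chi d) T s) + 2 * lQ / T"
  by blast
 qed
 then have "exp (Re h) <= exp (Re (smoothed_log_sum (chi d) T s) + 2 * lQ / T)" by simp
 moreover have "cmod (Dirichlet_L d s) = exp (Re h)" unfolding h(2)[symmetric] by simp
 ultimately show ?thesis by (simp add: lQ_def mult.assoc)
 qed
 have "cmod (Dirichlet_L d s) <= exp (Re (smoothed_log_sum (chi d) T s) + 2 * C * ln (\<bar>real_of_int d\<bar>*(2 + \<bar>Im s\<bar>)) / T)"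
 if d: "fundamental_discriminant d" "GRH_for d" "d \<noteq> 1" and s: "1/2 <= Re s" "Re s < 2" and T: "T >= 1" for d s T
 proof (cases "Re s = 1/2")
 case False
 then show ?thesis using open_case[OF d _ s(2) T] s by simp
 next
 case True
 let ?s = "%k. s + of_real (inverse (real (Suc k)))"
 let ?R = "%s. exp (Re (smoothed_log_sum (chi d) T s) + 2 * C * ln (\<bar>real_of_int d\<bar>*(2 + \<bar>Im s\<bar>)) / T)"
 have "(%k. ?s k) \<longlonglongrightarrow> s + of_real 0" by (intro tendsto_intros LIMSEQ_inverse_real_of_nat)
 then have lim: "(%k. ?s k) \<longlonglongrightarrow> s" by simp
 have "continuous_on UNIV (Dirichlet_L d)"
  using holomorphic_on_imp_continuous_on[OF holomorphic_Dirichlet_L[OF d(1)]] d(3) by (simp add: L_domain_def)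
 then have "(%k. Dirichlet_L d (?s k)) \<longlonglongrightarrow> Dirichlet_L d s"
  using lim by (auto simp: continuous_on_eq_continuous_at intro: isCont_tendsto_compose)
 then have l1: "(%k. cmod (Dirichlet_L d (?s k))) \<longlonglongrightarrow> cmod (Dirichlet_L d s)" by (rule tendsto_norm)
 have "(smoothed_log_sum (chi d) T) holomorphic_on UNIV" unfolding smoothed_log_sum_def by (intro holomorphic_intros) auto
 then have "continuous_on UNIV (smoothed_log_sum (chi d) T)" by (rule holomorphic_on_imp_continuous_on)
 then have "isCont (smoothed_log_sum (chi d) T) s" by (simp add: continuous_on_eq_continuous_at)
 then have "(%k. smoothed_log_sum (chi d) T (?s k)) \<longlonglongrightarrow> smoothed_log_sum (chi d) T s"
  using lim by (rule isCont_tendsto_compose)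
 then have "(%k. exp (Re (smoothed_log_sum (chi d) T (?s k)) + 2 * C * ln (\<bar>real_of_int d\<bar>*(2 + \<bar>Im s\<bar>)) / T)) \<longlonglongrightarrow> ?R s"
  by (intro tendsto_intros)
 then have l2: "(%k. ?R (?s k)) \<longlonglongrightarrow> ?R s" by simp
 show ?thesis
 proof (rule LIMSEQ_le[OF l1 l2], intro exI[of _ 0] allI impI)
  fix k
  have i1: "inverse (real (Suc k)) <= 1" by (simp add: inverse_le_1_iff)
  have i0: "inverse (real (Suc k)) > 0" by simp
  have R: "Re (?s k) = Re s + inverse (real (Suc k))" by (simp only: plus_complex.sel Re_complex_of_real)
  show "cmod (Dirichlet_L d (?s k)) <= ?R (?s k)"
  by (rule open_case[OF d _ _ T]) (use R True i0 i1 in linarith)+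
 qed
 qed
 then show ?thesis using C(1) by (intro exI[of _ "2 * C"]) auto
qed

section \<open>The logarithm of zeta to the right of the critical line\<close>

text \<open>Maximum modulus for g(z)/z^j on an annulus. With an integer j in place of the optimal
  real exponent, no multivalued power is needed; the choice of j is left to the application.\<close>

lemma three_circles:
 assumes g: "g holomorphic_on ball 0 R0" and r: "0 < r" "r < R" "R < R0"
 and m: "\<And>z. cmod z = r ==> cmod (g z) <= m" and M: "\<And>z. cmod z = R ==> cmod (g z) <= M"
 and z: "r <= cmod z" "cmod z <= R"
 shows "cmod (g z) <= max (m / r ^ j) (M / R ^ j) * cmod z ^ j"
proof -
 let ?S = "cball 0 R - ball (0::complex) r" and ?f = "%z. g z / z ^ j"
 have openA: "open (ball 0 R - cball (0::complex) r)" by (intro open_Diff) auto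
 have clS: "closed ?S" by (intro closed_Diff) auto
 have hol: "?f holomorphic_on (ball 0 R0 - {0})"
 by (intro holomorphic_intros holomorphic_on_subset[OF g]) auto
 have sub: "?S \<subseteq> ball 0 R0 - {0}" using r by auto
 have "cmod (?f z) <= max (m / r ^ j) (M / R ^ j)"
 proof (rule maximum_modulus_frontier[of ?f ?S])
 show "?f holomorphic_on interior ?S"
  by (rule holomorphic_on_subset[OF hol]) (use sub interior_subset in blast)
 show "continuous_on (closure ?S) ?f"
  using continuous_on_subset[OF holomorphic_on_imp_continuous_on[OF hol] sub] clS by simp
 show "bounded ?S" by (rule bounded_subset[OF bounded_cball]) auto
 fix w assume w: "w \<in> frontier ?S"
 have "ball 0 R - cball 0 r \<subseteq> interior ?S" by (intro interior_maximal openA) auto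
 then have "w \<in> ?S" "w \<notin> ball 0 R - cball 0 r" using w clS by (auto simp: frontier_def)
 then have "cmod w = r \<or> cmod w = R" by auto
 then show "cmod (?f w) <= max (m / r ^ j) (M / R ^ j)"
 proof
  assume "cmod w = r"
  then have "cmod (?f w) <= m / r ^ j" using m[of w] r by (simp add: norm_divide norm_power divide_right_mono)
  then show ?thesis by simp
 next
  assume "cmod w = R"
  then have "cmod (?f w) <= M / R ^ j" using M[of w] r by (simp add: norm_divide norm_power divide_right_mono)
  then show ?thesis by simp
 qed
 qed (use z in auto)
 moreover have "cmod z > 0" using z r by linarith
 ultimately show ?thesis by (simp add: norm_divide norm_power pos_divide_le_eq)
qed

lemma chi_1: "n > 0 ==> chi 1 n = 1"
 by (simp add: chi_def Kronecker_one_left)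

lemma log_series_chi_1_real:
 assumes s: "Re s > 1"
 shows "cmod (log_series (chi 1) s) <= Re (log_series (chi 1) (of_real (Re s)))"
proof -
 let ?t = "%s n. mangoldt n / of_real (ln (real n)) * chi 1 n * of_nat n powr - s"
 have sm: "summable (%n. cmod (?t w n))" if "Re w > 1" for w
 by (intro summable_dirichlet_series_norm norm_log_coeff_le norm_chi_le that)
 have eq: "cmod (?t s n) = Re (?t (of_real (Re s)) n)" for n
 proof (cases "n <= 1")
 case True
 then have "n = 0 \<or> n = Suc 0" by auto
 then show ?thesis by auto
 next
 case False
 then have n: "n > 0" "ln (real n) > 0" by auto
 have h: "(of_nat n :: complex) powr - of_real (Re s) = of_real (real n powr - Re s)"
  using powr_of_real[of "real n" "- Re s"] by simp
 have e1: "?t (of_real (Re s)) n = of_real (mangoldt n / ln (real n) * real n powr - Re s)"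
  unfolding h using n by (simp add: chi_1)
 have e2: "cmod (?t s n) = mangoldt n / ln (real n) * real n powr - Re s"
  using n by (simp add: chi_1 norm_mult norm_divide norm_nat_powr)
 show ?thesis unfolding e1 e2 by (simp only: Re_complex_of_real)
 qed
 have "cmod (log_series (chi 1) s) <= (\<Sum>n. cmod (?t s n))"
 unfolding log_series_def dirichlet_series_def by (rule summable_norm[OF sm[OF s]])
 also have "... = (\<Sum>n. Re (?t (of_real (Re s)) n))" by (simp only: eq)
 also have "... = Re (log_series (chi 1) (of_real (Re s)))"
 unfolding log_series_def dirichlet_series_def
 by (rule Re_suminf[symmetric]) (use sm[of "of_real (Re s)"] s in \<open>auto intro: summable_norm_cancel\<close>)
 finally show ?thesis .
qed

lemma zeta_real_bounds:
 assumes "\<sigma> > 1"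
 shows "cmod (Dirichlet_L 1 (of_real \<sigma>)) <= 1/(\<sigma> - 1) + \<sigma> + 1"
 and "cmod (Dirichlet_L 1 (of_real \<sigma>)) >= 1/(\<sigma> - 1) - \<sigma> - 1"
 and "cmod (Dirichlet_L 1 (of_real \<sigma>)) = exp (Re (log_series (chi 1) (of_real \<sigma>)))"
 and "Re (log_series (chi 1) (of_real \<sigma>)) >= 0"
proof -
 have "cmod (Dirichlet_L 1 (of_real \<sigma>) - 1/(of_real \<sigma> - 1)) <= cmod (of_real \<sigma>)*(1 + 1 / Re (of_real \<sigma>))"
 by (rule norm_zeta_minus_pole_le) (use assms in \<open>auto simp: complex_eq_iff\<close>)
 also have "... = \<sigma> + 1" using assms by (simp add: field_simps)
 finally have *: "cmod (Dirichlet_L 1 (of_real \<sigma>) - 1/(of_real \<sigma> - 1)) <= \<sigma> + 1" .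
 have "1/(of_real \<sigma> - 1) = complex_of_real (1/(\<sigma> - 1))" by simp
 then have "cmod (1/(of_real \<sigma> - 1)) = 1/(\<sigma> - 1)" using assms by (simp only: norm_of_real) simp
 then show "cmod (Dirichlet_L 1 (of_real \<sigma>)) <= 1/(\<sigma> - 1) + \<sigma> + 1"
 "cmod (Dirichlet_L 1 (of_real \<sigma>)) >= 1/(\<sigma> - 1) - \<sigma> - 1"
 using * norm_triangle_sub[of "Dirichlet_L 1 (of_real \<sigma>)" "1/(of_real \<sigma> - 1)"]
  norm_triangle_sub[of "1/(of_real \<sigma> - 1)" "Dirichlet_L 1 (of_real \<sigma>)"]
 by (simp_all add: norm_minus_commute)
 show "cmod (Dirichlet_L 1 (of_real \<sigma>)) = exp (Re (log_series (chi 1) (of_real \<sigma>)))"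
 using exp_log_series_chi[OF fundamental_discriminant_1, of "of_real \<sigma>"] assms
 by (metis Re_complex_of_real norm_exp_eq_Re)
 show "Re (log_series (chi 1) (of_real \<sigma>)) >= 0"
 using order_trans[OF norm_ge_zero log_series_chi_1_real[of "of_real \<sigma>"]] assms by simp
qed

lemma norm_log_series_chi_1_le_ln:
 assumes s: "Re s > 1"
 shows "cmod (log_series (chi 1) s) <= ln (1/(Re s - 1) + Re s + 1)"
proof -
 have "exp (Re (log_series (chi 1) (of_real (Re s)))) <= 1/(Re s - 1) + Re s + 1"
 using zeta_real_bounds(1,3)[OF s] by simp
 then have "Re (log_series (chi 1) (of_real (Re s))) <= ln (1/(Re s - 1) + Re s + 1)"
 using s by (subst ln_exp[symmetric], subst ln_le_cancel_iff) (auto intro!: add_pos_pos)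
 then show ?thesis using log_series_chi_1_real[OF s] by linarith
qed

text \<open>The half strip of heights within 2 of t is simply connected, and for |t| >= 4 it avoids
  the pole. The last clause bounds the branch at distance \<eta> from the critical line.\<close>

definition zeta_log_branch :: "real \<Rightarrow> real \<Rightarrow> (complex \<Rightarrow> complex) \<Rightarrow> bool" where
 "zeta_log_branch C t g \<longleftrightarrow> g holomorphic_on {s. Re s > 1/2 & \<bar>Im s - t\<bar> < 2} \<and>
  (\<forall>s. Re s > 1/2 & \<bar>Im s - t\<bar> < 2 --> exp (g s) = Dirichlet_L 1 s) \<and>
  (\<forall>s. Re s > 1/2 & \<bar>Im s - t\<bar> < 2 --> (g has_field_derivative deriv (Dirichlet_L 1) s / Dirichlet_L 1 s) (at s)) \<and>
  (\<forall>s. Re s > 1 & \<bar>Im s - t\<bar> < 2 --> g s = log_series (chi 1) s) \<and>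
  (\<forall>s \<eta>. \<eta> > 0 & Re s >= 1/2 + \<eta> & \<bar>Im s - t\<bar> < 2 --> cmod (g s) <= C * ln (4 + \<bar>t\<bar>)*(1 + 1 / \<eta>))"

lemma zeta_log_branchD:
 assumes "zeta_log_branch C t g"
 shows "g holomorphic_on {s. Re s > 1/2 & \<bar>Im s - t\<bar> < 2}"
 "\<And>s. Re s > 1/2 ==> \<bar>Im s - t\<bar> < 2 ==> exp (g s) = Dirichlet_L 1 s"
 "\<And>s. Re s > 1/2 ==> \<bar>Im s - t\<bar> < 2 ==> (g has_field_derivative deriv (Dirichlet_L 1) s / Dirichlet_L 1 s) (at s)"
 "\<And>s. Re s > 1 ==> \<bar>Im s - t\<bar> < 2 ==> g s = log_series (chi 1) s"
 "\<And>s \<eta>. \<eta> > 0 ==> Re s >= 1/2 + \<eta> ==> \<bar>Im s - t\<bar> < 2 ==> cmod (g s) <= C * ln (4 + \<bar>t\<bar>)*(1 + 1 / \<eta>)"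
 using assms by (simp_all add: zeta_log_branch_def)

text \<open>RH provides a zero-free convex region, hence a logarithm, normalised at 2 + it by the
  Dirichlet series. Its size follows by integrating the bound for zeta'/zeta along a horizontal
  segment from Re s = 2.\<close>

lemma log_zeta_exists:
 assumes RH: "GRH_for 1"
 shows "\<exists>C>0. \<forall>t. \<bar>t\<bar> >= 4 --> (\<exists>g. zeta_log_branch C t g)"
proof -
 obtain C where C: "C > 0" "\<And>s. \<bar>Im s\<bar> >= 2 ==> 1/2 < Re s ==> Re s <= 2 ==>
  cmod (deriv (Dirichlet_L 1) s / Dirichlet_L 1 s) <= C * ln (2 + \<bar>Im s\<bar>)*(1 + 1/(Re s - 1/2))"
 using logderiv_Dirichlet_L_bounds fundamental_discriminant_1 RH by fastforce
 define C' where "C' = 2 * C + 2"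
 have "\<exists>g. g holomorphic_on {s. Re s > 1/2 & \<bar>Im s - t\<bar> < 2} \<and>
  (\<forall>s. Re s > 1/2 & \<bar>Im s - t\<bar> < 2 --> exp (g s) = Dirichlet_L 1 s) \<and>
  (\<forall>s. Re s > 1/2 & \<bar>Im s - t\<bar> < 2 --> (g has_field_derivative deriv (Dirichlet_L 1) s / Dirichlet_L 1 s) (at s)) \<and>
  (\<forall>s. Re s > 1 & \<bar>Im s - t\<bar> < 2 --> g s = log_series (chi 1) s) \<and>
  (\<forall>s \<eta>. \<eta> > 0 & Re s >= 1/2 + \<eta> & \<bar>Im s - t\<bar> < 2 --> cmod (g s) <= C' * ln (4 + \<bar>t\<bar>)*(1 + 1 / \<eta>))"
 if t: "\<bar>t\<bar> >= 4" for t
 proof -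
 let ?U = "{s. Re s > 1/2 & \<bar>Im s - t\<bar> < 2}" and ?V = "{s. Re s > 1 & \<bar>Im s - t\<bar> < 2}"
 have Ueq: "{s. Re s > a & \<bar>Im s - t\<bar> < 2} = {s. Re s > a} \<inter> ({s. Im s > t - 2} \<inter> {s. Im s < t + 2})" for a
  by auto
 have openU: "open {s. Re s > a & \<bar>Im s - t\<bar> < 2}" for a
  unfolding Ueq by (intro open_Int open_halfspace_Re_gt open_halfspace_Im_gt open_halfspace_Im_lt)
 have convU: "convex {s. Re s > a & \<bar>Im s - t\<bar> < 2}" for a
  unfolding Ueq by (intro convex_Int convex_halfspace_Re_gt convex_halfspace_Im_gt convex_halfspace_Im_lt)
 have ImU: "\<bar>Im s\<bar> > 2" "\<bar>Im s\<bar> < 2 + \<bar>t\<bar>" if "\<bar>Im s - t\<bar> < 2" for s using that t by auto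
 have holL: "Dirichlet_L 1 holomorphic_on ?U"
  by (rule holomorphic_on_subset[OF holomorphic_Dirichlet_L[OF fundamental_discriminant_1]])
   (use t in \<open>auto simp: L_domain_def\<close>)
 have nz: "Dirichlet_L 1 s \<noteq> 0" if "s \<in> ?U" for s
  by (rule Dirichlet_L_nonzero_GRH[OF fundamental_discriminant_1 RH]) (use that t in auto)
 define c where "c = 2 + \<i> * of_real t"
 have cU: "c \<in> ?U" and cV: "c \<in> ?V" by (auto simp: c_def)
 obtain g0 where g0: "g0 holomorphic_on ?U" and g0': "\<And>s. s \<in> ?U ==> exp (g0 s) = Dirichlet_L 1 s"
  by (rule holomorphic_logarithm_exists[OF convU openU holL nz cU]) blast+
 define g where "g = (%s. g0 s - g0 c + log_series (chi 1) c)"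
 have "exp (log_series (chi 1) c) = exp (g0 c)"
  using exp_log_series_chi[OF fundamental_discriminant_1, of c] g0'[OF cU] by (simp add: c_def)
 then have eg: "exp (g s) = Dirichlet_L 1 s" if "s \<in> ?U" for s
  using g0'[OF that] by (simp add: g_def exp_add exp_diff)
 have holg: "g holomorphic_on ?U" unfolding g_def by (intro holomorphic_intros g0)
 have dg: "(g has_field_derivative deriv (Dirichlet_L 1) s / Dirichlet_L 1 s) (at s)" if s: "s \<in> ?U" for s
 proof -
  have d: "(g has_field_derivative deriv g s) (at s)" by (rule holomorphic_derivI[OF holg openU s])
  then have "((%s. exp (g s)) has_field_derivative exp (g s) * deriv g s) (at s)" by (auto intro!: derivative_eq_intros)
  then have "(Dirichlet_L 1 has_field_derivative exp (g s) * deriv g s) (at s)"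
  by (rule has_field_derivative_transform_within_open[OF _ openU s]) (rule eg)
  then have "deriv (Dirichlet_L 1) s / Dirichlet_L 1 s = deriv g s" using eg[OF s] nz[OF s] by (simp add: DERIV_imp_deriv)
  with d show ?thesis by simp
 qed
 have "\<exists>k. \<forall>s\<in>?V. g s - log_series (chi 1) s = k"
 proof (rule has_field_derivative_zero_constant[OF convU])
  fix s assume s: "s \<in> ?V"
  then have "(g has_field_derivative - mangoldt_series (chi 1) s) (at s)"
  using dg[of s] logderiv_Dirichlet_L_Re_gt_1[OF fundamental_discriminant_1, of s] by simp
  moreover have "(log_series (chi 1) has_field_derivative - mangoldt_series (chi 1) s) (at s)"
  by (rule has_field_derivative_log_series) (use s norm_chi_le in auto)
  ultimately have "((%s. g s - log_series (chi 1) s) has_field_derivative - mangoldt_series (chi 1) s - - mangoldt_series (chi 1) s) (at s)"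
  by (rule DERIV_diff)
  then have "((%s. g s - log_series (chi 1) s) has_field_derivative 0) (at s)" by simp
  then show "((%s. g s - log_series (chi 1) s) has_field_derivative 0) (at s within ?V)"
  by (rule has_field_derivative_at_within)
 qed
 then obtain k where k: "\<And>s. s \<in> ?V ==> g s - log_series (chi 1) s = k" by blast
 have "k = 0" using k[OF cV] by (simp add: g_def)
 then have gV: "g s = log_series (chi 1) s" if "s \<in> ?V" for s using k[OF that] by simp
 have l1: "ln (4 + \<bar>t\<bar>) >= 1"
 proof -
  have "exp 1 <= 4 + \<bar>t\<bar>" using exp_le by linarith
  then have "ln (exp 1) <= ln (4 + \<bar>t\<bar>)" by (subst ln_le_cancel_iff) auto
  then show ?thesis by simp
 qed
 have far: "cmod (g s) <= 2" if "Re s >= 2" "\<bar>Im s - t\<bar> < 2" for s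
 proof -
  have s1: "Re s > 1" using that by simp
  have "1/(Re s - 1) <= 1" using that by (simp add: divide_simps)
  then have "cmod (log_series (chi 1) s) <= 2" using norm_log_series_le[of "chi 1" s, OF norm_chi_le s1] by linarith
  then show ?thesis using gV[of s] that s1 by simp
 qed
 have bd: "cmod (g s) <= C' * ln (4 + \<bar>t\<bar>)*(1 + 1 / \<eta>)" if \<eta>: "\<eta> > 0" "Re s >= 1/2 + \<eta>" and im: "\<bar>Im s - t\<bar> < 2" for s \<eta>
 proof (cases "Re s >= 2")
  case True
  have "2*1*1 <= C' * ln (4 + \<bar>t\<bar>)*(1 + 1 / \<eta>)" using \<eta> C(1) l1 by (intro mult_mono) (auto simp: C'_def)
  then show ?thesis using far[OF True im] by simp
 next
  case False
  define e where "e = 2 + \<i> * of_real (Im s)"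
  let ?B = "C * ln (4 + \<bar>t\<bar>)*(1 + 1 / \<eta>)"
  have "cmod (g e - g s) <= ?B * cmod (e - s)"
  proof (rule field_differentiable_bound[of "closed_segment s e"])
  fix z assume z: "z \<in> closed_segment s e"
  then obtain u where u: "0 <= u" "u <= 1" "z = (1 - u) *\<^sub>R s + u *\<^sub>R e" by (auto simp: closed_segment_def)
  have Im: "Im z = Im s" unfolding u(3) by (simp add: e_def left_diff_distrib)
  have Re: "Re z = Re s + u*(2 - Re s)" unfolding u(3) by (simp add: e_def) (simp add: algebra_simps)
  have "0 <= u*(2 - Re s)" "u*(2 - Re s) <= 1*(2 - Re s)" using u False by (auto intro!: mult_right_mono)
  then have Re': "Re s <= Re z" "Re z <= 2" using Re by auto
  have zU: "z \<in> ?U" using Re' \<eta> im Im by auto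
  show "(g has_field_derivative deriv (Dirichlet_L 1) z / Dirichlet_L 1 z) (at z within closed_segment s e)"
   by (rule has_field_derivative_at_within[OF dg[OF zU]])
  have "cmod (deriv (Dirichlet_L 1) z / Dirichlet_L 1 z) <= C * ln (2 + \<bar>Im z\<bar>)*(1 + 1/(Re z - 1/2))"
   by (rule C(2)) (use zU Re' ImU(1)[of z] Im im in auto)
  also have "... <= ?B"
  proof (intro mult_mono add_left_mono)
   show "ln (2 + \<bar>Im z\<bar>) <= ln (4 + \<bar>t\<bar>)" using ImU(2)[of s] Im im by (subst ln_le_cancel_iff) auto
   show "1/(Re z - 1/2) <= 1 / \<eta>" using Re' \<eta> by (intro divide_left_mono) auto
  qed (use C(1) \<eta> l1 Re' in \<open>auto intro!: mult_nonneg_nonneg add_nonneg_nonneg divide_nonneg_nonneg ln_ge_zero\<close>)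
  finally show "cmod (deriv (Dirichlet_L 1) z / Dirichlet_L 1 z) <= ?B" .
  qed auto
  also have "cmod (e - s) <= 3/2"
  proof -
  have "e - s = of_real (2 - Re s)" by (simp add: e_def complex_eq_iff)
  then have "cmod (e - s) = \<bar>2 - Re s\<bar>" by (simp only: norm_of_real)
  then show ?thesis using False \<eta> by simp
  qed
  then have "?B * cmod (e - s) <= ?B*(3/2)" using C(1) \<eta> l1 by (intro mult_left_mono) auto
  finally have "cmod (g e - g s) <= ?B*(3/2)" .
  moreover have "cmod (g e) <= 2" by (rule far) (use im in \<open>auto simp: e_def\<close>)
  ultimately have "cmod (g s) <= ?B*(3/2) + 2"
  using norm_triangle_sub[of "g s" "g e"] norm_minus_commute[of "g s" "g e"] by linarith
  also have "... <= ?B*2 + 2 * ln (4 + \<bar>t\<bar>)*(1 + 1 / \<eta>)"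
  proof -
  have "2*1*1 <= 2 * ln (4 + \<bar>t\<bar>)*(1 + 1 / \<eta>)" using \<eta> l1 by (intro mult_mono) auto
  moreover have "?B >= 0" using C(1) \<eta> l1 by auto
  moreover have "B*(3/2) + 2 <= B*2 + D" if "2*1*1 <= D" "B >= 0" for B D :: real using that by simp
  ultimately show ?thesis by blast
  qed
  also have "... = C' * ln (4 + \<bar>t\<bar>)*(1 + 1 / \<eta>)" by (simp add: C'_def algebra_simps)
  finally show ?thesis .
 qed
 show ?thesis using holg eg dg gV bd by (intro exI[of _ g]) auto
 qed
 then have "\<exists>g. zeta_log_branch C' t g" if "\<bar>t\<bar> >= 4" for t using that unfolding zeta_log_branch_def by blast
 then have "\<forall>t. \<bar>t\<bar> >= 4 --> (\<exists>g. zeta_log_branch C' t g)" by blast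
 moreover have "C' > 0" using C(1) by (simp add: C'_def)
 ultimately show ?thesis by blast
qed

text \<open>Three circles about 2 + \<delta> + it with radii 1 - h, 1 and 4/3, where l = ln ln X and
  h = 1/l. On the inner circle the trivial bound is about ln l, on the outer one RH gives (ln X)^2.
  The result is of order ln ln ln X, uniformly in \<delta>, which is far below \<epsilon> ln ln
  X.\<close>

lemma log_series_chi_1_near_1:
 assumes RH: "GRH_for 1" and \<epsilon>: "\<epsilon> > 0"
 shows "\<forall>\<^sub>F X in at_top. \<forall>\<delta> t. 0 < \<delta> & \<delta> <= 1 & 4 <= \<bar>t\<bar> & \<bar>t\<bar> <= 2 * X -->
  cmod (log_series (chi 1) (1 + of_real \<delta> + \<i> * of_real t)) <= \<epsilon> * ln (ln X)"
proof -
 obtain C where C: "C > 0" "\<And>t. \<bar>t\<bar> >= 4 ==> \<exists>g. zeta_log_branch C t g"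
 using log_zeta_exists[OF RH] by blast
 have "\<forall>\<^sub>F X::real in at_top. ln (ln X) >= 2" by real_asymp
 moreover have "\<forall>\<^sub>F X::real in at_top. ln X >= 14 * C" using C(1) by real_asymp
 moreover have "\<forall>\<^sub>F X::real in at_top. X >= 4" by real_asymp
 moreover have "\<forall>\<^sub>F X::real in at_top. exp 18 * ln (ln (ln X) + 5) <= \<epsilon> * ln (ln X)" using \<epsilon> by real_asymp
 moreover have "\<forall>\<^sub>F X::real in at_top. 1 <= \<epsilon> * ln (ln X)" using \<epsilon> by real_asymp
 ultimately show ?thesis
 proof eventually_elim
 case (elim X)
 define l where "l = ln (ln X)"
 have l: "l >= 2" "exp 18 * ln (l + 5) <= \<epsilon> * l" "1 <= \<epsilon> * l" using elim by (auto simp: l_def)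
 have LX: "ln X > 0" using elim C(1) by (meson less_le_trans mult_pos_pos zero_less_numeral)
 have el: "exp l = ln X" using LX by (simp add: l_def)
 show ?case unfolding l_def[symmetric]
 proof (intro allI impI, elim conjE)
  fix \<delta> t :: real assume \<delta>: "0 < \<delta>" "\<delta> <= 1" and t: "4 <= \<bar>t\<bar>" "\<bar>t\<bar> <= 2 * X"
  obtain g where "zeta_log_branch C t g" using C(2)[OF t(1)] by blast
  note g = zeta_log_branchD[OF this]
  define c where "c = 2 + of_real \<delta> + \<i> * of_real t"
  define h where "h = 1 / l"
  \<comment> \<open>With j about 8l, (4/3)^j exceeds exp(2l) = (ln X)^2, while (1 - h)^j stays above
    exp(-18).\<close>
  define j where "j = nat \<lceil>8 * l\<rceil>"
  have h: "0 < h" "h <= 1/2" using l by (auto simp: h_def field_simps)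
  have j: "8 * l <= real j" "real j <= 8 * l + 1" using l by (auto simp: j_def)
  have Re: "Re (c + w) >= 2 + \<delta> - cmod w" "Re (c + w) <= 2 + \<delta> + cmod w" for w
  using abs_Re_le_cmod[of w] by (auto simp: c_def)
  have Im: "\<bar>Im (c + w) - t\<bar> <= cmod w" for w using abs_Im_le_cmod[of w] by (auto simp: c_def)
  have ln4: "ln (4 + \<bar>t\<bar>) <= 2 * ln X"
  proof -
  have "4 * X <= X * X" using elim by (intro mult_right_mono) auto
  then have "4 + \<bar>t\<bar> <= X^2" using t elim unfolding power2_eq_square by linarith
  then have "ln (4 + \<bar>t\<bar>) <= ln (X^2)" by (subst ln_le_cancel_iff) (use elim in auto)
  then show ?thesis using elim by (simp add: ln_realpow)
  qed
  have "cmod (g (c + -1)) <= max (ln (l + 5)/(1 - h) ^ j) ((ln X)\<^sup>2/(4/3) ^ j) * cmod (-1 :: complex) ^ j"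
  proof (rule three_circles[where g = "%w. g (c + w)" and ?R0.0 = "17/12"])
  have "(%w. c + w) ` ball 0 (17/12) \<subseteq> {s. Re s > 1/2 & \<bar>Im s - t\<bar> < 2}"
  proof (intro image_subsetI CollectI conjI)
   fix w :: complex assume "w \<in> ball 0 (17/12)"
   then have "cmod w < 17/12" by simp
   then show "Re (c + w) > 1/2" "\<bar>Im (c + w) - t\<bar> < 2" using Re(1)[of w] Im[of w] \<delta> by linarith+
  qed
  then have "(g \<circ> (%w. c + w)) holomorphic_on ball 0 (17/12)"
   by (intro holomorphic_on_compose_gen[OF _ g(1)] holomorphic_intros) auto
  then show "(%w. g (c + w)) holomorphic_on ball 0 (17/12)" by (simp add: o_def)
  show "0 < 1 - h" "1 - h < 4/3" using h by auto
  show "1 - h <= cmod (-1)" using h by simp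
  fix w assume w: "cmod w = 1 - h"
  let ?s = "c + w"
  have R: "Re ?s >= 1 + \<delta> + h" "Re ?s <= 4" using Re[of w] w h \<delta> by linarith+
  then have s1: "Re ?s > 1" using \<delta> h by linarith
  have "1/(Re ?s - 1) <= 1 / h" using R h \<delta> by (intro divide_left_mono) auto
  then have "1/(Re ?s - 1) + Re ?s + 1 <= l + 5" using R by (simp add: h_def)
  moreover have "1/(Re ?s - 1) + Re ?s + 1 > 0" using s1 by (intro add_pos_pos) auto
  ultimately have "ln (1/(Re ?s - 1) + Re ?s + 1) <= ln (l + 5)" by (rule ln_mono)
  then show "cmod (g ?s) <= ln (l + 5)"
   using norm_log_series_chi_1_le_ln[OF s1] g(4)[of ?s] s1 Im[of w] w h by auto
  next
  fix w assume w: "cmod w = 4/3"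
  have "cmod (g (c + w)) <= C * ln (4 + \<bar>t\<bar>)*(1 + 1/(1/6))"
   by (rule g(5)) (use Re(1)[of w] Im[of w] w \<delta> in auto)
  also have "... = (7 * C) * ln (4 + \<bar>t\<bar>)" by simp
  also have "... <= (7 * C)*(2 * ln X)" using C(1) ln4 by (intro mult_left_mono) auto
  also have "... = (14 * C) * ln X" by simp
  also have "... <= ln X * ln X" using elim LX by (intro mult_right_mono) auto
  finally show "cmod (g (c + w)) <= (ln X)\<^sup>2" by (simp add: power2_eq_square)
  qed auto
  also have "... = max (ln (l + 5)/(1 - h) ^ j) ((ln X)\<^sup>2/(4/3) ^ j)" by simp
  also have "... <= \<epsilon> * l"
  proof (rule max.boundedI)
  have "(1 - h) ^ j >= exp (-18)"
  proof -
   have "- h - 2 * h\<^sup>2 <= ln (1 - h)" using ln_one_minus_pos_lower_bound[of h] h by simp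
   moreover have "2 * h\<^sup>2 <= h"
   using mult_right_mono[of "2 * h" 1 h] h by (simp add: power2_eq_square)
   ultimately have lh: "- 2 * h <= ln (1 - h)" by linarith
   have "h * real j <= h*(8 * l + 1)" using j h by (intro mult_left_mono) auto
   also have "... = 8 + h" using l by (simp add: h_def field_simps)
   finally have "-18 <= real j*(- 2 * h)" using h by (simp add: mult.commute)
   also have "... <= real j * ln (1 - h)" using lh by (intro mult_left_mono) auto
   finally have "exp (-18) <= exp (real j * ln (1 - h))" by simp
   also have "... = (1 - h) ^ j" using h by (simp add: exp_of_nat_mult)
   finally show ?thesis .
  qed
  then have "ln (l + 5)/(1 - h) ^ j <= ln (l + 5) / exp (-18)"
   using l h by (intro divide_left_mono mult_pos_pos zero_less_power) auto
  also have "... = exp 18 * ln (l + 5)" by (simp add: exp_minus divide_inverse mult.commute)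
  finally show "ln (l + 5)/(1 - h) ^ j <= \<epsilon> * l" using l by linarith
  have "exp (- (1/4)) >= 3/(4 :: real)" using exp_ge_add_one_self[of "- (1/4) :: real"] by simp
  then have "exp (1/4) <= 4/(3 :: real)" by (simp add: exp_minus field_simps)
  then have "exp (1/4) ^ j <= (4/3 :: real) ^ j" by (intro power_mono) auto
  moreover have "exp (1/4 :: real) ^ j = exp (real j*(1/4))" by (rule exp_of_nat_mult[symmetric])
  moreover have "exp (2 * l) <= exp (real j*(1/4))" using j by simp
  moreover have "exp (2 * l) = (ln X)\<^sup>2" by (simp add: exp_double el)
  ultimately have "(ln X)\<^sup>2 <= (4/3) ^ j" by linarith
  then have "(ln X)\<^sup>2/(4/3) ^ j <= 1" by simp
  then show "(ln X)\<^sup>2/(4/3) ^ j <= \<epsilon> * l" using l by linarith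
  qed
  finally have "cmod (g (c + -1)) <= \<epsilon> * l" .
  moreover have "c + -1 = 1 + of_real \<delta> + \<i> * of_real t" by (simp add: c_def)
  moreover have "g (1 + of_real \<delta> + \<i> * of_real t) = log_series (chi 1) (1 + of_real \<delta> + \<i> * of_real t)"
  using \<delta> by (intro g(4)) auto
  ultimately show "cmod (log_series (chi 1) (1 + of_real \<delta> + \<i> * of_real t)) <= \<epsilon> * l" by (simp only:)
 qed
 qed
qed

text \<open>For d = 1 the pole rules out the smoothed sums, and this bound for a single term takes
  their place. Three circles give |log zeta| <= (ln X)/8 on the line Re s = 1/2 + \<eta>; the
  one-sided bound for zeta'/zeta then carries the estimate to the critical line at a cost of at most
  another (ln X)/8.\<close>

lemma zeta_critical_bound:
 assumes RH: "GRH_for 1"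
 shows "\<forall>\<^sub>F X in at_top. \<forall>z. 0 <= Re z & Re z <= 1 / ln X & \<bar>Im z\<bar> <= X --> cmod (Dirichlet_L 1 (1/2 + z))^4 <= X"
proof -
 obtain C where C: "C > 0" "\<And>t. \<bar>t\<bar> >= 4 ==> \<exists>g. zeta_log_branch C t g"
 using log_zeta_exists[OF RH] by blast
 obtain C2 where C2: "C2 > 0" "\<And>s. \<bar>Im s\<bar> >= 2 ==> 1/2 < Re s ==> Re s <= 2 ==>
  Re (deriv (Dirichlet_L 1) s / Dirichlet_L 1 s) >= - C2 * ln (2 + \<bar>Im s\<bar>)"
 using logderiv_Dirichlet_L_bounds fundamental_discriminant_1 RH by fastforce
 define \<eta> where "\<eta> = min (1/4) (1/(16 * C2))"
 have \<eta>: "0 < \<eta>" "\<eta> <= 1/4" "C2*\<eta> <= 1/16"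
 using C2(1) by (auto simp: \<eta>_def min_def field_simps)
 define A where "A = 2 * C*(1 + 1/(\<eta>/2))"
 have A: "A > 0" using C(1) \<eta> by (auto simp: A_def intro!: mult_pos_pos add_pos_pos)
 define \<rho> where "\<rho> = 3/2 - \<eta>"
 define R where "R = 3/2 - \<eta>/2"
 have \<rho>R: "1 < \<rho>" "\<rho> < R" "R < 3/2" using \<eta> by (auto simp: \<rho>_def R_def)
 then have "\<rho> / R < 1" "0 < 1/(16 * A)" using A by auto
 \<comment> \<open>This power makes the outer circle contribute at most (ln X)/16; the inner one
   contributes the constant 3 times 4^j, absorbed by taking X large.\<close>
 then obtain j where "(\<rho> / R) ^ j < 1/(16 * A)" using real_arch_pow_inv by blast
 then have j: "A*(\<rho> / R) ^ j <= 1/16" using A by (simp add: field_simps)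
 have large: "\<forall>\<^sub>F X::real in at_top. ln X >= c" for c :: real
 using ln_at_top by (simp add: filterlim_at_top)
 have "\<forall>\<^sub>F X::real in at_top. X >= 130321" by (rule eventually_ge_at_top)
 with large[of "48*4 ^ j"] large[of "1 / \<eta>"] show ?thesis
 proof eventually_elim
 case (elim X)
 have LX: "ln X > 0" using elim \<eta> by (auto intro: less_le_trans[of 0 "1 / \<eta>"])
 have inv: "1 / ln X <= \<eta>" using elim \<eta> LX by (simp add: field_simps)
 show ?case
 proof (intro allI impI, elim conjE)
  fix z assume z: "0 <= Re z" "Re z <= 1 / ln X" "\<bar>Im z\<bar> <= X"
  define s where "s = 1/2 + z"
  define t where "t = Im z"
  have s: "Re s >= 1/2" "Re s <= 1/2 + \<eta>" "Im s = t" using z inv by (auto simp: s_def t_def)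
  show "cmod (Dirichlet_L 1 (1/2 + z))^4 <= X" unfolding s_def[symmetric]
  proof (cases "\<bar>t\<bar> < 4")
  case True
  have "s \<noteq> 1" using s \<eta> by auto
  then have "cmod (Dirichlet_L 1 s - 1/(s - 1)) <= cmod s*(1 + 1 / Re s)"
   by (rule norm_zeta_minus_pole_le[rotated]) (use s in auto)
  also have "... <= 5*(1 + 2)"
  proof (intro mult_mono)
   show "cmod s <= 5" using cmod_le[of s] s True \<eta> by linarith
   show "1 + 1 / Re s <= 1 + 2" using s by (simp add: field_simps)
  qed (use s in auto)
  finally have 1: "cmod (Dirichlet_L 1 s - 1/(s - 1)) <= 15" by simp
  have "1/4 <= cmod (s - 1)" using abs_Re_le_cmod[of "s - 1"] s \<eta> by simp
  then have "1 / cmod (s - 1) <= 1/(1/4)" by (intro divide_left_mono mult_pos_pos) auto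
  then have 2: "cmod (1/(s - 1)) <= 4" by (simp add: norm_divide)
  have "cmod (Dirichlet_L 1 s) <= 19"
   using norm_triangle_sub[of "Dirichlet_L 1 s" "1/(s - 1)"] 1 2 by linarith
  \<comment> \<open>19^4 = 130321 is the threshold imposed on X.\<close>
  then have "cmod (Dirichlet_L 1 s)^4 <= 19^4" by (intro power_mono) auto
  then show "cmod (Dirichlet_L 1 s)^4 <= X" using elim by simp
  next
  case False
  then have t: "\<bar>t\<bar> >= 4" "\<bar>t\<bar> <= X" using z by (auto simp: t_def)
  obtain g where "zeta_log_branch C t g" using C(2)[OF t(1)] by blast
  note g = zeta_log_branchD[OF this]
  have ln4: "ln (4 + \<bar>t\<bar>) <= 2 * ln X"
  proof -
   have "4 * X <= X * X" using elim by (intro mult_right_mono) auto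
   then have "4 + \<bar>t\<bar> <= X^2" using t elim unfolding power2_eq_square by linarith
   then have "ln (4 + \<bar>t\<bar>) <= ln (X^2)" by (subst ln_le_cancel_iff) (use elim in auto)
   then show ?thesis using elim by (simp add: ln_realpow)
  qed
  define c where "c = 2 + \<i> * of_real t"
  have Re: "Re (c + w) >= 2 - cmod w" for w using abs_Re_le_cmod[of w] by (auto simp: c_def)
  have Im: "\<bar>Im (c + w) - t\<bar> <= cmod w" for w using abs_Im_le_cmod[of w] by (auto simp: c_def)
  have n\<rho>: "cmod (- of_real \<rho>) = \<rho>" using \<rho>R by simp
  have "cmod (g (c + - of_real \<rho>)) <= max (3/(1/2) ^ j) (A * ln X / R ^ j) * cmod (- of_real \<rho> :: complex) ^ j"
  proof (rule three_circles[where g = "%w. g (c + w)" and ?R0.0 = "3/2 - \<eta>/4"])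
   have "(%w. c + w) ` ball 0 (3/2 - \<eta>/4) \<subseteq> {s. Re s > 1/2 & \<bar>Im s - t\<bar> < 2}"
   proof (intro image_subsetI CollectI conjI)
   fix w :: complex assume "w \<in> ball 0 (3/2 - \<eta>/4)"
   then have "cmod w < 3/2 - \<eta>/4" by simp
   then show "Re (c + w) > 1/2" "\<bar>Im (c + w) - t\<bar> < 2" using Re[of w] Im[of w] \<eta> by linarith+
   qed
   then have "(g \<circ> (%w. c + w)) holomorphic_on ball 0 (3/2 - \<eta>/4)"
   by (intro holomorphic_on_compose_gen[OF _ g(1)] holomorphic_intros) auto
   then show "(%w. g (c + w)) holomorphic_on ball 0 (3/2 - \<eta>/4)" by (simp add: o_def)
   show "1/2 < R" "R < 3/2 - \<eta>/4" using \<eta> by (auto simp: R_def)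
   show "1/2 <= cmod (- of_real \<rho> :: complex)" "cmod (- of_real \<rho> :: complex) <= R" unfolding n\<rho> using \<rho>R by auto
   fix w assume w: "cmod w = 1/2"
   let ?s = "c + w"
   have R: "Re ?s >= 3/2" using Re[of w] w by linarith
   then have s1: "Re ?s > 1" by linarith
   have "1/(Re ?s - 1) <= 1/(1/2)" using R by (intro divide_left_mono) auto
   also have "1/(1/2) = (2 :: real)" by simp
   finally have "cmod (log_series (chi 1) ?s) <= 3"
   using norm_log_series_le[of "chi 1" ?s, OF norm_chi_le s1] by linarith
   then show "cmod (g ?s) <= 3" using g(4)[of ?s] s1 Im[of w] w by auto
  next
   fix w assume w: "cmod w = R"
   have "cmod (g (c + w)) <= C * ln (4 + \<bar>t\<bar>)*(1 + 1/(\<eta>/2))"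
   proof (rule g(5))
   show "Re (c + w) >= 1/2 + \<eta>/2" using Re[of w] w unfolding R_def by linarith
   show "\<bar>Im (c + w) - t\<bar> < 2" using Im[of w] w \<rho>R by linarith
   qed (use \<eta> in auto)
   also have "... = (C*(1 + 1/(\<eta>/2))) * ln (4 + \<bar>t\<bar>)" by simp
   also have "... <= (C*(1 + 1/(\<eta>/2)))*(2 * ln X)"
   by (rule mult_left_mono[OF ln4]) (use C(1) \<eta> in auto)
   also have "... = A * ln X" unfolding A_def by (simp only: mult_ac)
   finally show "cmod (g (c + w)) <= A * ln X" .
  qed auto
  also have "... <= (3/(1/2) ^ j + A * ln X / R ^ j)*\<rho> ^ j"
   unfolding n\<rho> by (rule mult_right_mono) (use A LX \<rho>R in auto)
  also have "... = 3*(2*\<rho>) ^ j + (A*(\<rho> / R) ^ j) * ln X"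
   by (simp add: power_mult_distrib power_divide field_simps)
  also have "... <= 3*4 ^ j + (1/16) * ln X"
  proof (intro add_mono mult_left_mono mult_right_mono j power_mono)
   show "2*\<rho> <= 4" using \<rho>R by linarith
  qed (use \<rho>R LX in auto)
  also have "... <= ln X/8" using elim by simp
  finally have g1: "cmod (g (c + - of_real \<rho>)) <= ln X/8" .
  have cr: "c + - of_real \<rho> = of_real (1/2 + \<eta>) + \<i> * of_real t" by (simp add: c_def \<rho>_def)
  \<comment> \<open>Increasing in x, because the real part of zeta'/zeta is at least -C2 ln(2 +
    |t|). Hence the value near 1/2 is controlled by the value at 1/2 + \<eta>.\<close>
  define \<phi> where "\<phi> = (%x. Re (g (of_real x + \<i> * of_real t)) + (C2 * ln (2 + \<bar>t\<bar>)) * x)"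
  have bound: "cmod (Dirichlet_L 1 (of_real x + \<i> * of_real t)) <= exp (ln X/4)" if x: "1/2 < x" "x <= 1/2 + \<eta>" for x
  proof -
   have "\<phi> x <= \<phi> (1/2 + \<eta>)"
   proof (rule DERIV_nonneg_imp_nondecreasing[OF x(2)])
   fix y assume y: "x <= y" "y <= 1/2 + \<eta>"
   let ?s = "of_real y + \<i> * of_real t :: complex"
   let ?d = "deriv (Dirichlet_L 1) ?s / Dirichlet_L 1 ?s"
   have "(g has_field_derivative ?d) (at ?s)" by (rule g(3)) (use x y in auto)
   moreover have "((%y. of_real y + \<i> * of_real t :: complex) has_vector_derivative 1) (at y)"
    unfolding has_vector_derivative_def by (auto intro!: derivative_eq_intros simp: scaleR_conv_of_real)
   ultimately have "((g \<circ> (%y. of_real y + \<i> * of_real t)) has_vector_derivative 1 * ?d) (at y)"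
    by (intro field_vector_diff_chain_at)
   then have "((%y. Re ((g \<circ> (%y. of_real y + \<i> * of_real t)) y)) has_real_derivative Re (1 * ?d)) (at y)"
    by (rule has_field_derivative_Re)
   then have "((%y. Re (g (of_real y + \<i> * of_real t))) has_real_derivative Re ?d) (at y)" by (simp add: o_def)
   then have "(\<phi> has_real_derivative Re ?d + C2 * ln (2 + \<bar>t\<bar>)) (at y)"
    unfolding \<phi>_def by (rule DERIV_add[OF _ DERIV_cmult_Id])
   moreover have "Re ?d >= - C2 * ln (2 + \<bar>Im ?s\<bar>)" by (rule C2(2)) (use t x y \<eta> in auto)
   ultimately show "\<exists>d. (\<phi> has_real_derivative d) (at y) & 0 <= d" by (intro exI[of _ "Re ?d + C2 * ln (2 + \<bar>t\<bar>)"]) auto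
   qed
   then have "Re (g (of_real x + \<i> * of_real t)) <= Re (g (c + - of_real \<rho>)) + C2 * ln (2 + \<bar>t\<bar>)*(1/2 + \<eta> - x)"
   unfolding cr by (simp add: \<phi>_def algebra_simps)
   also have "Re (g (c + - of_real \<rho>)) <= ln X/8" using g1 complex_Re_le_cmod[of "g (c + - of_real \<rho>)"] by linarith
   also have "C2 * ln (2 + \<bar>t\<bar>)*(1/2 + \<eta> - x) <= C2*(2 * ln X)*\<eta>"
   proof (intro mult_mono mult_nonneg_nonneg)
   have "ln (2 + \<bar>t\<bar>) <= ln (4 + \<bar>t\<bar>)" by (subst ln_le_cancel_iff) auto
   then show "ln (2 + \<bar>t\<bar>) <= 2 * ln X" using ln4 by linarith
   qed (use C2(1) x LX in auto)
   also have "C2*(2 * ln X)*\<eta> = (C2*\<eta>)*(2 * ln X)" by simp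
   also have "... <= (1/16)*(2 * ln X)" using \<eta> LX by (intro mult_right_mono) auto
   finally have "Re (g (of_real x + \<i> * of_real t)) <= ln X/4" by simp
   then have "cmod (exp (g (of_real x + \<i> * of_real t))) <= exp (ln X/4)" by simp
   moreover have "exp (g (of_real x + \<i> * of_real t)) = Dirichlet_L 1 (of_real x + \<i> * of_real t)"
   by (rule g(2)) (use x in auto)
   ultimately show ?thesis by simp
  qed
  have "cmod (Dirichlet_L 1 s) <= exp (ln X/4)"
  proof (cases "Re s = 1/2")
   case False
   have "s = of_real (Re s) + \<i> * of_real t" using s by (simp add: complex_eq_iff)
   then show ?thesis using bound[of "Re s"] s False by simp
  next
   case True
   have s_eq: "s = of_real (1/2) + \<i> * of_real t" using s True by (simp add: complex_eq_iff)
   have "isCont (Dirichlet_L 1) s"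
   proof -
   have "open (L_domain 1)" "s \<in> L_domain 1" using True by (auto simp: L_domain_def)
   then show ?thesis
    using holomorphic_on_imp_continuous_on[OF holomorphic_Dirichlet_L[OF fundamental_discriminant_1]]
    by (simp add: continuous_on_eq_continuous_at)
   qed
   moreover have "((%x. of_real x + \<i> * of_real t) \<longlongrightarrow> s) (at_right (1/2))"
   unfolding s_eq by (intro tendsto_intros)
   ultimately have "((%x. cmod (Dirichlet_L 1 (of_real x + \<i> * of_real t))) \<longlongrightarrow> cmod (Dirichlet_L 1 s)) (at_right (1/2))"
   by (intro tendsto_norm) (rule isCont_tendsto_compose)
   moreover have "\<forall>\<^sub>F x in at_right (1/2). cmod (Dirichlet_L 1 (of_real x + \<i> * of_real t)) <= exp (ln X/4)"
   unfolding eventually_at_right_field using \<eta> bound by (intro exI[of _ "1/2 + \<eta>"]) auto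
   ultimately show ?thesis by (rule tendsto_upperbound) simp
  qed
  then have "cmod (Dirichlet_L 1 s)^4 <= exp (ln X/4)^4" by (intro power_mono) auto
  also have "... = X" using elim by (simp flip: exp_of_nat_mult)
  finally show "cmod (Dirichlet_L 1 s)^4 <= X" .
  qed
 qed
 qed
qed

section \<open>Sums over primes compared with log zeta\<close>

definition ppw :: "nat \<Rightarrow> real" where
 "ppw n = mangoldt n / ln (real n)"

lemma ppw_0 [simp]: "ppw 0 = 0" and ppw_1 [simp]: "ppw (Suc 0) = 0"
 by (simp_all add: ppw_def)

lemma ppw_prime_power: "prime p ==> k > 0 ==> ppw (p ^ k) = 1 / real k"
 using prime_gt_1_nat[of p] by (simp add: ppw_def ln_realpow)

lemma ppw_prime: "prime p ==> ppw p = 1"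
 using ppw_prime_power[of p 1] by simp

lemma ppw_nonneg: "ppw n >= 0"
 by (cases "n = 0") (auto simp: ppw_def intro!: divide_nonneg_nonneg mangoldt_nonneg)

lemma ppw_le_1: "ppw n <= 1"
proof -
 have "cmod (of_real (ppw n)) <= 1"
 using norm_mangoldt_over_ln_le[of n] by (simp add: ppw_def)
 then show ?thesis using ppw_nonneg[of n] by (simp only: norm_of_real)
qed

lemma ppw_nonzero_imp:
 assumes "ppw n \<noteq> 0"
 obtains p k where "prime p" "k > 0" "n = p ^ k"
 using assms by (auto simp: ppw_def mangoldt_def primepow_def split: if_splits)

lemma ppw_sums:
 assumes "\<sigma> > 1"
 shows "(%n. ppw n * real n powr - \<sigma> * cos (t * ln (real n))) sums
 Re (log_series (chi 1) (of_real \<sigma> + \<i> * of_real t))"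
proof -
 let ?s = "of_real \<sigma> + \<i> * of_real t :: complex"
 let ?a = "%n. mangoldt n / of_real (ln (real n)) * chi 1 n * of_nat n powr - ?s"
 have "summable (%n. cmod (?a n))"
 by (rule summable_dirichlet_series_norm) (use assms norm_log_coeff_le norm_chi_le in auto)
 then have "?a sums log_series (chi 1) ?s"
 unfolding log_series_def dirichlet_series_def by (rule summable_sums[OF summable_norm_cancel])
 then have "(%n. Re (?a n)) sums Re (log_series (chi 1) ?s)" by (rule sums_Re)
 moreover have "Re (?a n) = ppw n * real n powr - \<sigma> * cos (t * ln (real n))" for n
 proof (cases "n = 0")
 case False
 have m: "(mangoldt n / of_real (ln (real n)) :: complex) = of_real (ppw n)" by (simp add: ppw_def)
 have p: "of_nat n powr - ?s = of_real (real n powr - \<sigma>) * cis (- (t * ln (real n)))"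
  by (rule of_nat_powr_imaginary) (use False in simp)
 have c: "chi 1 n = 1" by (rule chi_1) (use False in simp)
 show ?thesis unfolding m p c by simp
 qed simp
 ultimately show ?thesis by simp
qed

lemma ppw_sums_0:
 assumes "\<sigma> > 1"
 shows "(%n. ppw n * real n powr - \<sigma>) sums Re (log_series (chi 1) (of_real \<sigma>))"
 using ppw_sums[OF assms, of 0] by simp

text \<open>Up to bounded errors the two values of zeta are 2/\<delta> and 1/\<delta>; their ratio
  is at most 16. For large \<delta> the lower bound zeta >= 1 is used.\<close>

lemma log_zeta_gap:
 assumes \<delta>: "0 < \<delta>" "\<delta> <= 1"
 shows "Re (log_series (chi 1) (of_real (1 + \<delta>/2))) - Re (log_series (chi 1) (of_real (1 + \<delta>))) <= 4"
proof -
 let ?R = "%\<sigma>. Re (log_series (chi 1) (of_real \<sigma>))"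
 have 1: "exp (?R (1 + \<delta>/2)) <= 2 / \<delta> + 5/2"
 using zeta_real_bounds(1,3)[of "1 + \<delta>/2"] \<delta> by simp
 have 2: "exp (?R (1 + \<delta>)) >= 1 / \<delta> - 3" using zeta_real_bounds(2,3)[of "1 + \<delta>"] \<delta> by simp
 have 3: "exp (?R (1 + \<delta>)) >= 1" using zeta_real_bounds(4)[of "1 + \<delta>"] \<delta> by simp
 have d2: "2 / \<delta> = 2*(1 / \<delta>)" by simp
 have "exp (?R (1 + \<delta>/2)) <= 16 * exp (?R (1 + \<delta>))"
 using 1 2 3 unfolding d2 by (cases "1 / \<delta> <= 6") linarith+
 also have "... = exp (ln 16 + ?R (1 + \<delta>))" by (simp add: exp_add)
 finally have "?R (1 + \<delta>/2) <= ln 16 + ?R (1 + \<delta>)" by simp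
 moreover have "ln (16 :: real) <= 4"
 proof -
 have "ln (16 :: real) = ln (2^4)" by simp
 also have "... = 4 * ln 2" by (subst ln_realpow) auto
 finally show ?thesis using ln_le_minus_one[of "2 :: real"] by simp
 qed
 ultimately show ?thesis by linarith
qed

text \<open>The n-th term of log zeta(1 + \<delta>/2) - log zeta(1 + \<delta>). These terms are
  nonnegative with total at most 4, and they are comparable with the terms of log zeta(1 + \<delta>)
  near and beyond n = exp(1/\<delta>). So they control every error made in replacing smooth weights
  by a sharp cutoff, in place of the estimates of Chebyshev and Mertens.\<close>

definition gap :: "real \<Rightarrow> nat \<Rightarrow> real" where
 "gap \<delta> n = ppw n * real n powr - (1 + \<delta>)*(real n powr (\<delta>/2) - 1)"

lemma gap_sums:
 assumes "\<delta> > 0"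
 shows "gap \<delta> sums (Re (log_series (chi 1) (of_real (1 + \<delta>/2))) - Re (log_series (chi 1) (of_real (1 + \<delta>))))"
proof -
 have "(%n. ppw n * real n powr - (1 + \<delta>/2) - ppw n * real n powr - (1 + \<delta>)) sums
 (Re (log_series (chi 1) (of_real (1 + \<delta>/2))) - Re (log_series (chi 1) (of_real (1 + \<delta>))))"
 by (intro sums_diff ppw_sums_0) (use assms in auto)
 moreover have "ppw n * real n powr - (1 + \<delta>/2) - ppw n * real n powr - (1 + \<delta>) = gap \<delta> n" for n
 proof -
 have "real n powr - (1 + \<delta>/2) = real n powr - (1 + \<delta>) * real n powr (\<delta>/2)"
 proof -
  have "- (1 + \<delta>/2) = - (1 + \<delta>) + \<delta>/2" by (simp add: field_simps)
  then show ?thesis by (simp only: powr_add)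
 qed
 then show ?thesis by (simp add: gap_def right_diff_distrib)
 qed
 ultimately show ?thesis by simp
qed

lemma gap_nonneg: "\<delta> > 0 ==> gap \<delta> n >= 0"
 unfolding gap_def by (cases "n = 0") (auto intro!: mult_nonneg_nonneg ppw_nonneg ge_one_powr_ge_zero)

lemma gap_sum_le:
 assumes \<delta>: "0 < \<delta>" "\<delta> <= 1" and A: "finite A"
 shows "sum (gap \<delta>) A <= 4"
proof -
 have "sum (gap \<delta>) A <= suminf (gap \<delta>)"
 by (rule sum_le_suminf) (use gap_sums[OF \<delta>(1)] A gap_nonneg \<delta> in \<open>auto simp: sums_iff\<close>)
 then show ?thesis using gap_sums[OF \<delta>(1)] log_zeta_gap[OF \<delta>] by (simp add: sums_iff)
qed

lemma finite_primes_le: "finite {p. prime (p :: nat) & real p <= y & P p}"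
proof (rule finite_subset)
 show "{p. prime p & real p <= y & P p} \<subseteq> {..nat \<lfloor>y\<rfloor>}" by (auto simp: le_nat_floor)
qed simp

lemma inverse_ln_ge_3:
 assumes "y >= (3 :: real)"
 shows "0 < 1 / ln y" "1 / ln y <= 1" "ln y >= 1"
proof -
 have "exp 1 <= y" using assms exp_le by linarith
 then have "ln (exp 1) <= ln y" using assms by (subst ln_le_cancel_iff) auto
 then show "ln y >= 1" by simp
 then show "0 < 1 / ln y" "1 / ln y <= 1" by auto
qed

lemma powr_inverse_ln:
 assumes "y >= (3 :: real)" "1 <= x" "x <= y"
 shows "x powr (1 / ln y) <= 3" "1 / x <= 3 * x powr - (1 + 1 / ln y)"
proof -
 have "ln x <= ln y" using assms by (subst ln_le_cancel_iff) auto
 then have "1 / ln y * ln x <= 1" using inverse_ln_ge_3[OF assms(1)] by (simp add: field_simps)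
 then have "exp (1 / ln y * ln x) <= exp 1" by simp
 moreover have "x powr (1 / ln y) = exp (1 / ln y * ln x)" using assms by (simp only: powr_def) simp
 ultimately show *: "x powr (1 / ln y) <= 3" using exp_le by linarith
 have "1 / x = x powr (1 / ln y) * x powr - (1 + 1 / ln y)"
 using assms by (simp add: powr_add[symmetric] powr_minus_divide)
 also have "... <= 3 * x powr - (1 + 1 / ln y)" using * by (intro mult_right_mono) auto
 finally show "1 / x <= 3 * x powr - (1 + 1 / ln y)" .
qed

text \<open>With \<delta> = 1/ln x, a prime p in the window has \<open>gap\<close> at least a
  constant times (ln z / ln x)/p. Since the gaps sum to at most 4, the bound follows, with 24 = 6
  times 4.\<close>

lemma prime_reciprocal_window:
 assumes z: "1 < z" and x: "3 <= x"
 shows "(\<Sum>p | prime p & real p <= x & z < real p. 1 / real p) <= 24*(ln x / ln z)"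
proof -
 let ?\<delta> = "1 / ln x" and ?P = "{p. prime p & real p <= x & z < real p}"
 note \<delta> = inverse_ln_ge_3[OF x]
 have lz: "ln z > 0" using z by simp
 have "(\<Sum>p\<in>?P. 1 / real p) <= (\<Sum>p\<in>?P. 6*(ln x / ln z) * gap ?\<delta> p)"
 proof (rule sum_mono)
 fix p assume p: "p \<in> ?P"
 then have pz: "real p > z" and p1: "real p > 1" using z by auto
 have "ln z <= ln (real p)" using pz z by (subst ln_le_cancel_iff) auto
 then have "?\<delta>/2 * ln z <= ?\<delta>/2 * ln (real p)" using \<delta> by (intro mult_left_mono) auto
 also have "... <= real p powr (?\<delta>/2) - 1"
 proof -
  have "real p powr (?\<delta>/2) = exp (?\<delta>/2 * ln (real p))" using p1 by (simp only: powr_def) simp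
  then show ?thesis using exp_ge_add_one_self[of "?\<delta>/2 * ln (real p)"] by linarith
 qed
 finally have g: "?\<delta>/2 * ln z <= real p powr (?\<delta>/2) - 1" .
 have "1 / real p <= 3 * real p powr - (1 + ?\<delta>)" by (rule powr_inverse_ln(2)) (use x p p1 in auto)
 also have "... = 6*(ln x / ln z)*(real p powr - (1 + ?\<delta>)*(?\<delta>/2 * ln z))"
  using lz \<delta>(3) by (simp add: field_simps)
 also have "... <= 6*(ln x / ln z)*(real p powr - (1 + ?\<delta>)*(real p powr (?\<delta>/2) - 1))"
  using lz \<delta>(3) g by (intro mult_left_mono) auto
 also have "... = 6*(ln x / ln z) * gap ?\<delta> p" using p by (simp add: gap_def ppw_prime)
 finally show "1 / real p <= 6*(ln x / ln z) * gap ?\<delta> p" .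
 qed
 also have "... = 6*(ln x / ln z) * sum (gap ?\<delta>) ?P" by (simp add: sum_distrib_left)
 also have "... <= 6*(ln x / ln z)*4"
 using lz \<delta> by (intro mult_left_mono gap_sum_le finite_primes_le) auto
 finally show ?thesis by simp
qed

definition high_powers :: "nat \<Rightarrow> nat \<Rightarrow> nat set" where
 "high_powers j N = {n \<in> {1..N}. \<exists>p k. prime p & j <= k & n = p ^ k}"

text \<open>For each p the exponents k >= j form a geometric series with ratio at most 3/4, hence at
  most 4 p^(-j \<sigma>) <= 4 p^(-3/2); summing over p >= 2 gives at most 4 times 3. The two uses
  are squares at \<sigma> = 1 and cubes at \<sigma> = 1/2.\<close>

lemma sum_high_powers_le:
 assumes \<sigma>: "\<sigma> >= 1/2" and j: "real j*\<sigma> >= 3/2"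
 shows "(\<Sum>n\<in>high_powers j N. real n powr - \<sigma>) <= 12"
proof -
 have sub: "high_powers j N \<subseteq> (%(p, k). p ^ k) ` ({2..N + 1} \<times> {j..N})"
 proof
 fix n assume "n \<in> high_powers j N"
 then obtain p k where pk: "prime p" "j <= k" "n = p ^ k" "n <= N" by (auto simp: high_powers_def)
 have j0: "j > 0" using j by (cases "j = 0") auto
 have p2: "p >= 2" using pk(1) by (rule prime_ge_2_nat)
 have "p <= p ^ k" using self_le_power[of p k] p2 pk(2) j0 by simp
 moreover have "k < 2 ^ k" by (rule less_exp)
 moreover have "(2::nat) ^ k <= p ^ k" using p2 by (intro power_mono) auto
 ultimately have "p <= N + 1" "k <= N" using pk by linarith+
 then show "n \<in> (%(p, k). p ^ k) ` ({2..N + 1} \<times> {j..N})" using pk p2 by (intro image_eqI[of _ _ "(p, k)"]) auto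
 qed
 have "(\<Sum>n\<in>high_powers j N. real n powr - \<sigma>) <= (\<Sum>n\<in>(%(p, k). p ^ k) ` ({2..N + 1} \<times> {j..N}). real n powr - \<sigma>)"
 by (rule sum_mono2[OF _ sub]) auto
 also have "... <= sum ((%n. real n powr - \<sigma>) \<circ> (%(p, k). p ^ k)) ({2..N + 1} \<times> {j..N})"
 by (rule sum_image_le) auto
 also have "... = (\<Sum>p=2..N + 1. \<Sum>k=j..N. real (p ^ k) powr - \<sigma>)"
 by (simp add: sum.cartesian_product case_prod_unfold o_def)
 also have "... <= (\<Sum>p=2..N + 1. 4 * real p powr (- (1/2) - 1))"
 proof (rule sum_mono)
 fix p assume "p \<in> {2..N + 1}"
 then have p: "real p >= 2" by auto
 define q where "q = real p powr - \<sigma>"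
 have "q <= real p powr - (1/2)" unfolding q_def using p \<sigma> by (intro powr_mono) auto
 also have "... <= 2 powr - (1/2)" using p by (intro powr_mono2') auto
 also have "... = 1 / sqrt 2" by (simp add: powr_minus_divide powr_half_sqrt)
 also have "... <= 3/4"
 proof -
  have "4/3 <= sqrt 2" by (rule real_le_rsqrt) (simp add: power2_eq_square)
  then have "1 / sqrt 2 <= 1/(4/3)" by (intro divide_left_mono) auto
  then show ?thesis by simp
 qed
 finally have q: "0 <= q" "q <= 3/4" by (auto simp: q_def)
 have e: "real (p ^ k) powr - \<sigma> = q ^ k" for k
  using p by (simp add: q_def powr_realpow[symmetric] powr_powr powr_power mult.commute)
 have "(\<Sum>k=j..N. q ^ k) <= 4 * q ^ j"
 proof (cases "j <= N")
  case True
  have "(1 - q)*(\<Sum>k=j..N. q ^ k) = q ^ j - q ^ Suc N" using True by (rule sum_gp_multiplied)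
  then have "(1 - q)*(\<Sum>k=j..N. q ^ k) <= q ^ j" using q zero_le_power[of q "Suc N"] by linarith
  moreover have "1/4*(\<Sum>k=j..N. q ^ k) <= (1 - q)*(\<Sum>k=j..N. q ^ k)"
  using q by (intro mult_right_mono sum_nonneg) auto
  ultimately show ?thesis by linarith
 qed (use q in auto)
 also have "q ^ j = real p powr - (real j*\<sigma>)" using p by (simp add: q_def powr_power mult.commute)
 also have "... <= real p powr (- (1/2) - 1)" using p j by (intro powr_mono) auto
 finally show "(\<Sum>k=j..N. real (p ^ k) powr - \<sigma>) <= 4 * real p powr (- (1/2) - 1)" by (simp only: e)
 qed
 also have "... = 4*(\<Sum>n\<in>{1..<N + 1}. real (Suc n) powr (- (1/2) - 1))"
 unfolding sum_distrib_left
 by (rule sum.reindex_bij_witness[of _ Suc "%n. n - 1"]) auto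
 also have "(\<Sum>n\<in>{1..<N + 1}. real (Suc n) powr (- (1/2) - 1)) <= (\<Sum>n. real (Suc n) powr (- (1/2) - 1))"
 proof (rule sum_le_suminf)
 have "summable (%n. real n powr (- (1/2) - 1))" by (simp add: summable_real_powr_iff)
 then show "summable (%n. real (Suc n) powr (- (1/2) - 1))" by (rule summable_ignore_initial_segment[where k = 1, simplified])
 qed auto
 also have "... <= 3" using sums_Suc_powr_bound[of "1/2"] by simp
 finally show ?thesis by simp
qed

text \<open>The constant is 44 = 8 + 24 + 12. Beyond y every term of the series is at most twice its
  gap, so adding 2 \<open>gap\<close> makes the omitted tail nonnegative at a cost of 8. For primes
  up to y, exchanging p^(-1) for p^(-1-\<delta>) costs at most 6 gaps, hence 24. Proper prime powers
  cost 12.\<close>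

lemma prime_cos_sum_le_log_zeta:
 assumes y: "y >= 3"
 shows "(\<Sum>p | prime p & real p <= y. cos (t * ln (real p)) / real p)
 <= Re (log_series (chi 1) (of_real (1 + 1 / ln y) + \<i> * of_real t)) + 44"
proof -
 define \<delta> where "\<delta> = 1 / ln y"
 have \<delta>: "0 < \<delta>" "\<delta> <= 1" using inverse_ln_ge_3[OF y] by (auto simp: \<delta>_def)
 let ?a = "%n. ppw n * real n powr - (1 + \<delta>) * cos (t * ln (real n))"
 let ?R = "Re (log_series (chi 1) (of_real (1 + \<delta>) + \<i> * of_real t))"
 define N where "N = nat \<lfloor>y\<rfloor>"
 let ?A = "{1..N}" and ?P = "{p. prime p & real p <= y}"
 have N: "n <= N \<longleftrightarrow> real n <= y" for n using y unfolding N_def by (simp add: le_nat_iff le_floor_iff)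
 have PA: "?P \<subseteq> ?A" using N prime_gt_0_nat by (auto simp: Suc_le_eq)
 have as: "?a sums ?R" by (rule ppw_sums) (use \<delta> in auto)
 have "(\<Sum>n\<in>?A. ?a n + 2 * gap \<delta> n) <= (\<Sum>n. ?a n + 2 * gap \<delta> n)"
 proof (rule sum_le_suminf)
 show "summable (%n. ?a n + 2 * gap \<delta> n)"
  by (intro summable_add summable_mult sums_summable[OF as] sums_summable[OF gap_sums[OF \<delta>(1)]])
 show "?a n + 2 * gap \<delta> n >= 0" if n: "n \<in> - ?A" for n
 proof (cases "n = 0")
  case False
  then have ny: "real n > y" using n N[of n] by auto
  then have "ln y <= ln (real n)" using y by (subst ln_le_cancel_iff) auto
  then have "1/2 <= \<delta>/2 * ln (real n)" using \<delta> inverse_ln_ge_3[OF y] by (simp add: \<delta>_def field_simps)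
  then have "1/2 <= real n powr (\<delta>/2) - 1"
  proof -
  have "real n powr (\<delta>/2) = exp (\<delta>/2 * ln (real n))" using False by (simp only: powr_def) simp
  then show "1/2 <= real n powr (\<delta>/2) - 1" if "1/2 <= \<delta>/2 * ln (real n)"
   using that exp_ge_add_one_self[of "\<delta>/2 * ln (real n)"] by linarith
  qed
  then have "ppw n * real n powr - (1 + \<delta>)*(1/2) <= gap \<delta> n"
  unfolding gap_def by (intro mult_left_mono mult_nonneg_nonneg ppw_nonneg) auto
  moreover have "ppw n * real n powr - (1 + \<delta>)*(-1) <= ?a n"
  by (intro mult_left_mono mult_nonneg_nonneg ppw_nonneg cos_ge_minus_one) auto
  ultimately show ?thesis by linarith
 qed (simp add: gap_def)
 qed simp
 also have "... = ?R + 2 * suminf (gap \<delta>)"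
 using sums_add[OF as sums_mult[OF summable_sums[OF sums_summable[OF gap_sums[OF \<delta>(1)]]], of 2]]
 by (rule sums_unique[symmetric])
 also have "suminf (gap \<delta>) <= 4" using gap_sums[OF \<delta>(1)] log_zeta_gap[OF \<delta>] by (simp add: sums_iff)
 finally have "(\<Sum>n\<in>?A. ?a n) + (\<Sum>n\<in>?A. 2 * gap \<delta> n) <= ?R + 8" by (simp add: sum.distrib)
 moreover have "(\<Sum>n\<in>?A. 2 * gap \<delta> n) >= 0" by (intro sum_nonneg mult_nonneg_nonneg gap_nonneg \<delta>) auto
 ultimately have 1: "(\<Sum>n\<in>?A. ?a n) <= ?R + 8" by linarith
 have "(\<Sum>p\<in>?P. cos (t * ln (real p)) / real p - ?a p) <= (\<Sum>p\<in>?P. 6 * gap \<delta> p)"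
 proof (rule sum_mono)
 fix p assume p: "p \<in> ?P"
 then have pr: "prime p" and py: "real p <= y" and p1: "real p > 1" using prime_gt_1_nat by auto
 define u where "u = real p powr (\<delta>/2)"
 define v where "v = real p powr - (1 + \<delta>)"
 have u: "u >= 1" unfolding u_def using p1 \<delta> by (intro ge_one_powr_ge_zero) auto
 have uu: "u * u <= 3" unfolding u_def using powr_inverse_ln(1)[OF y, of "real p"] p1 py
  by (simp add: powr_add[symmetric] \<delta>_def)
 have v: "v >= 0" by (simp add: v_def)
 have inv: "1 / real p = v * (u * u)"
  unfolding u_def v_def using p1 by (simp add: powr_add[symmetric] powr_minus_divide)
 have "cos (t * ln (real p)) / real p - ?a p = cos (t * ln (real p))*(1 / real p) - cos (t * ln (real p)) * v"
  using pr by (simp add: ppw_prime v_def)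
 also have "... = cos (t * ln (real p))*(v * (u * u) - v)" unfolding inv by (simp only: right_diff_distrib)
 also have "... <= 1*(v * (u * u) - v)"
 proof (intro mult_right_mono cos_le_one)
  have "1*1 <= u * u" using u by (intro mult_mono) auto
  then have "v * 1 <= v * (u * u)" using v by (intro mult_left_mono) auto
  then show "0 <= v * (u * u) - v" by simp
 qed
 also have "... = (v * (u - 1))*(u + 1)" by (simp add: algebra_simps)
 also have "... <= (v * (u - 1))*6"
 proof (intro mult_left_mono mult_nonneg_nonneg v)
  have "u*1 <= u * u" using u by (intro mult_left_mono) auto
  then show "u + 1 <= 6" using uu by linarith
 qed (use u in auto)
 also have "... = 6 * gap \<delta> p" using pr by (simp add: gap_def ppw_prime u_def v_def)
 finally show "cos (t * ln (real p)) / real p - ?a p <= 6 * gap \<delta> p" .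
 qed
 also have "... = 6 * sum (gap \<delta>) ?P" by (simp add: sum_distrib_left)
 also have "... <= 6*4" using finite_primes_le[of y "%_. True"] by (intro mult_left_mono gap_sum_le \<delta>) auto
 finally have 2: "(\<Sum>p\<in>?P. cos (t * ln (real p)) / real p) - (\<Sum>p\<in>?P. ?a p) <= 24" by (simp add: sum_subtractf)
 have "(\<Sum>n\<in>?A - ?P. - ?a n) <= (\<Sum>n\<in>?A - ?P. if n \<in> high_powers 2 N then real n powr - 1 else 0)"
 proof (rule sum_mono)
 fix n assume n: "n \<in> ?A - ?P"
 show "- ?a n <= (if n \<in> high_powers 2 N then real n powr - 1 else 0)"
 proof (cases "ppw n = 0")
  case False
  then obtain p k where pk: "prime p" "k > 0" "n = p ^ k" by (rule ppw_nonzero_imp)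
  have "k \<noteq> 1" using pk n N[of n] by auto
  then have "2 <= k" using pk(2) by linarith
  then have hp: "n \<in> high_powers 2 N" using pk(1,3) n unfolding high_powers_def by blast
  have "- ?a n = (ppw n * real n powr - (1 + \<delta>))*(- cos (t * ln (real n)))" by simp
  also have "... <= (ppw n * real n powr - (1 + \<delta>))*1"
  using cos_ge_minus_one[of "t * ln (real n)"] ppw_nonneg[of n] by (intro mult_left_mono) auto
  also have "... <= (1 * real n powr - 1)*1"
  using n \<delta> by (intro mult_right_mono mult_mono powr_mono ppw_le_1) auto
  finally show ?thesis using hp by simp
 qed simp
 qed
 also have "... <= (\<Sum>n\<in>?A. if n \<in> high_powers 2 N then real n powr - 1 else 0)"
 by (rule sum_mono2) auto
 also have "... = (\<Sum>n\<in>high_powers 2 N. real n powr - 1)"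
 by (subst sum.inter_restrict[symmetric]) (auto simp: high_powers_def intro!: sum.cong)
 also have "... <= 12" by (rule sum_high_powers_le) auto
 finally have 3: "(\<Sum>n\<in>?A - ?P. - ?a n) <= 12" .
 have "(\<Sum>n\<in>?A. ?a n) = (\<Sum>n\<in>?A - ?P. ?a n) + (\<Sum>p\<in>?P. ?a p)" by (rule sum.subset_diff[OF PA]) simp
 then show ?thesis using 1 2 3 unfolding sum_negf \<delta>_def[symmetric] by linarith
qed

text \<open>The minimum of ln X and max(1, 1/|t|), arranged so that t = 0 falls into the first case.
  For bounded t this is the size of zeta(1 + 1/ln X + it); for large t the value 1 leaves the true
  size to the factor (ln X)^\<epsilon>.\<close>

definition peak :: "real \<Rightarrow> real \<Rightarrow> real" where
 "peak X t = (if \<bar>t\<bar> * ln X <= 1 then ln X else max 1 (1 / \<bar>t\<bar>))"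

lemma peak_bounds:
 assumes "ln X >= 1"
 shows "1 <= peak X t" "peak X t <= ln X"
proof -
 have "1 / \<bar>t\<bar> <= ln X" if "1 < \<bar>t\<bar> * ln X"
 proof -
 have "\<bar>t\<bar> > 0" using that by (cases "t = 0") auto
 then show ?thesis using that by (simp add: pos_divide_le_eq mult.commute)
 qed
 then show "1 <= peak X t" "peak X t <= ln X" using assms by (auto simp: peak_def)
qed

text \<open>For |t| >= 4 the bound near the edge of the strip applies, for smaller t the pole term
  1/(s - 1) dominates and |zeta| <= 12 + peak <= 13 peak. Constants, including those for y < 3,
  disappear into \<epsilon> ln ln X.\<close>

lemma prime_cos_sum_le:
 assumes RH: "GRH_for 1" and \<epsilon>: "\<epsilon> > 0"
 shows "\<forall>\<^sub>F X in at_top. \<forall>t y. \<bar>t\<bar> <= 2 * X & y <= X -->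
 (\<Sum>p | prime p & real p <= y. cos (t * ln (real p)) / real p) <= ln (peak X t) + \<epsilon> * ln (ln X)"
proof -
 have "\<epsilon>/2 > 0" using \<epsilon> by simp
 note log_series_chi_1_near_1[OF RH this]
 moreover have "\<forall>\<^sub>F X::real in at_top. ln X >= 1" by real_asymp
 moreover have "\<forall>\<^sub>F X::real in at_top. 56 <= (\<epsilon>/2) * ln (ln X)" using \<epsilon> by real_asymp
 ultimately show ?thesis
 proof eventually_elim
 case (elim X)
 note pk = peak_bounds[OF elim(2)]
 show ?case
 proof (intro allI impI, elim conjE)
  fix t y assume t: "\<bar>t\<bar> <= 2 * X" and y: "y <= X"
  let ?S = "\<Sum>p | prime p & real p <= y. cos (t * ln (real p)) / real p"
  have l0: "ln (peak X t) >= 0" using pk[of t] by simp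
  show "?S <= ln (peak X t) + \<epsilon> * ln (ln X)"
  proof (cases "y >= 3")
  case False
  have "?S <= (\<Sum>p | prime p & real p <= y. 1)"
  proof (rule sum_mono)
   fix p assume "p \<in> {p. prime p & real p <= y}"
   then have "real p >= 1" using prime_gt_0_nat[of p] by auto
   then have "cos (t * ln (real p)) / real p <= 1/1" by (intro frac_le) auto
   then show "cos (t * ln (real p)) / real p <= 1" by simp
  qed
  also have "... <= (\<Sum>p\<in>{2::nat}. 1)"
  proof (rule sum_mono2)
   show "{p. prime p & real p <= y} \<subseteq> {2}"
   proof
   fix p assume p: "p \<in> {p. prime p & real p <= y}"
   then have "real p < 3" using False by auto
   then show "p \<in> {2}" using p prime_ge_2_nat[of p] by auto
   qed
  qed auto
  finally show ?thesis using elim(3) l0 by simp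
  next
  case y3: True
  define \<delta> where "\<delta> = 1 / ln y"
  have \<delta>: "0 < \<delta>" "\<delta> <= 1" using inverse_ln_ge_3[OF y3] by (auto simp: \<delta>_def)
  let ?s = "of_real (1 + \<delta>) + \<i> * of_real t :: complex"
  have S: "?S <= Re (log_series (chi 1) ?s) + 44"
   unfolding \<delta>_def by (rule prime_cos_sum_le_log_zeta[OF y3])
  show ?thesis
  proof (cases "\<bar>t\<bar> >= 4")
   case True
   have "cmod (log_series (chi 1) (1 + of_real \<delta> + \<i> * of_real t)) <= \<epsilon>/2 * ln (ln X)"
   using elim(1) True \<delta> t by blast
   then have "Re (log_series (chi 1) ?s) <= \<epsilon>/2 * ln (ln X)"
   using complex_Re_le_cmod[of "log_series (chi 1) ?s"] by simp
   then show ?thesis using S elim(3) l0 by simp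
  next
   case False
   have s1: "?s \<noteq> 1" "Re ?s > 1" using \<delta> by (auto simp: complex_eq_iff)
   have "cmod (Dirichlet_L 1 ?s - 1/(?s - 1)) <= cmod ?s*(1 + 1 / Re ?s)"
   by (rule norm_zeta_minus_pole_le) (use s1 in auto)
   also have "... <= 6*(1 + 1)"
   proof (intro mult_mono add_left_mono)
   show "cmod ?s <= 6" using cmod_le[of ?s] False \<delta> by simp
   show "1 / Re ?s <= 1" using s1(2) by simp
   qed (use s1(2) in auto)
   finally have a: "cmod (Dirichlet_L 1 ?s - 1/(?s - 1)) <= 12" by simp
   have b: "cmod (1/(?s - 1)) <= peak X t"
   proof -
   have sm: "?s - 1 = of_real \<delta> + \<i> * of_real t" by simp
   have c: "\<delta> <= cmod (?s - 1)" "\<bar>t\<bar> <= cmod (?s - 1)"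
    using abs_Re_le_cmod[of "?s - 1"] abs_Im_le_cmod[of "?s - 1"] \<delta> by auto
   have pos: "cmod (?s - 1) > 0" using c(1) \<delta> by linarith
   show ?thesis
   proof (cases "\<bar>t\<bar> * ln X <= 1")
    case True
    have "1 / cmod (?s - 1) <= 1 / \<delta>" using c \<delta> pos by (intro divide_left_mono mult_pos_pos) auto
    also have "... = ln y" by (simp add: \<delta>_def)
    also have "... <= ln X" using y y3 by (subst ln_le_cancel_iff) auto
    finally show ?thesis using True by (simp add: peak_def norm_divide)
   next
    case False
    then have "\<bar>t\<bar> > 0" by (cases "t = 0") auto
    then have "1 / cmod (?s - 1) <= 1 / \<bar>t\<bar>" using c pos by (intro divide_left_mono mult_pos_pos) auto
    then show ?thesis using False by (simp add: peak_def norm_divide)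
   qed
   qed
   have "exp (Re (log_series (chi 1) ?s)) = cmod (Dirichlet_L 1 ?s)"
   using exp_log_series_chi[OF fundamental_discriminant_1 s1(2)] by (metis norm_exp_eq_Re)
   also have "... <= 12 + peak X t"
   using a b norm_triangle_sub[of "Dirichlet_L 1 ?s" "1/(?s - 1)"] by linarith
   also have "... <= 13 * peak X t" using pk[of t] by simp
   also have "... = exp (ln 13 + ln (peak X t))" using pk[of t] by (simp add: exp_add)
   finally have "Re (log_series (chi 1) ?s) <= ln 13 + ln (peak X t)" by simp
   moreover have "ln (13 :: real) <= 12" using ln_le_minus_one[of "13 :: real"] by simp
   moreover have "56 <= \<epsilon> * ln (ln X)" using elim(3) by simp
   ultimately show ?thesis using S by linarith
  qed
  qed
 qed
 qed
qed

section \<open>Moments of quadratic characters and random signs\<close>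

lemma prod_group_by_value:
 fixes f :: "'b \<Rightarrow> 'c :: comm_monoid_mult"
 assumes "finite S" "finite P" "g ` S \<subseteq> P"
 shows "(\<Prod>i\<in>S. f (g i)) = (\<Prod>p\<in>P. f p ^ card {i \<in> S. g i = p})"
proof -
 have "(\<Prod>p\<in>P. f p ^ card {i \<in> S. g i = p}) = (\<Prod>p\<in>P. \<Prod>i | i \<in> S & g i = p. f (g i))"
 by (intro prod.cong refl) simp
 also have "... = (\<Prod>i\<in>S. f (g i))" by (rule prod.group[OF assms])
 finally show ?thesis by simp
qed

text \<open>A subset E encodes a choice of signs, -1 on E and +1 off E. A product of signs averages
  to 0 unless every prime occurs in it an even number of times.\<close>

lemma sum_Pow_prod_signs:
 fixes P :: "'b set"
 assumes "finite S" "finite P" "g ` S \<subseteq> P"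
 shows "(\<Sum>E\<in>Pow P. \<Prod>i\<in>S. (if g i \<in> E then -1 else 1 :: real)) =
 (if \<forall>p\<in>P. even (card {i \<in> S. g i = p}) then 2 ^ card P else 0)"
proof -
 let ?c = "%p. card {i \<in> S. g i = p}"
 have "(\<Sum>E\<in>Pow P. \<Prod>i\<in>S. (if g i \<in> E then -1 else 1 :: real)) =
  (\<Sum>E\<in>Pow P. (\<Prod>p\<in>E. (-1) ^ ?c p)*(\<Prod>p\<in>P - E. 1))"
 proof (rule sum.cong)
 fix E assume E: "E \<in> Pow P"
 have "(\<Prod>i\<in>S. (if g i \<in> E then -1 else 1 :: real)) = (\<Prod>p\<in>P. (if p \<in> E then -1 else 1) ^ ?c p)"
  by (rule prod_group_by_value[OF assms, of "%p. if p \<in> E then -1 else 1"])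
 also have "... = (\<Prod>p\<in>P. if p \<in> E then (-1) ^ ?c p else 1)" by (intro prod.cong) auto
 also have "... = (\<Prod>p\<in>P \<inter> E. (-1) ^ ?c p)" using assms(2) by (rule prod.inter_restrict[symmetric])
 also have "P \<inter> E = E" using E by auto
 finally show "(\<Prod>i\<in>S. (if g i \<in> E then -1 else 1 :: real)) = (\<Prod>p\<in>E. (-1) ^ ?c p)*(\<Prod>p\<in>P - E. 1)" by simp
 qed simp
 also have "... = (\<Prod>p\<in>P. (-1) ^ ?c p + 1)" by (rule prod_add[symmetric]) (rule assms)
 also have "... = (if \<forall>p\<in>P. even (?c p) then 2 ^ card P else 0)"
 proof (cases "\<forall>p\<in>P. even (?c p)")
 case True
 then have "(\<Prod>p\<in>P. (-1) ^ ?c p + 1) = (\<Prod>p\<in>P. 2 :: real)" by (intro prod.cong) auto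
 then show ?thesis using True by simp
 next
 case False
 then obtain p where "p \<in> P" "odd (?c p)" by auto
 then show ?thesis using assms(2) by (auto intro!: prod_zero bexI[of _ p])
 qed
 finally show ?thesis .
qed

lemma even_binomial_sum:
 fixes u a :: real
 shows "(u + a)^(2 * k) + (u - a)^(2 * k) =
 2*(\<Sum>j\<le>k. of_nat ((2 * k) choose (2 * j))*(a\<^sup>2) ^ j * u^(2*(k - j)))"
proof -
 let ?f = "%i. of_nat ((2 * k) choose i) * a ^ i * u^(2 * k - i)"
 have "(u + a)^(2 * k) = (\<Sum>i\<le>2 * k. ?f i)" by (subst add.commute) (rule binomial_ring)
 moreover have "(u - a)^(2 * k) = (\<Sum>i\<le>2 * k. (-1) ^ i * ?f i)"
 using binomial_ring[of "- a" u "2 * k"] by (simp add: power_minus[of a] mult_ac)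
 ultimately have "(u + a)^(2 * k) + (u - a)^(2 * k) = (\<Sum>i\<le>2 * k. (1 + (-1) ^ i) * ?f i)"
 by (simp add: sum.distrib[symmetric] algebra_simps)
 also have "... = (\<Sum>i\<in>(%j. 2 * j) ` {..k}. (1 + (-1) ^ i) * ?f i)"
 proof (rule sum.mono_neutral_right)
 show "\<forall>i\<in>{..2 * k} - (%j. 2 * j) ` {..k}. (1 + (-1) ^ i) * ?f i = 0"
 proof
  fix i assume i: "i \<in> {..2 * k} - (%j. 2 * j) ` {..k}"
  have "odd i"
  proof
  assume "even i"
  then obtain j where "i = 2 * j" by (elim evenE)
  then show False using i by auto
  qed
  then show "(1 + (-1) ^ i) * ?f i = 0" by simp
 qed
 qed auto
 also have "... = (\<Sum>j\<le>k. (1 + (-1)^(2 * j)) * ?f (2 * j))"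
 by (subst sum.reindex) (auto simp: inj_on_def)
 also have "... = 2*(\<Sum>j\<le>k. of_nat ((2 * k) choose (2 * j))*(a\<^sup>2) ^ j * u^(2*(k - j)))"
 unfolding sum_distrib_left
 proof (rule sum.cong)
 fix j
 have e: "2 * k - 2 * j = 2*(k - j)" by simp
 show "(1 + (-1)^(2 * j)) * ?f (2 * j) = 2*(of_nat ((2 * k) choose (2 * j))*(a\<^sup>2) ^ j * u^(2*(k - j)))"
  unfolding e by (simp add: power_mult)
 qed simp
 finally show ?thesis .
qed

lemma two_power_fact_le_fact_double: "2 ^ j * fact j <= (fact (2 * j) :: real)"
proof (induction j)
 case (Suc j)
 have "2 ^ Suc j * fact (Suc j) = (2 * real j + 2)*(2 ^ j * fact j :: real)" by (simp add: algebra_simps)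
 also have "... <= (2 * real j + 2) * fact (2 * j)" by (intro mult_left_mono Suc.IH) auto
 also have "... <= (2 * real j + 2)*((2 * real j + 1) * fact (2 * j))" by (intro mult_left_mono) auto
 also have "... = fact (2 * Suc j)" by (simp add: algebra_simps)
 finally show ?case .
qed simp

text \<open>After cancelling factorials this is the inequality 2^j j! <= (2j)!.\<close>

lemma rademacher_coefficient_le:
 assumes "j <= k"
 shows "of_nat ((2 * k) choose (2 * j))*(fact (2*(k - j))/(2^(k - j) * fact (k - j)))
  <= (fact (2 * k)/(2 ^ k * fact k) :: real) * of_nat (k choose j)"
proof -
 have d: "2 * k - 2 * j = 2*(k - j)" by (simp add: diff_mult_distrib2)
 have "of_nat ((2 * k) choose (2 * j)) = (fact (2 * k)/(fact (2 * j) * fact (2*(k - j))) :: real)"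
 using binomial_fact[of "2 * j" "2 * k"] assms d by simp
 then have "of_nat ((2 * k) choose (2 * j))*(fact (2*(k - j))/(2^(k - j) * fact (k - j)))
  = (fact (2 * k)/(2^(k - j) * fact (k - j)) :: real) / fact (2 * j)"
 by (simp add: field_simps)
 also have "... <= fact (2 * k)/(2^(k - j) * fact (k - j))/(2 ^ j * fact j)"
 by (intro divide_left_mono two_power_fact_le_fact_double) auto
 also have "... = fact (2 * k)/(2 ^ k * fact k)*(fact k/(fact j * fact (k - j)))"
 proof -
 have "2 ^ k = 2^(k - j)*(2 :: real) ^ j" using assms by (simp add: power_add[symmetric])
 then show ?thesis by (simp add: field_simps)
 qed
 also have "fact k/(fact j * fact (k - j)) = (of_nat (k choose j) :: real)"
 by (rule binomial_fact[OF assms, symmetric])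
 finally show ?thesis .
qed

text \<open>Khinchine's inequality with the Gaussian constant. One sign is split off at a time: only
  even powers of its coefficient survive, and termwise the result is at most the binomial expansion
  of the k-th power of the enlarged variance.\<close>

lemma rademacher_moment:
 fixes a :: "'b \<Rightarrow> real"
 assumes "finite P"
 shows "(\<Sum>E\<in>Pow P. (\<Sum>p\<in>P. (if p \<in> E then -1 else 1) * a p)^(2 * k))
  <= 2 ^ card P*(fact (2 * k)/(2 ^ k * fact k))*(\<Sum>p\<in>P. (a p)\<^sup>2) ^ k"
 using assms
proof (induction P arbitrary: k rule: finite_induct)
 case empty
 show ?case by (cases k) auto
next
 case (insert q P)
 let ?u = "%E. \<Sum>p\<in>P. (if p \<in> E then -1 else 1) * a p"
 let ?v = "%E. \<Sum>p\<in>insert q P. (if p \<in> E then -1 else 1) * a p"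
 let ?S = "\<Sum>p\<in>P. (a p)\<^sup>2" and ?F = "%k. fact (2 * k)/(2 ^ k * fact k) :: real"
 have v1: "?v E = ?u E + a q" if "E \<in> Pow P" for E
 using insert.hyps that by auto
 have v2: "?v (insert q E) = ?u E - a q" if "E \<in> Pow P" for E
 proof -
 have "(\<Sum>p\<in>P. (if p \<in> insert q E then -1 else 1) * a p) = ?u E"
  using insert.hyps(2) by (intro sum.cong) auto
 then show ?thesis using insert.hyps by simp
 qed
 have inj: "inj_on (insert q) (Pow P)" using insert.hyps(2) by (auto simp: inj_on_def)
 have "(\<Sum>E\<in>Pow (insert q P). ?v E^(2 * k)) = (\<Sum>E\<in>Pow P. ?v E^(2 * k)) + (\<Sum>E\<in>insert q ` Pow P. ?v E^(2 * k))"
 unfolding Pow_insert by (rule sum.union_disjoint) (use insert.hyps in auto)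
 also have "(\<Sum>E\<in>insert q ` Pow P. ?v E^(2 * k)) = (\<Sum>E\<in>Pow P. ?v (insert q E)^(2 * k))"
 by (subst sum.reindex[OF inj]) (simp only: o_def)
 also have "(\<Sum>E\<in>Pow P. ?v E^(2 * k)) + (\<Sum>E\<in>Pow P. ?v (insert q E)^(2 * k))
  = (\<Sum>E\<in>Pow P. (?u E + a q)^(2 * k) + (?u E - a q)^(2 * k))"
 unfolding sum.distrib[symmetric] by (intro sum.cong refl) (simp only: v1 v2)
 also have "... = 2*(\<Sum>j\<le>k. of_nat ((2 * k) choose (2 * j))*((a q)\<^sup>2) ^ j*(\<Sum>E\<in>Pow P. ?u E^(2*(k - j))))"
 unfolding even_binomial_sum sum_distrib_left by (rule sum.swap)
 also have "... <= 2*(\<Sum>j\<le>k. of_nat ((2 * k) choose (2 * j))*((a q)\<^sup>2) ^ j*(2 ^ card P * ?F (k - j) * ?S^(k - j)))"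
 by (intro mult_left_mono sum_mono insert.IH mult_nonneg_nonneg) auto
 also have "... = 2 ^ Suc (card P)*(\<Sum>j\<le>k. (of_nat ((2 * k) choose (2 * j)) * ?F (k - j))*(((a q)\<^sup>2) ^ j * ?S^(k - j)))"
 by (simp add: sum_distrib_left mult_ac)
 also have "... <= 2 ^ Suc (card P)*(\<Sum>j\<le>k. (?F k * of_nat (k choose j))*(((a q)\<^sup>2) ^ j * ?S^(k - j)))"
 by (intro mult_left_mono sum_mono mult_right_mono rademacher_coefficient_le)
  (simp_all add: sum_nonneg)
 also have "... = 2 ^ Suc (card P)*(?F k*(\<Sum>j\<le>k. of_nat (k choose j)*((a q)\<^sup>2) ^ j * ?S^(k - j)))"
 by (simp add: sum_distrib_left mult_ac)
 also have "(\<Sum>j\<le>k. of_nat (k choose j)*((a q)\<^sup>2) ^ j * ?S^(k - j)) = ((a q)\<^sup>2 + ?S) ^ k"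
 by (rule binomial_ring[symmetric])
 finally show ?case using insert.hyps by (simp add: mult_ac)
qed

text \<open>The product of symbols is periodic modulo the product of the primes. A multiplier that
  is a nonresidue at p0 and 1 at the other primes reverses its sign, since p0 occurs an odd number
  of times.\<close>

lemma sum_prod_Legendre_le:
 fixes g :: "'i \<Rightarrow> nat"
 assumes S: "finite S" and g: "\<And>i. i \<in> S ==> prime (g i) & g i > 2" and odd: "odd (card {i \<in> S. g i = p0})"
 shows "\<bar>\<Sum>d\<in>{a..<b}. \<Prod>i\<in>S. Legendre d (int (g i))\<bar> <= int (\<Prod>i\<in>S. g i)"
proof -
 let ?h = "%d. \<Prod>i\<in>S. Legendre d (int (g i))" and ?N = "int (\<Prod>i\<in>S. g i)" and ?P = "g ` S"
 have "{i \<in> S. g i = p0} \<noteq> {}"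
 proof
 assume "{i \<in> S. g i = p0} = {}"
 then show False using odd by (simp only: card.empty) simp
 qed
 then have p0: "p0 \<in> ?P" by auto
 then have pp0: "prime p0" "p0 > 2" using g by auto
 obtain r :: int where r: "Legendre r (int p0) = -1" using exists_nonresidue[OF pp0] by metis
 let ?M = "\<Prod>q\<in>?P - {p0}. int q"
 have cop: "coprime (int p0) ?M"
 proof (rule prod_coprime_right)
 fix q assume q: "q \<in> ?P - {p0}"
 then have "prime q" using g by auto
 then show "coprime (int p0) (int q)" using pp0(1) q primes_coprime[of p0 q] by auto
 qed
 obtain b0 where b0: "[b0 = r] (mod int p0)" "[b0 = 1] (mod ?M)"
 using binary_chinese_remainder_int[OF cop] by blast
 have L0: "Legendre b0 (int p0) = -1" using Legendre_cong[OF b0(1)] r by simp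
 have L1: "Legendre b0 (int q) = 1" if "q \<in> ?P" "q \<noteq> p0" for q
 proof -
 have "int q dvd ?M" using that S by (intro dvd_prodI) auto
 then have "[b0 = 1] (mod int q)" using b0(2) by (rule cong_dvd_modulus[rotated])
 then have "Legendre b0 (int q) = Legendre 1 (int q)" by (rule Legendre_cong)
 moreover have "q > 1" using that(1) g prime_gt_1_nat by fastforce
 then have "Legendre 1 (int q) = 1" by (auto simp: Legendre_def QuadRes_def cong_def intro!: exI[of _ 1])
 ultimately show ?thesis by simp
 qed
 have hb: "?h b0 = -1"
 proof -
 have "?h b0 = (\<Prod>p\<in>?P. Legendre b0 (int p) ^ card {i \<in> S. g i = p})"
  by (rule prod_group_by_value[of S ?P g "%p. Legendre b0 (int p)"]) (use S in auto)
 also have "... = Legendre b0 (int p0) ^ card {i \<in> S. g i = p0}*(\<Prod>p\<in>?P - {p0}. Legendre b0 (int p) ^ card {i \<in> S. g i = p})"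
  by (rule prod.remove) (use S p0 in auto)
 also have "(\<Prod>p\<in>?P - {p0}. Legendre b0 (int p) ^ card {i \<in> S. g i = p}) = 1"
  by (intro prod.neutral ballI) (simp add: L1)
 finally show ?thesis using odd L0 by simp
 qed
 have N0: "?N > 0" using g by (auto simp: of_nat_prod intro!: prod_pos) (metis gr0I not_numeral_less_zero of_nat_0_less_iff)
 have per: "?h x = ?h y" if "[x = y] (mod ?N)" for x y
 proof (rule prod.cong)
 fix i assume i: "i \<in> S"
 have "int (g i) dvd ?N" unfolding of_nat_prod using S i by (intro dvd_prodI)
 then have "[x = y] (mod int (g i))" using that by (rule cong_dvd_modulus[rotated])
 then show "Legendre x (int (g i)) = Legendre y (int (g i))" by (rule Legendre_cong)
 qed simp
 have sgn: "?h (b0 * x) = - ?h x" for x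
 proof -
 have "?h (b0 * x) = (\<Prod>i\<in>S. Legendre b0 (int (g i)) * Legendre x (int (g i)))"
  using g by (intro prod.cong refl Legendre_mult) auto
 then show ?thesis using hb by (simp add: prod.distrib)
 qed
 have copb: "coprime b0 ?N"
 unfolding of_nat_prod
 proof (rule prod_coprime_right)
 fix i assume i: "i \<in> S"
 have "Legendre b0 (int (g i)) \<noteq> 0" using L0 L1[of "g i"] i by (cases "g i = p0") auto
 then have "\<not> int (g i) dvd b0" by (auto simp: Legendre_def cong_0_iff split: if_splits)
 moreover have "prime (int (g i))" using g[OF i] by simp
 ultimately have "coprime (int (g i)) b0" using prime_imp_coprime by blast
 then show "coprime b0 (int (g i))" by (rule coprime_imp_coprime[rotated 0]) (auto simp: coprime_commute)
 qed
 show ?thesis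
 proof (rule abs_sum_periodic_le[where h = ?h, OF N0 per])
 show "sum ?h {0..<?N} = 0" by (rule sum_zero_of_sign_change[where h = ?h, OF N0 copb per sgn])
 show "\<bar>?h x\<bar> <= 1" for x
 proof -
  have "\<bar>Legendre x (int (g i))\<bar> <= 1" for i using Legendre_cases[of x "int (g i)"] by auto
  then show ?thesis unfolding abs_prod by (intro prod_le_1) auto
 qed
 qed
qed

text \<open>The even power is nonnegative, so D may be enlarged to all integers of size at most X,
  where complete sums are available. Expanding gives tuples of primes. Tuples with square product
  have nonnegative coefficients and at most 3X integers d; the others contribute at most (B y)^(2k)
  each, and there are at most y^(2k) of them.\<close>

lemma character_moment:
 fixes a :: "nat \<Rightarrow> real" and X y B :: real
 assumes P: "finite P" "\<And>p. p \<in> P ==> prime p & p > 2 & real p <= y" and a: "\<And>p. p \<in> P ==> \<bar>a p\<bar> <= B" and B: "B >= 0"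
 and y: "y >= 0" and X: "X >= 1" and D: "\<And>d. d \<in> D ==> \<bar>real_of_int d\<bar> <= X"
 shows "(\<Sum>d\<in>D. (\<Sum>p\<in>P. a p * real_of_int (Legendre d (int p)))^(2 * k))
  <= 3 * X*(fact (2 * k)/(2 ^ k * fact k))*(\<Sum>p\<in>P. (a p)\<^sup>2) ^ k + (B * y\<^sup>2)^(2 * k)"
proof -
 define n where "n = 2 * k"
 define m where "m = \<lfloor>X\<rfloor>"
 let ?D = "{-m..<m+1}" and ?I = "{..<n}" and ?G = "Pi\<^sub>E {..<n} (%_. P)"
 let ?sq = "%g. \<forall>p\<in>P. even (card {i \<in> ?I. g i = p})"
 let ?L = "%d g. \<Prod>i\<in>?I. Legendre d (int (g i))"
 have m: "real_of_int m <= X" by (simp add: m_def)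
 have sub: "D \<subseteq> ?D"
 proof
 fix x assume "x \<in> D"
 then have "\<bar>real_of_int x\<bar> <= X" by (rule D)
 then have "real_of_int x <= X" "real_of_int (- x) <= X" by auto
 then have "x <= m" "- x <= m" by (simp_all only: m_def le_floor_iff)
 then show "x \<in> ?D" by auto
 qed
 have PiE: "g i \<in> P" if "g \<in> ?G" "i \<in> ?I" for g i using that by (auto simp: PiE_def Pi_def)
 have im: "g ` ?I \<subseteq> P" if "g \<in> ?G" for g using PiE[OF that] by auto
 have "(\<Sum>d\<in>D. (\<Sum>p\<in>P. a p * real_of_int (Legendre d (int p))) ^ n)
  <= (\<Sum>d\<in>?D. (\<Sum>p\<in>P. a p * real_of_int (Legendre d (int p))) ^ n)"
 by (rule sum_mono2[OF _ sub]) (auto simp: n_def)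
 also have "... = (\<Sum>d\<in>?D. \<Sum>g\<in>?G. \<Prod>i\<in>?I. a (g i) * real_of_int (Legendre d (int (g i))))"
 proof (rule sum.cong)
 fix d
 have "(\<Sum>p\<in>P. a p * real_of_int (Legendre d (int p))) ^ n = (\<Prod>i\<in>?I. \<Sum>p\<in>P. a p * real_of_int (Legendre d (int p)))" by simp
 also have "... = (\<Sum>g\<in>?G. \<Prod>i\<in>?I. a (g i) * real_of_int (Legendre d (int (g i))))"
  by (rule prod_sum_PiE) (use P in auto)
 finally show "(\<Sum>p\<in>P. a p * real_of_int (Legendre d (int p))) ^ n = ..." .
 qed simp
 also have "... = (\<Sum>g\<in>?G. (\<Prod>i\<in>?I. a (g i)) * real_of_int (\<Sum>d\<in>?D. ?L d g))"
 by (subst sum.swap) (simp add: prod.distrib sum_distrib_left of_int_prod)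
 also have "... <= (\<Sum>g\<in>?G. 3 * X*(if ?sq g then \<Prod>i\<in>?I. a (g i) else 0) + B ^ n * y ^ n)"
 proof (rule sum_mono)
 fix g assume g: "g \<in> ?G"
 have BY: "B ^ n * y ^ n >= 0" using B y by simp
 show "(\<Prod>i\<in>?I. a (g i)) * real_of_int (\<Sum>d\<in>?D. ?L d g) <= 3 * X*(if ?sq g then \<Prod>i\<in>?I. a (g i) else 0) + B ^ n * y ^ n"
 proof (cases "?sq g")
  case True
  have "(\<Prod>i\<in>?I. a (g i)) = (\<Prod>p\<in>P. a p ^ card {i \<in> ?I. g i = p})"
  by (rule prod_group_by_value) (use P im[OF g] in auto)
  also have "... >= 0" by (intro prod_nonneg ballI) (use True in \<open>auto intro: zero_le_even_power\<close>)
  finally have pos: "(\<Prod>i\<in>?I. a (g i)) >= 0" .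
  have "(\<Sum>d\<in>?D. ?L d g) <= (\<Sum>d\<in>?D. 1)"
  proof (rule sum_mono)
  fix d
  have "\<bar>Legendre d (int (g i))\<bar> <= 1" for i using Legendre_cases[of d "int (g i)"] by auto
  then have "\<bar>?L d g\<bar> <= 1" unfolding abs_prod by (intro prod_le_1) auto
  then show "?L d g <= 1" by linarith
  qed
  also have "... = 2 * m + 1" using X by (simp add: m_def)
  finally have "real_of_int (\<Sum>d\<in>?D. ?L d g) <= real_of_int (2 * m + 1)" by (simp only: of_int_le_iff)
  also have "... <= 3 * X" using m X by simp
  finally have "real_of_int (\<Sum>d\<in>?D. ?L d g) <= 3 * X" .
  then have "(\<Prod>i\<in>?I. a (g i)) * real_of_int (\<Sum>d\<in>?D. ?L d g) <= (\<Prod>i\<in>?I. a (g i))*(3 * X)"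
  using pos by (intro mult_left_mono)
  moreover have "3 * X*(if ?sq g then \<Prod>i\<in>?I. a (g i) else 0) = (\<Prod>i\<in>?I. a (g i))*(3 * X)" unfolding if_P[OF True] by (rule mult.commute)
  ultimately show ?thesis using BY by linarith
 next
  case False
  then obtain p0 where p0: "odd (card {i \<in> ?I. g i = p0})" by auto
  have "\<bar>\<Sum>d\<in>?D. ?L d g\<bar> <= int (\<Prod>i\<in>?I. g i)"
  by (rule sum_prod_Legendre_le[OF _ _ p0]) (use P PiE[OF g] in auto)
  then have "\<bar>real_of_int (\<Sum>d\<in>?D. ?L d g)\<bar> <= real (\<Prod>i\<in>?I. g i)"
  by (metis of_int_abs of_int_le_iff of_int_of_nat_eq)
  also have "... = (\<Prod>i\<in>?I. real (g i))" by (rule of_nat_prod)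
  also have "... <= (\<Prod>i\<in>?I. y)" by (intro prod_mono) (use P PiE[OF g] in auto)
  finally have 1: "\<bar>real_of_int (\<Sum>d\<in>?D. ?L d g)\<bar> <= y ^ n" by simp
  have "\<bar>\<Prod>i\<in>?I. a (g i)\<bar> = (\<Prod>i\<in>?I. \<bar>a (g i)\<bar>)" by (rule abs_prod)
  also have "... <= (\<Prod>i\<in>?I. B)" by (intro prod_mono) (use a PiE[OF g] in auto)
  finally have 2: "\<bar>\<Prod>i\<in>?I. a (g i)\<bar> <= B ^ n" by simp
  have "(\<Prod>i\<in>?I. a (g i)) * real_of_int (\<Sum>d\<in>?D. ?L d g) <= \<bar>\<Prod>i\<in>?I. a (g i)\<bar>*\<bar>real_of_int (\<Sum>d\<in>?D. ?L d g)\<bar>"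
  unfolding abs_mult[symmetric] by (rule abs_ge_self)
  also have "... <= B ^ n * y ^ n" using 1 2 B by (intro mult_mono) auto
  finally show ?thesis unfolding if_not_P[OF False] by simp
 qed
 qed
 also have "... = 3 * X*(\<Sum>g\<in>?G. if ?sq g then \<Prod>i\<in>?I. a (g i) else 0) + real (card P ^ n)*(B ^ n * y ^ n)"
 using P(1) by (simp add: sum.distrib sum_distrib_left card_PiE)
 also have "(\<Sum>g\<in>?G. if ?sq g then \<Prod>i\<in>?I. a (g i) else 0) <= (fact n/(2 ^ k * fact k))*(\<Sum>p\<in>P. (a p)\<^sup>2) ^ k"
 proof -
 \<comment> \<open>Averaging over all signs E detects the tuples with square product, so their total
   is exactly the moment of a random sum with the same coefficients.\<close>
 let ?s = "%E p. if p \<in> E then -1 else 1 :: real"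
 have "2 ^ card P*(\<Sum>g\<in>?G. if ?sq g then \<Prod>i\<in>?I. a (g i) else 0)
  = (\<Sum>g\<in>?G. (\<Prod>i\<in>?I. a (g i))*(\<Sum>E\<in>Pow P. \<Prod>i\<in>?I. ?s E (g i)))"
 proof (subst sum_distrib_left, rule sum.cong)
  fix g assume g: "g \<in> ?G"
  have gen: "c*(if b then A else 0) = A*(if b then c else 0)" for b and c A :: real by simp
  have e: "(\<Sum>E\<in>Pow P. \<Prod>i\<in>?I. ?s E (g i)) = (if ?sq g then 2 ^ card P else 0)"
  by (rule sum_Pow_prod_signs) (use P im[OF g] in auto)
  show "2 ^ card P*(if ?sq g then \<Prod>i\<in>?I. a (g i) else 0) = (\<Prod>i\<in>?I. a (g i))*(\<Sum>E\<in>Pow P. \<Prod>i\<in>?I. ?s E (g i))"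
  unfolding e by (rule gen)
 qed simp
 also have "... = (\<Sum>E\<in>Pow P. \<Sum>g\<in>?G. \<Prod>i\<in>?I. ?s E (g i) * a (g i))"
  unfolding sum_distrib_left by (subst sum.swap) (simp only: prod.distrib mult.commute)
 also have "... = (\<Sum>E\<in>Pow P. (\<Sum>p\<in>P. ?s E p * a p) ^ n)"
 proof (rule sum.cong)
  fix E
  have "(\<Sum>p\<in>P. ?s E p * a p) ^ n = (\<Prod>i\<in>?I. \<Sum>p\<in>P. ?s E p * a p)" by simp
  also have "... = (\<Sum>g\<in>?G. \<Prod>i\<in>?I. ?s E (g i) * a (g i))"
  by (rule prod_sum_PiE) (use P in auto)
  finally show "(\<Sum>g\<in>?G. \<Prod>i\<in>?I. ?s E (g i) * a (g i)) = (\<Sum>p\<in>P. ?s E p * a p) ^ n" by simp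
 qed simp
 also have "... <= 2 ^ card P*(fact n/(2 ^ k * fact k))*(\<Sum>p\<in>P. (a p)\<^sup>2) ^ k"
  unfolding n_def by (rule rademacher_moment[OF P(1)])
 finally have "2 ^ card P*(\<Sum>g\<in>?G. if ?sq g then \<Prod>i\<in>?I. a (g i) else 0)
  <= 2 ^ card P*((fact n/(2 ^ k * fact k))*(\<Sum>p\<in>P. (a p)\<^sup>2) ^ k)" by (simp only: mult.assoc)
 then show ?thesis by (rule mult_left_le_imp_le) simp
 qed
 also have "real (card P ^ n)*(B ^ n * y ^ n) <= y ^ n*(B ^ n * y ^ n)"
 proof -
 have "P \<subseteq> {1..nat \<lfloor>y\<rfloor>}"
 proof
  fix p assume "p \<in> P"
  then have "p > 2" "real p <= y" using P(2) by auto
  then show "p \<in> {1..nat \<lfloor>y\<rfloor>}" by (simp add: le_nat_floor)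
 qed
 then have "card P <= nat \<lfloor>y\<rfloor>" using card_mono[of "{1..nat \<lfloor>y\<rfloor>}" P] by simp
 then have "real (card P) <= real (nat \<lfloor>y\<rfloor>)" by (simp only: of_nat_le_iff)
 also have "... <= y" using y by (rule of_nat_floor)
 finally have "real (card P) <= y" .
 then have "real (card P) ^ n <= y ^ n" by (intro power_mono) auto
 then show ?thesis using B y by (simp only: of_nat_power) (intro mult_right_mono, auto)
 qed
 finally show ?thesis using X unfolding n_def[symmetric]
 by (simp add: power_mult_distrib power2_eq_square mult_ac)
qed

section \<open>From the smoothed sum to sums over primes\<close>

lemma powr_uminus_le_one: "1 <= x ==> 0 <= a ==> x powr - a <= (1 :: real)"
 using powr_mono[of "- a" 0 x] by simp

text \<open>Abel summation in a one-sided form: the partial sums are bounded from above only, so it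
  relies on the weights being nonnegative and nonincreasing.\<close>

lemma abel_weight_le:
 fixes c w :: "nat \<Rightarrow> real"
 assumes c: "\<And>m. m <= N ==> (\<Sum>n=1..m. c n) <= B" and w: "\<And>n. 1 <= n ==> n < N ==> w (Suc n) <= w n"
 and wN: "N >= 1 ==> w N >= 0" and w1: "w 1 <= 1" and B: "B >= 0"
 shows "(\<Sum>n=1..N. w n * c n) <= B"
proof (cases N)
 case (Suc M)
 have tel: "(\<Sum>n=1..M. w n - w (Suc n)) = w 1 - w (Suc M)" for M by (induction M) auto
 have id: "(\<Sum>n=1..Suc M. w n * c n) = w (Suc M)*(\<Sum>n=1..Suc M. c n) + (\<Sum>n=1..M. (w n - w (Suc n))*(\<Sum>i=1..n. c i))" for M
 by (induction M) (auto simp: algebra_simps)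
 have "(\<Sum>n=1..N. w n * c n) <= w (Suc M) * B + (\<Sum>n=1..M. (w n - w (Suc n)) * B)"
 unfolding Suc id
 proof (intro add_mono mult_left_mono sum_mono)
 show "w (Suc M) >= 0" using wN Suc by simp
 show "w n - w (Suc n) >= 0" if "n \<in> {1..M}" for n using w[of n] that Suc by auto
 show "(\<Sum>n=1..Suc M. c n) <= B" by (rule c) (simp add: Suc)
 show "(\<Sum>i=1..n. c i) <= B" if "n \<in> {1..M}" for n by (rule c) (use that Suc in auto)
 qed
 also have "... = w 1 * B" by (simp only: sum_distrib_right[symmetric] tel) (simp add: algebra_simps)
 also have "... <= 1 * B" using w1 B by (intro mult_right_mono)
 finally show ?thesis by simp
qed (use B in simp)

lemma weighted_prime_sum_le:
 fixes w f :: "nat \<Rightarrow> real"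
 assumes f: "\<And>y. y <= Y ==> (\<Sum>p | prime p & real p <= y. f p) <= B" and B: "B >= 0"
 and w: "\<And>m n. 1 <= m ==> m <= n ==> real n <= Y ==> w n <= w m" "\<And>n. 1 <= n ==> real n <= Y ==> w n >= 0" "w 1 <= 1"
 shows "(\<Sum>p | prime p & real p <= Y. w p * f p) <= B"
proof -
 define N where "N = nat \<lfloor>Y\<rfloor>"
 have N: "n <= N \<longleftrightarrow> real n <= Y" if "n >= 1" for n
 proof
 assume h: "n <= N"
 have "Y >= 0"
 proof (rule ccontr)
  assume "\<not> Y >= 0"
  then have "N = 0" by (simp add: N_def)
  then show False using h that by simp
 qed
 then have "real N <= Y" unfolding N_def by (rule of_nat_floor)
 then show "real n <= Y" using h by linarith
 next
 assume "real n <= Y"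
 then show "n <= N" unfolding N_def by (rule le_nat_floor)
 qed
 have set: "{p. prime p & real p <= real m} = {n \<in> {1..m}. prime n}" for m
 using prime_gt_0_nat by (auto simp: Suc_le_eq)
 have setY: "{p. prime p & real p <= Y} = {n \<in> {1..N}. prime n}"
 using N prime_gt_0_nat by (auto simp: Suc_le_eq)
 have "(\<Sum>n=1..N. w n*(if prime n then f n else 0)) <= B"
 proof (rule abel_weight_le[where c = "%n. if prime n then f n else 0" and w = w, OF _ _ _ w(3) B])
 fix m assume m: "m <= N"
 show "(\<Sum>n=1..m. if prime n then f n else 0) <= B"
 proof (cases "m = 0")
  case False
  have "(\<Sum>n=1..m. if prime n then f n else 0) = (\<Sum>p | prime p & real p <= real m. f p)"
  unfolding set by (rule sum.inter_filter[symmetric]) simp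
  also have "... <= B" by (rule f) (use m False N[of m] in auto)
  finally show ?thesis .
 qed (use B in simp)
 next
 fix n assume "1 <= n" "n < N"
 then show "w (Suc n) <= w n" using N[of "Suc n"] by (intro w(1)) auto
 next
 assume "N >= 1"
 then show "w N >= 0" using N[of N] by (intro w(2)) auto
 qed
 also have "(\<Sum>n=1..N. w n*(if prime n then f n else 0)) = (\<Sum>n=1..N. if prime n then w n * f n else 0)"
 by (intro sum.cong) auto
 also have "... = (\<Sum>p | prime p & real p <= Y. w p * f p)"
 unfolding setY by (rule sum.inter_filter[symmetric]) simp
 finally show ?thesis .
qed

lemma finite_prime_divisors:
 assumes "d \<noteq> (0 :: int)"
 shows "finite {p :: nat. prime p & int p dvd d}"
proof (rule finite_subset)
 show "{p :: nat. prime p & int p dvd d} \<subseteq> {..nat \<bar>d\<bar>}" 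
 proof
 fix p assume "p \<in> {p :: nat. prime p & int p dvd d}"
 then have "\<bar>int p\<bar> <= \<bar>d\<bar>" using assms by (intro dvd_imp_le_int) auto
 then show "p \<in> {..nat \<bar>d\<bar>}" by (simp add: le_nat_iff)
 qed
qed simp

lemma prod_primes_dvd:
 assumes "finite S" "\<And>p. p \<in> S ==> prime (p :: nat) & int p dvd d"
 shows "(\<Prod>p\<in>S. int p) dvd d"
 using assms
proof (induction S rule: finite_induct)
 case (insert p S)
 have "coprime (int p) (\<Prod>p\<in>S. int p)"
 proof (rule prod_coprime_right)
 fix q assume "q \<in> S"
 then show "coprime (int p) (int q)" using insert primes_coprime[of p q] by auto
 qed
 then show ?case using insert by (auto intro: divides_mult)
qed simp

text \<open>Primes up to ln X contribute at most ln ln ln X + O(1) whether they divide d or not.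
  Larger prime divisors have product at most X, so there are at most ln X of them, each contributing
  at most 1/ln X.\<close>

lemma prime_divisor_sum_le:
 assumes \<epsilon>: "\<epsilon> > 0"
 shows "\<forall>\<^sub>F X in at_top. \<forall>d. d \<noteq> 0 & \<bar>real_of_int d\<bar> <= X -->
 (\<Sum>p | prime p & int p dvd d. 1 / real p) <= \<epsilon> * ln (ln X)"
proof -
 have "\<forall>\<^sub>F X::real in at_top. ln (ln (ln X) + 3) + 45 <= \<epsilon> * ln (ln X)" using \<epsilon> by real_asymp
 moreover have "\<forall>\<^sub>F X::real in at_top. ln X >= 3" by real_asymp
 moreover have "\<forall>\<^sub>F X::real in at_top. X >= 1" by real_asymp
 ultimately show ?thesis
 proof eventually_elim
 case (elim X)
 let ?y = "ln X"
 note ly = inverse_ln_ge_3[OF elim(2)]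
 show ?case
 proof (intro allI impI, elim conjE)
  fix d :: int assume d: "d \<noteq> 0" "\<bar>real_of_int d\<bar> <= X"
  let ?D = "{p. prime p & int p dvd d}"
  note fin = finite_prime_divisors[OF d(1)]
  let ?S = "{p \<in> ?D. real p <= ?y}" and ?L = "{p \<in> ?D. \<not> real p <= ?y}"
  have finS: "finite ?S" by (rule finite_subset[OF _ fin]) auto
  have finL: "finite ?L" by (rule finite_subset[OF _ fin]) auto
  have "(\<Sum>p\<in>?D. 1 / real p) = (\<Sum>p\<in>?S \<union> ?L. 1 / real p)" by (intro sum.cong) auto
  also have "... = (\<Sum>p\<in>?S. 1 / real p) + (\<Sum>p\<in>?L. 1 / real p)" by (rule sum.union_disjoint[OF finS finL]) auto
  also have "(\<Sum>p\<in>?S. 1 / real p) <= (\<Sum>p | prime p & real p <= ?y. 1 / real p)"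
  using finite_primes_le[of ?y "%_. True"] by (intro sum_mono2) auto
  also have "... <= Re (log_series (chi 1) (of_real (1 + 1 / ln ?y))) + 44"
  using prime_cos_sum_le_log_zeta[OF elim(2), of 0] by simp
  also have "Re (log_series (chi 1) (of_real (1 + 1 / ln ?y))) <= ln (1/(1 / ln ?y) + (1 + 1 / ln ?y) + 1)"
  using norm_log_series_chi_1_le_ln[of "of_real (1 + 1 / ln ?y)"] ly(1)
   complex_Re_le_cmod[of "log_series (chi 1) (of_real (1 + 1 / ln ?y))"] by simp
  also have "... <= ln (ln ?y + 3)"
  proof (rule ln_mono)
  show "1/(1 / ln ?y) + (1 + 1 / ln ?y) + 1 <= ln ?y + 3" using ly(2) by simp
  show "0 < 1/(1 / ln ?y) + (1 + 1 / ln ?y) + 1" using ly by (intro add_pos_pos) auto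
  qed
  also have "(\<Sum>p\<in>?L. 1 / real p) <= 1"
  proof -
  have "?y ^ card ?L = (\<Prod>p\<in>?L. ?y)" by simp
  also have "... <= (\<Prod>p\<in>?L. real p)" using elim(2) by (intro prod_mono) auto
  also have "... = real_of_int (\<Prod>p\<in>?L. int p)" by simp
  also have "... <= real_of_int \<bar>d\<bar>"
  proof -
   have "(\<Prod>p\<in>?L. int p) dvd d" by (rule prod_primes_dvd[OF finL]) auto
   then have "(\<Prod>p\<in>?L. int p) <= \<bar>d\<bar>" using d(1) by (intro zdvd_imp_le) auto
   then show ?thesis by (simp only: of_int_le_iff)
  qed
  also have "... <= X" using d(2) by simp
  finally have "?y ^ card ?L <= X" .
  then have "ln (?y ^ card ?L) <= ln X"
   by (rule ln_mono) (rule zero_less_power, use elim(2) in linarith)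
  then have "real (card ?L) * ln ?y <= ?y" using elim(2) by (simp add: ln_realpow)
  moreover have "real (card ?L)*1 <= real (card ?L) * ln ?y" using ly(3) by (intro mult_left_mono) auto
  ultimately have cL: "real (card ?L) <= ?y" by linarith
  have "(\<Sum>p\<in>?L. 1 / real p) <= (\<Sum>p\<in>?L. 1 / ?y)" using elim(2) by (intro sum_mono divide_left_mono) auto
  also have "... <= 1" using cL elim(2) by simp
  finally show ?thesis .
  qed
  finally show "(\<Sum>p\<in>?D. 1 / real p) <= \<epsilon> * ln (ln X)" using elim(1) by simp
 qed
 qed
qed

text \<open>At 2 the Kronecker symbol is not a Legendre symbol; this prime goes into the constant
  terms.\<close>

definition odd_primes :: "real \<Rightarrow> nat set" where
 "odd_primes y = {p. prime p & p > 2 & real p <= y}"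

definition cutoff :: "real \<Rightarrow> nat \<Rightarrow> real" where
 "cutoff T n = (1 - ln (real n) / T)\<^sup>2"

lemma cutoff_bounds:
 assumes "T > 0" "1 <= n" "real n <= exp T"
 shows "0 <= cutoff T n" "cutoff T n <= 1"
proof -
 have "ln (real n) <= ln (exp T)" using assms by (intro ln_mono) auto
 then have "0 <= 1 - ln (real n) / T" "1 - ln (real n) / T <= 1" using assms by (auto simp: field_simps)
 then show "0 <= cutoff T n" "cutoff T n <= 1" unfolding cutoff_def by (auto intro: power_le_one)
qed

lemma cutoff_antimono:
 assumes "T > 0" "1 <= m" "m <= n" "real n <= exp T"
 shows "cutoff T n <= cutoff T m"
proof -
 have "ln (real n) <= ln (exp T)" using assms by (intro ln_mono) auto
 moreover have "ln (real m) <= ln (real n)" using assms by (intro ln_mono) auto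
 ultimately have "0 <= 1 - ln (real n) / T" "1 - ln (real n) / T <= 1 - ln (real m) / T"
 using assms by (auto simp: field_simps)
 then show ?thesis unfolding cutoff_def by (intro power_mono)
qed

lemma Kronecker_prime_sq:
 assumes "prime p"
 shows "(Kronecker_prime d (int p))\<^sup>2 = (if int p dvd d then 0 else 1)"
proof -
 have "(Legendre d (int p))\<^sup>2 = (if int p dvd d then 0 else 1)"
 by (auto simp: Legendre_def cong_0_iff)
 then show ?thesis by (auto simp: Kronecker_prime_def)
qed

text \<open>At p^2 the symbol is 1 unless p divides d. So the squares give a sum free of d, the
  source of the mean, and a correction over prime divisors of d. The constant 13 is 1 for the prime
  2 and 12 for cubes and higher powers.\<close>

lemma Re_smoothed_log_sum_le:
 assumes d: "d \<noteq> 0" and T: "T >= 1" and x: "x >= 0"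
 shows "Re (smoothed_log_sum (chi d) T (of_real (1/2 + x) + \<i> * of_real t)) \<le>
  (\<Sum>p\<in>odd_primes (exp T). real_of_int (Legendre d (int p))*(real p powr - (1/2 + x) * cos (t * ln (real p)) * cutoff T p))
  + 1/2*(\<Sum>p | prime p & real p <= exp (T/2). real p powr - (2 * x) * cutoff T (p\<^sup>2)*(cos (2 * t * ln (real p)) / real p))
  + 1/2*(\<Sum>p | prime p & int p dvd d. 1 / real p) + 13"
proof -
 define N where "N = nat \<lfloor>exp T\<rfloor>"
 define \<sigma> where "\<sigma> = 1/2 + x"
 define K where "K = (%n. real_of_int (Kronecker d (int n)))"
 define F where "F = (%n. K n * real n powr - \<sigma> * cos (t * ln (real n)) * cutoff T n)"
 let ?PS = "{p. prime p & real p <= exp (T/2)}"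
 let ?SQ = "(%p. p\<^sup>2) ` ?PS"
 have N: "n <= N \<longleftrightarrow> real n <= exp T" for n unfolding N_def by (simp add: le_nat_iff le_floor_iff)
 have Re_term: "Re (mangoldt n / of_real (ln (real n)) * chi d n * of_nat n powr - (of_real \<sigma> + \<i> * of_real t) * of_real ((1 - ln (real n) / T)\<^sup>2)) = ppw n * F n"
 if "n \<in> {1..N}" for n
 proof -
 have m: "(mangoldt n / of_real (ln (real n)) :: complex) = of_real (ppw n)" by (simp add: ppw_def)
 have p: "of_nat n powr - (of_real \<sigma> + \<i> * of_real t) = of_real (real n powr - \<sigma>) * cis (- (t * ln (real n)))"
  by (rule of_nat_powr_imaginary) (use that in simp)
 have c: "chi d n = of_real (K n)" using that by (simp add: chi_def K_def)
 show ?thesis unfolding m p c cutoff_def[symmetric] F_def by simp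
 qed
 have K1: "\<bar>K n\<bar> <= 1" if "n >= 1" for n
 using abs_Kronecker_le_1[of "int n" d] that unfolding K_def by (simp flip: of_int_abs)
 have Fle: "\<bar>F n\<bar> <= real n powr - (1/2)" if n: "n \<in> {1..N}" for n
 proof -
 have co: "0 <= cutoff T n" "cutoff T n <= 1" using cutoff_bounds[of T n] N[of n] n T by auto
 have "\<bar>F n\<bar> = \<bar>K n\<bar> * real n powr - \<sigma>*\<bar>cos (t * ln (real n))\<bar> * cutoff T n"
  using co by (simp add: F_def abs_mult)
 also have "... <= 1 * real n powr - (1/2)*1*1"
  using n x co by (intro mult_mono K1 powr_mono abs_cos_le_one) (auto simp: \<sigma>_def)
 finally show ?thesis by simp
 qed
 have SQ1: "n \<in> {1..N}" "ppw n = 1/2" "\<not> prime n" if n: "n \<in> ?SQ" for n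
 proof -
 obtain p where p: "prime p" "real p <= exp (T/2)" "n = p\<^sup>2" using n by auto
 have "(real p)\<^sup>2 <= (exp (T/2))\<^sup>2" using p by (intro power_mono) auto
 also have "... = exp T" by (simp flip: exp_double)
 finally show "n \<in> {1..N}" using N[of n] p prime_gt_0_nat[of p] by simp
 show "ppw n = 1/2" using ppw_prime_power[of p 2] p by simp
 show "\<not> prime n" using p(3) by (auto simp: prime_power_iff)
 qed
 have SQ2: "p\<^sup>2 \<in> ?SQ" if "prime p" "p\<^sup>2 \<in> {1..N}" for p
 proof -
 have "(real p)\<^sup>2 <= exp T" using that N[of "p\<^sup>2"] by simp
 also have "... = (exp (T/2))\<^sup>2" by (simp flip: exp_double)
 finally have "real p <= exp (T/2)" by (rule power2_le_imp_le) simp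
 then show ?thesis using that by auto
 qed
 have pt: "ppw n * F n <= (if prime n & n \<noteq> 2 then F n else 0) + (if n = 2 then 1 else 0)
  + (if n \<in> ?SQ then F n/2 else 0) + (if n \<in> high_powers 3 N then real n powr - (1/2) else 0)"
 (is "_ <= ?a + ?b + ?c + ?d") if n: "n \<in> {1..N}" for n
 proof -
 have b: "?b >= 0" and dd: "?d >= 0" by auto
 show ?thesis
 proof (cases "prime n")
  case True
  then have cs: "?c = 0" "ppw n = 1" using SQ1(3)[of n] by (auto simp: ppw_prime)
  show ?thesis
  proof (cases "n = 2")
  case True
  have "real n powr - (1/2) <= 1" using n by (intro powr_uminus_le_one) auto
  then have "F n <= 1" using Fle[OF n] by linarith
  then show ?thesis using True cs dd by auto
  next
  case False
  then show ?thesis using \<open>prime n\<close> cs dd by auto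
  qed
 next
  case np: False
  then have a: "?a = 0" by auto
  show ?thesis
  proof (cases "n \<in> ?SQ")
  case True
  then have "ppw n * F n = ?c" using SQ1(2) by simp
  then show ?thesis using a b dd by linarith
  next
  case False
  show ?thesis
  proof (cases "ppw n = 0")
   case True
   then show ?thesis using a b dd False by auto
  next
   case nz: False
   obtain p k where pk: "prime p" "k > 0" "n = p ^ k" using nz by (rule ppw_nonzero_imp)
   have "k \<noteq> 1" using np pk by auto
   moreover have "k \<noteq> 2" using SQ2[of p] False pk n by auto
   ultimately have "3 <= k" using pk(2) by linarith
   then have hp: "n \<in> high_powers 3 N" using pk n unfolding high_powers_def by blast
   have "ppw n * F n <= ppw n*\<bar>F n\<bar>" using ppw_nonneg[of n] by (intro mult_left_mono) auto
   also have "... <= 1*\<bar>F n\<bar>" using ppw_le_1[of n] by (intro mult_right_mono) auto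
   also have "... <= ?d" using Fle[OF n] hp by simp
   finally show ?thesis using a b False by auto
  qed
  qed
 qed
 qed
 have odd_mem: "n \<in> {n \<in> {1..N}. prime n & n \<noteq> 2} \<longleftrightarrow> n \<in> odd_primes (exp T)" for n
 using N[of n] prime_ge_2_nat[of n] by (auto simp: odd_primes_def)
 have "Re (smoothed_log_sum (chi d) T (of_real \<sigma> + \<i> * of_real t)) = (\<Sum>n=1..N. ppw n * F n)"
 unfolding smoothed_log_sum_def N_def[symmetric] Re_sum by (intro sum.cong refl Re_term)
 also have "... <= (\<Sum>n=1..N. (if prime n & n \<noteq> 2 then F n else 0) + (if n = 2 then 1 else 0)
  + (if n \<in> ?SQ then F n/2 else 0) + (if n \<in> high_powers 3 N then real n powr - (1/2) else 0))"
 by (intro sum_mono pt)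
 also have "... = (\<Sum>n=1..N. if prime n & n \<noteq> 2 then F n else 0) + (\<Sum>n=1..N. if n = 2 then 1 else 0)
  + (\<Sum>n=1..N. if n \<in> ?SQ then F n/2 else 0) + (\<Sum>n=1..N. if n \<in> high_powers 3 N then real n powr - (1/2) else 0)"
 by (simp only: sum.distrib)
 also have "(\<Sum>n=1..N. if n = 2 then 1 else (0::real)) <= 1" by (simp add: sum.delta)
 also have "(\<Sum>n=1..N. if n \<in> high_powers 3 N then real n powr - (1/2) else 0) = (\<Sum>n\<in>high_powers 3 N. real n powr - (1/2))"
 by (subst sum.inter_restrict[symmetric]) (auto simp: high_powers_def intro!: sum.cong)
 also have "... <= 12" by (rule sum_high_powers_le) auto
 also have "(\<Sum>n=1..N. if prime n & n \<noteq> 2 then F n else 0) = (\<Sum>n\<in>{n \<in> {1..N}. prime n & n \<noteq> 2}. F n)"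
 by (rule sum.inter_filter[symmetric]) simp
 also have "{n \<in> {1..N}. prime n & n \<noteq> 2} = odd_primes (exp T)" by (rule Set.set_eqI) (rule odd_mem)
 also have "(\<Sum>n\<in>odd_primes (exp T). F n) =
  (\<Sum>p\<in>odd_primes (exp T). real_of_int (Legendre d (int p))*(real p powr - \<sigma> * cos (t * ln (real p)) * cutoff T p))"
 proof (rule sum.cong)
 fix p assume p: "p \<in> odd_primes (exp T)"
 then have "prime (int p)" "int p \<noteq> 2" by (auto simp: odd_primes_def)
 then have "K p = real_of_int (Legendre d (int p))" by (simp add: K_def Kronecker_prime_right Kronecker_prime_def)
 then show "F p = real_of_int (Legendre d (int p))*(real p powr - \<sigma> * cos (t * ln (real p)) * cutoff T p)"
  by (simp add: F_def)
 qed simp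
 also have "(\<Sum>n=1..N. if n \<in> ?SQ then F n/2 else 0) = (\<Sum>n\<in>{n \<in> {1..N}. n \<in> ?SQ}. F n/2)"
 by (rule sum.inter_filter[symmetric]) simp
 also have "{n \<in> {1..N}. n \<in> ?SQ} = ?SQ" using SQ1(1) by blast
 also have "(\<Sum>n\<in>?SQ. F n/2) = (\<Sum>p\<in>?PS. F (p\<^sup>2)/2)"
 by (subst sum.reindex) (auto simp: inj_on_def)
 also have "... <= (\<Sum>p\<in>?PS. (real p powr - (2 * x) * cutoff T (p\<^sup>2)*(cos (2 * t * ln (real p)) / real p))/2 + (if int p dvd d then 1 / real p else 0)/2)"
 proof (rule sum_mono)
 fix p assume p: "p \<in> ?PS"
 then have pr: "prime p" and p1: "real p >= 1" using prime_gt_0_nat[of p] by auto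
 let ?G = "real p powr - (2 * x) * cutoff T (p\<^sup>2)*(cos (2 * t * ln (real p)) / real p)"
 have n: "p\<^sup>2 \<in> {1..N}" using SQ1(1)[of "p\<^sup>2"] p by blast
 have co: "0 <= cutoff T (p\<^sup>2)" "cutoff T (p\<^sup>2) <= 1" using cutoff_bounds[of T "p\<^sup>2"] N[of "p\<^sup>2"] n T by auto
 have Ksq: "K (p\<^sup>2) = (if int p dvd d then 0 else 1)"
 proof -
  have "Kronecker d (int (p\<^sup>2)) = (Kronecker_prime d (int p))\<^sup>2"
  using Kronecker_mult_right[of "int p" "int p" d] Kronecker_prime_right[of "int p" d] pr p1
  by (simp add: power2_eq_square)
  then show ?thesis using Kronecker_prime_sq[OF pr, of d] by (simp add: K_def)
 qed
 have P: "real (p\<^sup>2) powr - \<sigma> = real p powr - (2 * x)*(1 / real p)"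
 proof -
  have "real (p\<^sup>2) powr - \<sigma> = (real p powr 2) powr - \<sigma>" using p1 by simp
  also have "... = real p powr (2 * - \<sigma>)" by (rule powr_powr)
  also have "2 * - \<sigma> = - (2 * x) + - 1" by (simp add: \<sigma>_def)
  also have "real p powr (- (2 * x) + - 1) = real p powr - (2 * x) * real p powr - 1" by (rule powr_add)
  finally show ?thesis using p1 by (simp add: powr_minus_divide)
 qed
 have ln2: "ln (real (p\<^sup>2)) = 2 * ln (real p)" using p1 by (simp add: ln_realpow)
 have FG: "F (p\<^sup>2) = K (p\<^sup>2) * ?G" unfolding F_def P ln2 by (simp add: mult_ac)
 have "\<bar>?G\<bar> = real p powr - (2 * x) * cutoff T (p\<^sup>2)*(\<bar>cos (2 * t * ln (real p))\<bar> / real p)"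
  using co p1 by (simp add: abs_mult)
 also have "... <= 1*1*(1 / real p)"
  using p1 x co by (intro mult_mono divide_right_mono abs_cos_le_one powr_uminus_le_one) auto
 finally have "- ?G <= 1 / real p" by linarith
 then show "F (p\<^sup>2)/2 <= ?G/2 + (if int p dvd d then 1 / real p else 0)/2" unfolding FG Ksq by simp
 qed
 also have "... = 1/2*(\<Sum>p\<in>?PS. real p powr - (2 * x) * cutoff T (p\<^sup>2)*(cos (2 * t * ln (real p)) / real p))
  + 1/2*(\<Sum>p\<in>?PS. if int p dvd d then 1 / real p else 0)"
 by (simp only: sum.distrib sum_divide_distrib[symmetric] times_divide_eq_left mult_1)
 also have "(\<Sum>p\<in>?PS. if int p dvd d then 1 / real p else 0) <= (\<Sum>p | prime p & int p dvd d. 1 / real p)"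
 proof -
 have "(\<Sum>p\<in>?PS. if int p dvd d then 1 / real p else 0) = (\<Sum>p\<in>{p \<in> ?PS. int p dvd d}. 1 / real p)"
  using finite_primes_le[of "exp (T/2)" "%_. True"] by (intro sum.inter_filter[symmetric]) simp
 also have "... <= (\<Sum>p | prime p & int p dvd d. 1 / real p)"
  by (intro sum_mono2 finite_prime_divisors d) auto
 finally show ?thesis .
 qed
 finally show ?thesis unfolding \<sigma>_def by simp
qed

section \<open>Tail bounds and summation over levels\<close>

text \<open>A form of Stirling's bound, n! <= e n (n/e)^n, by induction from (1 - 1/(n+1))^(n+1) <=
  1/e.\<close>

lemma fact_exp_le:
 assumes "n >= 1"
 shows "fact n * exp (real n) <= exp 1 * real n * real n ^ n"
 using assms
proof (induction n rule: nat_induct_at_least)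
 case (Suc n)
 have "real n / real (Suc n) <= exp (- (1 / real (Suc n)))"
 using exp_ge_add_one_self[of "- (1 / real (Suc n))"] by (simp add: field_simps)
 then have "(real n / real (Suc n)) ^ Suc n <= exp (- (1 / real (Suc n))) ^ Suc n" by (intro power_mono) auto
 also have "... = exp (real (Suc n) * - (1 / real (Suc n)))" by (rule exp_of_nat_mult[symmetric])
 also have "real (Suc n) * - (1 / real (Suc n)) = -1" by simp
 finally have "real n ^ Suc n / real (Suc n) ^ Suc n <= exp (-1)" by (simp only: power_divide)
 then have "real n ^ Suc n <= exp (-1) * real (Suc n) ^ Suc n" by (subst (asm) pos_divide_le_eq) auto
 then have "exp 1 * real n ^ Suc n <= exp 1*(exp (-1) * real (Suc n) ^ Suc n)" by (intro mult_left_mono) auto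
 also have "... = real (Suc n) ^ Suc n" by (simp only: mult.assoc[symmetric] exp_add[symmetric]) simp
 finally have *: "exp 1 * real n ^ Suc n <= real (Suc n) ^ Suc n" .
 have "fact (Suc n) * exp (real (Suc n)) = (real (Suc n) * exp 1)*(fact n * exp (real n))"
 by (simp add: exp_add distrib_right)
 also have "... <= (real (Suc n) * exp 1)*(exp 1 * real n * real n ^ n)" by (intro mult_left_mono Suc.IH) auto
 also have "... = (exp 1 * real (Suc n))*(exp 1 * real n ^ Suc n)" by simp
 also have "... <= (exp 1 * real (Suc n)) * real (Suc n) ^ Suc n" using * by (intro mult_left_mono) auto
 finally show ?case .
qed simp

lemma double_fact_le: "fact (2 * j)/(2 ^ j * fact j) <= (2 * real j) ^ j"
proof (induction j)
 case (Suc j)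
 have "fact (2 * Suc j)/(2 ^ Suc j * fact (Suc j)) = (2 * real j + 1)*(fact (2 * j)/(2 ^ j * fact j) :: real)"
 proof -
 have e: "2 * Suc j = Suc (Suc (2 * j))" by simp
 have "fact (2 * Suc j) = (2*(real j + 1))*((2 * real j + 1) * fact (2 * j))"
  unfolding e fact_Suc by (simp add: algebra_simps)
 moreover have "2 ^ Suc j * fact (Suc j) = (2*(real j + 1))*(2 ^ j * fact j)" by (simp add: algebra_simps)
 moreover have "2*(real j + 1) \<noteq> 0" by simp
 ultimately show ?thesis by (simp only: mult_divide_mult_cancel_left) simp
 qed
 also have "... <= (2 * real j + 1)*(2 * real j) ^ j" by (intro mult_left_mono Suc.IH) auto
 also have "... <= (2 * real (Suc j))*(2 * real (Suc j)) ^ j" by (intro mult_mono power_mono) auto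
 finally show ?case by simp
qed simp

text \<open>Markov's inequality for the moment of order 2k. The bound 4 on the coefficients is the
  one that holds for \<open>acoef\<close>.\<close>

lemma tail_count:
 fixes a :: "nat \<Rightarrow> real"
 assumes D: "\<And>d. d \<in> D ==> \<bar>real_of_int d\<bar> <= X" "finite D" and X: "X >= 1"
 and P: "P \<subseteq> odd_primes y" and y: "y >= 0" and a: "\<And>p. p \<in> P ==> \<bar>a p\<bar> <= 4" and v: "(\<Sum>p\<in>P. (a p)\<^sup>2) <= v" and W: "W >= 0"
 shows "real (card {d \<in> D. W <= (\<Sum>p\<in>P. a p * real_of_int (Legendre d (int p)))}) * W^(2 * k)
 <= 3 * X*(fact (2 * k)/(2 ^ k * fact k)) * v ^ k + (4 * y\<^sup>2)^(2 * k)"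
proof -
 let ?S = "%d. \<Sum>p\<in>P. a p * real_of_int (Legendre d (int p))"
 have finP: "finite P" by (rule finite_subset[OF _ finite_primes_le[of y "%_. True"]]) (use P in \<open>auto simp: odd_primes_def\<close>)
 have "real (card {d \<in> D. W <= ?S d}) * W^(2 * k) = (\<Sum>d\<in>{d \<in> D. W <= ?S d}. W^(2 * k))" by simp
 also have "... <= (\<Sum>d\<in>{d \<in> D. W <= ?S d}. ?S d^(2 * k))" using W by (intro sum_mono power_mono) auto
 also have "... <= 3 * X*(fact (2 * k)/(2 ^ k * fact k))*(\<Sum>p\<in>P. (a p)\<^sup>2) ^ k + (4 * y\<^sup>2)^(2 * k)"
 by (rule character_moment[OF finP _ a _ y X]) (use P D in \<open>auto simp: odd_primes_def\<close>)
 also have "... <= 3 * X*(fact (2 * k)/(2 ^ k * fact k)) * v ^ k + (4 * y\<^sup>2)^(2 * k)"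
 using X v by (intro add_right_mono mult_left_mono power_mono sum_nonneg) auto
 finally show ?thesis .
qed

text \<open>Each d has a level \<open>\<kappa> d\<close>. Levels below K are lumped together through
  monotonicity of g; at every higher level d is counted by one of two exceptional sets, so that
  their cardinalities control the sum.\<close>

lemma layered_sum_le:
 fixes g :: "nat \<Rightarrow> real"
 assumes D: "finite D" and g: "\<And>k. g k >= 0" "mono g"
 and AB: "\<And>d. d \<in> D ==> K <= \<kappa> d ==> \<kappa> d <= M & (d \<in> A (\<kappa> d) \<or> d \<in> B (\<kappa> d))"
 and sub: "\<And>k. A k \<subseteq> D" "\<And>k. B k \<subseteq> D"
 shows "(\<Sum>d\<in>D. g (\<kappa> d)) <= real (card D) * g K + (\<Sum>k=K..M. g k * real (card (A k))) + (\<Sum>k=K..M. g k * real (card (B k)))"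
proof -
 let ?h = "%d k. g k*((if d \<in> A k then 1 else 0) + (if d \<in> B k then 1 else 0))"
 have h0: "?h d k >= 0" for d k using g(1)[of k] by auto
 have "g (\<kappa> d) <= g K + (\<Sum>k=K..M. ?h d k)" if d: "d \<in> D" for d
 proof (cases "K <= \<kappa> d")
 case True
 have "g (\<kappa> d) <= ?h d (\<kappa> d)" using AB[OF d True] g(1)[of "\<kappa> d"] by auto
 also have "... <= (\<Sum>k=K..M. ?h d k)"
  by (rule member_le_sum) (use AB[OF d True] True h0 in auto)
 finally show ?thesis using g(1)[of K] by linarith
 next
 case False
 have "g (\<kappa> d) <= g K" by (rule monoD[OF g(2)]) (use False in simp)
 moreover have "(\<Sum>k=K..M. ?h d k) >= 0" by (intro sum_nonneg h0)
 ultimately show ?thesis by linarith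
 qed
 then have "(\<Sum>d\<in>D. g (\<kappa> d)) <= (\<Sum>d\<in>D. g K + (\<Sum>k=K..M. ?h d k))" by (rule sum_mono)
 also have "... = (\<Sum>d\<in>D. g K) + (\<Sum>d\<in>D. \<Sum>k=K..M. ?h d k)" by (rule sum.distrib)
 also have "(\<Sum>d\<in>D. g K) = real (card D) * g K" by simp
 also have "(\<Sum>d\<in>D. \<Sum>k=K..M. ?h d k) = (\<Sum>k=K..M. \<Sum>d\<in>D. ?h d k)" by (rule sum.swap)
 also have "(\<Sum>k=K..M. \<Sum>d\<in>D. ?h d k) = (\<Sum>k=K..M. g k * real (card (A k)) + g k * real (card (B k)))"
 proof (rule sum.cong)
 fix k
 have c: "(\<Sum>d\<in>D. if d \<in> S then 1 else 0 :: real) = real (card S)" if "S \<subseteq> D" for S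
  using D that by (simp add: sum.inter_restrict[symmetric] Int_absorb1)
 show "(\<Sum>d\<in>D. ?h d k) = g k * real (card (A k)) + g k * real (card (B k))"
  by (simp only: sum_distrib_left[symmetric] sum.distrib c sub distrib_left)
 qed simp
 finally show ?thesis by (simp add: sum.distrib)
qed

lemma sum_exp_series_le: "u >= 0 ==> (\<Sum>k\<in>{K..M}. u ^ k / fact k) <= exp (u :: real)"
proof -
 assume u: "u >= 0"
 have s: "(%k. u ^ k / fact k) sums exp u" using exp_converges[of u] by (simp add: divide_inverse mult.commute)
 have "(\<Sum>k\<in>{K..M}. u ^ k / fact k) <= (\<Sum>k. u ^ k / fact k)"
 by (rule sum_le_suminf) (use s u in \<open>auto simp: sums_iff\<close>)
 then show ?thesis using s by (simp add: sums_iff)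
qed

text \<open>Level k collects the d whose centred logarithm lies between 2k(1 + 4e) and (2k + 2)(1 +
  4e); this is the exponential of the upper end.\<close>

definition level_weight :: "real \<Rightarrow> nat \<Rightarrow> real" where
 "level_weight e k = exp (real (2 * k + 2)*(1 + 4 * e))"

text \<open>The moment of order 2k at threshold 2k is the right choice: by Stirling exp(2k)
  (2k)!/(2k)^(2k) is at most e times 2k, so the level contributes about (v/2)^k/k!. Summing over k
  recovers the Gaussian value exp(v/2), up to the factor exp(9e) in the exponent.\<close>

lemma small_prime_levels:
 assumes e: "0 < e" "e <= 1/4" and X: "X >= 1" and v: "v >= 0" and K: "K >= 1"
 and c: "\<And>k. K <= k ==> k <= M ==> c k * real (2 * k)^(2 * k) <= 3 * X*(fact (2 * k)/(2 ^ k * fact k)) * v ^ k + 16 ^ k * X"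
 shows "(\<Sum>k=K..M. level_weight e k * c k) <= (3 * exp 5*(2 / e) + exp 4 * exp (4 * exp 4)) * X * exp (v * exp (9 * e)/2)"
proof -
 \<comment> \<open>In exp(9e), 8e comes from the width of the levels and e from the factor 2k of
   Stirling's bound, estimated by (2/e) exp(e k). \<open>?w\<close> governs the nonsquare tuples:
   exp(4k) 16^k/(2k)^(2k) is at most (4 exp 4)^k/k!.\<close>
 let ?u = "v * exp (9 * e)/2" and ?w = "4 * exp 4 :: real"
 have level: "level_weight e k * c k <= 3 * X * exp 5*(2 / e)*(?u ^ k / fact k) + exp 4 * X*(?w ^ k / fact k)"
 if k: "k \<in> {K..M}" for k
 proof -
 let ?n = "real (2 * k)"
 have k1: "k >= 1" and n0: "?n > 0" using k K by auto
 have pn: "?n^(2 * k) > 0" using n0 by simp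
 have g: "level_weight e k <= exp 4*(exp ?n * exp (8 * e) ^ k)"
 proof -
  have "exp (8 * e) ^ k = exp (real k*(8 * e))" by (rule exp_of_nat_mult[symmetric])
  then have "exp 4*(exp ?n * exp (8 * e) ^ k) = exp (4 + (?n + real k*(8 * e)))" by (simp only: exp_add)
  moreover have "real (2 * k + 2)*(1 + 4 * e) <= 4 + (?n + real k*(8 * e))" using e by (simp add: algebra_simps)
  ultimately show ?thesis by (simp add: level_weight_def)
 qed
 have "c k <= (3 * X*(fact (2 * k)/(2 ^ k * fact k)) * v ^ k + 16 ^ k * X) / ?n^(2 * k)"
  using c[of k] k pn by (simp only: pos_le_divide_eq atLeastAtMost_iff)
 then have "level_weight e k * c k <= level_weight e k*((3 * X*(fact (2 * k)/(2 ^ k * fact k)) * v ^ k + 16 ^ k * X) / ?n^(2 * k))"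
  by (intro mult_left_mono) (auto simp: level_weight_def)
 also have "... <= (exp 4*(exp ?n * exp (8 * e) ^ k))*((3 * X*(fact (2 * k)/(2 ^ k * fact k)) * v ^ k + 16 ^ k * X) / ?n^(2 * k))"
  using g X v n0 by (intro mult_right_mono divide_nonneg_nonneg add_nonneg_nonneg mult_nonneg_nonneg) auto
 also have "... = 3 * X * exp 4*(exp (8 * e) ^ k * v ^ k/(2 ^ k * fact k))*(fact (2 * k) * exp ?n / ?n^(2 * k))
  + exp 4 * X*(exp ?n * exp (8 * e) ^ k*16 ^ k / ?n^(2 * k))"
  by (simp add: add_divide_distrib distrib_left mult_ac)
 also have "... <= 3 * X * exp 5*(2 / e)*(?u ^ k / fact k) + exp 4 * X*(?w ^ k / fact k)"
 proof (rule add_mono)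
  have "fact (2 * k) * exp ?n <= exp 1 * ?n * ?n^(2 * k)" by (rule fact_exp_le) (use k1 in simp)
  then have "fact (2 * k) * exp ?n / ?n^(2 * k) <= exp 1 * ?n" using pn by (simp only: pos_divide_le_eq)
  also have "?n <= 2 / e * exp e ^ k"
  proof -
  have "e * real k <= exp (real k * e)" using exp_ge_add_one_self[of "real k * e"] by (subst mult.commute) linarith
  also have "... = exp e ^ k" by (rule exp_of_nat_mult)
  finally have "2*(e * real k) <= 2 * exp e ^ k" by simp
  then show ?thesis using e by (simp add: field_simps)
  qed
  finally have 1: "fact (2 * k) * exp ?n / ?n^(2 * k) <= exp 1*(2 / e * exp e ^ k)" by simp
  have "3 * X * exp 4*(exp (8 * e) ^ k * v ^ k/(2 ^ k * fact k))*(fact (2 * k) * exp ?n / ?n^(2 * k))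
  <= 3 * X * exp 4*(exp (8 * e) ^ k * v ^ k/(2 ^ k * fact k))*(exp 1*(2 / e * exp e ^ k))"
  using X v by (intro mult_left_mono[OF 1] mult_nonneg_nonneg divide_nonneg_nonneg) auto
  also have "... = 3 * X*(exp 4 * exp 1)*(2 / e)*((exp (8 * e) * exp e * v/2) ^ k / fact k)"
  by (simp add: power_mult_distrib power_divide mult_ac)
  also have "exp 4 * exp 1 = (exp 5 :: real)" by (simp flip: exp_add)
  also have "exp (8 * e) * exp e = exp (9 * e)" by (simp flip: exp_add)
  finally show "3 * X * exp 4*(exp (8 * e) ^ k * v ^ k/(2 ^ k * fact k))*(fact (2 * k) * exp ?n / ?n^(2 * k))
  <= 3 * X * exp 5*(2 / e)*(?u ^ k / fact k)" by (simp add: mult.commute)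
  have "exp ?n * exp (8 * e) ^ k <= exp 4 ^ k"
  proof -
  have "exp ?n * exp (8 * e) ^ k = exp (?n + real k*(8 * e))" by (simp only: exp_add exp_of_nat_mult)
  also have "?n + real k*(8 * e) <= real k*4" using mult_left_mono[of "8 * e" 2 "real k"] e by simp
  then have "exp (?n + real k*(8 * e)) <= exp (real k*4)" by simp
  also have "... = exp 4 ^ k" by (rule exp_of_nat_mult)
  finally show ?thesis .
  qed
  then have "exp ?n * exp (8 * e) ^ k*16 ^ k / ?n^(2 * k) <= exp 4 ^ k*16 ^ k / ?n^(2 * k)"
  using n0 by (intro divide_right_mono mult_right_mono) auto
  also have "... = ?w ^ k / real k^(2 * k)"
  proof -
  have 1: "?n^(2 * k) = 2^(2 * k) * real k^(2 * k)" by (simp add: power_mult_distrib)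
  have 2: "(2 :: real)^(2 * k) = 4 ^ k" by (simp add: power_mult)
  have 3: "(16 :: real) ^ k = 4 ^ k*4 ^ k" by (simp flip: power_mult_distrib)
  show ?thesis unfolding 1 2 3 power_mult_distrib by (simp add: mult.commute)
  qed
  also have "... <= ?w ^ k / fact k"
  proof (intro divide_left_mono mult_pos_pos)
  have "fact k <= real k ^ k" using fact_le_power[of k, where 'a = real] by simp
  also have "... <= real k^(2 * k)" using k1 by (intro power_increasing) auto
  finally show "fact k <= real k^(2 * k)" .
  qed (use k1 in auto)
  finally show "exp 4 * X*(exp ?n * exp (8 * e) ^ k*16 ^ k / ?n^(2 * k)) <= exp 4 * X*(?w ^ k / fact k)"
  using X by (intro mult_left_mono) auto
 qed
 finally show ?thesis .
 qed
 have u0: "?u >= 0" using v by simp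
 have "(\<Sum>k=K..M. level_weight e k * c k) <= (\<Sum>k=K..M. 3 * X * exp 5*(2 / e)*(?u ^ k / fact k) + exp 4 * X*(?w ^ k / fact k))"
 by (rule sum_mono[OF level])
 also have "... = 3 * X * exp 5*(2 / e)*(\<Sum>k=K..M. ?u ^ k / fact k) + exp 4 * X*(\<Sum>k=K..M. ?w ^ k / fact k)"
 by (simp only: sum.distrib sum_distrib_left)
 also have "... <= 3 * X * exp 5*(2 / e) * exp ?u + exp 4 * X*(exp ?w * exp ?u)"
 proof (intro add_mono mult_left_mono sum_exp_series_le u0)
 have "(\<Sum>k=K..M. ?w ^ k / fact k) <= exp ?w" by (rule sum_exp_series_le) simp
 also have "... <= exp ?w * exp ?u" using u0 by simp
 finally show "(\<Sum>k=K..M. ?w ^ k / fact k) <= exp ?w * exp ?u" .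
 qed (use X e in auto)
 finally show ?thesis by (simp add: algebra_simps)
qed

text \<open>Here the variance is at most the constant w, while the threshold 2 e k grows with k. A
  moment of order 2j with j about e k/(8C) yields a bound of the shape (constant/k)^j, which for
  large k decays faster than the level weights grow.\<close>

lemma large_prime_levels:
 assumes e: "0 < e" "e <= 1/4" and C: "C >= 1" and w: "w >= 8"
 shows "\<exists>A K. K >= 1 & (\<forall>X\<ge>1. \<forall>K'\<ge>K. \<forall>M c. (\<forall>k. K' <= k & k <= M --> (let j = nat \<lfloor>e * real k/(8 * C)\<rfloor> in
  c k*(2 * e * real k)^(2 * j) <= 3 * X*(fact (2 * j)/(2 ^ j * fact j)) * w ^ j + 16 ^ j * X)) -->
  (\<Sum>k=K'..M. level_weight e k * c k) <= A * X)"
proof -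
 \<comment> \<open>q j is about 5k, so exp(-q j) outweighs the level weight, which is at most exp(4k
   + 4). \<open>K\<close> is large enough that c'/k <= exp(-q).\<close>
 define q where "q = 40 * C / e"
 define c' where "c' = 2 * w/(4 * e\<^sup>2)"
 define K where "K = nat \<lceil>c' * exp q\<rceil> + 1"
 have q: "q > 0" using e C by (simp add: q_def)
 have c': "c' > 0" using e w by (simp add: c'_def)
 have main: "(\<Sum>k=K'..M. level_weight e k * c k) <= (4 * exp (4 + q)*2) * X"
 if X: "X >= 1" and K': "K' >= K" and c: "\<forall>k. K' <= k & k <= M --> (let j = nat \<lfloor>e * real k/(8 * C)\<rfloor> in
  c k*(2 * e * real k)^(2 * j) <= 3 * X*(fact (2 * j)/(2 ^ j * fact j)) * w ^ j + 16 ^ j * X)" for X K' M c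
 proof -
 have level: "level_weight e k * c k <= 4 * exp (4 + q) * X*(1/2) ^ k" if k: "k \<in> {K'..M}" for k
 proof -
  define j where "j = nat \<lfloor>e * real k/(8 * C)\<rfloor>"
  have k1: "real k >= 1" "real k >= c' * exp q"
  using k K' real_nat_ceiling_ge[of "c' * exp q"] by (auto simp: K_def)
  have nn: "e * real k/(8 * C) >= 0" using e C by simp
  have j1: "real j <= e * real k/(8 * C)" unfolding j_def by (rule of_nat_floor[OF nn])
  have j2: "real j > e * real k/(8 * C) - 1" using nn unfolding j_def by linarith
  have jk: "real j <= real k"
  proof -
  have "e * real k <= real k*(8 * C)" using mult_mono[of e "8 * C" "real k" "real k"] e C by (simp add: mult.commute)
  then have "e * real k/(8 * C) <= real k" using C by (simp add: pos_divide_le_eq)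
  then show ?thesis using j1 by linarith
  qed
  let ?b = "(2 * e * real k)^(2 * j)"
  have b: "?b > 0" using e k1 by simp
  have "c k * ?b <= 3 * X*(fact (2 * j)/(2 ^ j * fact j)) * w ^ j + 16 ^ j * X"
  using c k unfolding j_def Let_def by simp
  also have "... <= 3 * X*(2 * real k) ^ j * w ^ j + (2 * real k * w) ^ j * X"
  proof (intro add_mono mult_right_mono mult_left_mono)
  have "(2 * real j) ^ j <= (2 * real k) ^ j" using jk by (intro power_mono) auto
  then show "fact (2 * j)/(2 ^ j * fact j) <= (2 * real k) ^ j" using double_fact_le[of j] by linarith
  have "2*1*8 <= 2 * real k * w" using k1 w by (intro mult_mono) auto
  then show "16 ^ j <= (2 * real k * w) ^ j" by (intro power_mono) auto
  qed (use X w in auto)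
  also have "... = 4 * X*(2 * real k * w) ^ j" by (simp add: power_mult_distrib)
  finally have "c k <= 4 * X*(2 * real k * w) ^ j / ?b" using b by (simp only: pos_le_divide_eq)
  also have "... = 4 * X*(c' / real k) ^ j"
  proof -
  have "(2 * real k * w)/(2 * e * real k)\<^sup>2 = c' / real k"
   using e k1 by (simp add: c'_def power2_eq_square field_simps)
  moreover have "4 * X*(2 * real k * w) ^ j / ?b = 4 * X*((2 * real k * w)/(2 * e * real k)\<^sup>2) ^ j"
   by (simp only: power_mult power_divide times_divide_eq_right)
  ultimately show ?thesis by simp
  qed
  also have "... <= 4 * X * exp (- 5 * real k + q)"
  proof (intro mult_left_mono)
  have "c' / real k <= exp (- q)" using k1 by (simp add: exp_minus field_simps)
  then have "(c' / real k) ^ j <= exp (- q) ^ j" using c' k1 by (intro power_mono) auto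
  also have "... = exp (real j * - q)" by (rule exp_of_nat_mult[symmetric])
  also have "... <= exp (- 5 * real k + q)"
  proof -
   have "q*(e * real k/(8 * C) - 1) <= q * real j" using q j2 by (intro mult_left_mono) auto
   moreover have "q*(e * real k/(8 * C) - 1) = 5 * real k - q" using e C by (simp add: q_def field_simps)
   ultimately show ?thesis by (simp add: mult.commute)
  qed
  finally show "(c' / real k) ^ j <= exp (- 5 * real k + q)" .
  qed (use X in auto)
  finally have ck: "c k <= 4 * X * exp (- 5 * real k + q)" .
  have g: "level_weight e k <= exp (4 * real k + 4)"
  proof -
  have "real (2 * k + 2)*(1 + 4 * e) <= real (2 * k + 2)*2" using e by (intro mult_left_mono) auto
  then show ?thesis by (simp add: level_weight_def)
  qed
  have "level_weight e k * c k <= level_weight e k*(4 * X * exp (- 5 * real k + q))"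
  using ck by (intro mult_left_mono) (auto simp: level_weight_def)
  also have "... <= exp (4 * real k + 4)*(4 * X * exp (- 5 * real k + q))" using g X by (intro mult_right_mono) auto
  also have "... = 4 * X*(exp (4 * real k + 4) * exp (- 5 * real k + q))" by simp
  also have "exp (4 * real k + 4) * exp (- 5 * real k + q) = exp ((4 + q) + real k * -1)" by (simp flip: exp_add)
  also have "... = exp (4 + q) * exp (-1) ^ k" by (simp only: exp_add exp_of_nat_mult)
  also have "4 * X*(exp (4 + q) * exp (-1) ^ k) <= 4 * X*(exp (4 + q)*(1/2) ^ k)"
  proof (intro mult_left_mono power_mono)
  have "exp 1 >= (2 :: real)" using exp_ge_add_one_self[of 1] by simp
  then show "exp (-1) <= (1/2 :: real)" by (simp add: exp_minus field_simps)
  qed (use X in auto)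
  finally show ?thesis by (simp only: mult_ac)
 qed
 have "(\<Sum>k=K'..M. level_weight e k * c k) <= (\<Sum>k=K'..M. 4 * exp (4 + q) * X*(1/2) ^ k)" by (rule sum_mono[OF level])
 also have "... = 4 * exp (4 + q) * X*(\<Sum>k=K'..M. (1/2) ^ k)" by (simp only: sum_distrib_left)
 also have "... <= 4 * exp (4 + q) * X*2"
 proof (intro mult_left_mono)
  have "(\<Sum>k=K'..M. (1/2 :: real) ^ k) <= (\<Sum>k. (1/2) ^ k)" by (rule sum_le_suminf) auto
  then show "(\<Sum>k=K'..M. (1/2 :: real) ^ k) <= 2" by (simp add: suminf_geometric)
 qed (use X in auto)
 finally show ?thesis by simp
 qed
 show ?thesis using main by (intro exI[of _ "4 * exp (4 + q)*2"] exI[of _ K]) (auto simp: K_def)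
qed

section \<open>Variance, exponents and the bound for the sum over discriminants\<close>

text \<open>The coefficient of (d/p) in the logarithm of the product of the two squared absolute
  values; the 2 comes from the squares.\<close>

definition acoef :: "real \<Rightarrow> complex \<Rightarrow> complex \<Rightarrow> nat \<Rightarrow> real" where
 "acoef T z1 z2 p = 2 * cutoff T p * real p powr - (1/2) *
  (real p powr - Re z1 * cos (Im z1 * ln (real p)) + real p powr - Re z2 * cos (Im z2 * ln (real p)))"

lemma abs_acoef_le:
 assumes "T > 0" "1 <= p" "real p <= exp T" "Re z1 >= 0" "Re z2 >= 0"
 shows "\<bar>acoef T z1 z2 p\<bar> <= 4 * real p powr - (1/2)" "\<bar>acoef T z1 z2 p\<bar> <= 4" "(acoef T z1 z2 p)\<^sup>2 <= 16*(1 / real p)"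
proof -
 note co = cutoff_bounds[OF assms(1-3)]
 have c: "\<bar>real p powr - x * cos y\<bar> <= 1" if "x >= 0" for x y
 proof -
 have "\<bar>real p powr - x * cos y\<bar> = real p powr - x*\<bar>cos y\<bar>" by (simp add: abs_mult)
 also have "... <= 1*1" using assms that by (intro mult_mono powr_uminus_le_one abs_cos_le_one) auto
 finally show ?thesis by simp
 qed
 let ?s = "real p powr - Re z1 * cos (Im z1 * ln (real p)) + real p powr - Re z2 * cos (Im z2 * ln (real p))"
 have s: "\<bar>?s\<bar> <= 2" using c[OF assms(4), of "Im z1 * ln (real p)"] c[OF assms(5), of "Im z2 * ln (real p)"] by linarith
 have "\<bar>acoef T z1 z2 p\<bar> = (2 * cutoff T p * real p powr - (1/2))*\<bar>?s\<bar>" using co by (simp add: acoef_def abs_mult)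
 also have "... <= (2*1 * real p powr - (1/2))*2" using co s by (intro mult_mono) auto
 finally show 1: "\<bar>acoef T z1 z2 p\<bar> <= 4 * real p powr - (1/2)" by simp
 have "real p powr - (1/2) <= 1" using assms by (intro powr_uminus_le_one) auto
 then show "\<bar>acoef T z1 z2 p\<bar> <= 4" using 1 by linarith
 have "(acoef T z1 z2 p)\<^sup>2 = \<bar>acoef T z1 z2 p\<bar>\<^sup>2" by simp
 also have "... <= (4 * real p powr - (1/2))\<^sup>2" using 1 by (intro power_mono) auto
 also have "... = 16 * real p powr (- (1/2) + - (1/2))" by (simp only: power_mult_distrib power2_eq_square powr_add)
 also have "... = 16*(1 / real p)" using assms by (simp add: powr_minus_divide)
 finally show "(acoef T z1 z2 p)\<^sup>2 <= 16*(1 / real p)" .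
qed

text \<open>Squaring and multiplying cosines leaves frequencies 0, 2 Im z1, 2 Im z2 and Im z1 +- Im
  z2. Each comes with a nonincreasing weight at most 1, so the upper bounds F for unweighted sums
  apply.\<close>

lemma acoef_variance_le:
 assumes T: "T > 0" and z: "Re z1 >= 0" "Re z2 >= 0" and yT: "y <= exp T"
 and F: "\<And>t x. t \<in> {0, 2 * Im z1, 2 * Im z2, Im z1 + Im z2, Im z1 - Im z2} ==> x <= exp T ==>
  (\<Sum>p | prime p & real p <= x. cos (t * ln (real p)) / real p) <= F t" "\<And>t. F t >= 0"
 shows "(\<Sum>p\<in>odd_primes y. (acoef T z1 z2 p)\<^sup>2)
  <= 4*(F 0 + F (2 * Im z1)/2 + F (2 * Im z2)/2 + F (Im z1 + Im z2) + F (Im z1 - Im z2))"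
proof -
 let ?P = "{p. prime p & real p <= y}"
 let ?W = "%c p. (cutoff T p)\<^sup>2 * real p powr - c"
 let ?S = "%c t. \<Sum>p\<in>?P. ?W c p*(cos (t * ln (real p)) / real p)"
 have S: "?S c t <= F t" if c: "c >= 0" and t: "t \<in> {0, 2 * Im z1, 2 * Im z2, Im z1 + Im z2, Im z1 - Im z2}" for c t
 proof (rule weighted_prime_sum_le)
 show "(\<Sum>p | prime p & real p <= x. cos (t * ln (real p)) / real p) <= F t" if "x <= y" for x
  using F(1)[OF t] that yT by simp
 show "?W c n <= ?W c m" if "1 <= m" "m <= n" "real n <= y" for m n
  using that yT c cutoff_bounds[OF T, of n] cutoff_antimono[OF T, of m n]
  by (intro mult_mono power_mono powr_mono2') auto
 have "cutoff T 1 <= 1" "cutoff T 1 >= 0" using T by (auto intro!: cutoff_bounds)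
 then show "?W c 1 <= 1" by (simp add: power_le_one)
 qed (use F(2) in auto)
 have finP: "finite ?P" using finite_primes_le[of y "%_. True"] by simp
 have "(\<Sum>p\<in>odd_primes y. (acoef T z1 z2 p)\<^sup>2) <= (\<Sum>p\<in>?P. (acoef T z1 z2 p)\<^sup>2)"
 by (rule sum_mono2[OF finP]) (auto simp: odd_primes_def)
 also have "... = (\<Sum>p\<in>?P. 2*(?W (2 * Re z1) p*(cos (0 * ln (real p)) / real p)) + 2*(?W (2 * Re z1) p*(cos (2 * Im z1 * ln (real p)) / real p))
  + 2*(?W (2 * Re z2) p*(cos (0 * ln (real p)) / real p)) + 2*(?W (2 * Re z2) p*(cos (2 * Im z2 * ln (real p)) / real p))
  + 4*(?W (Re z1 + Re z2) p*(cos ((Im z1 + Im z2) * ln (real p)) / real p)) + 4*(?W (Re z1 + Re z2) p*(cos ((Im z1 - Im z2) * ln (real p)) / real p)))"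
 proof (rule sum.cong)
 fix p assume p: "p \<in> ?P"
 then have p0: "real p > 0" using prime_gt_0_nat by auto
 define l where "l = ln (real p)"
 define A where "A = real p powr - Re z1"
 define B where "B = real p powr - Re z2"
 have AA: "real p powr - (2 * Re z1) = A * A" unfolding A_def powr_add[symmetric] by simp
 have BB: "real p powr - (2 * Re z2) = B * B" unfolding B_def powr_add[symmetric] by simp
 have AB: "real p powr - (Re z1 + Re z2) = A * B" unfolding A_def B_def powr_add[symmetric] by simp
 have h: "real p powr - (1/2) * real p powr - (1/2) = 1 / real p" unfolding powr_add[symmetric] using p0 by (simp add: powr_minus_divide)
 have c1: "cos (2 * Im z1 * l) = 2*(cos (Im z1 * l))\<^sup>2 - 1" using cos_double_cos[of "Im z1 * l"] by (simp add: mult.assoc)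
 have c2: "cos (2 * Im z2 * l) = 2*(cos (Im z2 * l))\<^sup>2 - 1" using cos_double_cos[of "Im z2 * l"] by (simp add: mult.assoc)
 have c3: "cos ((Im z1 + Im z2) * l) = cos (Im z1 * l) * cos (Im z2 * l) - sin (Im z1 * l) * sin (Im z2 * l)"
  by (simp add: distrib_right cos_add)
 have c4: "cos ((Im z1 - Im z2) * l) = cos (Im z1 * l) * cos (Im z2 * l) + sin (Im z1 * l) * sin (Im z2 * l)"
  by (simp add: left_diff_distrib cos_diff)
 have "(acoef T z1 z2 p)\<^sup>2 = 4*(cutoff T p)\<^sup>2*(real p powr - (1/2) * real p powr - (1/2))*(A * cos (Im z1 * l) + B * cos (Im z2 * l))\<^sup>2"
  by (simp add: acoef_def A_def B_def l_def power2_eq_square mult_ac)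
 also have "... = (4*(cutoff T p)\<^sup>2*(A * cos (Im z1 * l) + B * cos (Im z2 * l))\<^sup>2)*(1 / real p)" unfolding h by simp
 finally show "(acoef T z1 z2 p)\<^sup>2 = 2*(?W (2 * Re z1) p*(cos (0 * ln (real p)) / real p)) + 2*(?W (2 * Re z1) p*(cos (2 * Im z1 * ln (real p)) / real p))
  + 2*(?W (2 * Re z2) p*(cos (0 * ln (real p)) / real p)) + 2*(?W (2 * Re z2) p*(cos (2 * Im z2 * ln (real p)) / real p))
  + 4*(?W (Re z1 + Re z2) p*(cos ((Im z1 + Im z2) * ln (real p)) / real p)) + 4*(?W (Re z1 + Re z2) p*(cos ((Im z1 - Im z2) * ln (real p)) / real p))"
  unfolding l_def[symmetric] AA BB AB c1 c2 c3 c4 by (simp add: power2_eq_square add_divide_distrib diff_divide_distrib algebra_simps)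
 qed simp
 also have "... = 2 * ?S (2 * Re z1) 0 + 2 * ?S (2 * Re z1) (2 * Im z1) + 2 * ?S (2 * Re z2) 0 + 2 * ?S (2 * Re z2) (2 * Im z2)
  + 4 * ?S (Re z1 + Re z2) (Im z1 + Im z2) + 4 * ?S (Re z1 + Re z2) (Im z1 - Im z2)"
 by (simp only: sum.distrib sum_distrib_left)
 also have "... <= 2 * F 0 + 2 * F (2 * Im z1) + 2 * F 0 + 2 * F (2 * Im z2) + 4 * F (Im z1 + Im z2) + 4 * F (Im z1 - Im z2)"
 by (intro add_mono mult_left_mono S) (use z in auto)
 finally show ?thesis by simp
qed

text \<open>Monotonicity up to a constant: passing to an argument of at least half the size at most
  doubles the peak.\<close>

lemma peak_half:
 assumes L: "ln X >= 1" and s: "\<bar>u\<bar>/2 <= \<bar>s\<bar>"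
 shows "peak X s <= 2 * peak X u"
proof (cases "\<bar>s\<bar> * ln X <= 1")
 case True
 then have ps: "peak X s = ln X" by (simp add: peak_def)
 show ?thesis
 proof (cases "\<bar>u\<bar> * ln X <= 1")
 case False
 then have u0: "\<bar>u\<bar> > 0" by (cases "u = 0") auto
 have "\<bar>u\<bar>/2 * ln X <= \<bar>s\<bar> * ln X" using s L by (intro mult_right_mono) auto
 then have "ln X*\<bar>u\<bar> <= 2" using True by (simp add: mult.commute)
 then have "ln X <= 2*(1 / \<bar>u\<bar>)" using u0 by (simp add: pos_le_divide_eq)
 also have "... <= 2 * peak X u" using False by (simp add: peak_def)
 finally show ?thesis using ps by simp
 qed (use ps L in \<open>simp add: peak_def\<close>)
next
 case False
 then have s0: "\<bar>s\<bar> > 0" by (cases "s = 0") auto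
 have ps: "peak X s = max 1 (1 / \<bar>s\<bar>)" using False by (simp add: peak_def)
 have "1 <= 2 * peak X u" using peak_bounds(1)[OF L, of u] by simp
 moreover have "1 / \<bar>s\<bar> <= 2 * peak X u"
 proof (cases "\<bar>u\<bar> * ln X <= 1")
 case True
 have "1 / \<bar>s\<bar> <= ln X" using False s0 by (simp add: pos_divide_le_eq mult.commute)
 then show ?thesis using True L by (simp add: peak_def)
 next
 case False
 then have u0: "\<bar>u\<bar> > 0" by (cases "u = 0") auto
 then have "1 / \<bar>s\<bar> <= 1/(\<bar>u\<bar>/2)" using s s0 by (intro divide_left_mono mult_pos_pos) auto
 also have "... = 2*(1 / \<bar>u\<bar>)" by simp
 also have "... <= 2 * peak X u" using False by (simp add: peak_def)
 finally show ?thesis .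
 qed
 ultimately show ?thesis unfolding ps by simp
qed

text \<open>Any two of 2a, 2b, a + b differ by a - b or 2(a - b), possibly up to sign, so at most
  one of them is smaller than |a - b|/2. That one is bounded by ln X, the other two by twice the
  peak at a - b.\<close>

lemma peak_product_le:
 assumes L: "ln X >= 1"
 shows "peak X (2 * a) * peak X (2 * b) * peak X (a + b) * peak X (a - b) <= 4 * ln X * peak X (a - b)^3"
proof -
 let ?u = "a - b"
 note pb = peak_bounds[OF L]
 have half: "peak X s <= 2 * peak X ?u" if "\<bar>?u\<bar>/2 <= \<bar>s\<bar>" for s by (rule peak_half[OF L that])
 have p0: "peak X s >= 0" for s using pb(1)[of s] by simp
 have gen: "x * y * z <= 4 * ln X * m^2" if "0 <= x" "0 <= y" "0 <= z" "x <= ln X" "y <= 2 * m" "z <= 2 * m" for x y z m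
 proof -
 have "x * y * z <= ln X*(2 * m)*(2 * m)" using that L by (intro mult_mono mult_nonneg_nonneg) auto
 then show ?thesis by (simp add: power2_eq_square mult_ac)
 qed
 have "peak X (2 * a) * peak X (2 * b) * peak X (a + b) <= 4 * ln X * peak X ?u^2"
 proof (cases "\<bar>?u\<bar>/2 <= \<bar>2 * b\<bar>")
 case b: True
 show ?thesis
 proof (cases "\<bar>?u\<bar>/2 <= \<bar>a + b\<bar>")
  case True
  then show ?thesis using gen[OF p0 p0 p0 pb(2) half half] b by blast
 next
  case False
  then have "\<bar>?u\<bar>/2 <= \<bar>2 * a\<bar>" by (auto simp: abs_if split: if_splits)
  then have "peak X (a + b) * peak X (2 * a) * peak X (2 * b) <= 4 * ln X * peak X ?u^2"
  using gen[OF p0 p0 p0 pb(2) half half] b by blast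
  then show ?thesis by (simp only: mult_ac)
 qed
 next
 case False
 then have "\<bar>?u\<bar>/2 <= \<bar>2 * a\<bar>" "\<bar>?u\<bar>/2 <= \<bar>a + b\<bar>" by (auto simp: abs_if split: if_splits)
 then have "peak X (2 * b) * peak X (2 * a) * peak X (a + b) <= 4 * ln X * peak X ?u^2"
  using gen[OF p0 p0 p0 pb(2) half half] by blast
 then show ?thesis by (simp only: mult_ac)
 qed
 then have "peak X (2 * a) * peak X (2 * b) * peak X (a + b) * peak X ?u <= 4 * ln X * peak X ?u^2 * peak X ?u"
 by (rule mult_right_mono[OF _ p0])
 then show ?thesis by (simp add: power2_eq_square power3_eq_cube mult_ac)
qed

lemma peak_power_le_shift_min:
 assumes L: "ln X >= 1"
 shows "peak X (a - b)^6 <= 1 + shift_min X a b"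
proof (cases "\<bar>a - b\<bar> * ln X <= 1")
 case True
 have "shift_min X a b = ln X^6"
 proof (cases "a = b")
 case False
 then have u: "\<bar>a - b\<bar> > 0" by simp
 have "ln X <= 1 / \<bar>a - b\<bar>" using True u by (simp add: pos_le_divide_eq mult.commute)
 then have "ln X^6 <= (1 / \<bar>a - b\<bar>)^6" using L by (intro power_mono) auto
 then show ?thesis using False by (simp add: shift_min_def power_divide)
 qed (simp add: shift_min_def)
 then show ?thesis using True by (simp add: peak_def)
next
 case False
 then have u: "\<bar>a - b\<bar> > 0" by (cases "a = b") auto
 have "1 / \<bar>a - b\<bar> <= ln X" using False u by (simp add: pos_divide_le_eq mult.commute)
 then have "(1 / \<bar>a - b\<bar>)^6 <= ln X^6" by (intro power_mono) auto
 then have "shift_min X a b = (1 / \<bar>a - b\<bar>)^6" using u by (simp add: shift_min_def power_divide)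
 moreover have "max 1 (1 / \<bar>a - b\<bar>)^6 <= 1 + (1 / \<bar>a - b\<bar>)^6" by (cases "1 <= 1 / \<bar>a - b\<bar>") (auto simp: max_def)
 ultimately show ?thesis using False by (simp add: peak_def)
qed

text \<open>The conductor term is at most 3 ln X, since |d|(2 + |Im z|) <= X^3. On squares of primes
  the factor p^(-2 Re z) times the cutoff is nonincreasing and at most 1, so the bound F survives
  the weights.\<close>

lemma norm_Dirichlet_L_le_prime_sum:
 assumes C: "C > 0" "\<forall>d s T. fundamental_discriminant d & GRH_for d & d \<noteq> 1 & 1/2 <= Re s & Re s < 2 & T >= 1 -->
  cmod (Dirichlet_L d s) <= exp (Re (smoothed_log_sum (chi d) T s) + C * ln (\<bar>real_of_int d\<bar>*(2 + \<bar>Im s\<bar>)) / T)"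
 and d: "fundamental_discriminant d" "GRH_for d" "d \<noteq> 1" "\<bar>real_of_int d\<bar> <= X" and X: "ln X >= 1" "X >= 2"
 and z: "0 <= Re z" "Re z <= 1 / ln X" "\<bar>Im z\<bar> <= X" and T: "1 <= T" "T <= ln X"
 and F: "\<And>y. y <= X ==> (\<Sum>p | prime p & real p <= y. cos (2 * Im z * ln (real p)) / real p) <= F" "F >= 0"
 and G: "(\<Sum>p | prime p & int p dvd d. 1 / real p) <= G"
 shows "cmod (Dirichlet_L d (1/2 + z)) <= exp ((\<Sum>p\<in>odd_primes (exp T). real_of_int (Legendre d (int p)) *
  (real p powr - (1/2 + Re z) * cos (Im z * ln (real p)) * cutoff T p)) + F/2 + G/2 + 13 + 3 * C * ln X / T)"
proof -
 have d0: "d \<noteq> 0" using d(1) by (auto simp: fundamental_discriminant_def)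
 have s: "1/2 + z = of_real (1/2 + Re z) + \<i> * of_real (Im z)" by (simp add: complex_eq_iff)
 have "1 / ln X <= 1" using X by simp
 then have R: "1/2 <= Re (1/2 + z)" "Re (1/2 + z) < 2" using z by auto
 have eTX: "exp T <= X"
 proof -
 have "exp T <= exp (ln X)" using T by simp
 then show ?thesis using X by simp
 qed
 have "cmod (Dirichlet_L d (1/2 + z)) <= exp (Re (smoothed_log_sum (chi d) T (1/2 + z)) + C * ln (\<bar>real_of_int d\<bar>*(2 + \<bar>Im (1/2 + z)\<bar>)) / T)"
 using C(2) d R T by blast
 moreover have "C * ln (\<bar>real_of_int d\<bar>*(2 + \<bar>Im (1/2 + z)\<bar>)) / T <= 3 * C * ln X / T"
 proof -
 have "\<bar>real_of_int d\<bar>*(2 + \<bar>Im (1/2 + z)\<bar>) <= X*(X * X)"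
 proof (intro mult_mono)
  have "2 * X <= X * X" using X by (intro mult_right_mono) auto
  moreover have "Im (1/2 + z) = Im z" by simp
  ultimately show "2 + \<bar>Im (1/2 + z)\<bar> <= X * X" using z X by linarith
 qed (use d(4) X in auto)
 also have "... = X^3" by (simp add: power3_eq_cube)
 finally have "ln (\<bar>real_of_int d\<bar>*(2 + \<bar>Im (1/2 + z)\<bar>)) <= ln (X^3)"
  using d0 by (intro ln_mono mult_pos_pos) auto
 also have "... = 3 * ln X" using X by (simp add: ln_realpow)
 finally have "C * ln (\<bar>real_of_int d\<bar>*(2 + \<bar>Im (1/2 + z)\<bar>)) <= C*(3 * ln X)" using C(1) by (intro mult_left_mono) auto
 then show ?thesis using T by (intro divide_right_mono) auto
 qed
 moreover have "(\<Sum>p | prime p & real p <= exp (T/2). real p powr - (2 * Re z) * cutoff T (p\<^sup>2)*(cos (2 * Im z * ln (real p)) / real p)) <= F"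
 proof (rule weighted_prime_sum_le[OF _ F(2)])
 have eT2: "exp (T/2) <= X" using eTX T exp_le_cancel_iff[of "T/2" T] by linarith
 then show "(\<Sum>p | prime p & real p <= y. cos (2 * Im z * ln (real p)) / real p) <= F" if "y <= exp (T/2)" for y
  using F(1) that by simp
 have sq: "real (n\<^sup>2) <= exp T" if "real n <= exp (T/2)" for n
 proof -
  have "(real n)\<^sup>2 <= (exp (T/2))\<^sup>2" using that by (intro power_mono) auto
  also have "... = exp T" by (simp flip: exp_double)
  finally show ?thesis by simp
 qed
 have T0: "T > 0" using T by simp
 show "real n powr - (2 * Re z) * cutoff T (n\<^sup>2) <= real m powr - (2 * Re z) * cutoff T (m\<^sup>2)"
  if "1 <= m" "m <= n" "real n <= exp (T/2)" for m n
 proof (intro mult_mono powr_mono2')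
  show "cutoff T (n\<^sup>2) <= cutoff T (m\<^sup>2)"
  by (rule cutoff_antimono[OF T0 _ _ sq[OF that(3)]]) (use that in \<open>auto intro: power_mono\<close>)
  show "0 <= cutoff T (n\<^sup>2)" by (rule cutoff_bounds(1)[OF T0 _ sq[OF that(3)]]) (use that in auto)
 qed (use that z in auto)
 show "0 <= real n powr - (2 * Re z) * cutoff T (n\<^sup>2)" if "1 <= n" "real n <= exp (T/2)" for n
  by (intro mult_nonneg_nonneg cutoff_bounds(1)[OF T0 _ sq[OF that(2)]]) (use that in auto)
 show "real 1 powr - (2 * Re z) * cutoff T (1\<^sup>2) <= 1" by (simp add: cutoff_def)
 qed
 moreover have "Re (smoothed_log_sum (chi d) T (1/2 + z)) \<le>
  (\<Sum>p\<in>odd_primes (exp T). real_of_int (Legendre d (int p))*(real p powr - (1/2 + Re z) * cos (Im z * ln (real p)) * cutoff T p))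
  + 1/2*(\<Sum>p | prime p & real p <= exp (T/2). real p powr - (2 * Re z) * cutoff T (p\<^sup>2)*(cos (2 * Im z * ln (real p)) / real p))
  + 1/2*(\<Sum>p | prime p & int p dvd d. 1 / real p) + 13"
 unfolding s by (rule Re_smoothed_log_sum_le[OF d0 T(1) z(1)])
 ultimately show ?thesis using G by (elim order_trans) simp
qed

definition L_product :: "complex \<Rightarrow> complex \<Rightarrow> int \<Rightarrow> real" where
 "L_product z1 z2 d = cmod (Dirichlet_L d (1/2 + z1))^2 * cmod (Dirichlet_L d (1/2 + z2))^2"

text \<open>Twice the sum of the two logarithmic bounds: 52 is 4 times 13, and 12 C is 4 times 3
  C.\<close>

lemma L_product_le:
 assumes C: "C > 0" "\<forall>d s T. fundamental_discriminant d & GRH_for d & d \<noteq> 1 & 1/2 <= Re s & Re s < 2 & T >= 1 -->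
  cmod (Dirichlet_L d s) <= exp (Re (smoothed_log_sum (chi d) T s) + C * ln (\<bar>real_of_int d\<bar>*(2 + \<bar>Im s\<bar>)) / T)"
 and C0: "12 * C <= C0"
 and d: "fundamental_discriminant d" "GRH_for d" "d \<noteq> 1" "\<bar>real_of_int d\<bar> <= X" and X: "ln X >= 1" "X >= 2"
 and z1: "0 <= Re z1" "Re z1 <= 1 / ln X" "\<bar>Im z1\<bar> <= X" and z2: "0 <= Re z2" "Re z2 <= 1 / ln X" "\<bar>Im z2\<bar> <= X"
 and T: "1 <= T" "T <= ln X"
 and F1: "\<And>y. y <= X ==> (\<Sum>p | prime p & real p <= y. cos (2 * Im z1 * ln (real p)) / real p) <= F1" "F1 >= 0"
 and F2: "\<And>y. y <= X ==> (\<Sum>p | prime p & real p <= y. cos (2 * Im z2 * ln (real p)) / real p) <= F2" "F2 >= 0"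
 and G: "(\<Sum>p | prime p & int p dvd d. 1 / real p) <= G" and \<mu>: "F1 + F2 + 2 * G + 52 <= \<mu>"
 shows "L_product z1 z2 d <= exp ((\<Sum>p\<in>odd_primes (exp T). acoef T z1 z2 p * real_of_int (Legendre d (int p))) + \<mu> + C0 * ln X / T)"
proof -
 let ?A = "%z. \<Sum>p\<in>odd_primes (exp T). real_of_int (Legendre d (int p))*(real p powr - (1/2 + Re z) * cos (Im z * ln (real p)) * cutoff T p)"
 let ?E = "%z F. ?A z + F/2 + G/2 + 13 + 3 * C * ln X / T"
 note b1 = norm_Dirichlet_L_le_prime_sum[OF C d X z1 T F1 G]
 note b2 = norm_Dirichlet_L_le_prime_sum[OF C d X z2 T F2 G]
 have "L_product z1 z2 d <= exp (?E z1 F1)^2 * exp (?E z2 F2)^2"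
 unfolding L_product_def by (intro mult_mono power_mono b1 b2) auto
 also have "... = exp (2 * ?E z1 F1 + 2 * ?E z2 F2)"
 proof -
 have "exp x^2 * exp y^2 = exp (2 * x + 2 * y)" for x y :: real by (simp add: exp_add exp_double)
 then show ?thesis .
 qed
 also have "... <= exp ((\<Sum>p\<in>odd_primes (exp T). acoef T z1 z2 p * real_of_int (Legendre d (int p))) + \<mu> + C0 * ln X / T)"
 proof -
 have pw: "real p powr - (1/2 + x) = real p powr - (1/2) * real p powr - x" for p x
  by (simp add: powr_add[symmetric])
 have "(\<Sum>p\<in>odd_primes (exp T). acoef T z1 z2 p * real_of_int (Legendre d (int p))) = 2 * ?A z1 + 2 * ?A z2"
  unfolding sum_distrib_left sum.distrib[symmetric]
  by (intro sum.cong refl) (simp only: acoef_def pw distrib_left distrib_right mult_ac)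
 moreover have "4*(3 * C * ln X / T) <= C0 * ln X / T"
 proof -
  have "(12 * C)*(ln X / T) <= C0*(ln X / T)" using C0 X T by (intro mult_right_mono) auto
  then show ?thesis by simp
 qed
 moreover have "2*(A1 + F1/2 + G/2 + 13 + c) + 2*(A2 + F2/2 + G/2 + 13 + c) <= S + \<mu> + c0"
  if "S = 2 * A1 + 2 * A2" "4 * c <= c0" for A1 A2 S c c0 :: real
  unfolding distrib_left using that \<mu> by linarith
 ultimately have "2 * ?E z1 F1 + 2 * ?E z2 F2 <= (\<Sum>p\<in>odd_primes (exp T). acoef T z1 z2 p * real_of_int (Legendre d (int p))) + \<mu> + C0 * ln X / T"
  by blast
 then show ?thesis by simp
 qed
 finally show ?thesis .
qed

text \<open>The losses in units of e ln ln X are 5/2 from the mean, 8 from v/2, and 288 = 9 times 32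
  from replacing exp(9e) by 1 + 18e with v <= 32 ln ln X. Together they stay below 300, which is why
  300 e <= \<epsilon> is assumed.\<close>

lemma exponent_bound:
 assumes e: "0 < e" "e <= 1/9" "300 * e <= \<epsilon>" and L: "ln X >= 1"
 and F: "\<And>t. F t = ln (peak X t) + e * ln (ln X)"
 and v: "v = 4*(F 0 + F (2 * a)/2 + F (2 * b)/2 + F (a + b) + F (a - b))"
 and \<mu>: "\<mu> = F (2 * a) + F (2 * b) + e/2 * ln (ln X)"
 shows "exp (\<mu> + v * exp (9 * e)/2) <= 16*(ln X powr (4 + \<epsilon>)*(1 + shift_min X a b))"
proof -
 define l where "l = ln (ln X)"
 have l: "l >= 0" using L by (simp add: l_def)
 note pb = peak_bounds[OF L]
 have lp: "0 <= ln (peak X t)" "ln (peak X t) <= l" for t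
 using pb[of t] L unfolding l_def by (auto intro!: ln_mono)
 have p0: "peak X t > 0" for t using pb(1)[of t] by linarith
 have F0: "F 0 = l + e * l" using F[of 0] by (simp add: peak_def l_def)
 have Ft: "F t = ln (peak X t) + e * l" for t using F by (simp add: l_def)
 have el: "0 <= e * l" "e * l <= l" using e l mult_right_mono[of e 1 l] by auto
 have v': "v = 4*((l + e * l) + F (2 * a)/2 + F (2 * b)/2 + F (a + b) + F (a - b))" by (simp only: v F0)
 have ar1: "4*((l + x) + (p + x)/2 + (q + x)/2 + (r + x) + (s + x)) <= 32 * l"
 if "p <= l" "q <= l" "r <= l" "s <= l" "x <= l" for p q r s x :: real
 unfolding add_divide_distrib distrib_left using that by linarith
 have v32: "v <= 32 * l" unfolding v' Ft by (rule ar1[OF lp(2) lp(2) lp(2) lp(2) el(2)])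
 have "v >= 0" unfolding v' Ft using lp(1) el(1) l e(1) by (intro mult_nonneg_nonneg add_nonneg_nonneg divide_nonneg_nonneg) auto
 note v32 = v32 this
 have ex: "exp (9 * e) <= 1 + 18 * e"
 proof -
 have "exp (9 * e) <= 1 + 9 * e + (9 * e)\<^sup>2" by (rule exp_bound) (use e in auto)
 moreover have "(9 * e)\<^sup>2 <= 1*(9 * e)" unfolding power2_eq_square using e by (intro mult_right_mono) auto
 ultimately show ?thesis by simp
 qed
 have ar3: "m + y <= 2 * l + 2*(p + q + r + s) + t"
 if "y <= u + 288 * x" "u = 2 * l + p + q + 2 * r + 2 * s + 8 * x" "m = p + q + (5/2) * x" "300 * x <= t" "0 <= x"
 for m y p q r s t u x :: real unfolding distrib_left using that by linarith
 have "v * exp (9 * e)/2 <= v * (1 + 18 * e)/2" using ex v32 by (intro divide_right_mono mult_left_mono) auto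
 also have "... = v/2 + 9*(e * v)" by (simp add: field_simps)
 also have "e * v <= e*(32 * l)" using e v32 by (intro mult_left_mono) auto
 finally have "v * exp (9 * e)/2 <= v/2 + 288*(e * l)" by simp
 moreover have "v/2 = 2 * l + ln (peak X (2 * a)) + ln (peak X (2 * b)) + 2 * ln (peak X (a + b)) + 2 * ln (peak X (a - b)) + 8*(e * l)"
 unfolding v' Ft by (simp add: algebra_simps add_divide_distrib)
 moreover have "\<mu> = ln (peak X (2 * a)) + ln (peak X (2 * b)) + (5/2)*(e * l)" unfolding \<mu> Ft by (simp add: l_def[symmetric])
 moreover have "300*(e * l) <= \<epsilon> * l" using mult_right_mono[OF e(3) l] by simp
 ultimately have "\<mu> + v * exp (9 * e)/2 <= 2 * l + 2*(ln (peak X (2 * a)) + ln (peak X (2 * b)) + ln (peak X (a + b)) + ln (peak X (a - b))) + \<epsilon> * l"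
 using el(1) ar3 by blast
 also have "ln (peak X (2 * a)) + ln (peak X (2 * b)) + ln (peak X (a + b)) + ln (peak X (a - b))
  = ln (peak X (2 * a) * peak X (2 * b) * peak X (a + b) * peak X (a - b))"
 using p0 by (simp add: ln_mult_pos mult_pos_pos)
 also have "... <= ln (4 * ln X * peak X (a - b)^3)"
 using peak_product_le[OF L] p0 by (intro ln_mono mult_pos_pos) auto
 finally have "exp (\<mu> + v * exp (9 * e)/2) <= exp (2 * l + 2 * ln (4 * ln X * peak X (a - b)^3) + \<epsilon> * l)" by simp
 also have "... = exp ((2 + \<epsilon>) * l)*(4 * ln X * peak X (a - b)^3)^2"
 proof -
 have "4 * ln X * peak X (a - b)^3 > 0" using L p0 by simp
 then have "exp (2 * ln (4 * ln X * peak X (a - b)^3)) = (4 * ln X * peak X (a - b)^3)^2" by (simp add: exp_double)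
 moreover have "2 * l + 2 * ln (4 * ln X * peak X (a - b)^3) + \<epsilon> * l = (2 + \<epsilon>) * l + 2 * ln (4 * ln X * peak X (a - b)^3)"
  by (simp add: distrib_right)
 ultimately show ?thesis by (simp only: exp_add)
 qed
 also have "exp ((2 + \<epsilon>) * l) = ln X powr (2 + \<epsilon>)" using L by (simp add: powr_def l_def)
 also have "(4 * ln X * peak X (a - b)^3)^2 = 16 * ln X powr 2 * peak X (a - b)^6"
 using L by (simp add: power_mult_distrib power_mult[symmetric])
 also have "ln X powr (2 + \<epsilon>)*(16 * ln X powr 2 * peak X (a - b)^6) = 16*((ln X powr (2 + \<epsilon>) * ln X powr 2) * peak X (a - b)^6)"
 by simp
 also have "ln X powr (2 + \<epsilon>) * ln X powr 2 = ln X powr (4 + \<epsilon>)" by (simp add: powr_add[symmetric] add.commute)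
 also have "16*(ln X powr (4 + \<epsilon>) * peak X (a - b)^6) <= 16*(ln X powr (4 + \<epsilon>)*(1 + shift_min X a b))"
 by (intro mult_left_mono peak_power_le_shift_min L) auto
 finally show ?thesis .
qed

text \<open>For d other than 1 the values are sorted into levels by the size of the centred
  logarithm, and T is adapted to the level. Each level is counted by two tail bounds, one for short
  primes and one for the remaining ones; d = 1 is added at the end.\<close>

lemma main_bound:
 assumes all: "\<forall>d. fundamental_discriminant d --> GRH_for d" and \<epsilon>: "\<epsilon> > 0"
 shows "\<exists>A. \<forall>\<^sub>F X in at_top. \<forall>z1 z2. 0 <= Re z1 & Re z1 <= 1 / ln X & 0 <= Re z2 & Re z2 <= 1 / ln X & \<bar>Im z1\<bar> <= X & \<bar>Im z2\<bar> <= X -->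
 (\<Sum>d | fundamental_discriminant d & \<bar>real_of_int d\<bar> <= X. L_product z1 z2 d) <= A*(X * ln X powr (4 + \<epsilon>)*(1 + shift_min X (Im z1) (Im z2)))"
proof -
 note GRH = all[rule_format]
 note RH = GRH[OF fundamental_discriminant_1]
 define e where "e = min (1/9) (\<epsilon>/300)"
 have e: "0 < e" "e <= 1/9" "300 * e <= \<epsilon>" "e <= 1/4" using \<epsilon> by (auto simp: e_def)
 obtain C where C: "C > 0" "\<forall>d s T. fundamental_discriminant d & GRH_for d & d \<noteq> 1 & 1/2 <= Re s & Re s < 2 & T >= 1 -->
  cmod (Dirichlet_L d s) <= exp (Re (smoothed_log_sum (chi d) T s) + C * ln (\<bar>real_of_int d\<bar>*(2 + \<bar>Im s\<bar>)) / T)"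
 using norm_Dirichlet_L_le_smoothed_log_sum by (elim exE conjE) (rule that)
 define C0 where "C0 = max 1 (12 * C)"
 have C0: "C0 >= 1" "12 * C <= C0" by (auto simp: C0_def)
 \<comment> \<open>The variance over primes between exp(ln X/(8k)) and exp(T k): 16 from the
   coefficients, 24 from the window lemma, and a ratio of logarithms equal to 8 C0/e.\<close>
 define w where "w = 3072 * C0 / e"
 have w: "w >= 8"
 proof -
 have "8 * e <= 3072 * C0" using e C0 by linarith
 then show ?thesis using e by (simp add: w_def pos_le_divide_eq)
 qed
 obtain A2 K2 where A2: "K2 >= 1" "\<forall>X\<ge>1. \<forall>K'\<ge>K2. \<forall>M c. (\<forall>k. K' <= k & k <= M --> (let j = nat \<lfloor>e * real k/(8 * C0)\<rfloor> in
  c k*(2 * e * real k)^(2 * j) <= 3 * X*(fact (2 * j)/(2 ^ j * fact j)) * w ^ j + 16 ^ j * X)) -->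
  (\<Sum>k=K'..M. level_weight e k * c k) <= A2 * X"
 using large_prime_levels[OF e(1,4) C0(1) w] by blast
 \<comment> \<open>Levels from C0/e onwards have T k <= ln X; the finitely many lower ones are
   estimated trivially.\<close>
 define K where "K = max K2 (nat \<lceil>C0 / e\<rceil>)"
 define A1 where "A1 = 3 * exp 5*(2 / e) + exp 4 * exp (4 * exp 4)"
 define B where "B = 3 * level_weight e K + A1 + \<bar>A2\<bar>"
 have A1: "A1 >= 0" using e by (simp add: A1_def)
 have B: "B >= 0" using A1 by (simp add: B_def level_weight_def)
 have K: "K >= 1" "K >= K2" "real k >= C0 / e" if "k >= K" for k
 proof -
 show "K >= 1" "K >= K2" using A2(1) by (auto simp: K_def)
 have "nat \<lceil>C0 / e\<rceil> <= k" using that by (simp add: K_def)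
 then show "real k >= C0 / e" using real_nat_ceiling_ge[of "C0 / e"] by linarith
 qed
 note K' = K[OF order_refl]
 have e8: "e/8 > 0" using e by simp
 have "\<forall>\<^sub>F X::real in at_top. ln X >= 3" by real_asymp
 moreover have "\<forall>\<^sub>F X::real in at_top. X >= 3" by real_asymp
 moreover have "\<forall>\<^sub>F X::real in at_top. 52 <= e/4 * ln (ln X)" using e(1) by real_asymp
 moreover note prime_cos_sum_le[OF RH e(1)] prime_divisor_sum_le[OF e8] zeta_critical_bound[OF RH]
 ultimately have "\<forall>\<^sub>F X in at_top. \<forall>z1 z2. 0 <= Re z1 & Re z1 <= 1 / ln X & 0 <= Re z2 & Re z2 <= 1 / ln X & \<bar>Im z1\<bar> <= X & \<bar>Im z2\<bar> <= X -->
 (\<Sum>d | fundamental_discriminant d & \<bar>real_of_int d\<bar> <= X. L_product z1 z2 d) <= (1 + 16 * B)*(X * ln X powr (4 + \<epsilon>)*(1 + shift_min X (Im z1) (Im z2)))"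
 proof eventually_elim
 case (elim X)
 note LX = elim(1) and X3 = elim(2) and c52 = elim(3)
 have cosb: "(\<Sum>p | prime p & real p <= y. cos (t * ln (real p)) / real p) <= ln (peak X t) + e * ln (ln X)"
  if "\<bar>t\<bar> <= 2 * X" "y <= X" for t y by (rule elim(4)[rule_format, OF conjI[OF that]])
 have divb: "(\<Sum>p | prime p & int p dvd d. 1 / real p) <= e/8 * ln (ln X)"
  if "d \<noteq> 0" "\<bar>real_of_int d\<bar> <= X" for d by (rule elim(5)[rule_format, OF conjI[OF that]])
 have zetab: "cmod (Dirichlet_L 1 (1/2 + z))^4 <= X"
  if "0 <= Re z" "Re z <= 1 / ln X" "\<bar>Im z\<bar> <= X" for z
  by (rule elim(6)[rule_format, OF conjI[OF that(1) conjI[OF that(2,3)]]])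
 have L1: "ln X >= 1" and X1: "X >= 1" and X2: "X >= 2" using LX X3 by auto
 have eLX: "exp (ln X) = X" using X3 by simp
 show ?case
 proof (intro allI impI, elim conjE)
  fix z1 z2 :: complex
  assume z1: "0 <= Re z1" "Re z1 <= 1 / ln X" and z2: "0 <= Re z2" "Re z2 <= 1 / ln X" and im: "\<bar>Im z1\<bar> <= X" "\<bar>Im z2\<bar> <= X"
  let ?a = "Im z1" and ?b = "Im z2"
  let ?R = "X * ln X powr (4 + \<epsilon>)*(1 + shift_min X ?a ?b)"
  define F where "F = (%t. ln (peak X t) + e * ln (ln X))"
  define v where "v = 4*(F 0 + F (2 * ?a)/2 + F (2 * ?b)/2 + F (?a + ?b) + F (?a - ?b))"
  define \<mu> where "\<mu> = F (2 * ?a) + F (2 * ?b) + e/2 * ln (ln X)"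
  have ll: "ln (ln X) >= 0" using L1 by simp
  have F0: "F t >= 0" for t using peak_bounds(1)[OF L1, of t] ll e by (simp add: F_def)
  have Fb: "(\<Sum>p | prime p & real p <= y. cos (t * ln (real p)) / real p) <= F t"
  if "t \<in> {0, 2 * ?a, 2 * ?b, ?a + ?b, ?a - ?b}" "y <= X" for t y
  unfolding F_def using that im by (intro cosb) auto
  have v0: "v >= 0" using F0 by (simp add: v_def)
  have mu0: "\<mu> >= 0" using F0 ll e by (simp add: \<mu>_def)
  define D where "D = {d. fundamental_discriminant d & \<bar>real_of_int d\<bar> <= X}"
  define D1 where "D1 = D - {1}"
  have Dsub: "D \<subseteq> {- \<lfloor>X\<rfloor>..\<lfloor>X\<rfloor>}"
  proof
  fix d assume "d \<in> D"
  then have "real_of_int d <= X" "real_of_int (- d) <= X" by (auto simp: D_def)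
  then have "d <= \<lfloor>X\<rfloor>" "- d <= \<lfloor>X\<rfloor>" by (simp_all only: le_floor_iff)
  then show "d \<in> {- \<lfloor>X\<rfloor>..\<lfloor>X\<rfloor>}" by auto
  qed
  have finD: "finite D" by (rule finite_subset[OF Dsub]) simp
  have finD1: "finite D1" using finD by (simp add: D1_def)
  have cardD1: "real (card D1) <= 3 * X"
  proof -
  have "card D1 <= card {- \<lfloor>X\<rfloor>..\<lfloor>X\<rfloor>}" by (rule card_mono) (use Dsub in \<open>auto simp: D1_def\<close>)
  also have "... = nat (2*\<lfloor>X\<rfloor> + 1)" by simp
  finally have "real (card D1) <= real (nat (2*\<lfloor>X\<rfloor> + 1))" by (simp only: of_nat_le_iff)
  also have "... = 2 * real_of_int \<lfloor>X\<rfloor> + 1" using X3 by simp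
  also have "... <= 3 * X" using of_int_floor_le[of X] X3 by linarith
  finally show ?thesis .
  qed
  have D1D: "fundamental_discriminant d" "d \<noteq> 1" "\<bar>real_of_int d\<bar> <= X" "d \<noteq> 0" if "d \<in> D1" for d
  using that by (auto simp: D1_def D_def fundamental_discriminant_def)
  \<comment> \<open>Makes the error C0 ln X / T equal to e k, a small fraction of the level.\<close>
  define T where "T = (%k. C0 * ln X/(e * real k))"
  \<comment> \<open>With length X^(1/(8k)) the nonsquare tuples in the moment of order 2k contribute
    16^k X^(1/2), below the main term in X.\<close>
  define P1 where "P1 = (%k. odd_primes (exp (ln X/(8 * real k))))"
  define P2 where "P2 = (%k. odd_primes (exp (T k)) - P1 k)"
  let ?S = "%T P d. \<Sum>p\<in>P. acoef T z1 z2 p * real_of_int (Legendre d (int p))"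
  define AA where "AA = (%k. {d \<in> D1. real (2 * k) <= ?S (T k) (P1 k) d})"
  define BB where "BB = (%k. {d \<in> D1. 2 * e * real k <= ?S (T k) (P2 k) d})"
  \<comment> \<open>If the product vanishes, ln 0 = 0 makes \<open>Y d\<close> equal to minus \<mu>,
    which is at most 0, so d gets level 0.\<close>
  define Y where "Y = (%d. ln (L_product z1 z2 d) - \<mu>)"
  define \<kappa> where "\<kappa> = (%d. nat \<lfloor>Y d/(2*(1 + 4 * e))\<rfloor>)"
  \<comment> \<open>For k up to this bound T k is at least 1; that no level lies above it is shown
    below by taking T = 1.\<close>
  define M where "M = nat \<lfloor>C0 * ln X / e\<rfloor>"
  have e4: "2*(1 + 4 * e) > 0" using e by simp
  have Lb: "L_product z1 z2 d <= exp (?S t (odd_primes (exp t)) d + \<mu> + C0 * ln X / t)" if d: "d \<in> D1" and t: "1 <= t" "t <= ln X" for d t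
  proof (rule L_product_le[OF C C0(2) D1D(1)[OF d] GRH[OF D1D(1)[OF d]] D1D(2,3)[OF d] L1 X2 z1 im(1) z2 im(2) t Fb F0 Fb F0])
  show "(\<Sum>p | prime p & int p dvd d. 1 / real p) <= e/8 * ln (ln X)" by (rule divb[OF D1D(4,3)[OF d]])
  show "F (2 * ?a) + F (2 * ?b) + 2*(e/8 * ln (ln X)) + 52 <= \<mu>" using c52 by (simp add: \<mu>_def)
  qed auto
  have Q0: "L_product z1 z2 d >= 0" for d by (simp add: L_product_def)
  have Yb: "Y d <= ?S t (odd_primes (exp t)) d + C0 * ln X / t" if d: "d \<in> D1" and t: "1 <= t" "t <= ln X" and pos: "Y d > 0" for d t
  proof -
  have "L_product z1 z2 d \<noteq> 0" using pos mu0 by (auto simp: Y_def)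
  then have "L_product z1 z2 d > 0" using Q0[of d] by linarith
  then have "ln (L_product z1 z2 d) <= ln (exp (?S t (odd_primes (exp t)) d + \<mu> + C0 * ln X / t))"
   using Lb[OF d t] by (intro ln_mono) auto
  then show ?thesis by (simp add: Y_def)
  qed
  have Qle: "L_product z1 z2 d <= exp \<mu> * level_weight e (\<kappa> d)" for d
  proof (cases "L_product z1 z2 d = 0")
  case False
  have "Y d/(2*(1 + 4 * e)) < real (\<kappa> d) + 1" unfolding \<kappa>_def by linarith
  then have "Y d < (real (\<kappa> d) + 1)*(2*(1 + 4 * e))" using e4 by (simp only: pos_divide_less_eq)
  also have "... = real (2*\<kappa> d + 2)*(1 + 4 * e)" by (simp add: algebra_simps)
  finally have "Y d <= real (2*\<kappa> d + 2)*(1 + 4 * e)" by (rule less_imp_le)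
  then have "exp (Y d) <= level_weight e (\<kappa> d)" unfolding level_weight_def by (rule iffD2[OF exp_le_cancel_iff])
  then have "exp \<mu> * exp (Y d) <= exp \<mu> * level_weight e (\<kappa> d)" by (intro mult_left_mono) auto
  moreover have "exp \<mu> * exp (Y d) = L_product z1 z2 d"
   unfolding exp_add[symmetric] using False Q0[of d] by (simp add: Y_def)
  ultimately show ?thesis by simp
  qed (simp add: level_weight_def)
  have Tk: "1 <= T k" "T k <= ln X" "ln X/(8 * real k) <= T k" "C0 * ln X / T k = e * real k" "real k >= 1" "real k > 0" if k: "K <= k" "k <= M" for k
  proof -
  show k1: "real k >= 1" using K'(1) k by simp
  then show k0: "real k > 0" by linarith
  have "real k <= real M" using k by simp
  also have "... <= C0 * ln X / e" unfolding M_def by (rule of_nat_floor) (use C0 LX e in auto)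
  finally have "e * real k <= C0 * ln X" using e by (simp add: pos_le_divide_eq mult.commute)
  then show "1 <= T k" using e k0 by (simp add: T_def)
  have "C0 <= e * real k" using K(3)[OF k(1)] e by (simp add: pos_divide_le_eq mult.commute)
  then have "C0 * ln X <= (e * real k) * ln X" using LX by (intro mult_right_mono) auto
  then show "T k <= ln X" unfolding T_def using e k0 by (simp add: pos_divide_le_eq mult.commute)
  have "ln X/(8 * real k) <= C0 * ln X/(e * real k)"
  proof (rule frac_le)
   show "ln X <= C0 * ln X" using C0 LX mult_right_mono[of 1 C0 "ln X"] by simp
   show "e * real k <= 8 * real k" using e k0 by (intro mult_right_mono) auto
  qed (use C0 LX e k0 in auto)
  then show "ln X/(8 * real k) <= T k" by (simp add: T_def)
  show "C0 * ln X / T k = e * real k" using C0 LX e k0 by (simp add: T_def)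
  qed
  have fin_odd: "finite (odd_primes y)" for y
  by (rule finite_subset[OF _ finite_primes_le[of y "%_. True"]]) (auto simp: odd_primes_def)
  have sub12: "P1 k \<subseteq> odd_primes (exp (T k))" if k: "K <= k" "k <= M" for k
  proof -
  have le: "exp (ln X/(8 * real k)) <= exp (T k)" using Tk(3)[OF k] by simp
  show ?thesis by (auto simp: P1_def odd_primes_def intro: order_trans[OF _ le])
  qed
  have in_odd: "1 <= p" "real p <= exp t" if "p \<in> odd_primes (exp t)" for p t using that by (auto simp: odd_primes_def)
  have level: "\<kappa> d <= M & (d \<in> AA (\<kappa> d) \<or> d \<in> BB (\<kappa> d))" if d: "d \<in> D1" and kd: "K <= \<kappa> d" for d
  proof -
  let ?k = "\<kappa> d"
  have k1: "?k >= 1" using K'(1) kd by simp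
  have "real ?k <= Y d/(2*(1 + 4 * e))" unfolding \<kappa>_def
  proof (rule of_nat_floor, rule ccontr)
   assume "\<not> 0 <= Y d/(2*(1 + 4 * e))"
   then have "?k = 0" by (simp add: \<kappa>_def)
   then show False using k1 by simp
  qed
  then have Yk: "Y d >= real ?k*(2*(1 + 4 * e))" using e4 by (simp only: pos_le_divide_eq)
  have "real ?k*(2*(1 + 4 * e)) = 2 * real ?k + 8*(e * real ?k)" by (simp add: algebra_simps)
  with Yk have Yk: "Y d >= 2 * real ?k + 8*(e * real ?k)" by simp
  have ek: "e * real ?k > 0" using e k1 by simp
  then have Ypos: "Y d > 0" using Yk by linarith
  \<comment> \<open>At T = 1 at most the prime 3 can occur, so the polynomial is at most 4. This
    crude bound, of size C0 ln X, limits the possible levels.\<close>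
  have "?S 1 (odd_primes (exp 1)) d <= (\<Sum>p\<in>odd_primes (exp 1). 4)"
  proof (rule sum_mono)
   fix p assume p: "p \<in> odd_primes (exp 1)"
   have "acoef 1 z1 z2 p * real_of_int (Legendre d (int p)) <= \<bar>acoef 1 z1 z2 p\<bar>*\<bar>real_of_int (Legendre d (int p))\<bar>"
   unfolding abs_mult[symmetric] by (rule abs_ge_self)
   also have "... <= 4*1"
   proof (intro mult_mono)
   show "\<bar>acoef 1 z1 z2 p\<bar> <= 4" by (rule abs_acoef_le(2)) (use in_odd[OF p] z1 z2 in auto)
   show "\<bar>real_of_int (Legendre d (int p))\<bar> <= 1" using Legendre_cases[of d "int p"] by auto
   qed auto
   finally show "acoef 1 z1 z2 p * real_of_int (Legendre d (int p)) <= 4" by simp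
  qed
  also have "... <= (\<Sum>p\<in>{3::nat}. 4)"
  proof (rule sum_mono2)
   show "odd_primes (exp 1) \<subseteq> {3}"
   proof
   fix p assume "p \<in> odd_primes (exp 1)"
   then have "p > 2" "real p <= 3" using exp_le by (auto simp: odd_primes_def)
   then show "p \<in> {3}" by auto
   qed
  qed auto
  finally have "?S 1 (odd_primes (exp 1)) d <= 4" by simp
  then have "Y d <= 4 + C0 * ln X" using Yb[OF d _ L1 Ypos] by simp
  then have "2 * real ?k <= 4 + C0 * ln X" using Yk ek by linarith
  moreover have "1*3 <= C0 * ln X" using C0 LX by (intro mult_mono) auto
  moreover have "9*(C0 * ln X) <= C0 * ln X / e"
  proof -
   have "(9 * e)*(C0 * ln X) <= 1*(C0 * ln X)" using e C0 LX by (intro mult_right_mono) auto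
   then show ?thesis using e by (simp add: pos_le_divide_eq mult_ac)
  qed
  ultimately have "real ?k <= C0 * ln X / e" by linarith
  then have kM: "?k <= M" unfolding M_def by (rule le_nat_floor)
  note tk = Tk[OF kd kM]
  have "Y d <= ?S (T ?k) (odd_primes (exp (T ?k))) d + e * real ?k"
   using Yb[OF d tk(1,2) Ypos] tk(4) by simp
  moreover have "?S (T ?k) (odd_primes (exp (T ?k))) d = ?S (T ?k) (P2 ?k) d + ?S (T ?k) (P1 ?k) d"
   unfolding P2_def by (rule sum.subset_diff[OF sub12[OF kd kM] fin_odd])
  \<comment> \<open>If both parts were below their thresholds, \<open>Y d\<close> would be less than
    2k + 2ek + ek, the last summand being the error term; but at level k it is at least 2k +
    8ek.\<close>
  ultimately have "2 * real ?k <= ?S (T ?k) (P1 ?k) d \<or> 2*(e * real ?k) <= ?S (T ?k) (P2 ?k) d"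
   using Yk ek by linarith
  then show ?thesis using d kM by (auto simp: AA_def BB_def mult.assoc)
  qed
  have cA: "real (card (AA k)) * real (2 * k)^(2 * k) <= 3 * X*(fact (2 * k)/(2 ^ k * fact k)) * v ^ k + 16 ^ k * X"
  if k: "K <= k" "k <= M" for k
  proof -
  note tk = Tk[OF k]
  let ?y = "exp (ln X/(8 * real k))"
  have T0: "T k > 0" using tk by linarith
  have "real (card (AA k)) * real (2 * k)^(2 * k) <= 3 * X*(fact (2 * k)/(2 ^ k * fact k)) * v ^ k + (4 * ?y\<^sup>2)^(2 * k)"
   unfolding AA_def
  proof (rule tail_count[OF D1D(3) finD1 X1])
   show "P1 k \<subseteq> odd_primes ?y" by (simp add: P1_def)
   show "\<bar>acoef (T k) z1 z2 p\<bar> <= 4" if "p \<in> P1 k" for p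
   proof -
   have "p \<in> odd_primes (exp (T k))" using sub12[OF k] that by blast
   then show ?thesis by (intro abs_acoef_le(2)[OF T0]) (use z1 z2 in \<open>auto simp: odd_primes_def\<close>)
   qed
   show "(\<Sum>p\<in>P1 k. (acoef (T k) z1 z2 p)\<^sup>2) <= v"
   unfolding P1_def v_def
   proof (rule acoef_variance_le[OF T0 z1(1) z2(1) _ _ F0])
   show "?y <= exp (T k)" using tk(3) by simp
   fix t x assume t: "t \<in> {0, 2 * ?a, 2 * ?b, ?a + ?b, ?a - ?b}" and x: "x <= exp (T k)"
   have "exp (T k) <= exp (ln X)" using tk(2) by simp
   then have "x <= X" unfolding eLX using x by linarith
   then show "(\<Sum>p | prime p & real p <= x. cos (t * ln (real p)) / real p) <= F t" by (rule Fb[OF t])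
   qed
  qed auto
  also have "(4 * ?y\<^sup>2)^(2 * k) <= 16 ^ k * X"
  proof -
   have "(4 * ?y\<^sup>2)^(2 * k) = 16 ^ k * ?y^(4 * k)" by (simp add: power_mult_distrib power_mult)
   also have "?y^(4 * k) = exp (real (4 * k)*(ln X/(8 * real k)))" by (rule exp_of_nat_mult[symmetric])
   also have "real (4 * k)*(ln X/(8 * real k)) = ln X/2" using tk(6) by simp
   also have "exp (ln X/2) <= exp (ln X)" using LX by simp
   finally show ?thesis using eLX X3 by simp
  qed
  finally show ?thesis by simp
  qed
  have cB: "let j = nat \<lfloor>e * real k/(8 * C0)\<rfloor> in
   real (card (BB k))*(2 * e * real k)^(2 * j) <= 3 * X*(fact (2 * j)/(2 ^ j * fact j)) * w ^ j + 16 ^ j * X"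
  if k: "K <= k" "k <= M" for k
  proof -
  note tk = Tk[OF k]
  define j where "j = nat \<lfloor>e * real k/(8 * C0)\<rfloor>"
  have T0: "T k > 0" using tk by linarith
  let ?y = "exp (T k)" and ?z = "exp (ln X/(8 * real k))"
  have "real (card (BB k))*(2 * e * real k)^(2 * j) <= 3 * X*(fact (2 * j)/(2 ^ j * fact j)) * w ^ j + (4 * ?y\<^sup>2)^(2 * j)"
   unfolding BB_def
  proof (rule tail_count[OF D1D(3) finD1 X1])
   show "P2 k \<subseteq> odd_primes ?y" by (auto simp: P2_def)
   show "\<bar>acoef (T k) z1 z2 p\<bar> <= 4" if "p \<in> P2 k" for p
   by (rule abs_acoef_le(2)[OF T0]) (use that z1 z2 in \<open>auto simp: P2_def odd_primes_def\<close>)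
   show "0 <= 2 * e * real k" using e by simp
   show "(\<Sum>p\<in>P2 k. (acoef (T k) z1 z2 p)\<^sup>2) <= w"
   proof (cases "?y >= 3")
   case False
   have "p \<notin> P2 k" for p
   proof
    assume "p \<in> P2 k"
    then have "3 <= p" "real p <= ?y" by (auto simp: P2_def odd_primes_def)
    then show False using False of_nat_mono[of 3 p, where 'a = real] by simp
   qed
   then have "P2 k = {}" by blast
   then show ?thesis using w by simp
   next
   case True
   have zz: "?z > 1" using LX tk(6) by simp
   have "(\<Sum>p\<in>P2 k. (acoef (T k) z1 z2 p)\<^sup>2) <= (\<Sum>p\<in>P2 k. 16*(1 / real p))"
    by (rule sum_mono, rule abs_acoef_le(3)[OF T0]) (use z1 z2 in \<open>auto simp: P2_def odd_primes_def\<close>)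
   also have "... <= (\<Sum>p | prime p & real p <= ?y & ?z < real p. 16*(1 / real p))"
    by (rule sum_mono2[OF finite_primes_le]) (auto simp: P2_def P1_def odd_primes_def)
   also have "... = 16*(\<Sum>p | prime p & real p <= ?y & ?z < real p. 1 / real p)" by (simp only: sum_distrib_left)
   also have "... <= 16*(24*(ln ?y / ln ?z))" by (intro mult_left_mono prime_reciprocal_window zz True) auto
   also have "... = w" using LX e tk(6) by (simp add: T_def w_def field_simps)
   finally show ?thesis .
   qed
  qed auto
  also have "(4 * ?y\<^sup>2)^(2 * j) <= 16 ^ j * X"
  proof -
   have j: "real j <= e * real k/(8 * C0)" unfolding j_def by (rule of_nat_floor) (use e C0 in auto)
   have "(4 * ?y\<^sup>2)^(2 * j) = 16 ^ j * ?y^(4 * j)" by (simp add: power_mult_distrib power_mult)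
   \<comment> \<open>The divisor 8 C0 in j makes 4 j T k at most (ln X)/2.\<close>
   also have "?y^(4 * j) = exp (real (4 * j) * T k)" by (rule exp_of_nat_mult[symmetric])
   also have "real (4 * j) * T k <= ln X"
   proof -
   have "real (4 * j) * T k <= (4*(e * real k/(8 * C0))) * T k" using j T0 by (intro mult_right_mono) auto
   also have "... = ln X/2" using e C0 tk(6) by (simp add: T_def)
   finally show ?thesis using LX by simp
   qed
   then have "exp (real (4 * j) * T k) <= exp (ln X)" by simp
   finally show ?thesis using eLX X3 by simp
  qed
  finally show ?thesis unfolding j_def Let_def by simp
  qed
  have "(\<Sum>d\<in>D1. L_product z1 z2 d) <= (\<Sum>d\<in>D1. exp \<mu> * level_weight e (\<kappa> d))" by (intro sum_mono Qle)
  also have "... = exp \<mu>*(\<Sum>d\<in>D1. level_weight e (\<kappa> d))" by (simp only: sum_distrib_left)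
  also have "... <= exp \<mu>*(real (card D1) * level_weight e K + (\<Sum>k=K..M. level_weight e k * real (card (AA k))) + (\<Sum>k=K..M. level_weight e k * real (card (BB k))))"
  proof (rule mult_left_mono[OF layered_sum_le[OF finD1 _ _ level]])
  show "mono (level_weight e)" unfolding mono_def level_weight_def using e by (auto intro!: mult_right_mono)
  qed (auto simp: level_weight_def AA_def BB_def)
  also have "... <= exp \<mu>*(3 * X * level_weight e K * exp (v * exp (9 * e)/2) + A1 * X * exp (v * exp (9 * e)/2) + \<bar>A2\<bar> * X * exp (v * exp (9 * e)/2))"
  proof (intro mult_left_mono add_mono)
  have ex1: "1 <= exp (v * exp (9 * e)/2)" using v0 by simp
  have "real (card D1) * level_weight e K <= 3 * X * level_weight e K" using cardD1 by (intro mult_right_mono) (auto simp: level_weight_def)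
  also have "...*1 <= 3 * X * level_weight e K * exp (v * exp (9 * e)/2)" using X1 ex1 by (intro mult_left_mono) (auto simp: level_weight_def)
  finally show "real (card D1) * level_weight e K <= 3 * X * level_weight e K * exp (v * exp (9 * e)/2)" by simp
  show "(\<Sum>k=K..M. level_weight e k * real (card (AA k))) <= A1 * X * exp (v * exp (9 * e)/2)"
   unfolding A1_def by (rule small_prime_levels[OF e(1,4) X1 v0 K'(1) cA])
  have "(\<Sum>k=K..M. level_weight e k * real (card (BB k))) <= A2 * X"
  proof (rule A2(2)[rule_format, OF X1 K'(2), where c = "%k. real (card (BB k))" and M = M])
   fix k assume "K <= k & k <= M"
   then show "let j = nat \<lfloor>e * real k/(8 * C0)\<rfloor> in
    real (card (BB k))*(2 * e * real k)^(2 * j) <= 3 * X*(fact (2 * j)/(2 ^ j * fact j)) * w ^ j + 16 ^ j * X"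
   using cB[of k] by blast
  qed
  also have "... <= \<bar>A2\<bar> * X" using X1 by (intro mult_right_mono) auto
  also have "...*1 <= \<bar>A2\<bar> * X * exp (v * exp (9 * e)/2)" using X1 ex1 by (intro mult_left_mono) auto
  finally show "(\<Sum>k=K..M. level_weight e k * real (card (BB k))) <= \<bar>A2\<bar> * X * exp (v * exp (9 * e)/2)" by simp
  qed auto
  also have "... = B * X * exp (\<mu> + v * exp (9 * e)/2)" unfolding B_def by (simp add: exp_add algebra_simps)
  also have "... <= B * X*(16*(ln X powr (4 + \<epsilon>)*(1 + shift_min X ?a ?b)))"
  using B X1 exponent_bound[OF e(1-3) L1 F_def[THEN fun_cong] v_def \<mu>_def] by (intro mult_left_mono) auto
  also have "... = 16 * B * ?R" by simp
  finally have main: "(\<Sum>d\<in>D1. L_product z1 z2 d) <= 16 * B * ?R" .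
  \<comment> \<open>Each of the two squares has square at most X by the bound on the critical line,
    so their product is at most the mean of two quantities below X.\<close>
  have one: "L_product z1 z2 1 <= X"
  proof -
  define x where "x = cmod (Dirichlet_L 1 (1/2 + z1))^2"
  define y where "y = cmod (Dirichlet_L 1 (1/2 + z2))^2"
  have "x\<^sup>2 <= X" "y\<^sup>2 <= X" unfolding x_def y_def power_mult[symmetric] using zetab[OF z1 im(1)] zetab[OF z2 im(2)] by simp_all
  moreover have "2 * x * y <= x\<^sup>2 + y\<^sup>2" by (rule sum_squares_bound)
  ultimately have "x * y <= X" by simp
  then show ?thesis by (simp add: L_product_def x_def y_def)
  qed
  have shift0: "shift_min X ?a ?b >= 0" using L1 by (auto simp: shift_min_def)
  have "X*1*1 <= ?R" using X1 shift0 L1 \<epsilon> by (intro mult_mono ge_one_powr_ge_zero) auto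
  then have oneR: "L_product z1 z2 1 <= ?R" using one by simp
  have "(\<Sum>d\<in>D. L_product z1 z2 d) <= (\<Sum>d\<in>insert 1 D1. L_product z1 z2 d)"
  by (rule sum_mono2) (use finD1 Q0 in \<open>auto simp: D1_def\<close>)
  also have "... = L_product z1 z2 1 + (\<Sum>d\<in>D1. L_product z1 z2 d)"
  by (rule sum.insert[OF finD1]) (simp add: D1_def)
  also have "... <= ?R + 16 * B * ?R" by (intro add_mono oneR main)
  also have "... = (1 + 16 * B) * ?R" by (simp only: distrib_right mult_1)
  finally show "(\<Sum>d | fundamental_discriminant d & \<bar>real_of_int d\<bar> <= X. L_product z1 z2 d) <= (1 + 16 * B) * ?R"
  by (simp only: D_def)
 qed
 qed
 then show ?thesis by blast
qed

theorem theorem2p4: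
  assumes GRH: "\<And>d. fundamental_discriminant d \<Longrightarrow> GRH_for d"
  shows "\<forall>\<epsilon>>0. \<exists>C X0 :: real. \<forall>X\<ge>X0. \<forall>z1 z2 :: complex.
           0 \<le> Re z1 \<and> Re z1 \<le> 1 / ln X \<and> 0 \<le> Re z2 \<and> Re z2 \<le> 1 / ln X \<and>
           \<bar>Im z1\<bar> \<le> X \<and> \<bar>Im z2\<bar> \<le> X \<longrightarrow>
           (\<Sum>d | fundamental_discriminant d \<and> \<bar>real_of_int d\<bar> \<le> X.
              cmod (Dirichlet_L d (1 / 2 + z1)) ^ 2 * cmod (Dirichlet_L d (1 / 2 + z2)) ^ 2)
           \<le> C * (X * ln X powr (4 + \<epsilon>) * (1 + shift_min X (Im z1) (Im z2)))"
proof (intro allI impI)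
  fix \<epsilon> :: real assume \<epsilon>: "\<epsilon> > 0"
  have all: "\<forall>d. fundamental_discriminant d \<longrightarrow> GRH_for d" using GRH by blast
  from main_bound[OF all \<epsilon>] show "\<exists>C X0 :: real. \<forall>X\<ge>X0. \<forall>z1 z2 :: complex.
           0 \<le> Re z1 \<and> Re z1 \<le> 1 / ln X \<and> 0 \<le> Re z2 \<and> Re z2 \<le> 1 / ln X \<and>
           \<bar>Im z1\<bar> \<le> X \<and> \<bar>Im z2\<bar> \<le> X \<longrightarrow>
           (\<Sum>d | fundamental_discriminant d \<and> \<bar>real_of_int d\<bar> \<le> X.
              cmod (Dirichlet_L d (1 / 2 + z1)) ^ 2 * cmod (Dirichlet_L d (1 / 2 + z2)) ^ 2)
           \<le> C * (X * ln X powr (4 + \<epsilon>) * (1 + shift_min X (Im z1) (Im z2)))"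
    unfolding L_product_def eventually_at_top_linorder by (elim exE) (intro exI, assumption)
qed

end
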